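(* Let $X$ be a graph-like continuum with $\mathcal{H}(X)<\infty$, let $B$ be Brownian motion on $X$, and let $W$ be standard Brownian motion on $\mathbb{R}$. Let $e$ be an edge of $X$ and let $F:e\to\mathbb{R}$ be an isometry (with respect to arc length on $e$) onto its image, an open interval. Then for any continuous function $\phi:F(e)^{k-1}\to\mathbb{R}$, any increasing sequence of times $t_1,t_2,\dots,t_k$, and any $x\in e$, $$\mathbb{E}_x\big[\phi(F(B(t_1)),\dots,F(B(t_{k-1})))\,1_{t_k<\tau_{\partial e}}\big]=\mathbb{E}_{F(x)}\big[\phi(W(t_1),\dots,W(t_{k-1}))\,1_{t_k<\tau_{\partial F(e)}}\big],$$ where $\mathbb{E}_x$ denotes expectation for $B$ started at $x$, $\mathbb{E}_{F(x)}$ expectation for $W$ started at $F(x)$, and $\tau_{\partial e}$, $\tau_{\partial F(e)}$ are the first hitting times of $\partial e$ by $B$ and of $\partial F(e)$ by $W$, respectively.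
   Context: A continuum is a compact, connected, non-empty metrizable space; $X$ carries a fixed compatible metric $d$, and $\mathcal{H}$ is the 1-dimensional Hausdorff measure. An edge of $X$ is an open subspace $I\subseteq X$ homeomorphic to $(0,1)$ whose closure in $X$ is homeomorphic to $[0,1]$; its frontier $\partial I$ consists of two points. $X$ is graph-like if there is a (possibly infinite) set $E$ of pairwise disjoint edges of $X$ such that $X\setminus\bigcup E$ is totally disconnected. A finite edge-set is a finite set of pairwise disjoint edges of $X$, also viewed as the union of these edges. A (finite) graph is a space homeomorphic to a finite simplicial 1-complex; a metric graph is a graph with positive edge lengths $\ell(e)$. A graph approximation of $X$ is a sequence $(G_n)_{n\in\mathbb{N}}$ of finite graphs that are subspaces of $X$ such that (i) for every edge $e\in E(G_n)$, the length $\ell(e)$ of $e$ in $G_n$ equals the length of the corresponding arc of $X$; (ii) for every finite edge-set $F$ of $X$ and every component $C$ of $X\setminus F$, for all but finitely many $i$ there is a unique component of $G_i\setminus F$ meeting $C$. Standard Brownian motion on a finite metric graph $G$ is the continuous strong Markov process that inside edges (parametrised by length) behaves like standard Brownian motion on a real interval (generator $\frac12 f''$), and at each vertex $v$ behaves like a Walsh spider with equiprobable legs: if $p_1,\dots,p_k$ are points, one inside each edge incident with $v$, at distances $\ell_1,\dots,\ell_k$ from $v$ along the edge, the probability from $v$ of reaching $p_j$ first among the $p_i$ is $(1/\ell_j)/\sum_i(1/\ell_i)$; and the expected exit time from the ball of radius $r$ around $v$, starting at $v$, tends to $0$ as $r\to0$. Brownian motion $B$ on $X$ started at $o\in X$: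 the unique-in-law process with continuous sample paths in $X$ such that for every graph approximation $(G_n)$ of $X$ and all $o_n\in G_n$ with $o_n\to o$, standard Brownian motion $B_n$ on $G_n$ from $o_n$ converges weakly to $B$ (i.e. for every $T>0$ the laws on $C([0,T],X)$ with the supremum metric converge weakly). The existence and uniqueness of this process when $\mathcal{H}(X)<\infty$ is part of the setting. The integrand on either side is understood to be $0$ off the event in the indicator (on which all arguments of $\phi$ lie in $F(e)$). *)

theory Defs
  imports "HOL-Probability.Probability"
begin

section \<open>Length and one-dimensional Hausdorff measure\<close>

text \<open>Total variation of a curve on \<open>[a, b]\<close>; the sorted lists are the partitions.\<close>

definition curve_length :: "(real \<Rightarrow> 'a::metric_space) \<Rightarrow> real \<Rightarrow> real \<Rightarrow> ennreal" where
  "curve_length g a b =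
    (SUP xs\<in>{xs. sorted xs \<and> set xs \<subseteq> {a..b}}.
       \<Sum>i<length xs - 1. ennreal (dist (g (xs ! i)) (g (xs ! Suc i))))"

text \<open>The covering sets are required to be bounded because \<^const>\<open>diameter\<close> is unspecified on
  unbounded sets.\<close>

definition hausdorff_premeasure1 :: "real \<Rightarrow> 'a::metric_space set \<Rightarrow> ennreal" where
  "hausdorff_premeasure1 \<delta> A =
    (INF U\<in>{U :: nat \<Rightarrow> 'a set. A \<subseteq> (\<Union>i. U i) \<and> (\<forall>i. bounded (U i) \<and> diameter (U i) \<le> \<delta>)}.
       \<Sum>i. ennreal (diameter (U i)))"

definition hausdorff_measure1 :: "'a::metric_space set \<Rightarrow> ennreal" where
  "hausdorff_measure1 A = (SUP \<delta>\<in>{0<..}. hausdorff_premeasure1 \<delta> A)"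


section \<open>Graph-like continua\<close>

definition is_edge :: "'a::metric_space set \<Rightarrow> 'a set \<Rightarrow> bool" where
  "is_edge X I \<longleftrightarrow> openin (top_of_set X) I \<and> I homeomorphic {0<..<1::real}
     \<and> (top_of_set X closure_of I) homeomorphic {0..1::real}"

definition edge_set :: "'a::metric_space set \<Rightarrow> 'a set set \<Rightarrow> bool" where
  "edge_set X E \<longleftrightarrow> (\<forall>I\<in>E. is_edge X I) \<and> pairwise disjnt E"

definition totally_disconnected :: "'a::topological_space set \<Rightarrow> bool" where
  "totally_disconnected S \<longleftrightarrow> (\<forall>C\<in>components S. \<exists>x. C = {x})"

definition graph_like_continuum :: "'a::metric_space set \<Rightarrow> bool" where
  "graph_like_continuum X \<longleftrightarrow> compact X \<and> connected X \<and> X \<noteq> {}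
     \<and> (\<exists>E. edge_set X E \<and> totally_disconnected (X - \<Union>E))"

text \<open>\<open>F\<close> is an isometry for the arc-length metric of the open arc \<open>e\<close>: any two distinct points of \<open>e\<close>
  are joined by an arc inside \<open>e\<close>, unique up to reparametrisation.\<close>

definition arclength_isometry :: "'a::metric_space set \<Rightarrow> ('a \<Rightarrow> real) \<Rightarrow> bool" where
  "arclength_isometry e F \<longleftrightarrow>
    (\<forall>g. arc g \<and> path_image g \<subseteq> e \<longrightarrow>
       curve_length g 0 1 = ennreal \<bar>F (pathfinish g) - F (pathstart g)\<bar>)"


section \<open>Finite metric graphs and graph approximations\<close>

text \<open>A finite metric graph, triangulated as a simplicial 1-complex inside an ambient space. Edges
  are open arcs, and \<open>chart G e\<close> parametrises the closure of \<open>e\<close> by the interval \<open>[0, len G e]\<close> (in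
  one of the two directions). Loops and parallel edges are excluded as in a simplicial complex; a
  multigraph has to be subdivided.\<close>

record 'a mgraph =
  verts :: "'a set"
  edges :: "'a set set"
  len :: "'a set \<Rightarrow> real"
  chart :: "'a set \<Rightarrow> real \<Rightarrow> 'a"

definition ends :: "'a mgraph \<Rightarrow> 'a set \<Rightarrow> 'a set" where
  "ends G e = {chart G e 0, chart G e (len G e)}"

definition points :: "'a mgraph \<Rightarrow> 'a set" where
  "points G = verts G \<union> \<Union>(edges G)"

definition finite_metric_graph :: "'a::metric_space mgraph \<Rightarrow> bool" where
  "finite_metric_graph G \<longleftrightarrow> finite (verts G) \<and> finite (edges G) \<and> pairwise disjnt (edges G)
     \<and> (\<forall>e\<in>edges G. 0 < len G e \<and> continuous_on {0..len G e} (chart G e)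
          \<and> inj_on (chart G e) {0..len G e} \<and> chart G e ` {0<..<len G e} = e
          \<and> ends G e \<subseteq> verts G \<and> e \<inter> verts G = {})
     \<and> inj_on (ends G) (edges G)"

text \<open>In the clause on \<^const>\<open>curve_length\<close>, \<open>s = 0\<close> and \<open>t = len (G n) e\<close> say that the length of \<open>e\<close> in
  the graph is the length of the arc of \<open>X\<close>; the remaining cases say that \<open>chart (G n) e\<close>, i.e. the
  parametrisation of \<open>e\<close> by length, is that of the arc of \<open>X\<close>.\<close>

definition graph_approximation :: "'a::metric_space set \<Rightarrow> (nat \<Rightarrow> 'a mgraph) \<Rightarrow> bool" where
  "graph_approximation X G \<longleftrightarrow>
     (\<forall>n. finite_metric_graph (G n) \<and> points (G n) \<subseteq> X)
     \<and> (\<forall>n. \<forall>e\<in>edges (G n). \<forall>s t. 0 \<le> s \<and> s \<le> t \<and> t \<le> len (G n) e \<longrightarrow>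
          curve_length (chart (G n) e) s t = ennreal (t - s))
     \<and> (\<forall>F. finite F \<and> edge_set X F \<longrightarrow> (\<forall>C\<in>components (X - \<Union>F).
          eventually (\<lambda>i. \<exists>!D. D \<in> components (points (G i) - \<Union>F) \<and> D \<inter> C \<noteq> {}) sequentially))"

definition incident :: "'a mgraph \<Rightarrow> 'a \<Rightarrow> 'a set set" where
  "incident G v = {e \<in> edges G. v \<in> ends G e}"

text \<open>The point at distance \<open>d\<close> from \<open>v\<close> along the incident edge \<open>e\<close>.\<close>

definition leg :: "'a mgraph \<Rightarrow> 'a \<Rightarrow> 'a set \<Rightarrow> real \<Rightarrow> 'a" where
  "leg G v e d = (if chart G e 0 = v then chart G e d else chart G e (len G e - d))"

text \<open>For \<open>r\<close> not exceeding the lengths of the edges at \<open>v\<close>, this is the minimum of \<open>r\<close> and the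
  distance from \<open>v\<close> to \<open>p\<close> in the graph.\<close>

definition radius :: "'a mgraph \<Rightarrow> 'a \<Rightarrow> real \<Rightarrow> 'a \<Rightarrow> real" where
  "radius G v r p = Inf (insert r {d \<in> {0..r}. \<exists>e\<in>incident G v. p = leg G v e d})"


section \<open>Path space\<close>

definition path_space :: "'a::topological_space set \<Rightarrow> (real \<Rightarrow> 'a) measure" where
  "path_space S =
    restrict_space (Pi\<^sub>M {0..} (\<lambda>_. restrict_space borel S)) {w. continuous_on {0..} w}"

definition path_filtration :: "'a::topological_space set \<Rightarrow> real \<Rightarrow> (real \<Rightarrow> 'a) measure" where
  "path_filtration S t = vimage_algebra (space (path_space S)) (\<lambda>w. restrict w {0..t})
     (Pi\<^sub>M {0..t} (\<lambda>_. restrict_space borel S))"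

definition hitting_time :: "'a set \<Rightarrow> (real \<Rightarrow> 'a) \<Rightarrow> ennreal" where
  "hitting_time A w = (INF t\<in>{t. 0 \<le> t \<and> w t \<in> A}. ennreal t)"

definition stopped :: "'a set \<Rightarrow> (real \<Rightarrow> 'a) \<Rightarrow> real \<Rightarrow> 'a" where
  "stopped A w t = w (enn2real (min (ennreal t) (hitting_time A w)))"

text \<open>Measurability into \<^const>\<open>path_space\<close> comprises continuity of all sample paths.\<close>

definition continuous_process ::
  "'a::topological_space set \<Rightarrow> 'w measure \<Rightarrow> (real \<Rightarrow> 'w \<Rightarrow> 'a) \<Rightarrow> bool" where
  "continuous_process S M B \<longleftrightarrow> prob_space M \<and> (\<lambda>\<omega>. \<lambda>t\<in>{0..}. B t \<omega>) \<in> M \<rightarrow>\<^sub>M path_space S"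

definition process_law ::
  "'a::topological_space set \<Rightarrow> 'w measure \<Rightarrow> (real \<Rightarrow> 'w \<Rightarrow> 'a) \<Rightarrow> (real \<Rightarrow> 'a) measure" where
  "process_law S M B = distr M (path_space S) (\<lambda>\<omega>. \<lambda>t\<in>{0..}. B t \<omega>)"


section \<open>Brownian motion\<close>

definition real_brownian_motion :: "real \<Rightarrow> 'w measure \<Rightarrow> (real \<Rightarrow> 'w \<Rightarrow> real) \<Rightarrow> bool" where
  "real_brownian_motion x M W \<longleftrightarrow> continuous_process UNIV M W
     \<and> (\<forall>\<omega>\<in>space M. W 0 \<omega> = x)
     \<and> (\<forall>s t. 0 \<le> s \<and> s < t \<longrightarrow>
          distributed M lborel (\<lambda>\<omega>. W t \<omega> - W s \<omega>) (normal_density 0 (sqrt (t - s))))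
     \<and> (\<forall>(s::nat \<Rightarrow> real) n. 0 \<le> s 0 \<and> mono s \<longrightarrow>
          prob_space.indep_vars M (\<lambda>_. borel) (\<lambda>i \<omega>. W (s (Suc i)) \<omega> - W (s i) \<omega>) {..<n})"

text \<open>Finite stopping times suffice: the strong Markov property at \<open>T\<close> on \<open>{T < \<infinity>}\<close> follows from
  that at the times \<open>min T n\<close>.\<close>

definition strong_markov_family ::
  "'a::topological_space set \<Rightarrow> ('a \<Rightarrow> (real \<Rightarrow> 'a) measure) \<Rightarrow> bool" where
  "strong_markov_family S P \<longleftrightarrow>
     P \<in> restrict_space borel S \<rightarrow>\<^sub>M prob_algebra (path_space S)
     \<and> (\<forall>x\<in>S. AE w in P x. w 0 = x)
     \<and> (\<forall>x\<in>S. \<forall>T. stopping_time (path_filtration S) T \<and> (\<forall>w\<in>space (path_space S). 0 \<le> T w) \<longrightarrow>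
          (\<forall>A\<in>sets (filtration.pre_sigma (space (path_space S)) (path_filtration S) T).
           \<forall>B\<in>sets (path_space S).
             measure (P x) {w\<in>A. (\<lambda>t\<in>{0..}. w (T w + t)) \<in> B}
             = (\<integral>w. indicator A w * measure (P (w (T w))) B \<partial>P x)))"

text \<open>Started inside \<open>e\<close> and stopped on reaching an end of \<open>e\<close>, the process is the image under the chart
  of a stopped linear Brownian motion. (Truncation to \<open>[0, len G e]\<close> only affects a null set.)\<close>

definition brownian_inside_edge ::
  "'a::metric_space mgraph \<Rightarrow> ('a \<Rightarrow> (real \<Rightarrow> 'a) measure) \<Rightarrow> 'a set \<Rightarrow> bool" where
  "brownian_inside_edge G P e \<longleftrightarrow>
    (\<forall>s\<in>{0<..<len G e}. \<forall>Q. real_brownian_motion s Q (\<lambda>t w. w t) \<longrightarrow>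
       process_law (points G) (P (chart G e s)) (\<lambda>t w. stopped (ends G e) w t)
       = process_law (points G) Q
           (\<lambda>t w. chart G e (max 0 (min (len G e) (stopped {0, len G e} w t)))))"

text \<open>Walsh spider with equiprobable legs at \<open>v\<close>: the distance from \<open>v\<close> is locally a reflecting Brownian
  motion, the hitting probabilities of points on the legs are inversely proportional to their
  distances from \<open>v\<close>, and expected exit times from small balls tend to zero. The first condition is
  not implied by the other two, which also hold for processes that are sticky at \<open>v\<close>. An isolated
  vertex carries the constant process.\<close>

definition walsh_at_vertex ::
  "'a::metric_space mgraph \<Rightarrow> ('a \<Rightarrow> (real \<Rightarrow> 'a) measure) \<Rightarrow> 'a \<Rightarrow> bool" where
  "walsh_at_vertex G P v \<longleftrightarrow> (incident G v \<noteq> {} \<longrightarrow>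
     (\<forall>r>0. (\<forall>e\<in>incident G v. r < len G e) \<longrightarrow>
        (\<forall>Q. real_brownian_motion 0 Q (\<lambda>t w. w t) \<longrightarrow>
           process_law UNIV (P v) (\<lambda>t w. stopped {r} (\<lambda>u. radius G v r (w u)) t)
           = process_law UNIV Q (\<lambda>t w. stopped {r} (\<lambda>u. \<bar>w u\<bar>) t)))
     \<and> (\<forall>l. (\<forall>e\<in>incident G v. 0 < l e \<and> l e < len G e) \<longrightarrow>
        (\<forall>j\<in>incident G v.
           measure (P v) {w \<in> space (P v). hitting_time {leg G v j (l j)} w
               < hitting_time ((\<lambda>e. leg G v e (l e)) ` (incident G v - {j})) w}
           = (1 / l j) / (\<Sum>e\<in>incident G v. 1 / l e)))
     \<and> ((\<lambda>r. \<integral>\<^sup>+w. hitting_time {p \<in> points G. \<not> radius G v r p < r} w \<partial>P v) \<longlongrightarrow> 0) (at_right 0))"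

text \<open>\<open>P x\<close> is the law of standard Brownian motion on \<open>G\<close> started at \<open>x\<close>.\<close>

definition graph_brownian_motion ::
  "'a::metric_space mgraph \<Rightarrow> ('a \<Rightarrow> (real \<Rightarrow> 'a) measure) \<Rightarrow> bool" where
  "graph_brownian_motion G P \<longleftrightarrow> strong_markov_family (points G) P
     \<and> (\<forall>e\<in>edges G. brownian_inside_edge G P e) \<and> (\<forall>v\<in>verts G. walsh_at_vertex G P v)"

text \<open>The laws \<open>L n\<close> may live on paths in subspaces of \<open>X\<close>.\<close>

definition weakly_converges ::
  "'a::metric_space set \<Rightarrow> (nat \<Rightarrow> (real \<Rightarrow> 'a) measure) \<Rightarrow> (real \<Rightarrow> 'a) measure \<Rightarrow> bool" where
  "weakly_converges X L N \<longleftrightarrow>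
    (\<forall>T>0. let C = cfunspace (top_of_set {0..T}) (submetric euclidean_metric X) in
       \<forall>\<Phi>. continuous_map (mtopology_of C) euclideanreal \<Phi> \<and> bounded (\<Phi> ` mspace C) \<longrightarrow>
         (\<lambda>n. \<integral>w. \<Phi> (restrict w {0..T}) \<partial>L n) \<longlonglongrightarrow> (\<integral>w. \<Phi> (restrict w {0..T}) \<partial>N))"

definition graph_limit_law :: "'a::metric_space set \<Rightarrow> 'a \<Rightarrow> (real \<Rightarrow> 'a) measure \<Rightarrow> bool" where
  "graph_limit_law X x N \<longleftrightarrow> N \<in> space (prob_algebra (path_space X)) \<and> (AE w in N. w 0 = x)
     \<and> (\<forall>G P y. graph_approximation X G
          \<and> (\<forall>n. graph_brownian_motion (G n) (P n) \<and> y n \<in> points (G n)) \<and> y \<longlonglongrightarrow> x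
          \<longrightarrow> weakly_converges X (\<lambda>n. P n (y n)) N)"

text \<open>Brownian motion on \<open>X\<close> from \<open>x\<close> is the unique-in-law process with the approximation property, so
  uniqueness of the law is part of the definition.\<close>

definition brownian_motion ::
  "'a::metric_space set \<Rightarrow> 'a \<Rightarrow> 'w measure \<Rightarrow> (real \<Rightarrow> 'w \<Rightarrow> 'a) \<Rightarrow> bool" where
  "brownian_motion X x M B \<longleftrightarrow> continuous_process X M B \<and> (\<forall>\<omega>\<in>space M. B 0 \<omega> = x)
     \<and> graph_limit_law X x (process_law X M B)
     \<and> (\<forall>N. graph_limit_law X x N \<longrightarrow> N = process_law X M B)"

end

(* Uniqueness of the limit law yields a graph approximation with Brownian motions. By connectedness
   its graphs eventually contain any compact subarc of e, on which they have finitely many vertices,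
   all of degree 2. Compared with a sine, the resolvent of the killed graph process has an error that
   solves the equation between vertices and, by a maximum principle at the vertices, vanishes; so the
   killed process has the sine eigenfunctions of killed linear Brownian motion, hence its law.
   Continuous cutoffs of paths then pass to the weak limit, and subintervals exhaust e. *)

theory Submission
  imports Defs
begin

text \<open>Why sines: expectations of a Dirichlet sine under killing change in time by a known
  exponential factor, a sine times powers of the cosine is again a combination of sines, and by
  Weierstrass these approximate all test functions. So the eigenfunctions fix the finite-dimensional
  laws. The obstacle is a vertex inside the arc, where the process is known only through its radial
  law, its hitting probabilities and its vanishing exit times. Expanding the sine about the vertex,
  the radial law treats the even part exactly, equal hitting probabilities cancel the exit values of
  the odd part, and small exit times leave an error o(r) on the ball of radius r. Between vertices
  the error of the resolvent is damped by the mean of \<open>exp (- tau)\<close>, \<open>tau\<close>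
  the exit time; at distance r from a vertex this loses an amount linear in r, which beats o(r) at a
  maximum. Survival in an open arc is not a continuous functional and the starting points move with
  \<open>n\<close>, so the limit is squeezed between smaller and larger intervals. As the image of
  \<open>F\<close> may be unbounded, the final comparison of laws uses the coordinate
  \<open>arctan\<close>.\<close>

abbreviation "bmeas M == borel_measurable M"
abbreviation "rborel == restrict_space borel"
abbreviation meas_to (infixr "->>" 60) where "A ->> B == measurable A B"
lemmas integral_congr = Bochner_Integration.integral_cong

section \<open>Path space, its filtration and time shifts\<close>

lemma space_path_space:
 "space (path_space S) = {w : {0..} \<rightarrow>\<^sub>E S. continuous_on {0..} w}" by (auto simp: path_space_def space_restrict_space space_PiM)

lemma path_space_in: "w : space (path_space S) ==> 0 <= t ==> w t : S" by (auto simp: space_path_space)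

lemma path_cont: "w : space (path_space S) ==> continuous_on {0..} w" by (auto simp: space_path_space)

lemma measurable_eval:
 "0 <= t ==> (%w. w t) : path_space S ->> rborel S" unfolding path_space_def by (intro measurable_restrict_space1 measurable_component_singleton) auto

lemma eval_borel:
 "0 <= t ==> (%w. w t) : path_space S ->> borel" by (rule measurable_restrict_space2_iff[THEN iffD1, THEN conjunct1, OF measurable_eval])

lemma into_paths:
 assumes "!!t. 0 <= t ==> (%x. X x t) : M ->> rborel S"
  and "!!x. x : space M ==> continuous_on {0..} (X x)"
 shows "(%x. \<lambda>t\<in>{0..}. X x t) : M ->> path_space S" unfolding path_space_def
proof (rule measurable_restrict_space2)
 show "(%x. \<lambda>t\<in>{0..}. X x t) : M ->> Pi\<^sub>M {0..} (%_. rborel S)" using assms(1) by (intro measurable_restrict) auto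
 show "(%x. \<lambda>t\<in>{0..}. X x t) : space M \<rightarrow> {w. continuous_on {0..} w}"
 proof safe
  fix x assume "x : space M"
  moreover have "continuous_on {0..} (\<lambda>t\<in>{0..}. X x t) = continuous_on {0..} (X x)" by (rule continuous_on_cong) auto
  ultimately show "continuous_on {0..} (\<lambda>t\<in>{0..}. X x t)" using assms(2) by simp
 qed
qed

lemma space_path_filtration [simp]: "space (path_filtration S t) = space (path_space S)" by (simp add: path_filtration_def)

lemma measurable_path_filtration_restrict:
 "(%w. restrict w {0..t}) : path_filtration S t ->> Pi\<^sub>M {0..t} (%_. rborel S)" unfolding path_filtration_def by (rule measurable_vimage_algebra1) (auto simp: space_PiM path_space_in space_restrict_space)

lemma eval_filt:
 assumes "0 <= s" "s <= t"
 shows "(%w. w s) : path_filtration S t ->> rborel S"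
proof -
 have "(%w. restrict w {0..t} s) : path_filtration S t ->> rborel S" using assms by (intro measurable_compose[OF measurable_path_filtration_restrict measurable_component_singleton]) auto
 then show ?thesis using assms by simp
qed

lemma sets_subset_if_measurable_ident:
 assumes "(%x. x) : M ->> N" "space M = space N"
 shows "sets N <= sets M"
proof
 fix A assume A: "A : sets N"
 then have "(%x. x) -` A Int space M : sets M" by (rule measurable_sets[OF assms(1)])
 moreover have "(%x. x) -` A Int space M = A" using sets.sets_into_space[OF A] assms(2) by auto
 ultimately show "A : sets M" by simp
qed

lemma path_filtration_mono:
 assumes "s <= t"
 shows "sets (path_filtration S s) <= sets (path_filtration S t)"
proof -
 have "(%w. restrict w {0..s}) : path_filtration S t ->> Pi\<^sub>M {0..s} (%_. rborel S)" using assms by (intro measurable_restrict eval_filt) auto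
 then have "(%w. w) : path_filtration S t ->> path_filtration S s" unfolding path_filtration_def[of S s] by (intro measurable_vimage_algebra2) (auto simp: path_filtration_def)
 then show ?thesis by (rule sets_subset_if_measurable_ident) simp
qed

lemma filt_subset: "sets (path_filtration S t) <= sets (path_space S)"
proof -
 have "(%w. restrict w {0..t}) : path_space S ->> Pi\<^sub>M {0..t} (%_. rborel S)" by (intro measurable_restrict measurable_eval) auto
 then have "(%w. w) : path_space S ->> path_filtration S t" unfolding path_filtration_def by (intro measurable_vimage_algebra2) auto
 then show ?thesis by (rule sets_subset_if_measurable_ident) simp
qed

lemma filt_meas:
 "f : path_filtration S t ->> N ==> f : path_space S ->> N" using filt_subset[of S t] unfolding measurable_def by auto

lemma filtration_path: "filtration (space (path_space S)) (path_filtration S)" by standard (simp, rule path_filtration_mono)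

text \<open>The random time is rounded up to a multiple of \<open>1 / (n + 1)\<close>. Evaluation at
  a countably valued time is measurable piece by piece, and path continuity passes to the
  limit.\<close>

lemma measurable_eval_at:
 fixes X :: "'b => real => 'a::metric_space"
 assumes [measurable]: "X : M ->> path_space S" "T : bmeas M"
  and T: "!!x. x : space M ==> 0 <= T x"
 shows "(%x. X x (T x)) : M ->> rborel S"
proof (rule measurable_restrict_space2)
 have X: "X x : space (path_space S)" if "x : space M" for x using measurable_space[OF assms(1) that] .
 show "(%x. X x (T x)) : space M \<rightarrow> S" using X T by (auto intro: path_space_in)
 define r where "r n x = real (nat \<lceil>T x * real (Suc n)\<rceil>) / real (Suc n)" for n x
 have "(%x. X x (r n x)) : M ->> borel" for n
 proof -
  have "(%x. X x (real i / real (Suc n))) : M ->> borel" for i by (rule measurable_compose[OF assms(1) eval_borel]) auto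
  moreover have "(%x. nat \<lceil>T x * real (Suc n)\<rceil>) : M ->> count_space UNIV" by measurable
  ultimately show ?thesis unfolding r_def by (rule measurable_compose_countable[where f="%i x. X x (real i / real (Suc n))"])
 qed
 moreover have "(%n. X x (r n x)) \<longlonglongrightarrow> X x (T x)" if x: "x : space M" for x
 proof -
  have "T x <= r n x & r n x <= T x + inverse (real (Suc n))" for n
  proof -
   have "T x * real (Suc n) <= real (nat \<lceil>T x * real (Suc n)\<rceil>)" by linarith
   moreover have "real (nat \<lceil>T x * real (Suc n)\<rceil>) <= T x * real (Suc n) + 1" using T[OF x] by (smt (verit) mult_nonneg_nonneg of_nat_0_le_iff of_nat_nat of_int_ceiling_le_add_one zero_le_ceiling)
   ultimately show ?thesis unfolding r_def by (simp add: field_simps del: of_nat_Suc)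
  qed
  note r = this
  have "(%n. T x + inverse (real (Suc n))) \<longlonglongrightarrow> T x" using tendsto_add[OF tendsto_const[of "T x"] LIMSEQ_inverse_real_of_nat] by simp
  then have "(%n. r n x) \<longlonglongrightarrow> T x" by (rule tendsto_sandwich[OF _ _ tendsto_const, rotated 2]) (use r in auto)
  moreover have "0 <= r n x" for n by (simp add: r_def)
  ultimately show ?thesis using path_cont[OF X[OF x]] T[OF x] by (auto simp: continuous_on_sequentially comp_def)
 qed
 ultimately show "(%x. X x (T x)) : bmeas M" by (rule borel_measurable_LIMSEQ_metric)
qed

text \<open>Restriction to \<open>{0..}\<close> keeps the shifted path extensional, hence a point of
  \<open>path_space\<close>, and gives exactly the term that \<open>strong_markov_family\<close>
  uses.\<close>

definition shift :: "real => (real => 'a) => real => 'a" where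
 "shift r w = (\<lambda>t\<in>{0..}. w (r + t))"

lemma shift_apply [simp]: "0 <= t ==> shift r w t = w (r + t)" by (simp add: shift_def)

lemma measurable_shift:
 fixes X :: "'b => real => 'a::metric_space"
 assumes [measurable]: "X : M ->> path_space S" "T : bmeas M"
  and T: "!!x. x : space M ==> 0 <= T x"
 shows "(%x. shift (T x) (X x)) : M ->> path_space S" unfolding shift_def
proof (rule into_paths)
 show "(%x. X x (T x + t)) : M ->> rborel S" if "0 <= t" for t
 proof (rule measurable_eval_at[OF assms(1)])
  show "(%x. T x + t) : bmeas M" by measurable
  show "0 <= T x + t" if "x : space M" for x using T[OF that] \<open>0 <= t\<close> by simp
 qed
 show "continuous_on {0..} (%t. X x (T x + t))" if "x : space M" for x
 proof (rule continuous_on_compose2[OF path_cont[OF measurable_space[OF assms(1) that]]])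
  show "continuous_on {0..} ((+) (T x))" by (intro continuous_intros)
  show "(+) (T x) ` {0..} <= {0..}" using T[OF that] by auto
 qed
qed

lemma shift_in_path_space:
 fixes w :: "real => 'a::metric_space"
 assumes "w : space (path_space S)" "0 <= r"
 shows "shift r w : space (path_space S)" using measurable_space[OF measurable_shift[OF measurable_ident_sets[OF refl], of "%_. r"] assms(1)] assms(2) by simp

subsection \<open>Hitting times of closed sets\<close>

text \<open>The minimum is taken in \<open>ennreal\<close>: a path that never hits \<open>A\<close>
  gets the horizon \<open>t\<close>, whereas \<open>enn2real\<close> of its infinite hitting time
  would be 0.\<close>

definition hit :: "'a set => real => (real => 'a) => real" where
 "hit A t w = enn2real (min (ennreal t) (hitting_time A w))"

lemma stopped_hit: "stopped A w t = w (hit A t w)" by (simp add: stopped_def hit_def)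

lemma closed_hits:
 assumes "w : space (path_space S)" "closedin (top_of_set S) (S Int A)"
 shows "closed {t. 0 <= t & w t : A}"
proof -
 from assms(2) obtain C where C: "closed C" "S Int A = S Int C" by (auto simp: closedin_closed)
 have "{t. 0 <= t & w t : A} = {0..} Int w -` C" using C path_space_in[OF assms(1)] by auto
 moreover have "closed ({0..} Int w -` C)" using continuous_closed_preimage[OF path_cont[OF assms(1)] _ C(1)] by auto
 ultimately show ?thesis by simp
qed

text \<open>A closed set of hitting times leaves an open gap after \<open>t\<close>, so avoiding
  \<open>A\<close> on \<open>[0,t]\<close> pushes the infimum strictly beyond
  \<open>t\<close>.\<close>

lemma less_hitting_time_iff_closed:
 assumes cl: "closed {s. 0 <= s & w s : A}" and t: "0 <= t"
 shows "ennreal t < hitting_time A w \<longleftrightarrow> (ALL s:{0..t}. w s ~: A)"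
proof
 assume *: "ennreal t < hitting_time A w"
 show "ALL s:{0..t}. w s ~: A"
 proof
  fix s assume s: "s : {0..t}"
  show "w s ~: A"
  proof
   assume "w s : A"
   with s have "hitting_time A w <= ennreal s" unfolding hitting_time_def by (auto intro!: INF_lower2)
   moreover have "ennreal s <= ennreal t" using s by (intro ennreal_leI) auto
   ultimately show False using * by (meson leD order_trans)
  qed
 qed
next
 assume *: "ALL s:{0..t}. w s ~: A"
 define C where "C = {s. 0 <= s & w s : A}"
 have "t : - C" using * t by (auto simp: C_def)
 moreover have "open (- C)" using cl unfolding C_def by (rule open_Compl)
 ultimately obtain d where d: "d > 0" "ball t d <= - C" by (auto simp: open_contains_ball)
 have "ennreal (t + d) <= hitting_time A w" unfolding hitting_time_def
 proof (rule INF_greatest)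
  fix s assume s: "s : {t. 0 <= t & w t : A}"
  then have "s : C" "t < s" using * by (auto simp: C_def not_le[symmetric])
  then have "t + d <= s" using d by (auto simp: subset_iff dist_real_def) (smt (verit))
  then show "ennreal (t + d) <= ennreal s" by (rule ennreal_leI)
 qed
 moreover have "ennreal t < ennreal (t + d)" using d t by (intro ennreal_lessI) auto
 ultimately show "ennreal t < hitting_time A w" by simp
qed

lemma less_hit_iff:
 assumes "w : space (path_space S)" "closedin (top_of_set S) (S Int A)" "0 <= t"
 shows "ennreal t < hitting_time A w \<longleftrightarrow> (ALL s:{0..t}. w s ~: A)" using assms by (intro less_hitting_time_iff_closed closed_hits)

lemma hit_eqI:
 assumes "0 <= r" "r <= t" "!!s. 0 <= s ==> s < r ==> w s ~: A" "r = t | w r : A"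
 shows "hit A t w = r"
proof -
 have ge: "ennreal r <= hitting_time A w" unfolding hitting_time_def using assms(3) by (intro INF_greatest ennreal_leI) (auto simp: not_less[symmetric])
 have "min (ennreal t) (hitting_time A w) = ennreal r" using assms(4)
 proof
  assume "r = t" with ge show ?thesis by (simp add: min_absorb1)
 next
  assume "w r : A"
  then have "hitting_time A w <= ennreal r" unfolding hitting_time_def using assms(1) by (auto intro!: INF_lower2)
  with ge have "hitting_time A w = ennreal r" by simp
  with assms(2) show ?thesis by (simp add: min_absorb2 ennreal_leI)
 qed
 with assms(1) show ?thesis by (simp add: hit_def)
qed

lemma hit_cases:
 assumes cl: "closed {s. 0 <= s & w s : A}" and t: "0 <= t"
 obtains (stay) "ALL s:{0..t}. w s ~: A" "hit A t w = t"
 | (hit) "0 <= hit A t w" "hit A t w <= t" "w (hit A t w) : A" "!!s. 0 <= s ==> s < hit A t w ==> w s ~: A"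
proof (cases "ALL s:{0..t}. w s ~: A")
 case True
 then have "hit A t w = t" using t by (intro hit_eqI) auto
 with True show ?thesis by (rule stay)
next
 case False
 define C where "C = {s. 0 <= s & w s : A}"
 from False obtain s0 where s0: "s0 : C" "s0 <= t" by (auto simp: C_def)
 have bdd: "bdd_below C" by (auto simp: C_def intro!: bdd_belowI)
 have inC: "Inf C : C" using s0 cl bdd by (intro closed_contains_Inf) (auto simp: C_def)
 have le: "Inf C <= t" using s0 bdd by (meson cInf_lower order_trans)
 have less: "w s ~: A" if "0 <= s" "s < Inf C" for s using that bdd by (metis (mono_tags, lifting) C_def cInf_lower mem_Collect_eq not_less)
 have eq: "hit A t w = Inf C" using inC le less by (intro hit_eqI) (auto simp: C_def)
 show ?thesis using inC le less by (intro hit) (auto simp: eq C_def)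
qed

lemma hit_le_iff:
 assumes cl: "closed {s. 0 <= s & w s : A}" and t: "0 <= t"
 shows "hit A t w <= c \<longleftrightarrow> t <= c | (0 <= c & (EX s:{0..c}. w s : A))" using cl t
proof (cases rule: hit_cases)
 case stay
 then show ?thesis by (auto simp: not_le)
next
 case hit
 show ?thesis
 proof
  assume "hit A t w <= c"
  with hit show "t <= c | (0 <= c & (EX s:{0..c}. w s : A))" by auto
 next
  assume "t <= c | (0 <= c & (EX s:{0..c}. w s : A))"
  then show "hit A t w <= c" using hit by auto (meson not_less order_trans)
 qed
qed

lemma hit_nonneg: "0 <= hit A t w" by (simp add: hit_def)

lemma hit_le: "0 <= t ==> hit A t w <= t" unfolding hit_def using enn2real_mono[of "min (ennreal t) (hitting_time A w)" "ennreal t"] by simp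

lemma stopped_in_iff:
 assumes cl: "closed {s. 0 <= s & w s : A}" and t: "0 <= t"
 shows "stopped A w t : A \<longleftrightarrow> (EX s:{0..t}. w s : A)" using cl t by (cases rule: hit_cases) (use t in \<open>auto simp: stopped_hit\<close>)

text \<open>By compactness of \<open>[0,t]\<close>, a continuous path that avoids a closed set keeps
  a distance of some \<open>1 / (m + 1)\<close> from it, and by continuity this bound can be tested
  at countably many times.\<close>

lemma sets_stay:
 fixes S :: "'a::metric_space set"
 assumes cl: "closedin (top_of_set S) (S Int A)"
 shows "{w : space (path_space S). ALL s:{0..t}. w s ~: A} : sets (path_filtration S t)"
\<comment> \<open>The distance \<open>infdist\<close> to the empty set is 0, so that case is set
  apart. In both exceptional cases the event is the whole path space.\<close>
proof (cases "t < 0 | S Int A = {}")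
 case True
 then have "{w : space (path_space S). ALL s:{0..t}. w s ~: A} = space (path_filtration S t)" by (auto dest: path_space_in)
 then show ?thesis by (metis sets.top)
next
 case False
 then have t: "0 <= t" and ne: "S Int A ~= {}" by auto
 from cl obtain C where C: "closed C" "S Int A = S Int C" by (auto simp: closedin_closed)
 have Cne: "C ~= {}" using C ne by auto
 \<comment> \<open>The test times are \<open>t * q\<close> with \<open>q\<close> in
   \<open>Q\<close>. The scaling keeps them inside \<open>[0,t]\<close>, so the event lies in
   \<open>path_filtration S t\<close> and not merely in a later sigma-algebra.\<close>
 define Q where "Q = insert 1 (\<rat> Int {0..1::real})"
 have [simp]: "countable Q" by (auto simp: Q_def countable_rat)
 have Q: "q : Q ==> 0 <= q & q <= 1" for q by (auto simp: Q_def)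
 have "{w : space (path_space S). ALL s:{0..t}. w s ~: A}
   = {w : space (path_filtration S t). \<exists>m::nat. ALL q:Q. inverse (real (Suc m)) <= infdist (w (t * q)) C}"
 proof (intro set_eqI iffI; (elim CollectE conjE)?; intro CollectI conjI)
  fix w assume w: "w : space (path_space S)" and A: "ALL s:{0..t}. w s ~: A"
  have "continuous_on {0..t} (%s. infdist (w s) C)" by (intro continuous_intros continuous_on_subset[OF path_cont[OF w]]) auto
  then obtain s0 where s0: "s0 : {0..t}" "!!s. s : {0..t} ==> infdist (w s0) C <= infdist (w s) C" using continuous_attains_inf[of "{0..t}" "%s. infdist (w s) C"] t by auto
  have "w s0 ~: C" using A s0(1) C path_space_in[OF w, of s0] by auto
  then have "infdist (w s0) C > 0" using C Cne by (metis in_closed_iff_infdist_zero infdist_nonneg less_eq_real_def)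
  then obtain m where "inverse (real (Suc m)) < infdist (w s0) C" using reals_Archimedean by blast
  then show "\<exists>m::nat. ALL q:Q. inverse (real (Suc m)) <= infdist (w (t * q)) C" using s0(2) Q t by (intro exI[of _ m] ballI order_trans[OF less_imp_le s0(2)]) (auto simp: mult_left_le)
  show "w : space (path_filtration S t)" using w by simp
 next
  fix w assume w': "w : space (path_filtration S t)" and ex: "\<exists>m::nat. ALL q:Q. inverse (real (Suc m)) <= infdist (w (t * q)) C"
  from w' show w: "w : space (path_space S)" by simp
  from ex obtain m where m: "!!q. q : Q ==> inverse (real (Suc m)) <= infdist (w (t * q)) C" by blast
  have cont: "continuous_on {0..1} (%q. infdist (w (t * q)) C)" using t by (intro continuous_intros continuous_on_compose2[OF path_cont[OF w]]) (auto intro!: continuous_intros)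
  have "inverse (real (Suc m)) <= infdist (w (t * q)) C" if q: "q : {0..1}" for q
  proof -
   have "{0<..<1::real} <= closure (\<rat> Int {0<..<1})" using open_Int_closure_subset[of "{0<..<1::real}" \<rat>] Rats_closure_real by (auto simp: Int_commute)
   then have "closure {0<..<1::real} <= closure (\<rat> Int {0<..<1})" using closure_mono closure_closure by blast
   then have "{0..1::real} <= closure (\<rat> Int {0<..<1})" by simp
   then have "q : closure (\<rat> Int {0..1})" using q closure_mono[of "\<rat> Int {0<..<1::real}" "\<rat> Int {0..1}"] by (auto simp: subset_iff)
   then obtain f where f: "!!n. f n : \<rat> Int {0..1}" "f \<longlonglongrightarrow> q" by (auto simp: closure_sequential)
   have "(%n. infdist (w (t * f n)) C) \<longlonglongrightarrow> infdist (w (t * q)) C" using cont f q by (auto simp: continuous_on_sequentially comp_def)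
   then show ?thesis by (rule LIMSEQ_le_const) (use f m in \<open>auto simp: Q_def\<close>)
  qed
  note * = this
  show "ALL s:{0..t}. w s ~: A"
  proof
   fix s assume s: "s : {0..t}"
   have "inverse (real (Suc m)) <= infdist (w s) C"
   proof (cases "t = 0")
    case True with s *[of 0] show ?thesis by auto
   next
    case False with s t *[of "s / t"] show ?thesis by auto
   qed
   then have "w s ~: C" by (metis Cne infdist_zero inverse_nonpositive_iff_nonpositive not_le of_nat_0_less_iff zero_less_Suc)
   then show "w s ~: A" using C path_space_in[OF w, of s] s by auto
  qed
 qed
 moreover have "{w : space (path_filtration S t). \<exists>m::nat. ALL q:Q. inverse (real (Suc m)) <= infdist (w (t * q)) C} : sets (path_filtration S t)"
 proof -
  have [measurable]: "(%w. w (t * q)) : path_filtration S t ->> borel" if "q : Q" for q using eval_filt[of "t * q" t S] Q[OF that] t by (auto simp: measurable_restrict_space2_iff mult_left_le)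
  have [measurable]: "(%x. infdist x C) : bmeas borel" by (intro borel_measurable_continuous_onI continuous_intros)
  have "Measurable.pred (path_filtration S t) (%w. \<exists>m::nat. ALL q:Q. inverse (real (Suc m)) <= infdist (w (t * q)) C)" by (intro pred_intros_countable pred_intros_countable_bounded) measurable
  then show ?thesis by (simp add: Measurable.pred_def)
 qed
 ultimately show ?thesis by simp
qed

lemma pred_stay:
 fixes S :: "'a::metric_space set"
 assumes "closedin (top_of_set S) (S Int A)"
 shows "Measurable.pred (path_filtration S t) (%w. ALL s:{0..t}. w s ~: A)" using sets_stay[OF assms] by (simp add: Measurable.pred_def)

text \<open>For a closed \<open>A\<close> the unaugmented filtration suffices: whether
  \<open>A\<close> was met by time \<open>c\<close> is decided by the path on \<open>[0,c]\<close>,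
  end point included.\<close>

lemma stopping_time_hit:
 fixes S :: "'a::metric_space set"
 assumes "closedin (top_of_set S) (S Int A)" "0 <= t"
 shows "stopping_time (path_filtration S) (hit A t)"
proof (rule stopping_timeI)
 fix c
 have A: "Measurable.pred (path_filtration S c) (%w. t <= c | (0 <= c & \<not> (ALL s:{0..c}. w s ~: A)))" by (intro pred_intros_logic pred_stay assms measurable_const) auto
 have B: "hit A t w <= c \<longleftrightarrow> t <= c | (0 <= c & \<not> (ALL s:{0..c}. w s ~: A))" if "w : space (path_filtration S c)" for w using hit_le_iff[OF closed_hits[OF _ assms(1)] assms(2), of w c] that by auto
 show "Measurable.pred (path_filtration S c) (%w. hit A t w <= c)" by (rule iffD2[OF measurable_cong, OF B A])
qed

lemma measurable_hit:
 fixes X :: "'b => real => 'a::metric_space"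
 assumes cl: "closedin (top_of_set S) (S Int A)"
  and X [measurable]: "X : M ->> path_space S" and T [measurable]: "T : bmeas M"
  and T0: "!!x. x : space M ==> 0 <= T x"
 shows "(%x. hit A (T x) (X x)) : bmeas M"
proof (rule borel_measurableI_le)
 fix c
 have "Measurable.pred (path_space S) (%w. ALL s:{0..c}. w s ~: A)" by (rule filt_meas[OF pred_stay[OF cl]])
 then have [measurable]: "Measurable.pred M (%x. ALL s:{0..c}. X x s ~: A)" by (rule measurable_compose[OF X])
 have A: "Measurable.pred M (%x. T x <= c | (0 <= c & \<not> (ALL s:{0..c}. X x s ~: A)))" by (intro pred_intros_logic) measurable
 have B: "hit A (T x) (X x) <= c \<longleftrightarrow> T x <= c | (0 <= c & \<not> (ALL s:{0..c}. X x s ~: A))" if "x : space M" for x using hit_le_iff[OF closed_hits[OF measurable_space[OF X that] cl] T0[OF that], of c] by auto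
 have "Measurable.pred M (%x. hit A (T x) (X x) <= c)" by (rule iffD2[OF measurable_cong, OF B A])
 then show "{x : space M. hit A (T x) (X x) <= c} : sets M" by (simp add: Measurable.pred_def)
qed

lemma measurable_stopped_at:
 fixes X :: "'b => real => 'a::metric_space"
 assumes cl: "closedin (top_of_set S) (S Int A)"
  and X: "X : M ->> path_space S" and T: "T : bmeas M"
  and T0: "!!x. x : space M ==> 0 <= T x"
 shows "(%x. stopped A (X x) (T x)) : M ->> rborel S" unfolding stopped_hit by (intro measurable_eval_at X measurable_hit[OF cl] T T0 hit_nonneg)

text \<open>The form with \<open>min\<close> makes the truncated time 1-Lipschitz in its horizon,
  which is why stopped paths are continuous.\<close>

lemma hit_lipschitz:
 assumes cl: "closed {s. 0 <= s & w s : A}" and t: "0 <= s" "s <= t"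
 shows "hit A s w = min s (hit A t w)"
proof -
 from t have "0 <= t" by simp
 from cl this show ?thesis
 proof (cases rule: hit_cases)
  case stay
  have "hit A s w = s" by (rule hit_eqI) (use stay t in auto)
  with stay t show ?thesis by simp
 next
  case hit
  show ?thesis
  proof (rule hit_eqI)
   show "w r ~: A" if "0 <= r" "r < min s (hit A t w)" for r using hit(4)[OF that(1)] that(2) by simp
   show "min s (hit A t w) = s | w (min s (hit A t w)) : A" using hit(3) by (simp add: min_def)
  qed (use hit t in auto)
 qed
qed

lemma continuous_stopped:
 assumes cl: "closed {s. 0 <= s & w s : A}" and w: "continuous_on {0..} w"
 shows "continuous_on {0..} (stopped A w)"
proof -
 have lip: "\<bar>hit A s w - hit A t w\<bar> <= \<bar>s - t\<bar>" if "0 <= s" "0 <= t" for s t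
 proof (cases "s <= t")
  case True then show ?thesis using hit_lipschitz[OF cl that(1) True] hit_le[OF that(2), of A w] by auto
 next
  case False then show ?thesis using hit_lipschitz[OF cl that(2), of s] hit_le[OF that(1), of A w] by auto
 qed
 have "continuous_on {0..} (%t. hit A t w)" unfolding continuous_on_iff dist_real_def
 proof (intro ballI allI impI)
  fix t e :: real assume t: "t : {0..}" and "0 < e"
  then show "\<exists>d>0. ALL s:{0..}. \<bar>s - t\<bar> < d --> \<bar>hit A s w - hit A t w\<bar> < e"
  proof (intro exI[of _ e] conjI ballI impI)
   fix s assume "s : {0..}" "\<bar>s - t\<bar> < e"
   with t show "\<bar>hit A s w - hit A t w\<bar> < e" using lip[of s t] by simp
  qed
 qed
 then have "continuous_on {0..} (%t. w (hit A t w))" by (rule continuous_on_compose2[OF w]) (auto simp: hit_nonneg)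
 then show ?thesis by (simp add: stopped_hit[abs_def])
qed

lemma stopped_path_meas:
 fixes S :: "'a::metric_space set"
 assumes cl: "closedin (top_of_set S) (S Int A)"
 shows "(%w. \<lambda>t\<in>{0..}. stopped A w t) : path_space S ->> path_space S"
proof (rule into_paths)
 show "(%w. stopped A w t) : path_space S ->> rborel S" if "0 <= t" for t by (rule measurable_stopped_at[OF cl measurable_ident_sets[OF refl]]) (use that in auto)
 show "continuous_on {0..} (stopped A w)" if "w : space (path_space S)" for w using that by (intro continuous_stopped closed_hits[OF _ cl] path_cont)
qed

lemma hit_shift:
 assumes cl: "closed {s. 0 <= s & w s : A}" and r: "0 <= r" and t: "0 <= t"
  and out: "!!s. 0 <= s ==> s < r ==> w s ~: A"
  and cl': "closed {s. 0 <= s & shift r w s : A}"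
 shows "hit A (r + t) w = r + hit A t (shift r w)" using cl' t
proof (cases rule: hit_cases)
 case stay
 have "w s ~: A" if "0 <= s" "s < r + t" for s using stay(1)[rule_format, of "s - r"] out[of s] that by (cases "s < r") auto
 note o = this
 have "hit A (r + t) w = r + t" using r t by (intro hit_eqI o) auto
 with stay show ?thesis by simp
next
 case hit
 have "w s ~: A" if "0 <= s" "s < r + hit A t (shift r w)" for s using hit(4)[of "s - r"] out[of s] that by (cases "s < r") auto
 note o = this
 show ?thesis by (rule hit_eqI[OF _ _ o]) (use hit(1-3) r t in auto)
qed

lemma stopped_shift:
 assumes "closed {s. 0 <= s & w s : A}" "0 <= r" "0 <= t"
  "!!s. 0 <= s ==> s < r ==> w s ~: A" "closed {s. 0 <= s & shift r w s : A}"
 shows "stopped A w (r + t) = stopped A (shift r w) t" using hit_shift[OF assms(1-5)] by (simp add: stopped_hit hit_nonneg)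

subsection \<open>The strong Markov property for functionals\<close>

locale path_markov =
 fixes S :: "'a::metric_space set" and P :: "'a => (real => 'a) measure"
 assumes strong_markov: "strong_markov_family S P"
begin

lemma measurable_P: "P : rborel S ->> subprob_algebra (path_space S)" using strong_markov by (auto simp: strong_markov_family_def intro: measurable_prob_algebraD)

lemma
 assumes "x : S"
 shows prob_space_P: "prob_space (P x)"
  and sets_P: "sets (P x) = sets (path_space S)"
  and space_P: "space (P x) = space (path_space S)"
proof -
 have "P : rborel S ->> prob_algebra (path_space S)" using strong_markov by (auto simp: strong_markov_family_def)
 then have *: "P x : space (prob_algebra (path_space S))" by (rule measurable_space) (simp add: space_restrict_space assms)
 then show "prob_space (P x)" and s: "sets (P x) = sets (path_space S)" by (auto simp: space_prob_algebra)
 show "space (P x) = space (path_space S)" by (rule sets_eq_imp_space_eq[OF s])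
qed

lemma AE_start: "x : S ==> AE w in P x. w 0 = x" using strong_markov by (auto simp: strong_markov_family_def)

lemma P_meas_iff: "x : S ==> P x ->> N = path_space S ->> N" by (rule measurable_cong_sets[OF sets_P refl])

lemma measurable_kernel_integral:
 fixes H :: "_ => real"
 assumes "H : bmeas (path_space S)"
 shows "(%y. \<integral>v. H v \<partial>P y) : bmeas (rborel S)" by (rule measurable_compose[OF measurable_P integral_measurable_subprob_algebra[OF assms]])

lemma pre_sigma_subset:
 assumes T: "stopping_time (path_filtration S) T"
 shows "sets (filtration.pre_sigma (space (path_space S)) (path_filtration S) T) <= sets (path_space S)"
proof
 interpret F: filtration "space (path_space S)" "path_filtration S" by (rule filtration_path)
 fix A assume A: "A : sets (F.pre_sigma T)"
 have eq: "A = (\<Union>n::nat. {w : A. T w <= real n})" by (auto intro: real_arch_simple)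
 have "{w : A. T w <= real n} : sets (path_space S)" for n using F.sets_pre_sigmaD[OF T A, of "real n"] filt_subset by blast
 then have "(\<Union>n::nat. {w : A. T w <= real n}) : sets (path_space S)" by (intro sets.countable_UN) blast
 then show "A : sets (path_space S)" by (simp only: eq[symmetric])
qed

lemma measurable_pre_sigma:
 assumes T: "stopping_time (path_filtration S) T"
  and f: "f : filtration.pre_sigma (space (path_space S)) (path_filtration S) T ->> N"
 shows "f : path_space S ->> N"
proof -
 interpret F: filtration "space (path_space S)" "path_filtration S" by (rule filtration_path)
 show ?thesis
 proof (rule measurableI)
  show "f w : space N" if "w : space (path_space S)" for w using measurable_space[OF f] that by (simp add: F.space_pre_sigma)
  show "f -` A Int space (path_space S) : sets (path_space S)" if "A : sets N" for A using measurable_sets[OF f that] pre_sigma_subset[OF T] by (auto simp: F.space_pre_sigma)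
 qed
qed

text \<open>The definition supplies only indicators of an event before \<open>T\<close> and of an
  event after \<open>T\<close>. The first is extended to \<open>Z\<close> by monotone approximation,
  the second to \<open>H\<close> by recognising two equal measures on path space.\<close>

lemma strong_markov_nn:
 fixes Z H :: "(real => 'a) => ennreal"
 assumes x: "x : S" and T: "stopping_time (path_filtration S) T"
  and T0: "!!w. w : space (path_space S) ==> 0 <= T w"
  and Z: "Z : bmeas (filtration.pre_sigma (space (path_space S)) (path_filtration S) T)"
  and H: "H : bmeas (path_space S)"
 shows "(\<integral>\<^sup>+w. Z w * H (shift (T w) w) \<partial>P x) = (\<integral>\<^sup>+w. Z w * (\<integral>\<^sup>+v. H v \<partial>P (w (T w))) \<partial>P x)"
proof -
 interpret F: filtration "space (path_space S)" "path_filtration S" by (rule filtration_path)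
 interpret Px: prob_space "P x" by (rule prob_space_P[OF x])
 have space_FT: "space (F.pre_sigma T) = space (P x)" by (simp add: F.space_pre_sigma space_P[OF x])
 have FT: "f : P x ->> N" if "f : F.pre_sigma T ->> N" for f :: "_ => 'b" and N :: "'b measure" unfolding P_meas_iff[OF x] by (rule measurable_pre_sigma[OF T that])
 have T': "T : bmeas (path_space S)" by (rule measurable_stopping_time[OF T]) (use filt_subset in auto)
 have id: "(%w. w) : P x ->> path_space S" unfolding P_meas_iff[OF x] by simp
 have TP [measurable]: "T : bmeas (P x)" unfolding P_meas_iff[OF x] by (rule T')
 have T0': "0 <= T w" if "w : space (P x)" for w using T0 that by (simp add: space_P[OF x])
 have th [measurable]: "(%w. shift (T w) w) : P x ->> path_space S" by (rule measurable_shift[OF id TP T0'])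
 have ev: "(%w. w (T w)) : P x ->> rborel S" by (rule measurable_eval_at[OF id TP T0'])
 have evS: "w (T w) : S" if "w : space (P x)" for w using that T0' by (auto simp: space_P[OF x] intro: path_space_in)
 have K [measurable]: "(%w. P (w (T w))) : P x ->> subprob_algebra (path_space S)" by (rule measurable_compose[OF ev measurable_P])
 have Zm [measurable]: "Z : bmeas (P x)" by (rule FT[OF Z])
 have base: "(\<integral>\<^sup>+w. Z w * indicator B (shift (T w) w) \<partial>P x) = (\<integral>\<^sup>+w. Z w * emeasure (P (w (T w))) B \<partial>P x)"
  if B [measurable]: "B : sets (path_space S)" for B using Z
 proof (induction rule: borel_measurable_induct)
  case (cong f g)
  then show ?case by (simp add: space_FT cong: nn_integral_cong)
 next
  case (set A)
  have Am [measurable]: "A : sets (P x)" using pre_sigma_subset[OF T] set sets_P[OF x] by auto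
  have AS: "A <= space (P x)" using sets.sets_into_space[OF Am] .
  have "(\<integral>\<^sup>+w. indicator A w * indicator B (shift (T w) w) \<partial>P x)
    = (\<integral>\<^sup>+w. indicator {w : A. (\<lambda>t\<in>{0..}. w (T w + t)) : B} w \<partial>P x)" by (intro nn_integral_cong) (auto simp: indicator_def shift_def)
  also have "... = emeasure (P x) {w : A. (\<lambda>t\<in>{0..}. w (T w + t)) : B}"
  proof (rule nn_integral_indicator)
   have "{w : A. (\<lambda>t\<in>{0..}. w (T w + t)) : B} = A Int {w : space (P x). shift (T w) w : B}" using AS by (auto simp: shift_def)
   also have "... : sets (P x)" by measurable
   finally show "{w : A. (\<lambda>t\<in>{0..}. w (T w + t)) : B} : sets (P x)" .
  qed
  also have "... = ennreal (\<integral>w. indicator A w * measure (P (w (T w))) B \<partial>P x)" using strong_markov x T T0 set B unfolding strong_markov_family_def Px.emeasure_eq_measure by auto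
  also have "... = (\<integral>\<^sup>+w. ennreal (indicator A w * measure (P (w (T w))) B) \<partial>P x)"
  proof (rule nn_integral_eq_integral[symmetric])
   show "integrable (P x) (%w. indicator A w * measure (P (w (T w))) B)"
   proof (rule Px.integrable_const_bound[where B=1])
    show "AE w in P x. norm (indicator A w * measure (P (w (T w))) B) <= 1" by (intro AE_I2) (auto simp: indicator_def intro!: prob_space.prob_le_1 prob_space_P evS)
    have "(%w. measure (P (w (T w))) B) : bmeas (P x)" by (rule measurable_compose[OF K measurable_measure_subprob_algebra[OF B]])
    then show "(%w. indicator A w * measure (P (w (T w))) B) : bmeas (P x)" by (intro borel_measurable_times borel_measurable_indicator Am)
   qed
  qed auto
  also have "... = (\<integral>\<^sup>+w. indicator A w * emeasure (P (w (T w))) B \<partial>P x)"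
  proof (intro nn_integral_cong)
   fix w assume "w : space (P x)"
   then interpret Pw: prob_space "P (w (T w))" by (intro prob_space_P evS)
   show "ennreal (indicator A w * measure (P (w (T w))) B) = indicator A w * emeasure (P (w (T w))) B" by (simp add: Pw.emeasure_eq_measure indicator_def)
  qed
  finally show ?case .
 next
  case (mult u c)
  note [measurable] = FT[OF mult(2)]
  have [measurable]: "(%w. emeasure (P (w (T w))) B) : bmeas (P x)" by (rule measurable_compose[OF K measurable_emeasure_subprob_algebra[OF B]])
  show ?case using mult(4) by (simp add: mult.assoc nn_integral_cmult)
 next
  case (add u v)
  note [measurable] = FT[OF add.hyps(1)] FT[OF add.hyps(3)]
  have [measurable]: "(%w. emeasure (P (w (T w))) B) : bmeas (P x)" by (rule measurable_compose[OF K measurable_emeasure_subprob_algebra[OF B]])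
  show ?case using add.IH by (simp add: distrib_right nn_integral_add)
 next
  case (seq U)
  note [measurable] = FT[OF seq.hyps(1)]
  have [measurable]: "(%w. emeasure (P (w (T w))) B) : bmeas (P x)" by (rule measurable_compose[OF K measurable_emeasure_subprob_algebra[OF B]])
  have 1: "(\<Squnion>i. U i) w * c = (SUP i. U i w * c)" for w c by (simp add: SUP_mult_right_ennreal image_comp)
  have m: "incseq (%i w. U i w * g w)" for g using seq.hyps(3) by (auto simp: incseq_def le_fun_def intro!: mult_right_mono)
  show ?case unfolding 1 by (subst (1 2) nn_integral_monotone_convergence_SUP[OF m]) (auto simp: seq.IH)
 qed
 define D where "D = density (P x) Z"
 have thD [measurable]: "(%w. shift (T w) w) : D ->> path_space S"
  and KD [measurable]: "(%w. P (w (T w))) : D ->> subprob_algebra (path_space S)" using th K by (auto simp: D_def)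
 have ne: "space D ~= {}" using Px.not_empty by (simp add: D_def)
 \<comment> \<open>Weighted by \<open>Z\<close>, the law of the shifted path is the mixture of the
   laws \<open>P (w (T w))\<close>. Agreement on all events then gives equal integrals of
   \<open>H\<close>.\<close>
 have "distr D (path_space S) (%w. shift (T w) w) = D \<bind> (%w. P (w (T w)))"
 proof (rule measure_eqI)
  show "sets (distr D (path_space S) (%w. shift (T w) w)) = sets (D \<bind> (%w. P (w (T w))))" using sets_bind[of D "%w. P (w (T w))" "path_space S"] ne evS sets_P by (simp add: D_def)
  fix B assume "B : sets (distr D (path_space S) (%w. shift (T w) w))"
  then have B [measurable]: "B : sets (path_space S)" by simp
  have "emeasure (distr D (path_space S) (%w. shift (T w) w)) B
    = (\<integral>\<^sup>+w. indicator B (shift (T w) w) \<partial>D)" using nn_integral_distr[OF thD, of "indicator B"] by simp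
  also have "... = (\<integral>\<^sup>+w. Z w * indicator B (shift (T w) w) \<partial>P x)" unfolding D_def by (rule nn_integral_density) measurable
  also have "... = (\<integral>\<^sup>+w. Z w * emeasure (P (w (T w))) B \<partial>P x)" by (rule base[OF B])
  also have "... = (\<integral>\<^sup>+w. emeasure (P (w (T w))) B \<partial>D)" unfolding D_def by (rule nn_integral_density[symmetric, OF Zm measurable_compose[OF K measurable_emeasure_subprob_algebra[OF B]]])
  also have "... = emeasure (D \<bind> (%w. P (w (T w)))) B" by (rule emeasure_bind[symmetric, OF ne KD B])
  finally show "emeasure (distr D (path_space S) (%w. shift (T w) w)) B = emeasure (D \<bind> (%w. P (w (T w)))) B" .
 qed
 then have eq: "(\<integral>\<^sup>+v. H v \<partial>distr D (path_space S) (%w. shift (T w) w)) = (\<integral>\<^sup>+v. H v \<partial>(D \<bind> (%w. P (w (T w)))))" by simp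
 have "(\<integral>\<^sup>+w. Z w * H (shift (T w) w) \<partial>P x) = (\<integral>\<^sup>+w. H (shift (T w) w) \<partial>D)" unfolding D_def by (rule nn_integral_density[symmetric, OF Zm measurable_compose[OF th H]])
 also have "... = (\<integral>\<^sup>+v. H v \<partial>distr D (path_space S) (%w. shift (T w) w))" by (rule nn_integral_distr[symmetric, OF thD]) (use H in simp)
 also have "... = (\<integral>\<^sup>+v. H v \<partial>(D \<bind> (%w. P (w (T w)))))" by (rule eq)
 also have "... = (\<integral>\<^sup>+w. \<integral>\<^sup>+v. H v \<partial>P (w (T w)) \<partial>D)" by (rule nn_integral_bind[OF H KD])
 also have "... = (\<integral>\<^sup>+w. Z w * (\<integral>\<^sup>+v. H v \<partial>P (w (T w))) \<partial>P x)" unfolding D_def by (rule nn_integral_density[OF Zm measurable_compose[OF K nn_integral_measurable_subprob_algebra[OF H]]])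
 finally show ?thesis .
qed

text \<open>Adding the bound \<open>b\<close> makes \<open>H\<close> nonnegative. The nonnegative
  case applies to \<open>H + b\<close>, and the contribution of \<open>b\<close>, the same on both
  sides, cancels.\<close>

lemma strong_markov_real:
 fixes Z H :: "(real => 'a) => real"
 assumes x: "x : S" and T: "stopping_time (path_filtration S) T"
  and T0: "!!w. w : space (path_space S) ==> 0 <= T w"
  and Z: "Z : bmeas (filtration.pre_sigma (space (path_space S)) (path_filtration S) T)"
  and Z0: "!!w. w : space (path_space S) ==> 0 <= Z w" "!!w. w : space (path_space S) ==> Z w <= c"
  and H: "H : bmeas (path_space S)" "!!w. w : space (path_space S) ==> \<bar>H w\<bar> <= b"
 shows "(\<integral>w. Z w * H (shift (T w) w) \<partial>P x) = (\<integral>w. Z w * (\<integral>v. H v \<partial>P (w (T w))) \<partial>P x)"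
proof -
 interpret F: filtration "space (path_space S)" "path_filtration S" by (rule filtration_path)
 interpret Px: prob_space "P x" by (rule prob_space_P[OF x])
 have Zm [measurable]: "Z : bmeas (P x)" unfolding P_meas_iff[OF x] by (rule measurable_pre_sigma[OF T Z])
 have T': "T : bmeas (path_space S)" by (rule measurable_stopping_time[OF T]) (use filt_subset in auto)
 have id: "(%w. w) : path_space S ->> path_space S" by simp
 have th: "(%w. shift (T w) w) : path_space S ->> path_space S" by (rule measurable_shift[OF id T' T0])
 have Hm [measurable]: "(%w. H (shift (T w) w)) : bmeas (P x)" unfolding P_meas_iff[OF x] by (rule measurable_compose[OF th H(1)])
 have ev: "(%w. w (T w)) : path_space S ->> rborel S" by (rule measurable_eval_at[OF id T' T0])
 have Km [measurable]: "(%w. \<integral>v. H v \<partial>P (w (T w))) : bmeas (P x)" unfolding P_meas_iff[OF x] by (rule measurable_compose[OF ev measurable_kernel_integral[OF H(1)]])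
 have sp: "space (P x) = space (path_space S)" by (rule space_P[OF x])
 have Hb: "\<bar>H (shift (T w) w)\<bar> <= b" if "w : space (P x)" for w using that by (intro H(2) shift_in_path_space T0) (simp_all add: sp)
 have inS: "w (T w) : S" if "w : space (P x)" for w using that by (intro path_space_in[of w] T0) (simp_all add: sp)
 have Kb: "integrable (P y) H" "\<bar>\<integral>v. H v \<partial>P y\<bar> <= b" if y: "y : S" for y
 proof -
  interpret Py: prob_space "P y" by (rule prob_space_P[OF y])
  show i: "integrable (P y) H" by (rule Py.integrable_const_bound[where B=b])
     (auto simp: space_P[OF y] P_meas_iff[OF y] H intro!: AE_I2)
  have "\<bar>\<integral>v. H v \<partial>P y\<bar> <= (\<integral>v. \<bar>H v\<bar> \<partial>P y)" by (rule integral_abs_bound)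
  also have "... <= b" by (rule Py.integral_le_const) (use i H(2) in \<open>auto simp: space_P[OF y] intro!: AE_I2\<close>)
  finally show "\<bar>\<integral>v. H v \<partial>P y\<bar> <= b" .
 qed
 have b0: "0 <= b" using Kb(2)[OF x] by linarith
 have int: "integrable (P x) (%w. Z w * g w)"
  if "g : bmeas (P x)" "!!w. w : space (P x) ==> \<bar>g w\<bar> <= d" for g d
 proof (rule Px.integrable_const_bound[where B="c * d"])
  show "AE w in P x. norm (Z w * g w) <= c * d" by (intro AE_I2) (use Z0 that(2) in \<open>auto simp: abs_mult sp intro!: mult_mono order_trans[OF Z0(1) Z0(2)]\<close>)
  show "(%w. Z w * g w) : bmeas (P x)" using that(1) by measurable
 qed
 have intZ: "integrable (P x) (%w. Z w * b)" by (rule int[of "%_. b" b]) (use b0 in auto)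
 have i1: "integrable (P x) (%w. Z w * H (shift (T w) w))" by (rule int[OF Hm Hb])
 have i2: "integrable (P x) (%w. Z w * (\<integral>v. H v \<partial>P (w (T w))))" by (rule int[OF Km]) (rule Kb(2)[OF inS])
 have "(\<integral>w. Z w * H (shift (T w) w) \<partial>P x) + (\<integral>w. Z w * b \<partial>P x) = (\<integral>w. Z w * (H (shift (T w) w) + b) \<partial>P x)" using i1 intZ by (simp add: distrib_left)
 also have "... = enn2real (\<integral>\<^sup>+w. ennreal (Z w * (H (shift (T w) w) + b)) \<partial>P x)"
 proof (rule integral_eq_nn_integral)
  show "AE w in P x. 0 <= Z w * (H (shift (T w) w) + b)"
  proof (rule AE_I2)
   fix w assume w: "w : space (P x)"
   show "0 <= Z w * (H (shift (T w) w) + b)" using Hb[OF w] Z0(1)[of w] w by (auto simp: sp)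
  qed
 qed measurable
 also have "(\<integral>\<^sup>+w. ennreal (Z w * (H (shift (T w) w) + b)) \<partial>P x) = (\<integral>\<^sup>+w. ennreal (Z w) * ennreal (H (shift (T w) w) + b) \<partial>P x)"
 proof (intro nn_integral_cong ennreal_mult)
  fix w assume w: "w : space (P x)"
  show "0 <= Z w" "0 <= H (shift (T w) w) + b" using Hb[OF w] Z0(1)[of w] w by (auto simp: sp)
 qed
 also have "... = (\<integral>\<^sup>+w. ennreal (Z w) * (\<integral>\<^sup>+v. ennreal (H v + b) \<partial>P (w (T w))) \<partial>P x)" by (rule strong_markov_nn[OF x T T0]) (use Z H(1) in measurable)
 also have "... = (\<integral>\<^sup>+w. ennreal (Z w * ((\<integral>v. H v \<partial>P (w (T w))) + b)) \<partial>P x)"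
 proof (intro nn_integral_cong)
  fix w assume w: "w : space (P x)"
  define y where "y = w (T w)"
  have y: "y : S" using inS[OF w] by (simp add: y_def)
  interpret Py: prob_space "P y" by (rule prob_space_P[OF y])
  have "(\<integral>\<^sup>+v. ennreal (H v + b) \<partial>P y) = ennreal (\<integral>v. H v + b \<partial>P y)"
  proof (rule nn_integral_eq_integral)
   show "integrable (P y) (%v. H v + b)" using Kb(1)[OF y] by simp
   show "AE v in P y. 0 <= H v + b"
   proof (rule AE_I2)
    fix v assume "v : space (P y)"
    then show "0 <= H v + b" using H(2)[of v] by (simp add: space_P[OF y])
   qed
  qed
  also have "(\<integral>v. H v + b \<partial>P y) = (\<integral>v. H v \<partial>P y) + b" using Kb(1)[OF y] by (simp add: Py.prob_space)
  finally show "ennreal (Z w) * (\<integral>\<^sup>+v. ennreal (H v + b) \<partial>P (w (T w))) = ennreal (Z w * ((\<integral>v. H v \<partial>P (w (T w))) + b))" using Z0(1)[of w] w Kb(2)[OF y] unfolding y_def sp by (subst ennreal_mult) auto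
 qed
 also have "enn2real ... = (\<integral>w. Z w * ((\<integral>v. H v \<partial>P (w (T w))) + b) \<partial>P x)"
 proof (rule integral_eq_nn_integral[symmetric])
  show "AE w in P x. 0 <= Z w * ((\<integral>v. H v \<partial>P (w (T w))) + b)"
  proof (rule AE_I2)
   fix w assume w: "w : space (P x)"
   show "0 <= Z w * ((\<integral>v. H v \<partial>P (w (T w))) + b)" using Kb(2)[OF inS[OF w]] Z0(1)[of w] w by (auto simp: sp)
  qed
 qed measurable
 also have "... = (\<integral>w. Z w * (\<integral>v. H v \<partial>P (w (T w))) \<partial>P x) + (\<integral>w. Z w * b \<partial>P x)" using i2 intZ by (simp add: distrib_left)
 finally show ?thesis by simp
qed

lemma markov_real:
 fixes Z H :: "(real => 'a) => real"
 assumes x: "x : S" and s: "0 <= s"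
  and Z: "Z : bmeas (path_filtration S s)"
  and Z0: "!!w. w : space (path_space S) ==> 0 <= Z w" "!!w. w : space (path_space S) ==> Z w <= c"
  and H: "H : bmeas (path_space S)" "!!w. w : space (path_space S) ==> \<bar>H w\<bar> <= b"
 shows "(\<integral>w. Z w * H (shift s w) \<partial>P x) = (\<integral>w. Z w * (\<integral>v. H v \<partial>P (w s)) \<partial>P x)"
proof -
 interpret F: filtration "space (path_space S)" "path_filtration S" by (rule filtration_path)
 have st: "stopping_time (path_filtration S) (%_. s)" by (rule stopping_time_const)
 have sub: "sets (path_filtration S s) <= sets (F.pre_sigma (%_. s))"
 proof
  fix A assume A: "A : sets (path_filtration S s)"
  show "A : sets (F.pre_sigma (%_. s))"
  proof (rule F.sets_pre_sigmaI[OF st])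
   fix t show "{w : A. s <= t} : sets (path_filtration S t)" using A path_filtration_mono[of s t S] by (cases "s <= t") auto
  qed
 qed
 have "Z : bmeas (F.pre_sigma (%_. s))" using Z sub unfolding measurable_def by (auto simp: F.space_pre_sigma)
 from strong_markov_real[OF x st _ this Z0 H] s show ?thesis by simp
qed

end

subsection \<open>Potentials at an independent exponential time\<close>

text \<open>An exponential clock of rate 1. Integration against it turns a stopped or killed
  semigroup into its resolvent at parameter 1, and lack of memory replaces time shifts by factors
  \<open>exp (- r)\<close>.\<close>

definition exp1 :: "real measure" where
 "exp1 = density lborel (exponential_density 1)"

lemma sets_exp1 [simp, measurable_cong]: "sets exp1 = sets borel" by (simp add: exp1_def)

lemma space_exp1 [simp]: "space exp1 = UNIV" by (simp add: exp1_def)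

interpretation exp1: prob_space exp1 unfolding exp1_def by (rule prob_space_exponential_density) simp

lemma measure_exp1_UNIV [simp]: "measure exp1 UNIV = 1" using exp1.prob_space by simp

lemma AE_exp1_nonneg: "AE t in exp1. 0 <= t" unfolding exp1_def by (subst AE_density) (auto simp: exponential_density_def intro!: AE_I2)

lemma AE_exp1I: "(!!t. 0 <= t ==> Q t) ==> AE t in exp1. Q t" by (rule AE_mp[OF AE_exp1_nonneg]) (simp add: AE_I2)

lemma integral_exp1:
 fixes f :: "real => real"
 assumes "f : bmeas borel"
 shows "(\<integral>t. f t \<partial>exp1) = (\<integral>t. exponential_density 1 t * f t \<partial>lborel)" unfolding exp1_def using assms by (subst integral_density) (auto simp: exponential_density_nonneg)

lemma integral_exp1_shift:
 fixes f :: "real => real"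
 assumes [measurable]: "f : bmeas borel" and r: "0 <= r"
 shows "(\<integral>t. indicator {r..} t * f t \<partial>exp1) = exp (- r) * (\<integral>t. f (r + t) \<partial>exp1)"
proof -
 have "(\<integral>t. indicator {r..} t * f t \<partial>exp1) = (\<integral>t. exponential_density 1 t * (indicator {r..} t * f t) \<partial>lborel)" by (rule integral_exp1) measurable
 also have "... = (\<integral>t. exponential_density 1 (r + t) * (indicator {r..} (r + t) * f (r + t)) \<partial>lborel)" using lborel_integral_real_affine[of 1 "%t. exponential_density 1 t * (indicator {r..} t * f t)" r] by simp
 also have "... = (\<integral>t. exp (- r) * (exponential_density 1 t * f (r + t)) \<partial>lborel)" using r by (intro integral_congr) (auto simp: exponential_density_def indicator_def exp_add[symmetric])
 also have "... = exp (- r) * (\<integral>t. exponential_density 1 t * f (r + t) \<partial>lborel)" by simp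
 also have "(\<integral>t. exponential_density 1 t * f (r + t) \<partial>lborel) = (\<integral>t. f (r + t) \<partial>exp1)" by (rule integral_exp1[symmetric]) measurable
 finally show ?thesis .
qed

lemma exp1_bdd:
 fixes f :: "real => real"
 assumes "f : bmeas borel" "!!t. \<bar>f t\<bar> <= c"
 shows "integrable exp1 f" by (rule exp1.integrable_const_bound[where B=c]) (use assms in \<open>auto intro!: AE_I2\<close>)

text \<open>\<open>exp1\<close> is a measure on the whole line while the measurability facts ask for
  nonnegative times; a negative time acts as 0.\<close>

lemma stopped_max: "stopped A w t = stopped A w (max 0 t)" by (cases "0 <= t") (auto simp: stopped_def ennreal_neg max_def)

lemma stopped_in_space:
 "w : space (path_space S) ==> stopped A w t : S" unfolding stopped_hit by (rule path_space_in) (auto simp: hit_nonneg)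

text \<open>Let \<open>tau\<close> be the hitting time of \<open>A\<close>. As the stopped path is
  frozen at \<open>tau\<close>, this is the discounted integral of \<open>H\<close> up to
  \<open>tau\<close> plus \<open>exp (- tau)\<close> times \<open>H\<close> at the exit point. One
  functional thus serves both for potentials of the killed path and for boundary value
  problems.\<close>

definition pot :: "'a set => ('a => real) => (real => 'a) => real" where
 "pot A H w = (\<integral>t. H (stopped A w t) \<partial>exp1)"

context
 fixes S :: "'a::metric_space set" and A :: "'a set" and H :: "'a => real" and c :: real
 assumes cl: "closedin (top_of_set S) (S Int A)"
  and H: "H : bmeas (rborel S)"
  and H_bound: "!!y. y : S ==> \<bar>H y\<bar> <= c"
begin

lemma measurable_stopped_pair:
 "(%(w, t). H (stopped A w t)) : bmeas (path_space S \<Otimes>\<^sub>M exp1)"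
proof -
 have "(%p. stopped A (fst p) (max 0 (snd p))) : path_space S \<Otimes>\<^sub>M exp1 ->> rborel S" by (rule measurable_stopped_at[OF cl]) measurable
 from measurable_compose[OF this H] show ?thesis by (simp add: stopped_max[symmetric] case_prod_beta')
qed

lemma stopped_fun_meas:
 "(%w. H (stopped A w t)) : bmeas (path_space S)" using measurable_Pair1'[of t exp1 "path_space S"] measurable_compose[OF _ measurable_stopped_pair, of "%w. (w, t)" "path_space S"] by simp

lemma stopped_time_meas:
 "w : space (path_space S) ==> (%t. H (stopped A w t)) : bmeas borel" using measurable_compose[OF measurable_Pair1' measurable_stopped_pair, of w] by (simp cong: measurable_cong_sets)

lemma abs_stopped_le: "w : space (path_space S) ==> \<bar>H (stopped A w t)\<bar> <= c" by (intro H_bound stopped_in_space)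

lemma potential_meas: "pot A H : bmeas (path_space S)" unfolding pot_def[abs_def] by (rule exp1.borel_measurable_lebesgue_integral[OF measurable_stopped_pair])

lemma potential_bound:
 assumes "w : space (path_space S)"
 shows "\<bar>pot A H w\<bar> <= c"
proof -
 have "\<bar>pot A H w\<bar> <= (\<integral>t. \<bar>H (stopped A w t)\<bar> \<partial>exp1)" unfolding pot_def by (rule integral_abs_bound)
 also have "... <= c"
 proof (rule exp1.integral_le_const)
  show "integrable exp1 (%t. \<bar>H (stopped A w t)\<bar>)" by (intro integrable_abs exp1_bdd[of _ c] stopped_time_meas abs_stopped_le assms)
 qed (use abs_stopped_le[OF assms] in auto)
 finally show ?thesis .
qed

lemma pot_Fubini:
 fixes g :: "real => real"
 assumes M: "prob_space M" "sets M = sets (path_space S)"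
  and g [measurable]: "g : bmeas borel" and gb: "!!t. \<bar>g t\<bar> <= b"
 shows "(\<integral>w. (\<integral>t. g t * H (stopped A w t) \<partial>exp1) \<partial>M) = (\<integral>t. g t * (\<integral>w. H (stopped A w t) \<partial>M) \<partial>exp1)"
  and "(%t. \<integral>w. H (stopped A w t) \<partial>M) : bmeas borel"
  and "\<bar>\<integral>w. H (stopped A w t) \<partial>M\<bar> <= c"
proof -
 interpret M: prob_space M by fact
 interpret pair_prob_space M exp1 ..
 have sp: "space M = space (path_space S)" by (rule sets_eq_imp_space_eq[OF M(2)])
 have [measurable]: "(%(w, t). H (stopped A w t)) : bmeas (M \<Otimes>\<^sub>M exp1)" using measurable_stopped_pair by (simp cong: measurable_cong_sets sets_pair_measure_cong add: M(2))
 have b0: "0 <= b" using gb[of 0] by linarith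
 have "integrable (M \<Otimes>\<^sub>M exp1) (%(w, t). g t * H (stopped A w t))"
 proof (rule P.integrable_const_bound[where B="b * c"])
  show "AE p in M \<Otimes>\<^sub>M exp1. norm (case p of (w, t) => g t * H (stopped A w t)) <= b * c"
  proof (rule AE_I2)
   fix p assume "p : space (M \<Otimes>\<^sub>M exp1)"
   then obtain w t where p: "p = (w, t)" "w : space (path_space S)" by (auto simp: space_pair_measure sp)
   show "norm (case p of (w, t) => g t * H (stopped A w t)) <= b * c" using gb[of t] abs_stopped_le[OF p(2), of t] b0 by (auto simp: p abs_mult intro!: mult_mono)
  qed
 qed (measurable)
 from Fubini_integral[OF this]
 show "(\<integral>w. (\<integral>t. g t * H (stopped A w t) \<partial>exp1) \<partial>M) = (\<integral>t. g t * (\<integral>w. H (stopped A w t) \<partial>M) \<partial>exp1)" by simp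
 have "(%t. \<integral>w. H (stopped A w t) \<partial>M) : bmeas exp1" by (rule M.borel_measurable_lebesgue_integral) measurable
 then show "(%t. \<integral>w. H (stopped A w t) \<partial>M) : bmeas borel" by (simp cong: measurable_cong_sets)
 have "\<bar>\<integral>w. H (stopped A w t) \<partial>M\<bar> <= (\<integral>w. \<bar>H (stopped A w t)\<bar> \<partial>M)" by (rule integral_abs_bound)
 also have "... <= c"
 proof (rule M.integral_le_const)
  have "(%w. H (stopped A w t)) : bmeas M" using stopped_fun_meas by (simp cong: measurable_cong_sets add: M(2))
  then show "integrable M (%w. \<bar>H (stopped A w t)\<bar>)" by (intro integrable_abs M.integrable_const_bound[where B=c] AE_I2) (simp_all add: sp abs_stopped_le)
  show "AE w in M. \<bar>H (stopped A w t)\<bar> <= c" by (intro AE_I2) (simp add: sp abs_stopped_le)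
 qed
 finally show "\<bar>\<integral>w. H (stopped A w t) \<partial>M\<bar> <= c" .
qed

lemma int_pot:
 assumes "prob_space M" "sets M = sets (path_space S)"
 shows "(\<integral>w. pot A H w \<partial>M) = (\<integral>t. (\<integral>w. H (stopped A w t) \<partial>M) \<partial>exp1)" using pot_Fubini(1)[OF assms, of "%_. 1" 1] by (simp add: pot_def)

lemma potential_tail:
 assumes w: "w : space (path_space S)" and r: "0 <= r" and out: "!!s. 0 <= s ==> s < r ==> w s ~: A"
 shows "(\<integral>t. indicator {r..} t * H (stopped A w t) \<partial>exp1) = exp (- r) * pot A H (shift r w)"
proof -
 have [measurable]: "(%t. H (stopped A w t)) : bmeas borel" by (rule stopped_time_meas[OF w])
 have w': "shift r w : space (path_space S)" by (rule shift_in_path_space[OF w r])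
 have [measurable]: "(%t. H (stopped A (shift r w) t)) : bmeas borel" by (rule stopped_time_meas[OF w'])
 have "(\<integral>t. H (stopped A w (r + t)) \<partial>exp1) = pot A H (shift r w)" unfolding pot_def
 proof (rule integral_cong_AE)
  have "H (stopped A w (r + t)) = H (stopped A (shift r w) t)" if "0 <= t" for t using stopped_shift[OF closed_hits[OF w cl] r that out closed_hits[OF w' cl]] by simp
  then show "AE t in exp1. H (stopped A w (r + t)) = H (stopped A (shift r w) t)" by (rule AE_exp1I)
 qed (measurable)
 then show ?thesis by (simp add: integral_exp1_shift r)
qed

text \<open>The clock either rings before \<open>r\<close> or, by lack of memory, starts afresh
  along the shifted path at the cost of a factor \<open>exp (- r)\<close>.\<close>

lemma potential_split:
 assumes w: "w : space (path_space S)" and r: "0 <= r" and out: "!!s. 0 <= s ==> s < r ==> w s ~: A"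
 shows "pot A H w = (\<integral>t. indicator {..<r} t * H (stopped A w t) \<partial>exp1) + exp (- r) * pot A H (shift r w)"
proof -
 have [measurable]: "(%t. H (stopped A w t)) : bmeas borel" by (rule stopped_time_meas[OF w])
 have c0: "0 <= c" using abs_stopped_le[OF w, of 0] by linarith
 have i: "integrable exp1 (%t. indicator B t * H (stopped A w t))" if [measurable]: "B : sets borel" for B using abs_stopped_le[OF w] c0 by (intro exp1_bdd[of _ c]) (auto simp: indicator_def)
 have "pot A H w = (\<integral>t. indicator {..<r} t * H (stopped A w t) + indicator {r..} t * H (stopped A w t) \<partial>exp1)" unfolding pot_def by (intro integral_congr) (auto simp: indicator_def)
 also have "... = (\<integral>t. indicator {..<r} t * H (stopped A w t) \<partial>exp1) + (\<integral>t. indicator {r..} t * H (stopped A w t) \<partial>exp1)" by (intro Bochner_Integration.integral_add i) auto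
 finally show ?thesis using potential_tail[OF w r out] by simp
qed

end

lemma hit_zero [simp]: "hit A 0 w = 0" by (simp add: hit_def)

lemma stopped_zero [simp]: "stopped A w 0 = w 0" by (simp add: stopped_hit)

lemma hit_start_in: "w 0 : A ==> 0 <= t ==> hit A t w = 0" by (rule hit_eqI) auto

lemma stopped_start_in: "w 0 : A ==> stopped A w t = w 0" by (subst stopped_max) (simp add: stopped_hit hit_start_in)

lemma stopped_stay:
 assumes "!!s. 0 <= s ==> s < t ==> w s ~: A" "0 <= t"
 shows "stopped A w t = w t" unfolding stopped_hit by (subst hit_eqI[of t]) (use assms in auto)

lemma sets_closedin:
 fixes S :: "'a::metric_space set"
 assumes "closedin (top_of_set S) (S Int A)"
 shows "S Int A : sets (rborel S)"
proof -
 from assms obtain C where "closed C" "S Int A = S Int C" by (auto simp: closedin_closed)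
 then show ?thesis by (auto simp: sets_restrict_space)
qed

context path_markov
begin

text \<open>The strong Markov property at the time of hitting \<^term>\<open>B\<close>, truncated at \<^term>\<open>n\<close>; the truncation error is
 at most \<open>2 c exp (- n)\<close>.\<close>

lemma potential_decomposition:
 assumes A: "closedin (top_of_set S) (S Int A)" and B: "closedin (top_of_set S) (S Int B)" and AB: "A <= B"
  and H: "H : bmeas (rborel S)" and Hb: "!!y. y : S ==> \<bar>H y\<bar> <= c"
  and x: "x : S"
 defines "R \<equiv> %y. \<integral>w. pot A H w \<partial>P y"
 shows "R x = (\<integral>w. pot B (%y. if y : B then R y else H y) w \<partial>P x)"
proof -
 interpret F: filtration "space (path_space S)" "path_filtration S" by (rule filtration_path)
 interpret Px: prob_space "P x" by (rule prob_space_P[OF x])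
 define K where "K = (%y. if y : B then R y else H y)"
 have c0: "0 <= c" using Hb[OF x] by linarith
 have pm: "pot A H : bmeas (path_space S)" by (rule potential_meas[OF A H Hb])
 have pb: "\<bar>pot A H w\<bar> <= c" if "w : space (path_space S)" for w by (rule potential_bound[OF A H Hb that])
 have Rm: "R : bmeas (rborel S)" unfolding R_def by (rule measurable_kernel_integral[OF pm])
 have Rb: "\<bar>R y\<bar> <= c" if y: "y : S" for y
 proof -
  interpret Py: prob_space "P y" by (rule prob_space_P[OF y])
  have "\<bar>R y\<bar> <= (\<integral>w. \<bar>pot A H w\<bar> \<partial>P y)" unfolding R_def by (rule integral_abs_bound)
  also have "... <= c"
  proof (rule Py.integral_le_const)
   show "integrable (P y) (%w. \<bar>pot A H w\<bar>)" by (intro integrable_abs Py.integrable_const_bound[where B=c] AE_I2)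
      (simp_all add: space_P[OF y] pb P_meas_iff[OF y] pm)
  qed (auto simp: space_P[OF y] pb intro!: AE_I2)
  finally show ?thesis .
 qed
 have Km: "K : bmeas (rborel S)" unfolding K_def
 proof (rule measurable_If)
  have "{y : space (rborel S). y : B} = S Int B" by (auto simp: space_restrict_space)
  then show "{y : space (rborel S). y : B} : sets (rborel S)" using sets_closedin[OF B] by simp
 qed (rule Rm H)+
 have Kb: "\<bar>K y\<bar> <= c" if "y : S" for y using Rb[OF that] Hb[OF that] by (simp add: K_def)
 have qm: "pot B K : bmeas (path_space S)" by (rule potential_meas[OF B Km Kb])
 have qb: "\<bar>pot B K w\<bar> <= c" if "w : space (path_space S)" for w by (rule potential_bound[OF B Km Kb that])
 have ip: "integrable (P x) (pot A H)" and iq: "integrable (P x) (pot B K)" by (intro Px.integrable_const_bound[where B=c] AE_I2;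
    simp add: space_P[OF x] pb qb P_meas_iff[OF x] pm qm)+
 have le: "\<bar>R x - (\<integral>w. pot B K w \<partial>P x)\<bar> <= 2 * c * exp (- real n)" for n :: nat
 proof -
  define T where "T = hit B (real n)"
  have T: "stopping_time (path_filtration S) T" unfolding T_def by (rule stopping_time_hit[OF B]) simp
  have T0: "0 <= T w" for w by (simp add: T_def hit_nonneg)
  have Tm: "T : bmeas (path_space S)" by (rule measurable_stopping_time[OF T]) (use filt_subset in auto)
  have id: "(%w. w) : path_space S ->> path_space S" by simp
  have th: "(%w. shift (T w) w) : path_space S ->> path_space S" by (rule measurable_shift[OF id Tm T0])
  have ev: "(%w. w (T w)) : path_space S ->> rborel S" by (rule measurable_eval_at[OF id Tm T0])
  have Tpre: "T : bmeas (F.pre_sigma T)" by (rule F.measurable_stopping_time_pre_sigma[OF T])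
  have thS: "shift (T w) w : space (path_space S)" if "w : space (path_space S)" for w by (rule shift_in_path_space[OF that T0])
  have TS: "w (T w) : S" if "w : space (path_space S)" for w by (rule path_space_in[OF that T0])
  have exp_le: "exp (- T w) <= 1" for w by (simp add: T0)
  have int: "integrable (P x) (%w. exp (- T w) * g w)"
   if "g : bmeas (path_space S)" "!!w. w : space (path_space S) ==> \<bar>g w\<bar> <= c" for g
  proof (intro Px.integrable_const_bound[where B=c] AE_I2)
   fix w assume w: "w : space (P x)"
   have "\<bar>exp (- T w) * g w\<bar> <= 1 * c" unfolding abs_mult using that(2)[of w] w exp_le[of w] by (intro mult_mono) (auto simp: space_P[OF x])
   then show "norm (exp (- T w) * g w) <= c" by simp
  next
   show "(%w. exp (- T w) * g w) : bmeas (P x)" unfolding P_meas_iff[OF x] using that(1) Tm by measurable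
  qed
  have i1: "integrable (P x) (%w. exp (- T w) * pot A H (shift (T w) w))" by (rule int) (intro measurable_compose[OF th pm] pb thS; assumption)+
  have i2: "integrable (P x) (%w. exp (- T w) * pot B K (shift (T w) w))" by (rule int) (intro measurable_compose[OF th qm] qb thS; assumption)+
  have i3: "integrable (P x) (%w. exp (- T w) * R (w (T w)))" by (rule int) (intro measurable_compose[OF ev Rm] Rb TS; assumption)+
  \<comment> \<open>Before \<open>T\<close> neither path is stopped and both integrands are
    \<open>H\<close>, so these parts cancel. What is left are the discounted potentials after
    \<open>T\<close>.\<close>
  have pt: "pot A H w - pot B K w
    = exp (- T w) * pot A H (shift (T w) w) - exp (- T w) * pot B K (shift (T w) w)"
   if w: "w : space (path_space S)" for w
  proof -
   have out: "w s ~: B" if "0 <= s" "s < T w" for s using that unfolding T_def by (cases rule: hit_cases[OF closed_hits[OF w B], of "real n"]) auto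
   have "(\<integral>t. indicator {..<T w} t * H (stopped A w t) \<partial>exp1) = (\<integral>t. indicator {..<T w} t * K (stopped B w t) \<partial>exp1)"
   proof (rule integral_cong_AE)
    have [measurable]: "(%t. H (stopped A w t)) : bmeas borel" by (rule stopped_time_meas[OF A H Hb w])
    have [measurable]: "(%t. K (stopped B w t)) : bmeas borel" by (rule stopped_time_meas[OF B Km Kb w])
    show "(%t. indicator {..<T w} t * H (stopped A w t)) : bmeas exp1"
       "(%t. indicator {..<T w} t * K (stopped B w t)) : bmeas exp1" by measurable
    have "indicator {..<T w} t * H (stopped A w t) = indicator {..<T w} t * K (stopped B w t)" if "0 <= t" for t
    proof (cases "t < T w")
     case True
     have "w s ~: B" if "0 <= s" "s < t" for s using out[OF that(1)] that(2) True by simp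
     then have "stopped B w t = w t" "stopped A w t = w t" using AB that by (auto intro!: stopped_stay)
     moreover have "w t ~: B" using out[OF \<open>0 <= t\<close> True] .
     ultimately show ?thesis by (simp add: K_def)
    qed simp
    then show "AE t in exp1. indicator {..<T w} t * H (stopped A w t) = indicator {..<T w} t * K (stopped B w t)" by (rule AE_exp1I)
   qed
   moreover have outA: "w s ~: A" if "0 <= s" "s < T w" for s using out[OF that] AB by blast
   ultimately show ?thesis using potential_split[OF A H Hb w T0 outA] potential_split[OF B Km Kb w T0 out] by simp
  qed
  \<comment> \<open>If \<open>B\<close> has been hit, the shifted path is frozen in the
    \<open>B\<close>-potential and yields exactly \<open>R\<close> at the hitting point. Otherwise
    \<open>T w = real n\<close>, and the discount alone bounds the difference.\<close>
  have G: "\<bar>exp (- T w) * R (w (T w)) - exp (- T w) * pot B K (shift (T w) w)\<bar> <= 2 * c * exp (- real n)"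
   if w: "w : space (path_space S)" for w using closed_hits[OF w B] of_nat_0_le_iff[of n]
  proof (cases rule: hit_cases)
   case stay
   have "\<bar>R (w (T w)) - pot B K (shift (T w) w)\<bar> <= 2 * c" using Rb[OF TS[OF w]] qb[OF thS[OF w]] by linarith
   then have "exp (- T w) * \<bar>R (w (T w)) - pot B K (shift (T w) w)\<bar> <= exp (- T w) * (2 * c)" by (intro mult_left_mono) auto
   moreover have "T w = real n" using stay(2) by (simp add: T_def)
   moreover have "exp (- T w) * R (w (T w)) - exp (- T w) * pot B K (shift (T w) w)
     = exp (- T w) * (R (w (T w)) - pot B K (shift (T w) w))" by (simp add: right_diff_distrib)
   ultimately show ?thesis by (simp only: abs_mult abs_exp_cancel mult.commute)
  next
   case hit
   then have "w (T w) : B" by (simp add: T_def)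
   then have "pot B K (shift (T w) w) = R (w (T w))" unfolding pot_def by (subst stopped_start_in) (auto simp: K_def T0)
   then show ?thesis using c0 by simp
  qed
  have "R x - (\<integral>w. pot B K w \<partial>P x) = (\<integral>w. pot A H w - pot B K w \<partial>P x)" unfolding R_def using ip iq by simp
  also have "... = (\<integral>w. exp (- T w) * pot A H (shift (T w) w) - exp (- T w) * pot B K (shift (T w) w) \<partial>P x)" by (intro integral_congr pt) (auto simp: space_P[OF x])
  also have "... = (\<integral>w. exp (- T w) * pot A H (shift (T w) w) \<partial>P x) - (\<integral>w. exp (- T w) * pot B K (shift (T w) w) \<partial>P x)" using i1 i2 by simp
  also have "(\<integral>w. exp (- T w) * pot A H (shift (T w) w) \<partial>P x) = (\<integral>w. exp (- T w) * R (w (T w)) \<partial>P x)" unfolding R_def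
  proof (rule strong_markov_real[OF x T, where c=1 and b=c])
   show "(%w. exp (- T w)) : bmeas (F.pre_sigma T)" using Tpre by measurable
  qed (auto simp: T0 pm pb)
  also have "... - (\<integral>w. exp (- T w) * pot B K (shift (T w) w) \<partial>P x)
    = (\<integral>w. exp (- T w) * R (w (T w)) - exp (- T w) * pot B K (shift (T w) w) \<partial>P x)" using i3 i2 by simp
  finally have "\<bar>R x - (\<integral>w. pot B K w \<partial>P x)\<bar>
    = \<bar>\<integral>w. exp (- T w) * R (w (T w)) - exp (- T w) * pot B K (shift (T w) w) \<partial>P x\<bar>" by simp
  also have "... <= (\<integral>w. \<bar>exp (- T w) * R (w (T w)) - exp (- T w) * pot B K (shift (T w) w)\<bar> \<partial>P x)" by (rule integral_abs_bound)
  also have "... <= 2 * c * exp (- real n)" by (rule Px.integral_le_const) (use i2 i3 G in \<open>auto simp: space_P[OF x] intro!: AE_I2\<close>)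
  finally show ?thesis .
 qed
 have "(%n. 2 * c * exp (- real n)) \<longlonglongrightarrow> 2 * c * 0" by (intro tendsto_intros filterlim_compose[OF exp_at_bot] filterlim_uminus_at_bot_at_top[THEN filterlim_compose] filterlim_real_sequentially)
 then have "\<bar>R x - (\<integral>w. pot B K w \<partial>P x)\<bar> <= 2 * c * 0" by (rule LIMSEQ_le_const) (use le in auto)
 then show ?thesis by (simp add: K_def)
qed

end

subsection \<open>Eigenfunctions of the killed semigroup\<close>

text \<open>The equation improves its own solution: bounded and measurable makes \<open>h\<close>
  continuous, hence differentiable with \<open>h' = - h / kp\<close>, so that
  \<open>h x * exp (x / kp)\<close> is constant.\<close>

lemma exp_of_integral_equation:
 fixes h :: "real => real"
 assumes hm: "h : bmeas borel" and hb: "!!t. \<bar>h t\<bar> <= c" and kp: "0 < kp"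
  and eq: "!!s. 0 <= s ==> kp * h s = kp * h 0 - integral {0..s} h" and b: "0 <= b"
 shows "h b = h 0 * exp (- b / kp)"
proof -
 have int: "h integrable_on {0..b}"
 proof -
  have "set_integrable lborel {0..b} h" unfolding set_integrable_def
  proof (rule integrableI_bounded_set[where A="{0..b}" and B=c])
   show "AE x in lborel. x : {0..b} --> norm (indicator {0..b} x *\<^sub>R h x) <= c" using hb by (auto simp: indicator_def intro!: AE_I2)
  qed (use hm in \<open>auto simp: indicator_def emeasure_lborel_Icc_eq\<close>)
  then show ?thesis by (rule set_borel_integral_eq_integral(1))
 qed
 have h: "h s = h 0 - integral {0..s} h / kp" if "0 <= s" for s using eq[OF that] kp by (simp add: field_simps)
 have "continuous_on {0..b} (%s. h 0 - integral {0..s} h / kp)" using kp by (intro continuous_intros indefinite_integral_continuous_1[OF int]) auto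
 then have cont: "continuous_on {0..b} h" by (rule continuous_on_eq) (simp add: h[symmetric])
 have "((%x. h x * exp (x / kp)) has_field_derivative 0) (at s within {0..b})" if s: "s : {0..b}" for s
 proof -
  have "((%s. h 0 - integral {0..s} h / kp) has_field_derivative (- h s / kp)) (at s within {0..b})" using integral_has_real_derivative[OF cont s] kp by (auto intro!: derivative_eq_intros)
  then have d: "(h has_field_derivative (- h s / kp)) (at s within {0..b})"
  proof (rule has_field_derivative_transform_within[where d=1])
   show "h 0 - integral {0..x} h / kp = h x" if "x : {0..b}" for x using h[of x] that by simp
  qed (use s in simp_all)
  show ?thesis using DERIV_mult[OF d has_field_derivative_at_within[OF DERIV_fun_exp[OF DERIV_cdivide[OF DERIV_ident]]], of kp] by (simp add: field_simps)
 qed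
 then obtain d where d: "!!x. x : {0..b} ==> h x * exp (x / kp) = d" using has_field_derivative_zero_constant[of "{0..b}" "%x. h x * exp (x / kp)"] by auto
 have "h b * exp (b / kp) = h 0" using d[of b] d[of 0] b by simp
 then show ?thesis by (simp add: exp_minus field_simps)
qed

context path_markov
begin

context
 fixes A :: "'a set" and f :: "'a => real" and c :: real
 assumes A: "closedin (top_of_set S) (S Int A)"
  and f: "f : bmeas (rborel S)" and fb: "!!y. y : S ==> \<bar>f y\<bar> <= c"
  and f0: "!!y. y : A ==> f y = 0"
begin

lemma killed_eq:
 assumes w: "w : space (path_space S)" and s: "0 <= s"
 shows "f (stopped A w s) = indicator {w. ALL r:{0..s}. w r ~: A} w * f (w s)"
proof (cases "ALL r:{0..s}. w r ~: A")
 case True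
 then have "stopped A w s = w s" using s by (intro stopped_stay) auto
 with True show ?thesis by simp
next
 case False
 then have "stopped A w s : A" using stopped_in_iff[OF closed_hits[OF w A] s] by auto
 with False show ?thesis by (simp add: f0)
qed

lemma killed_shift:
 assumes w: "w : space (path_space S)" and s: "0 <= s" "s <= t"
 shows "f (stopped A w t) = indicator {w. ALL r:{0..s}. w r ~: A} w * f (stopped A (shift s w) (t - s))"
proof (cases "ALL r:{0..s}. w r ~: A")
 case True
 have "stopped A w (s + (t - s)) = stopped A (shift s w) (t - s)" by (rule stopped_shift[OF closed_hits[OF w A]]) (use True s closed_hits[OF shift_in_path_space[OF w s(1)] A] in auto)
 with True show ?thesis by simp
next
 case False
 then have "stopped A w t : A" using stopped_in_iff[OF closed_hits[OF w A], of t] s by force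
 with False show ?thesis by (simp add: f0)
qed

lemma measurable_stay_indicator:
 "(indicator {w. ALL r:{0..s}. w r ~: A} :: _ => real) : bmeas (path_filtration S s)" using pred_stay[OF A, of s] by (subst borel_measurable_indicator_iff) (simp add: Measurable.pred_def Int_def conj_commute)

text \<open>As \<open>f\<close> vanishes on \<open>A\<close>, its value at time \<open>t\<close>
  already contains the indicator of survival up to \<open>s\<close>. Together with \<open>Z\<close>
  this is a weight known at time \<open>s\<close>, so the Markov property applies there.\<close>

lemma killed_markov:
 assumes x: "x : S" and s: "0 <= s" "s <= t"
  and Z: "Z : bmeas (path_filtration S s)"
  and Z0: "!!w. w : space (path_space S) ==> 0 <= Z w" "!!w. w : space (path_space S) ==> Z w <= 1"
  and eigen: "!!y. y : S ==> (\<integral>w. f (stopped A w (t - s)) \<partial>P y) = q * f y"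
 shows "(\<integral>w. Z w * f (stopped A w t) \<partial>P x) = q * (\<integral>w. Z w * f (stopped A w s) \<partial>P x)"
proof -
 let ?I = "indicator {w. ALL r:{0..s}. w r ~: A} :: _ => real"
 have "(\<integral>w. Z w * f (stopped A w t) \<partial>P x) = (\<integral>w. (Z w * ?I w) * f (stopped A (shift s w) (t - s)) \<partial>P x)" by (intro integral_congr) (auto simp: space_P[OF x] killed_shift[OF _ s] mult.assoc)
 also have "... = (\<integral>w. (Z w * ?I w) * (\<integral>v. f (stopped A v (t - s)) \<partial>P (w s)) \<partial>P x)"
 proof (rule markov_real[OF x s(1), where c=1 and b=c])
  show "(%w. Z w * ?I w) : bmeas (path_filtration S s)" by (intro borel_measurable_times Z measurable_stay_indicator)
  show "(%v. f (stopped A v (t - s))) : bmeas (path_space S)" by (rule stopped_fun_meas[OF A f fb])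
  show "\<bar>f (stopped A v (t - s))\<bar> <= c" if "v : space (path_space S)" for v by (rule abs_stopped_le[OF A f fb that])
  show "0 <= Z w * ?I w" "Z w * ?I w <= 1" if "w : space (path_space S)" for w using Z0[OF that] by (auto simp: indicator_def)
 qed
 also have "... = (\<integral>w. q * (Z w * f (stopped A w s)) \<partial>P x)" by (intro integral_congr)
    (auto simp: space_P[OF x] eigen path_space_in s killed_eq[OF _ s(1)] ac_simps)
 finally show ?thesis by simp
qed

text \<open>A resolvent at a single parameter is enough for an eigenfunction. For \<open>u t\<close>
  the mean of \<open>f\<close> at the stopped path, the Markov property at \<open>s\<close>
  expresses \<open>kp * u s\<close> by the values of \<open>u\<close> after \<open>s\<close>; this
  is an integral equation whose only bounded solution is the exponential with rate
  \<open>1 / kp - 1\<close>.\<close>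

lemma resolvent_eigenfunction:
 assumes kp: "0 < kp" and R: "!!y. y : S ==> (\<integral>w. pot A f w \<partial>P y) = kp * f y"
  and x: "x : S" and t: "0 <= t"
 shows "(\<integral>w. f (stopped A w t) \<partial>P x) = exp (- (1 / kp - 1) * t) * f x"
proof -
 define u where "u t = (\<integral>w. f (stopped A w t) \<partial>P x)" for t
 note Fub = pot_Fubini[OF A f fb prob_space_P[OF x] sets_P[OF x]]
 have um [measurable]: "u : bmeas borel" and ub: "\<bar>u s\<bar> <= c" for s unfolding u_def using Fub(2,3)[of "%_. 0" 0] by auto
 have c0: "0 <= c" using ub[of 0] by linarith
 let ?I = "%s. indicator {w. ALL r:{0..s}. w r ~: A} :: _ => real"
 have Im: "?I s : bmeas (path_filtration S s)" for s by (rule measurable_stay_indicator)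
 \<comment> \<open>Survival up to \<open>s\<close> times the resolvent at \<open>w s\<close> is, by
   lack of memory, the part of the clock integral after \<open>s\<close>, rescaled by
   \<open>exp s\<close>.\<close>
 have eq: "kp * u s = exp s * (\<integral>t. indicator {s..} t * u t \<partial>exp1)" if s: "0 <= s" for s
 proof -
  have "kp * u s = (\<integral>w. kp * f (stopped A w s) \<partial>P x)" unfolding u_def by simp
  also have "... = (\<integral>w. ?I s w * (\<integral>v. pot A f v \<partial>P (w s)) \<partial>P x)" by (intro integral_congr)
     (auto simp: space_P[OF x] R path_space_in s killed_eq[OF _ s])
  also have "... = (\<integral>w. ?I s w * pot A f (shift s w) \<partial>P x)" by (rule markov_real[OF x s Im, where c=1 and b=c, symmetric])
     (auto simp: indicator_def potential_meas[OF A f fb] potential_bound[OF A f fb])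
  also have "... = (\<integral>w. exp s * (\<integral>t. indicator {s..} t * f (stopped A w t) \<partial>exp1) \<partial>P x)"
  proof (intro integral_congr refl)
   fix w assume "w : space (P x)"
   then have w: "w : space (path_space S)" by (simp add: space_P[OF x])
   show "?I s w * pot A f (shift s w) = exp s * (\<integral>t. indicator {s..} t * f (stopped A w t) \<partial>exp1)"
   proof (cases "ALL r:{0..s}. w r ~: A")
    case True
    then show ?thesis by (subst potential_tail[OF A f fb w s]) (auto simp: exp_minus)
   next
    case False
    then have "f (stopped A w t) = 0" if "s <= t" for t using killed_shift[OF w s that] by simp
    then have "(%t. indicator {s..} t * f (stopped A w t)) = (%t. 0)" by (auto simp: indicator_def fun_eq_iff)
    with False show ?thesis by simp
   qed
  qed
  also have "... = exp s * (\<integral>w. (\<integral>t. indicator {s..} t * f (stopped A w t) \<partial>exp1) \<partial>P x)" by simp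
  also have "(\<integral>w. (\<integral>t. indicator {s..} t * f (stopped A w t) \<partial>exp1) \<partial>P x) = (\<integral>t. indicator {s..} t * u t \<partial>exp1)" unfolding u_def by (rule Fub(1)[where b=1]) (auto simp: indicator_def)
  finally show ?thesis .
 qed
 \<comment> \<open>The absolute value keeps \<open>h\<close> bounded on negative times; on positive
   ones it is the density of the clock.\<close>
 define h where "h t = exp (- \<bar>t\<bar>) * u t" for t
 have hm: "h : bmeas borel" unfolding h_def[abs_def] by measurable
 have hb: "\<bar>h t\<bar> <= c" for t
 proof -
  have "\<bar>h t\<bar> <= 1 * c" unfolding h_def abs_mult using ub[of t] by (intro mult_mono) auto
  then show ?thesis by simp
 qed
 have i: "integrable exp1 (%t. indicator B t * u t)" if [measurable]: "B : sets borel" for B using ub c0 by (intro exp1_bdd[of _ c]) (auto simp: indicator_def)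
 have h_eq: "kp * h s = kp * h 0 - integral {0..s} h" if s: "0 <= s" for s
 proof -
  have "(\<integral>t. indicator {0..} t * u t \<partial>exp1) = (\<integral>t. indicator {0..<s} t * u t + indicator {s..} t * u t \<partial>exp1)" using s by (intro integral_congr) (auto simp: indicator_def)
  also have "... = (\<integral>t. indicator {0..<s} t * u t \<partial>exp1) + (\<integral>t. indicator {s..} t * u t \<partial>exp1)" by (intro Bochner_Integration.integral_add i) auto
  also have "(\<integral>t. indicator {0..<s} t * u t \<partial>exp1) = (\<integral>t. indicator {0..s} t *\<^sub>R h t \<partial>lborel)"
  proof -
   have "(\<integral>t. indicator {0..<s} t * u t \<partial>exp1) = (\<integral>t. exponential_density 1 t * (indicator {0..<s} t * u t) \<partial>lborel)" by (rule integral_exp1) measurable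
   also have "... = (\<integral>t. indicator {0..s} t *\<^sub>R h t \<partial>lborel)"
   proof (rule integral_cong_AE)
    show "AE t in lborel. exponential_density 1 t * (indicator {0..<s} t * u t) = indicator {0..s} t *\<^sub>R h t" using AE_lborel_singleton[of s] by eventually_elim (auto simp: indicator_def exponential_density_def h_def)
   qed (use hm in measurable)
   finally show ?thesis .
  qed
  also have "... = integral {0..s} h"
  proof -
   have "set_integrable lborel {0..s} h" unfolding set_integrable_def
   proof (rule integrableI_bounded_set[where A="{0..s}" and B=c])
    show "AE x in lborel. x : {0..s} --> norm (indicator {0..s} x *\<^sub>R h x) <= c" using hb by (auto simp: indicator_def intro!: AE_I2)
   qed (use hm in \<open>auto simp: indicator_def emeasure_lborel_Icc_eq\<close>)
   from set_borel_integral_eq_integral(2)[OF this] show ?thesis by (simp add: set_lebesgue_integral_def)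
  qed
  finally have "kp * u 0 = integral {0..s} h + exp (- s) * (kp * u s)" using eq[of 0] eq[OF s] by (simp add: mult.assoc[symmetric] exp_add[symmetric])
  then show ?thesis using s by (simp add: h_def)
 qed
 have "h t = h 0 * exp (- t / kp)" by (rule exp_of_integral_equation[OF hm hb kp h_eq t])
 then have "u t = exp t * exp (- t / kp) * u 0" using t by (simp add: h_def exp_minus field_simps)
 also have "exp t * exp (- t / kp) = exp (- (1 / kp - 1) * t)" by (simp add: exp_add[symmetric] algebra_simps)
 also have "u 0 = f x"
 proof -
  interpret Px: prob_space "P x" by (rule prob_space_P[OF x])
  have "u 0 = (\<integral>w. f x \<partial>P x)" unfolding u_def
  proof (rule integral_cong_AE)
   show "(%w. f (stopped A w 0)) : bmeas (P x)" unfolding P_meas_iff[OF x] by (rule stopped_fun_meas[OF A f fb])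
   show "AE w in P x. f (stopped A w 0) = f x" using AE_start[OF x] by eventually_elim simp
  qed simp
  then show ?thesis by (simp add: Px.prob_space)
 qed
 finally show ?thesis by (simp add: u_def)
qed

end

end

subsection \<open>Linear Brownian motion: exponential martingales\<close>

text \<open>Linear Brownian motion as a law on the full path space. The start holds only almost
  surely, because path space contains paths from every point, whereas
  \<open>real_brownian_motion\<close> fixes it on the whole sample space.\<close>

locale lbm = prob_space Q for Q :: "(real => real) measure" +
 fixes z :: real
 assumes sets_Q: "sets Q = sets (path_space UNIV)"
  and start: "AE w in Q. w 0 = z"
  and increments: "0 <= s ==> s < t ==> distributed Q lborel (%w. w t - w s) (normal_density 0 (sqrt (t - s)))"
  and indep: "0 <= (u::nat => real) 0 ==> mono u ==> indep_vars (%_. borel) (%i w. w (u (Suc i)) - w (u i)) {..<n::nat}"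
begin

lemma space_Q: "space Q = space (path_space UNIV)" by (rule sets_eq_imp_space_eq[OF sets_Q])

lemma Q_meas_iff: "Q ->> N = path_space UNIV ->> N" by (rule measurable_cong_sets[OF sets_Q refl])

lemma measurable_eval_Q: "0 <= t ==> (%w. w t) : bmeas Q" unfolding Q_meas_iff by (rule eval_borel)

lemma measurable_filtration_Q: "f : path_filtration UNIV s ->> N ==> f : Q ->> N" unfolding Q_meas_iff by (rule filt_meas)

text \<open>The values at the times of \<open>J\<close> are \<open>z\<close> plus partial sums of
  increments before \<open>s\<close>. The event about them and the later increment thus depend on
  disjoint blocks of an independent family.\<close>

lemma increments_partition:
 assumes J: "finite J" "J <= {0..s}" and E: "!!j. j : J ==> E j : sets borel" and B: "B : sets borel"
  and st: "0 <= s" "s < t"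
 shows "prob ({w : space Q. ALL j:J. w j : E j} Int {w : space Q. w t - w s : B})
    = prob {w : space Q. ALL j:J. w j : E j} * prob {w : space Q. w t - w s : B}"
proof -
 define L where "L = sorted_list_of_set (insert 0 (insert s J))"
 define n where "n = length L - 1"
 \<comment> \<open>Padding with \<open>t\<close> turns the sorted times into the infinite monotone
   sequence that \<open>indep\<close> asks for. The increments with index below \<open>n\<close>
   describe the past of \<open>s\<close>, and the one with index \<open>n\<close> is
   \<open>w t - w s\<close>.\<close>
 define v where "v i = (if i <= n then L ! i else t)" for i
 have fin: "finite (insert 0 (insert s J))" using J by simp
 have set_L: "set L = insert 0 (insert s J)" and sorted_L: "sorted L" unfolding L_def by (rule set_sorted_list_of_set[OF fin], rule sorted_sorted_list_of_set)
 have len: "length L = Suc n"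
 proof -
  have "L ~= []" using set_L by auto
  then show ?thesis by (simp add: n_def)
 qed
 have L_bounds: "0 <= x & x <= s" if "x : set L" for x using that set_L J st by auto
 have L0: "L ! 0 = 0"
 proof -
  obtain i where i: "i < length L" "L ! i = 0" using set_L by (metis in_set_conv_nth insertI1)
  then have "L ! 0 <= 0" using sorted_nth_mono[OF sorted_L, of 0 i] by simp
  moreover have "0 <= L ! 0" using L_bounds[OF nth_mem, of 0] len by simp
  ultimately show ?thesis by simp
 qed
 have Ln: "L ! n = s"
 proof -
  obtain i where i: "i < length L" "L ! i = s" using set_L by (metis in_set_conv_nth insertI1 insertI2)
  then have "s <= L ! n" using sorted_nth_mono[OF sorted_L, of i n] len by simp
  moreover have "L ! n <= s" using L_bounds[OF nth_mem, of n] len by simp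
  ultimately show ?thesis by simp
 qed
 have mono_v: "mono v"
 proof (rule monoI)
  fix i j :: nat assume "i <= j"
  moreover have "L ! i <= t" if "i <= n" using L_bounds[OF nth_mem, of i] that len st by simp
  ultimately show "v i <= v j" using sorted_nth_mono[OF sorted_L, of i j] len by (auto simp: v_def)
 qed
 have v0: "v 0 = 0" and vn: "v n = s" and vSn: "v (Suc n) = t" using L0 Ln by (auto simp: v_def)
 define D where "D i w = w (v (Suc i)) - w (v i)" for i and w :: "real => real"
 have ind: "indep_vars (%_. borel) D {..<Suc n}" using indep[of v "Suc n"] mono_v v0 by (simp add: D_def[abs_def])
 have "ALL j:J. \<exists>k. k <= n & v k = j"
 proof
  fix j assume "j : J"
  then have "j : set L" by (simp add: set_L)
  then obtain i where "i < length L" "L ! i = j" by (auto simp: in_set_conv_nth)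
  then show "\<exists>k. k <= n & v k = j" using len by (intro exI[of _ i]) (simp add: v_def)
 qed
 from bchoice[OF this] obtain k where k: "!!j. j : J ==> k j <= n & v (k j) = j" by blast
 have tele: "w (v i) = z + (\<Sum>l<i. D l w)" if "w 0 = z" for w i unfolding D_def[abs_def] using that v0 by (simp add: sum_lessThan_telescope[of "%i. w (v i)"])
 define Xa where "Xa = {d : space (Pi\<^sub>M {..<n} (%_. borel)). ALL j:J. z + (\<Sum>l<k j. d l) : E j}"
 define Xb where "Xb = {d : space (Pi\<^sub>M {n} (%_. borel :: real measure)). d n : B}"
 have Xa: "Xa : sets (Pi\<^sub>M {..<n} (%_. borel))" unfolding Xa_def
 proof (rule sets.sets_Collect_finite_All[OF _ J(1)])
  fix j assume j: "j : J"
  have "(%d. z + (\<Sum>l<k j. d l)) : bmeas (Pi\<^sub>M {..<n} (%_. borel :: real measure))"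
  proof (intro borel_measurable_add borel_measurable_sum measurable_const measurable_component_singleton)
   show "l : {..<n}" if "l : {..<k j}" for l using that k[OF j] by simp
  qed simp
  from measurable_sets[OF this E[OF j]]
  show "{d : space (Pi\<^sub>M {..<n} (%_. borel)). z + (\<Sum>l<k j. d l) : E j} : sets (Pi\<^sub>M {..<n} (%_. borel))" by (simp add: vimage_def Int_def conj_commute)
 qed
 have Xb: "Xb : sets (Pi\<^sub>M {n} (%_. borel))" unfolding Xb_def using B by measurable
 have iv: "indep_var (Pi\<^sub>M {..<n} (%_. borel)) (%w. \<lambda>i\<in>{..<n}. D i w) (Pi\<^sub>M {n} (%_. borel)) (%w. \<lambda>i\<in>{n}. D i w)" by (rule indep_var_restrict[OF ind]) auto
 from indep_varD[OF iv Xa Xb]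
 have *: "prob ((%w. (\<lambda>i\<in>{..<n}. D i w, \<lambda>i\<in>{n}. D i w)) -` (Xa \<times> Xb) Int space Q)
   = prob ((%w. \<lambda>i\<in>{..<n}. D i w) -` Xa Int space Q) * prob ((%w. \<lambda>i\<in>{n}. D i w) -` Xb Int space Q)" .
 have a: "(\<lambda>i\<in>{..<n}. D i w) : Xa \<longleftrightarrow> (ALL j:J. w j : E j)" if w: "w 0 = z" for w
 proof -
  have "z + (\<Sum>l<k j. (\<lambda>i\<in>{..<n}. D i w) l) = w j" if j: "j : J" for j
  proof -
   have "(\<Sum>l<k j. (\<lambda>i\<in>{..<n}. D i w) l) = (\<Sum>l<k j. D l w)" using k[OF j] by (intro sum.cong) auto
   then show ?thesis using tele[of w "k j"] w k[OF j] by simp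
  qed
  then show ?thesis by (auto simp: Xa_def space_PiM)
 qed
 have b: "(\<lambda>i\<in>{n}. D i w) : Xb \<longleftrightarrow> w t - w s : B" for w by (auto simp: Xb_def space_PiM D_def vn vSn)
 let ?A = "(%w. \<lambda>i\<in>{..<n}. D i w) -` Xa Int space Q" and ?B = "(%w. \<lambda>i\<in>{n}. D i w) -` Xb Int space Q"
 let ?A' = "{w : space Q. ALL j:J. w j : E j}" and ?B' = "{w : space Q. w t - w s : B}"
 have A: "?A : events" by (rule measurable_sets[OF indep_var_rv1[OF iv] Xa])
 have B: "?B : events" by (rule measurable_sets[OF indep_var_rv2[OF iv] Xb])
 have A': "?A' : events"
 proof (rule sets.sets_Collect_finite_All[OF _ J(1)])
  fix j assume j: "j : J"
  then have "(%w. w j) : bmeas Q" using J(2) by (intro measurable_eval_Q) auto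
  from measurable_sets[OF this E[OF j]] show "{w : space Q. w j : E j} : events" by (simp add: vimage_def Int_def conj_commute)
 qed
 have BB: "?B = ?B'" using b by auto
 have AA: "AE w in Q. w : ?A \<longleftrightarrow> w : ?A'" using start by eventually_elim (use a in auto)
 have "prob ?A = prob ?A'" by (rule measure_eq_AE[OF AA A A'])
 moreover have "prob (?A Int ?B) = prob (?A' Int ?B)" by (rule measure_eq_AE) (use AA A A' B in \<open>auto elim!: eventually_mono\<close>)
 moreover have "(%w. (\<lambda>i\<in>{..<n}. D i w, \<lambda>i\<in>{n}. D i w)) -` (Xa \<times> Xb) Int space Q = ?A Int ?B" by auto
 ultimately show ?thesis using * unfolding BB by simp
qed

text \<open>Cylinder events are an intersection-stable generator of the past of \<open>s\<close>;
  independence on them, from \<open>increments_partition\<close>, extends to the generated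
  sigma-algebra and so to \<open>Z\<close>.\<close>

lemma indep_increment:
 assumes st: "0 <= s" "s < t" and Z: "Z : bmeas (path_filtration UNIV s)"
 shows "indep_var borel (Z :: _ => real) borel (%w. w t - w s)"
proof -
 let ?\<Omega> = "space Q" and ?r = "%w. restrict w {0..s}" and ?X = "%w. w t - w s :: real"
 let ?PM = "Pi\<^sub>M {0..s} (%_. rborel UNIV :: real measure)"
 define \<G> where "\<G> = {?r -` a Int ?\<Omega> | a. a : prod_algebra {0..s} (%_. rborel UNIV :: real measure)}"
 define \<D> where "\<D> = {?X -` b Int ?\<Omega> | b. b : sets (borel :: real measure)}"
 have Xm: "?X : bmeas Q" using st by (intro borel_measurable_diff measurable_eval_Q) auto
 have rm: "?r : Q ->> ?PM" by (rule measurable_filtration_Q[OF measurable_path_filtration_restrict])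
 have G_ev: "\<G> <= events" unfolding \<G>_def using measurable_sets[OF rm] by (auto simp: sets_PiM intro: sigma_sets.Basic)
 have D_ev: "\<D> <= events" unfolding \<D>_def using measurable_sets[OF Xm] by auto
 have "indep_set \<G> \<D>"
 proof (rule indep_setI[OF G_ev D_ev])
  fix a b assume "a : \<G>" "b : \<D>"
  then obtain a' B where a: "a = ?r -` a' Int ?\<Omega>" "a' : prod_algebra {0..s} (%_. rborel UNIV :: real measure)"
   and b: "b = ?X -` B Int ?\<Omega>" "B : sets borel" by (auto simp: \<G>_def \<D>_def)
  obtain J E where J: "a' = prod_emb {0..s} (%_. rborel UNIV :: real measure) J (\<Pi>\<^sub>E j\<in>J. E j)"
   "finite J" "J <= {0..s}" "!!i. i : J ==> E i : sets (rborel UNIV :: real measure)" using prod_algebraE[OF a(2)] by metis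
  have a_eq: "a = {w : ?\<Omega>. ALL j:J. w j : E j}"
  proof (rule set_eqI)
   fix w :: "real => real"
   have "restrict (restrict w {0..s}) J = restrict w J" using J(3) by (simp add: restrict_restrict Int_absorb1)
   then have "restrict w {0..s} : a' \<longleftrightarrow> (ALL j:J. w j : E j)" unfolding J(1) prod_emb_iff by (simp add: restrict_PiE_iff space_restrict_space Pi_iff)
   then show "w : a \<longleftrightarrow> w : {w : ?\<Omega>. ALL j:J. w j : E j}" unfolding a(1) by auto
  qed
  have b_eq: "b = {w : ?\<Omega>. w t - w s : B}" unfolding b(1) by auto
  have "E j : sets borel" if "j : J" for j using J(4)[OF that] by (simp add: sets_restrict_space)
  then show "prob (a Int b) = prob a * prob b" unfolding a_eq b_eq by (intro increments_partition J(2,3) b(2) st)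
 qed
 moreover have "Int_stable \<G>"
 proof (rule Int_stableI)
  fix a b assume "a : \<G>" "b : \<G>"
  then obtain a' b' where "a = ?r -` a' Int ?\<Omega>" "b = ?r -` b' Int ?\<Omega>"
   and ab: "a' : prod_algebra {0..s} (%_. rborel UNIV :: real measure)" "b' : prod_algebra {0..s} (%_. rborel UNIV :: real measure)" by (auto simp: \<G>_def)
  then have "a Int b = ?r -` (a' Int b') Int ?\<Omega>" by auto
  moreover have "a' Int b' : prod_algebra {0..s} (%_. rborel UNIV :: real measure)" using Int_stable_prod_algebra ab by (rule Int_stableD)
  ultimately show "a Int b : \<G>" unfolding \<G>_def by blast
 qed
 moreover have "Int_stable \<D>"
 proof (rule Int_stableI)
  fix a b assume "a : \<D>" "b : \<D>"
  then obtain a' b' where "a = ?X -` a' Int ?\<Omega>" "b = ?X -` b' Int ?\<Omega>" and ab: "a' : sets borel" "b' : sets borel" by (auto simp: \<D>_def)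
  then have "a Int b = ?X -` (a' Int b') Int ?\<Omega>" "a' Int b' : sets borel" by auto
  then show "a Int b : \<D>" unfolding \<D>_def by blast
 qed
 ultimately have ind: "indep_set (sigma_sets ?\<Omega> \<G>) (sigma_sets ?\<Omega> \<D>)" by (rule indep_set_sigma_sets)
 have filt: "sets (path_filtration UNIV s) = sigma_sets ?\<Omega> \<G>"
 proof -
  let ?sp = "\<Pi>\<^sub>E i\<in>{0..s}. space (rborel UNIV :: real measure)"
  have "?r : ?\<Omega> \<rightarrow> ?sp" by (auto simp: space_restrict_space)
  from sigma_sets_vimage_commute[OF this, of "prod_algebra {0..s} (%_. rborel UNIV :: real measure)"]
  show ?thesis unfolding path_filtration_def by (subst sets_vimage_algebra2) (auto simp: \<G>_def space_Q sets_PiM space_PiM space_restrict_space)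
 qed
 show ?thesis unfolding indep_var_eq
 proof (intro conjI)
  show "random_variable borel Z" by (rule measurable_filtration_Q[OF Z])
  show "random_variable borel ?X" by (rule Xm)
  show "indep_set (sigma_sets ?\<Omega> {Z -` A Int ?\<Omega> | A. A : sets borel}) (sigma_sets ?\<Omega> {?X -` A Int ?\<Omega> | A. A : sets borel})" unfolding indep_set_def
  proof (rule indep_sets_mono_sets[OF ind[unfolded indep_set_def]])
   fix i :: bool
   have "sigma_sets ?\<Omega> {Z -` A Int ?\<Omega> | A. A : sets borel} <= sets (path_filtration UNIV s)" using measurable_sets[OF Z] by (intro sets.sigma_sets_subset'[of _ "path_filtration UNIV s" ?\<Omega>]) (auto simp: space_Q intro: sets.top[of "path_filtration UNIV s", simplified])
   then show "(case i of True => sigma_sets ?\<Omega> {Z -` A Int ?\<Omega> | A. A : sets borel} | False => sigma_sets ?\<Omega> {?X -` A Int ?\<Omega> | A. A : sets borel})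
     <= (case i of True => sigma_sets ?\<Omega> \<G> | False => sigma_sets ?\<Omega> \<D>)" by (auto simp: filt \<D>_def split: bool.split)
  qed
 qed
qed

text \<open>Real and imaginary part of the characteristic function of a centred normal law of
  variance \<open>t - s\<close>.\<close>

lemma increment_moments:
 assumes st: "0 <= s" "s < t"
 shows "expectation (%w. cos (th * (w t - w s))) = exp (- (th^2 / 2) * (t - s))"
  and "expectation (%w. sin (th * (w t - w s))) = 0"
proof -
 define sg where "sg = sqrt (t - s)"
 have sg: "sg > 0" using st by (simp add: sg_def)
 have D: "distributed Q lborel (%w. w t - w s) (normal_density 0 sg)" unfolding sg_def by (rule increments[OF st])
 have "distributed Q lborel (%w. 0 + (1 / sg) * (w t - w s)) (normal_density (0 + (1 / sg) * 0) (\<bar>1 / sg\<bar> * sg))" by (rule normal_density_affine[OF D]) (use sg in auto)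
 then have N: "distributed Q lborel (%w. (w t - w s) / sg) std_normal_density" using sg by simp
 define r where "r = th * sg"
 have r: "r * ((w t - w s) / sg) = th * (w t - w s)" for w :: "real => real" using sg by (simp add: r_def)
 have int: "integrable std_normal_distribution (%x. iexp (r * x))"
 proof -
  interpret N: real_distribution std_normal_distribution by (rule real_dist_normal_dist)
  show ?thesis by (rule N.integrable_iexp) auto
 qed
 have ch: "complex_of_real (exp (- (r^2) / 2)) = (\<integral>x. iexp (r * x) \<partial>std_normal_distribution)" using char_std_normal_distribution by (auto simp: char_def fun_eq_iff)
 have "expectation (%w. cos (th * (w t - w s))) = (\<integral>x. std_normal_density x * cos (r * x) \<partial>lborel)" using distributed_integral[OF N, of "%x. cos (r * x)"] unfolding r by simp
 also have "... = (\<integral>x. cos (r * x) \<partial>std_normal_distribution)" by (subst integral_density) auto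
 also have "... = (\<integral>x. Re (iexp (r * x)) \<partial>std_normal_distribution)" by (simp add: Re_exp)
 also have "... = Re (\<integral>x. iexp (r * x) \<partial>std_normal_distribution)" by (rule integral_Re[OF int])
 also have "... = exp (- (r^2) / 2)" unfolding ch[symmetric] by simp
 also have "- (r^2) / 2 = - (th^2 / 2) * (t - s)" using st by (simp add: r_def sg_def power_mult_distrib)
 finally show "expectation (%w. cos (th * (w t - w s))) = exp (- (th^2 / 2) * (t - s))" .
 have "expectation (%w. sin (th * (w t - w s))) = (\<integral>x. std_normal_density x * sin (r * x) \<partial>lborel)" using distributed_integral[OF N, of "%x. sin (r * x)"] unfolding r by simp
 also have "... = (\<integral>x. sin (r * x) \<partial>std_normal_distribution)" by (subst integral_density) auto
 also have "... = (\<integral>x. Im (iexp (r * x)) \<partial>std_normal_distribution)" by (simp add: Im_exp)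
 also have "... = Im (\<integral>x. iexp (r * x) \<partial>std_normal_distribution)" by (rule integral_Im[OF int])
 also have "... = 0" unfolding ch[symmetric] by simp
 finally show "expectation (%w. sin (th * (w t - w s))) = 0" .
qed

text \<open>The imaginary part of the complex exponential martingale with exponent
  \<open>i * (th * w r + gmm) + th^2 / 2 * r\<close>. The free phase makes sines and cosines
  available at once.\<close>

definition wave :: "real => real => real => (real => real) => real" where
 "wave th gmm r w = exp (th^2 / 2 * r) * sin (th * w r + gmm)"

text \<open>The addition theorem separates the increment from the past. The mean of its cosine
  cancels the growth factor, and the mean of its sine is 0.\<close>

lemma wave_martingale:
 assumes st: "0 <= s" "s <= t" and Z: "Z : bmeas (path_filtration UNIV s)"
  and Zb: "!!w. w : space Q ==> \<bar>Z w\<bar> <= c"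
 shows "expectation (%w. Z w * wave th gmm t w) = expectation (%w. Z w * wave th gmm s w)"
proof (cases "s = t")
 case False
 with st have st: "0 <= s" "s < t" by auto
 let ?De = "%w. w t - w s :: real"
 have Zm: "Z : bmeas Q" by (rule measurable_filtration_Q[OF Z])
 have ws: "(%w. w s) : bmeas (path_filtration UNIV s)" using eval_filt[OF st(1) order_refl, of UNIV] by (simp add: measurable_restrict_space2_iff)
 have Dem: "?De : bmeas Q" using st by (intro borel_measurable_diff measurable_eval_Q) auto
 note [measurable] = Zm Dem measurable_filtration_Q[OF ws]
 define Z1 Z2 where "Z1 w = Z w * sin (th * w s + gmm)" and "Z2 w = Z w * cos (th * w s + gmm)" for w
 have Z12: "Z1 : bmeas (path_filtration UNIV s)" "Z2 : bmeas (path_filtration UNIV s)" unfolding Z1_def[abs_def] Z2_def[abs_def] using Z ws by measurable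
 have c0: "0 <= c" using Zb not_empty by (metis abs_ge_zero all_not_in_conv order_trans)
 have bound: "\<bar>x * y\<bar> <= c" if "\<bar>x\<bar> <= c" "\<bar>y\<bar> <= 1" for x y using mult_mono[OF that] c0 by (simp add: abs_mult)
 have int: "integrable Q g" if "g : bmeas Q" "!!w. w : space Q ==> \<bar>g w\<bar> <= d" for g :: "_ => real" and d by (rule integrable_const_bound[where B=d]) (use that in \<open>auto intro!: AE_I2\<close>)
 have i1: "integrable Q Z1" "integrable Q Z2" unfolding Z1_def[abs_def] Z2_def[abs_def] using Zb by (intro int[of _ c] bound; simp)+
 have i2: "integrable Q (%w. cos (th * ?De w))" "integrable Q (%w. sin (th * ?De w))" by (rule int[of _ 1]; simp)+
 have cm: "(%x::real. cos (th * x)) : bmeas borel" "(%x::real. sin (th * x)) : bmeas borel" by measurable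
 have ind1: "indep_var borel Z1 borel (%w. cos (th * ?De w))" using indep_var_compose[OF indep_increment[OF st Z12(1)] measurable_ident cm(1)] by (simp add: comp_def id_def)
 have ind2: "indep_var borel Z2 borel (%w. sin (th * ?De w))" using indep_var_compose[OF indep_increment[OF st Z12(2)] measurable_ident cm(2)] by (simp add: comp_def id_def)
 have "expectation (%w. Z w * wave th gmm t w)
   = expectation (%w. exp (th^2 / 2 * t) * (Z1 w * cos (th * ?De w) + Z2 w * sin (th * ?De w)))"
 proof (intro integral_congr refl)
  fix w :: "real => real"
  have "th * w t + gmm = (th * w s + gmm) + th * ?De w" by (simp add: algebra_simps)
  then have "sin (th * w t + gmm) = sin (th * w s + gmm) * cos (th * ?De w) + cos (th * w s + gmm) * sin (th * ?De w)" by (simp only: sin_add)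
  then show "Z w * wave th gmm t w = exp (th^2 / 2 * t) * (Z1 w * cos (th * ?De w) + Z2 w * sin (th * ?De w))" by (simp only: wave_def Z1_def Z2_def) (simp add: algebra_simps)
 qed
 also have "... = exp (th^2 / 2 * t) * (expectation (%w. Z1 w * cos (th * ?De w)) + expectation (%w. Z2 w * sin (th * ?De w)))" by (simp add: indep_var_integrable[OF ind1 i1(1) i2(1)] indep_var_integrable[OF ind2 i1(2) i2(2)])
 also have "expectation (%w. Z1 w * cos (th * ?De w)) = expectation Z1 * exp (- (th^2 / 2) * (t - s))" using indep_var_lebesgue_integral[OF ind1 i1(1) i2(1)] increment_moments(1)[OF st] by simp
 also have "expectation (%w. Z2 w * sin (th * ?De w)) = 0" using indep_var_lebesgue_integral[OF ind2 i1(2) i2(2)] increment_moments(2)[OF st] by simp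
 also have "exp (th^2 / 2 * t) * (expectation Z1 * exp (- (th^2 / 2) * (t - s)) + 0) = exp (th^2 / 2 * s) * expectation Z1"
 proof -
  have "exp (th^2 / 2 * t) * exp (- (th^2 / 2) * (t - s)) = exp (th^2 / 2 * s)" by (simp add: exp_add[symmetric] field_simps)
  moreover have "exp (th^2 / 2 * t) * (expectation Z1 * exp (- (th^2 / 2) * (t - s)) + 0)
    = (exp (th^2 / 2 * t) * exp (- (th^2 / 2) * (t - s))) * expectation Z1"
  proof -
   have "a * (b * c + 0) = a * c * b" for a b c :: real by simp
   then show ?thesis .
  qed
  ultimately show ?thesis by (simp only:)
 qed
 also have "... = expectation (%w. exp (th^2 / 2 * s) * Z1 w)" by (rule integral_mult_right_zero[symmetric])
 also have "... = expectation (%w. Z w * wave th gmm s w)" by (intro integral_congr refl) (simp add: Z1_def wave_def)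
 finally show ?thesis .
qed simp

end

subsection \<open>Optional stopping and Dynkin's formula on an interval\<close>

lemma exit_at_boundary:
 fixes w :: "real => real"
 assumes w: "continuous_on {0..} w" and r: "0 <= r" "w r ~: {a<..<b}"
  and before: "!!s. 0 <= s ==> s < r ==> w s : {a<..<b}" and w0: "w 0 : {a<..<b}"
 shows "w r = a | w r = b"
proof -
 have "r ~= 0" using r w0 by auto
 with r have r: "0 < r" by simp
 have cl: "closure {0..<r} = {0..r}" using closure_atLeastLessThan[OF r] .
 have "w ` closure {0..<r} <= {a..b}"
 proof (rule image_closure_subset)
  show "continuous_on (closure {0..<r}) w" unfolding cl by (rule continuous_on_subset[OF w]) auto
  show "w ` {0..<r} <= {a..b}"
  proof
   fix y assume "y : w ` {0..<r}"
   then obtain s where "s : {0..<r}" "y = w s" by blast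
   then show "y : {a..b}" using before[of s] by simp
  qed
 qed simp
 then have "w r : {a..b}" unfolding cl using r by (auto simp: image_subset_iff)
 with assms(3) show ?thesis by auto
qed

text \<open>Used with \<open>mu = th^2 / 2\<close> to undo the growth of \<open>wave\<close>, and
  with \<open>mu = 0\<close> to bound a discounted exit time by the exit time itself.\<close>

lemma exp1_discount:
 assumes mu: "0 <= mu" and r: "0 <= r"
 shows "(\<integral>s. indicator {..<r} s * exp (- mu * \<bar>s\<bar>) \<partial>exp1) = (1 - exp (- (1 + mu) * r)) / (1 + mu)"
proof -
 define f where "f s = exp (- mu * \<bar>s\<bar>)" for s :: real
 have fm [measurable]: "f : bmeas borel" unfolding f_def[abs_def] by measurable
 have fb: "\<bar>f s\<bar> <= 1" for s using mu by (simp add: f_def)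
 have i: "integrable exp1 (%s. indicator B s * f s)" if [measurable]: "B : sets borel" for B using fb by (intro exp1_bdd[of _ 1]) (auto simp: indicator_def)
 have "(\<integral>s. f s \<partial>exp1) = (\<integral>s. 1 / (1 + mu) * exponential_density (1 + mu) s \<partial>lborel)" unfolding integral_exp1[OF fm]
 proof (intro integral_congr refl)
  fix s :: real
  show "exponential_density 1 s * f s = 1 / (1 + mu) * exponential_density (1 + mu) s"
  proof (cases "s < 0")
   case False
   have "exp (- s) * exp (- mu * s) = exp (- (s * (1 + mu)))" by (simp add: exp_add[symmetric] algebra_simps)
   with False mu show ?thesis by (simp add: exponential_density_def f_def)
  qed (simp add: exponential_density_def)
 qed
 also have "... = 1 / (1 + mu) * (\<integral>s. exponential_density (1 + mu) s \<partial>lborel)" by (rule integral_mult_right_zero)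
 also have "(\<integral>s. exponential_density (1 + mu) s \<partial>lborel) = 1"
 proof -
  interpret E: prob_space "density lborel (exponential_density (1 + mu))" by (rule prob_space_exponential_density) (use mu in simp)
  have "(\<integral>s. 1 \<partial>density lborel (exponential_density (1 + mu))) = (\<integral>s. exponential_density (1 + mu) s *\<^sub>R (1::real) \<partial>lborel)" by (rule integral_density) (use mu in \<open>auto simp: exponential_density_nonneg\<close>)
  then show ?thesis using E.prob_space by simp
 qed
 finally have tot: "(\<integral>s. f s \<partial>exp1) = 1 / (1 + mu)" by simp
 have "(\<integral>s. indicator {r..} s * f s \<partial>exp1) = exp (- r) * (\<integral>s. f (r + s) \<partial>exp1)" by (rule integral_exp1_shift[OF fm r])
 also have "(\<integral>s. f (r + s) \<partial>exp1) = (\<integral>s. exp (- mu * r) * f s \<partial>exp1)"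
 proof (rule integral_cong_AE)
  show "AE s in exp1. f (r + s) = exp (- mu * r) * f s" using r by (intro AE_exp1I) (simp add: f_def exp_add[symmetric] algebra_simps)
 qed measurable
 also have "... = exp (- mu * r) * (1 / (1 + mu))" unfolding tot[symmetric] by (rule integral_mult_right_zero)
 finally have tail: "(\<integral>s. indicator {r..} s * f s \<partial>exp1) = exp (- r) * exp (- mu * r) / (1 + mu)" by simp
 have "(\<integral>s. f s \<partial>exp1) = (\<integral>s. indicator {..<r} s * f s + indicator {r..} s * f s \<partial>exp1)" by (intro integral_congr) (auto simp: indicator_def)
 also have "... = (\<integral>s. indicator {..<r} s * f s \<partial>exp1) + (\<integral>s. indicator {r..} s * f s \<partial>exp1)" by (intro Bochner_Integration.integral_add i) auto
 finally have "(\<integral>s. indicator {..<r} s * f s \<partial>exp1) = 1 / (1 + mu) - exp (- r) * exp (- mu * r) / (1 + mu)" unfolding tot tail by simp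
 also have "exp (- r) * exp (- mu * r) = exp (- (1 + mu) * r)" by (simp add: exp_add[symmetric] algebra_simps)
 finally show ?thesis by (simp add: f_def diff_divide_distrib)
qed

context lbm
begin

lemma path_Q: "w : space Q ==> w : space (path_space UNIV)" by (simp add: space_Q)

lemma int_Q_bdd:
 "g : bmeas Q ==> (!!w. w : space Q ==> \<bar>g w\<bar> <= c) ==> integrable Q (g :: _ => real)" by (rule integrable_const_bound[where B=c]) (auto intro!: AE_I2)

lemma abs_wave_le: "0 <= r ==> r <= t ==> \<bar>wave th gmm r w\<bar> <= exp (th^2 / 2 * t)"
proof -
 assume "0 <= r" "r <= t"
 then have "exp (th^2 / 2 * r) * \<bar>sin (th * w r + gmm)\<bar> <= exp (th^2 / 2 * t) * 1" by (intro mult_mono) (auto intro!: mult_left_mono)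
 then show ?thesis by (simp add: wave_def abs_mult)
qed

lemma measurable_wave_hit:
 assumes A: "closed A" and t: "0 <= t"
 shows "(%w. wave th gmm (hit A t w) w) : bmeas Q"
proof -
 have cl: "closedin (top_of_set UNIV) (UNIV Int A)" using A by simp
 have 1: "(%w. hit A t w) : bmeas Q" unfolding Q_meas_iff by (rule measurable_hit[OF cl measurable_ident_sets[OF refl]]) (use t in auto)
 have 2: "(%w. w (hit A t w)) : bmeas Q" using measurable_stopped_at[OF cl measurable_ident_sets[OF refl], of "%_. t"] t unfolding Q_meas_iff stopped_hit by (simp add: measurable_restrict_space2_iff)
 show ?thesis unfolding wave_def using 1 2 by measurable
qed

text \<open>Optional stopping by discretisation: martingale differences on a grid, each multiplied
  by the indicator that \<open>A\<close> has not yet been hit, have mean 0 and telescope to stopping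
  at the next grid time. The mesh then tends to 0 under a uniform bound.\<close>

lemma wave_stopping:
 assumes A: "closed A" and st: "0 <= s" "s <= t" and Z: "Z : bmeas (path_filtration UNIV s)"
  and Zb: "!!w. w : space Q ==> \<bar>Z w\<bar> <= c"
 shows "expectation (%w. Z w * wave th gmm (hit A t w) w) = expectation (%w. Z w * wave th gmm (hit A s w) w)"
proof -
 have cl: "closedin (top_of_set UNIV) (UNIV Int A)" using A by simp
 let ?M = "wave th gmm"
 define K where "K = exp (th^2 / 2 * t)"
 define r where "r n j = s + (t - s) * real j / real (Suc n)" for n j
 define I where "I n j = (indicator {w. ALL u:{0..r n j}. w u ~: A} :: _ => real)" for n j
 define D where "D n w = (\<Sum>j<Suc n. I n j w * (?M (r n (Suc j)) w - ?M (r n j) w))" for n w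
 have t0: "0 <= t" using st by simp
 have c0: "0 <= c" using Zb not_empty by (metis abs_ge_zero all_not_in_conv order_trans)
 have K0: "0 <= K" by (simp add: K_def)
 have r_mono: "r n i <= r n j" if "i <= j" for n i j unfolding r_def using that st by (intro add_left_mono divide_right_mono mult_left_mono) auto
 have r0: "r n 0 = s" and r_end: "r n (Suc n) = t" for n by (simp_all add: r_def del: of_nat_Suc)
 have r_bounds: "s <= r n j" "j <= Suc n ==> r n j <= t" for n j using r_mono[of 0 j n] r_mono[of j "Suc n" n] by (simp_all add: r0 r_end)
 have r_pos: "0 <= r n j" for n j using r_bounds(1)[of n j] st by simp
 have r_step: "r n (Suc j) = r n j + (t - s) / real (Suc n)" for n j by (simp add: r_def field_simps del: of_nat_Suc) (simp add: algebra_simps)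
 have Zm [measurable]: "Z : bmeas Q" by (rule measurable_filtration_Q[OF Z])
 have Im: "I n j : bmeas (path_filtration UNIV (r n j))" for n j using pred_stay[OF cl, of "r n j"] unfolding I_def by (subst borel_measurable_indicator_iff) (simp add: Measurable.pred_def Int_def conj_commute)
 have ImQ [measurable]: "I n j : bmeas Q" for n j by (rule measurable_filtration_Q[OF Im])
 have Mm: "?M (r n j) : bmeas Q" for n j unfolding wave_def[abs_def] using measurable_eval_Q[OF r_pos] by measurable
 note [measurable] = Mm
 have ZI: "\<bar>Z w * I n j w\<bar> <= c" if "w : space Q" for w n j using Zb[OF that] c0 by (auto simp: I_def indicator_def)
 have E0: "expectation (%w. Z w * D n w) = 0" for n
 proof -
  have int: "integrable Q (%w. Z w * I n j w * ?M (r n l) w)" if "l <= Suc n" for j l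
  proof (rule int_Q_bdd[where c="c * K"])
   fix w assume w: "w : space Q"
   show "\<bar>Z w * I n j w * ?M (r n l) w\<bar> <= c * K" unfolding abs_mult[of "Z w * I n j w"] K_def by (intro mult_mono ZI[OF w] abs_wave_le r_bounds r_pos that) (use c0 in auto)
  qed measurable
  have "expectation (%w. Z w * D n w)
    = expectation (%w. \<Sum>j<Suc n. (Z w * I n j w * ?M (r n (Suc j)) w - Z w * I n j w * ?M (r n j) w))" unfolding D_def by (simp only: sum_distrib_left right_diff_distrib mult.assoc)
  also have "... = (\<Sum>j<Suc n. expectation (%w. Z w * I n j w * ?M (r n (Suc j)) w) - expectation (%w. Z w * I n j w * ?M (r n j) w))"
  proof (subst Bochner_Integration.integral_sum)
   show "integrable Q (%w. Z w * I n j w * ?M (r n (Suc j)) w - Z w * I n j w * ?M (r n j) w)" if "j : {..<Suc n}" for j using that by (intro Bochner_Integration.integrable_diff int) auto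
   show "(\<Sum>j<Suc n. expectation (%w. Z w * I n j w * ?M (r n (Suc j)) w - Z w * I n j w * ?M (r n j) w))
     = (\<Sum>j<Suc n. expectation (%w. Z w * I n j w * ?M (r n (Suc j)) w) - expectation (%w. Z w * I n j w * ?M (r n j) w))" by (intro sum.cong refl Bochner_Integration.integral_diff int) auto
  qed
  also have "... = 0"
  proof (intro sum.neutral ballI)
   fix j assume j: "j : {..<Suc n}"
   have "Z : bmeas (path_filtration UNIV (r n j))" using Z path_filtration_mono[OF r_bounds(1)[of n j], of UNIV] unfolding measurable_def by auto
   then have "(%w. Z w * I n j w) : bmeas (path_filtration UNIV (r n j))" by (intro borel_measurable_times Im)
   from wave_martingale[OF r_pos[of n j] r_mono[OF le_SucI[OF order_refl]] this ZI, where th=th and gmm=gmm]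
   show "expectation (%w. Z w * I n j w * ?M (r n (Suc j)) w) - expectation (%w. Z w * I n j w * ?M (r n j) w) = 0" by simp
  qed
  finally show ?thesis .
 qed
 \<comment> \<open>The grid time \<open>rh\<close> lags behind the true hitting time by at most one
   mesh width. If \<open>A\<close> was hit before \<open>s\<close>, all terms of \<open>D\<close>
   vanish and \<open>rh\<close> is the hitting time itself.\<close>
 have D_eq: "\<exists>rh. 0 <= rh & rh <= t & hit A t w <= rh & rh <= hit A t w + (t - s) / real (Suc n) & D n w = ?M rh w - ?M (hit A s w) w"
  if w: "w : space Q" for n w
 proof -
  have clw: "closed {s. 0 <= s & w s : A}" by (rule closed_hits[OF path_Q[OF w] cl])
  define stay where "stay u \<longleftrightarrow> (ALL v:{0..u}. w v ~: A)" for u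
  have I: "I n j w = (if stay (r n j) then 1 else 0)" for j by (simp add: I_def stay_def indicator_def)
  have stay_mono: "stay u" if "stay v" "u <= v" for u v using that by (auto simp: stay_def)
  show ?thesis
  proof (cases "stay s")
   case False
   then have "I n j w = 0" for j using stay_mono[OF _ r_bounds(1)[of n j]] by (auto simp: I)
   then have D0: "D n w = 0" by (simp add: D_def)
   have "hit A t w <= s" using False hit_le_iff[OF clw t0, of s] st(1) by (auto simp: stay_def)
   then have "hit A s w = hit A t w" using hit_lipschitz[OF clw st] by simp
   then show ?thesis using D0 st hit_le[OF t0, of A w] by (intro exI[of _ "hit A t w"]) (simp add: hit_nonneg)
  next
   case True
   \<comment> \<open>The first grid index by whose time \<open>A\<close> has been hit, capped at
     \<open>Suc n\<close>, where the grid ends at \<open>t\<close>.\<close>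
   define k where "k = (LEAST k. k = Suc n | \<not> stay (r n k))"
   have k: "k = Suc n | \<not> stay (r n k)" unfolding k_def by (rule LeastI[of _ "Suc n"]) simp
   have k_le: "k <= Suc n" unfolding k_def by (rule Least_le) simp
   have below: "stay (r n j)" if "j < k" for j using not_less_Least[of j "%k. k = Suc n | \<not> stay (r n k)"] that k_le by (auto simp: k_def)
   have "k ~= 0"
   proof
    assume "k = 0"
    with k True show False by (simp add: r0)
   qed
   then obtain k' where k': "k = Suc k'" by (cases k) auto
   have above: "\<not> stay (r n j)" if "k <= j" "j < Suc n" for j using k that stay_mono[OF _ r_mono[OF that(1)], of n] by auto
   have "D n w = (\<Sum>j<Suc n. if j < k then ?M (r n (Suc j)) w - ?M (r n j) w else 0)" unfolding D_def by (intro sum.cong refl) (use below above in \<open>force simp: I not_less\<close>)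
   also have "... = (\<Sum>j<k. ?M (r n (Suc j)) w - ?M (r n j) w)" using k_le by (intro sum.mono_neutral_cong_right) auto
   also have "... = ?M (r n k) w - ?M (r n 0) w" by (rule sum_lessThan_telescope)
   finally have D: "D n w = ?M (r n k) w - ?M s w" by (simp add: r0)
   have hs: "hit A s w = s" using True st by (intro hit_eqI) (auto simp: stay_def)
   have "hit A t w <= r n k" using k hit_le_iff[OF clw t0, of "r n k"] r_pos[of n k] by (auto simp: stay_def r_end)
   moreover have "r n k' <= hit A t w"
   proof -
    have "stay (r n k')" by (rule below) (simp add: k')
    then have "hit A (r n k') w = r n k'" using r_pos[of n k'] by (intro hit_eqI) (auto simp: stay_def)
    moreover have "hit A (r n k') w = min (r n k') (hit A t w)" using k_le by (intro hit_lipschitz[OF clw r_pos r_bounds(2)]) (simp add: k')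
    ultimately show ?thesis by simp
   qed
   ultimately show ?thesis using D hs r_step[of n k'] r_pos[of n k] r_bounds(2)[OF k_le] by (intro exI[of _ "r n k"]) (simp add: k')
  qed
 qed
 have Db: "\<bar>D n w\<bar> <= 2 * K" if w: "w : space Q" for n w
 proof -
  from D_eq[OF w, of n] obtain rh where rh: "0 <= rh" "rh <= t" "D n w = ?M rh w - ?M (hit A s w) w" by auto
  have "hit A s w <= t" using hit_le[OF st(1), of A w] st by simp
  then have "\<bar>?M rh w\<bar> <= K" "\<bar>?M (hit A s w) w\<bar> <= K" unfolding K_def using rh(1,2) hit_nonneg[of A s w] by (rule_tac [!] abs_wave_le) assumption+
  then show ?thesis using rh(3) by linarith
 qed
 have Dlim: "(%n. D n w) \<longlonglongrightarrow> ?M (hit A t w) w - ?M (hit A s w) w" if w: "w : space Q" for w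
 proof -
  let ?C = "%n rh. 0 <= rh & rh <= t & hit A t w <= rh & rh <= hit A t w + (t - s) / real (Suc n) & D n w = ?M rh w - ?M (hit A s w) w"
  define rh where "rh n = (SOME rh. ?C n rh)" for n
  have rh: "?C n (rh n)" for n unfolding rh_def by (rule someI_ex[OF D_eq[OF w]])
  have "(%n. hit A t w + (t - s) * inverse (real (Suc n))) \<longlonglongrightarrow> hit A t w + (t - s) * 0" by (intro tendsto_intros LIMSEQ_inverse_real_of_nat)
  then have up: "(%n. hit A t w + (t - s) / real (Suc n)) \<longlonglongrightarrow> hit A t w" by (simp add: divide_inverse)
  have rh_lim: "rh \<longlonglongrightarrow> hit A t w"
  proof (rule tendsto_sandwich[OF eventuallyI eventuallyI tendsto_const up])
   fix n
   show "hit A t w <= rh n" "rh n <= hit A t w + (t - s) / real (Suc n)" using rh[of n] by blast+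
  qed
  have wc: "continuous_on {0..} w" by (rule path_cont[OF path_Q[OF w]])
  have "(%n. w (rh n)) \<longlonglongrightarrow> w (hit A t w)"
  proof (rule continuous_on_tendsto_compose[OF wc rh_lim])
   show "hit A t w : {0..}" by (simp add: hit_nonneg)
   show "\<forall>\<^sub>F n in sequentially. rh n : {0..}"
   proof (rule eventuallyI)
    show "rh n : {0..}" for n using rh[of n] by simp
   qed
  qed
  then have "(%n. ?M (rh n) w - ?M (hit A s w) w) \<longlonglongrightarrow> ?M (hit A t w) w - ?M (hit A s w) w" unfolding wave_def by (intro tendsto_intros rh_lim)
  moreover have "D n w = ?M (rh n) w - ?M (hit A s w) w" for n using rh by blast
  ultimately show ?thesis by simp
 qed
 note [measurable] = measurable_wave_hit[OF A t0, of th gmm] measurable_wave_hit[OF A st(1), of th gmm]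
 have "(%n. expectation (%w. Z w * D n w)) \<longlonglongrightarrow> expectation (%w. Z w * (?M (hit A t w) w - ?M (hit A s w) w))"
 proof (rule integral_dominated_convergence[where w="%_. c * (2 * K)"])
  show "(%w. Z w * (?M (hit A t w) w - ?M (hit A s w) w)) : bmeas Q" by measurable
  show "(%w. Z w * D n w) : bmeas Q" for n unfolding D_def by measurable
  show "AE w in Q. (%n. Z w * D n w) \<longlonglongrightarrow> Z w * (?M (hit A t w) w - ?M (hit A s w) w)" by (intro AE_I2 tendsto_intros Dlim)
  show "AE w in Q. norm (Z w * D n w) <= c * (2 * K)" for n
  proof (rule AE_I2)
   fix w assume w: "w : space Q"
   show "norm (Z w * D n w) <= c * (2 * K)" using mult_mono[OF Zb[OF w] Db[OF w, of n] c0 abs_ge_zero] by (simp add: abs_mult)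
  qed
 qed simp
 then have 0: "expectation (%w. Z w * (?M (hit A t w) w - ?M (hit A s w) w)) = 0" using LIMSEQ_unique[OF _ tendsto_const] by (simp add: E0)
 have i: "integrable Q (%w. Z w * ?M (hit A u w) w)" if u: "0 <= u" "u <= t" for u
 proof (rule int_Q_bdd[where c="c * K"])
  show "(%w. Z w * ?M (hit A u w) w) : bmeas Q" by (intro borel_measurable_times Zm measurable_wave_hit A u)
  fix w assume w: "w : space Q"
  have "\<bar>?M (hit A u w) w\<bar> <= K" unfolding K_def using hit_nonneg[of A u w] hit_le[OF u(1), of A w] u by (intro abs_wave_le) auto
  then show "\<bar>Z w * ?M (hit A u w) w\<bar> <= c * K" using mult_mono[OF Zb[OF w] _ c0 abs_ge_zero] by (simp add: abs_mult)
 qed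
 show ?thesis using 0 i[OF t0] i[OF st] by (simp add: right_diff_distrib)
qed

end

context lbm
begin

lemma wave_at_exit:
 assumes "w : space Q" "0 <= t" "w 0 : {a<..<b}" "sin (th * a + gmm) = 0" "sin (th * b + gmm) = 0"
 shows "wave th gmm (hit (- {a<..<b}) t w) w
    = exp (th^2 / 2 * t) * (if stopped (- {a<..<b}) w t : {a<..<b} then sin (th * stopped (- {a<..<b}) w t + gmm) else 0)"
proof -
 have wp: "w : space (path_space UNIV)" by (rule path_Q[OF assms(1)])
 have clw: "closed {s. 0 <= s & w s : - {a<..<b}}" by (rule closed_hits[OF wp]) (auto intro: closed_Compl)
 show ?thesis using clw assms(2)
 proof (cases rule: hit_cases)
  case stay
  then have "w t : {a<..<b}" using assms(2) by auto
  then show ?thesis using stay(2) by (simp add: stopped_hit wave_def)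
 next
  case hit
  have "w (hit (- {a<..<b}) t w) = a | w (hit (- {a<..<b}) t w) = b" by (rule exit_at_boundary[OF path_cont[OF wp] hit(1) _ _ assms(3)]) (use hit in auto)
  then show ?thesis using assms(4,5) by (auto simp: stopped_hit wave_def)
 qed
qed

text \<open>A sine that vanishes at both end points does not distinguish stopping from killing:
  after the exit the stopped martingale is 0, whatever its frozen exponent, so at time
  \<open>u\<close> it equals \<open>exp (th^2 / 2 * u)\<close> times the killed sine.\<close>

lemma killed_wave:
 assumes st: "0 <= s" "s <= t" and Z: "Z : bmeas (path_filtration UNIV s)"
  and Zb: "!!w. w : space Q ==> \<bar>Z w\<bar> <= c" and z: "z : {a<..<b}"
  and sin0: "sin (th * a + gmm) = 0" "sin (th * b + gmm) = 0"
 defines "f \<equiv> %y. if y : {a<..<b} then sin (th * y + gmm) else 0"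
 shows "expectation (%w. Z w * f (stopped (- {a<..<b}) w t))
    = exp (- (th^2 / 2) * (t - s)) * expectation (%w. Z w * f (stopped (- {a<..<b}) w s))"
proof -
 let ?A = "- {a<..<b}"
 have A: "closed ?A" by (intro closed_Compl) simp
 have cl: "closedin (top_of_set UNIV) (UNIV Int ?A)" using A by simp
 have Zm: "Z : bmeas Q" by (rule measurable_filtration_Q[OF Z])
 have fm: "f : bmeas (rborel UNIV)" and fb: "\<bar>f y\<bar> <= 1" for y by (simp_all add: f_def measurable_restrict_space1)
 have *: "wave th gmm (hit ?A u w) w = exp (th^2 / 2 * u) * f (stopped ?A w u)" if "w : space Q" "w 0 = z" "0 <= u" for u w unfolding f_def using that z sin0 by (intro wave_at_exit) auto
 have **: "expectation (%w. Z w * wave th gmm (hit ?A u w) w) = exp (th^2 / 2 * u) * expectation (%w. Z w * f (stopped ?A w u))" if "0 <= u" for u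
 proof -
  have "expectation (%w. Z w * wave th gmm (hit ?A u w) w) = expectation (%w. exp (th^2 / 2 * u) * (Z w * f (stopped ?A w u)))"
  proof (rule integral_cong_AE)
   have "(%w. f (stopped ?A w u)) : bmeas Q" unfolding Q_meas_iff by (rule stopped_fun_meas[OF cl fm fb])
   then show "(%w. exp (th^2 / 2 * u) * (Z w * f (stopped ?A w u))) : bmeas Q" using Zm by measurable
   show "(%w. Z w * wave th gmm (hit ?A u w) w) : bmeas Q" by (intro borel_measurable_times Zm measurable_wave_hit A that)
   show "AE w in Q. Z w * wave th gmm (hit ?A u w) w = exp (th^2 / 2 * u) * (Z w * f (stopped ?A w u))" using start AE_space by eventually_elim (simp add: *[OF _ _ that])
  qed
  then show ?thesis by simp
 qed
 have "exp (th^2 / 2 * t) * expectation (%w. Z w * f (stopped ?A w t)) = exp (th^2 / 2 * s) * expectation (%w. Z w * f (stopped ?A w s))" using wave_stopping[OF A st Z Zb, of th gmm] **[of t] **[of s] st by simp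
 then have "exp (- (th^2 / 2 * t)) * (exp (th^2 / 2 * t) * expectation (%w. Z w * f (stopped ?A w t)))
   = exp (- (th^2 / 2 * t)) * (exp (th^2 / 2 * s) * expectation (%w. Z w * f (stopped ?A w s)))" by simp
 moreover have "exp (- (th^2 / 2 * t)) * exp (th^2 / 2 * t) = 1" by (simp add: exp_minus)
 moreover have "exp (- (th^2 / 2 * t)) * exp (th^2 / 2 * s) = exp (- (th^2 / 2) * (t - s))" by (simp add: exp_add[symmetric] field_simps)
 ultimately show ?thesis by (simp only: mult.assoc[symmetric] mult_1)
qed

text \<open>The horizon \<open>n\<close> makes the exponential martingale bounded; the error of stopping at \<open>n\<close> is of the order \<open>exp (- n)\<close>.\<close>

lemma dynkin:
 fixes th gmm :: real
 assumes z: "z : {c<..<d}"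
 defines "V \<equiv> - {c<..<d}" and "mu \<equiv> th^2 / 2"
 shows "expectation (pot V (%y. if y : V then sin (th * y + gmm) else (1 + mu) * sin (th * y + gmm))) = sin (th * z + gmm)"
proof -
 define h where "h y = sin (th * y + gmm)" for y
 \<comment> \<open>\<open>H1\<close> is the part collected inside the interval, to be multiplied by
   \<open>1 + mu\<close>, and \<open>H2\<close> is the exit value.\<close>
 define H1 where "H1 y = (if y : V then 0 else h y)" for y
 define H2 where "H2 y = (if y : V then h y else 0)" for y
 have mu0: "0 <= mu" by (simp add: mu_def)
 have V: "closed V" unfolding V_def by (intro closed_Compl) simp
 then have cl: "closedin (top_of_set UNIV) (UNIV Int V)" by simp
 have [measurable]: "V : sets borel" using V by simp
 have hm: "h : bmeas borel" unfolding h_def[abs_def] by measurable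
 have H1m: "H1 : bmeas (rborel UNIV)" and H2m: "H2 : bmeas (rborel UNIV)" unfolding H1_def[abs_def] H2_def[abs_def] by (intro measurable_restrict_space1; use hm in measurable)+
 have Nm: "(indicator (- V) :: real => real) : bmeas (rborel UNIV)" by (intro measurable_restrict_space1) measurable
 have hb: "\<bar>h y\<bar> <= 1" for y by (simp add: h_def)
 have H1b: "\<bar>H1 y\<bar> <= 1" and H2b: "\<bar>H2 y\<bar> <= 1" and Nb: "\<bar>indicator (- V) y :: real\<bar> <= 1" for y using hb by (auto simp: H1_def H2_def indicator_def)
 note Fub1 = pot_Fubini[OF cl H1m H1b prob_space_axioms sets_Q]
 have mQ: "g : bmeas Q" if "g : bmeas (path_space UNIV)" for g :: "_ => real" using that by (simp add: Q_meas_iff)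
 define b where "b s = expectation (%w. H1 (stopped V w s))" for s
 have bm: "b : bmeas borel" and bb: "\<bar>b s\<bar> <= 1" for s unfolding b_def using Fub1(2,3)[of "%_. 0" 0] by auto
 note [measurable] = bm
 have E1: "expectation (pot V H1) = (\<integral>s. b s \<partial>exp1)" unfolding b_def by (rule int_pot[OF cl H1m H1b prob_space_axioms sets_Q])
 \<comment> \<open>The constant is \<open>(1 + mu) + 2\<close>: cutting the inner part at the
   horizon costs \<open>(1 + mu) * exp (- real n)\<close>, and the exit part costs
   \<open>2 * exp (- real n)\<close>.\<close>
 have err: "\<bar>(1 + mu) * expectation (pot V H1) + expectation (pot V H2) - h z\<bar> <= (3 + mu) * exp (- real n)" for n :: nat
 proof -
  define T where "T = real n"
  have T0: "0 <= T" by (simp add: T_def)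
  define rh where "rh = hit V T"
  define m where "m w = wave th gmm (rh w) w" for w
  define K where "K = exp (th^2 / 2 * T)"
  have rh: "0 <= rh w" "rh w <= T" for w using T0 by (auto simp: rh_def hit_nonneg hit_le)
  have mb: "\<bar>m w\<bar> <= K" for w unfolding m_def K_def by (rule abs_wave_le[OF rh])
  have mm [measurable]: "m : bmeas Q" unfolding m_def rh_def by (rule measurable_wave_hit[OF V T0])
  have rhm [measurable]: "rh : bmeas Q" unfolding Q_meas_iff rh_def by (rule measurable_hit[OF cl measurable_ident_sets[OF refl]]) (use T0 in auto)
  have clw: "closed {s. 0 <= s & w s : V}" if "w : space Q" for w by (rule closed_hits[OF path_Q[OF that] cl])
  have Em: "expectation m = h z"
  proof -
   have "expectation m = expectation (%w. 1 * wave th gmm (hit V 0 w) w)" using wave_stopping[OF V order_refl T0, of "%_. 1" 1 th gmm] by (simp add: m_def[abs_def] rh_def)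
   also have "... = expectation (%w. h z)"
   proof (rule integral_cong_AE)
    show "(%w. 1 * wave th gmm (hit V 0 w) w) : bmeas Q" using measurable_wave_hit[OF V order_refl, of th gmm] by simp
    show "AE w in Q. 1 * wave th gmm (hit V 0 w) w = h z" using start by eventually_elim (simp add: wave_def h_def)
   qed simp
   finally show ?thesis by (simp add: prob_space)
  qed
  define N where "N w s = (indicator (- V) (stopped V w s) :: real)" for w s
  have Nst: "N w s = indicator {..<rh w} s" if w: "w : space Q" and s: "0 <= s" "s < T" for w s unfolding N_def using stopped_in_iff[OF clw[OF w] s(1)] hit_le_iff[OF clw[OF w] T0, of s] s by (auto simp: indicator_def rh_def not_le[symmetric])
  have Nst': "indicator {0..<T} s * N w s = indicator {..<rh w} s" if w: "w : space Q" and s: "0 <= s" for w s using Nst[OF w s] rh[of w] s by (cases "s < T") (auto simp: indicator_def)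
  have Npair: "(%(w, s). N w s) : bmeas (Q \<Otimes>\<^sub>M exp1)" using measurable_stopped_pair[OF cl Nm Nb] unfolding N_def by (simp cong: measurable_cong_sets sets_pair_measure_cong add: sets_Q)
  have Ntm: "(%s. N w s) : bmeas borel" if "w : space Q" for w unfolding N_def by (rule stopped_time_meas[OF cl Nm Nb path_Q[OF that]])
  define Ph where "Ph w s = indicator {0..<T} s * exp (- mu * \<bar>s\<bar>) * N w s * m w" for w s
  \<comment> \<open>On survival up to \<open>s\<close> the stopped martingale is
    \<open>exp (mu * s)\<close> times the sine, and it may be replaced by its value \<open>m\<close>
    at the horizon. The dependence on \<open>s\<close> then sits in an explicit exponential and the
    survival indicator, so the clock integral can be computed for each path.\<close>
  have b_eq: "indicator {0..<T} s * b s = expectation (%w. Ph w s)" for s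
  proof (cases "0 <= s & s < T")
   case True
   then have s: "0 <= s" "s <= T" by auto
   let ?I = "indicator {w. ALL r:{0..s}. w r ~: V} :: _ => real"
   have Im: "?I : bmeas (path_filtration UNIV s)" using pred_stay[OF cl, of s] by (subst borel_measurable_indicator_iff) (simp add: Measurable.pred_def Int_def conj_commute)
   have IN: "?I w = N w s" if "w : space Q" for w unfolding N_def using stopped_in_iff[OF clw[OF that] s(1)] by (auto simp: indicator_def)
   have "expectation (%w. ?I w * m w) = expectation (%w. ?I w * wave th gmm (hit V s w) w)" unfolding m_def rh_def by (rule wave_stopping[OF V s Im, of 1]) (auto simp: indicator_def)
   also have "... = expectation (%w. exp (mu * s) * H1 (stopped V w s))"
   proof (intro integral_congr refl)
    fix w assume w: "w : space Q"
    show "?I w * wave th gmm (hit V s w) w = exp (mu * s) * H1 (stopped V w s)" using IN[OF w] by (auto simp: N_def indicator_def wave_def H1_def h_def mu_def stopped_hit split: if_splits)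
       (auto simp: hit_eqI[of s s] s)
   qed
   finally have "exp (mu * s) * b s = expectation (%w. ?I w * m w)" by (simp add: b_def)
   then have "exp (- mu * s) * (exp (mu * s) * b s) = exp (- mu * s) * expectation (%w. ?I w * m w)" by simp
   moreover have "exp (- mu * s) * (exp (mu * s) * b s) = b s" by (simp add: mult.assoc[symmetric] exp_add[symmetric])
   ultimately have "b s = expectation (%w. exp (- mu * s) * (?I w * m w))" by (simp only: integral_mult_right_zero)
   also have "... = expectation (%w. Ph w s)" by (intro integral_congr refl) (use True in \<open>simp add: Ph_def IN\<close>)
   finally show ?thesis using True by simp
  next
   case False
   then show ?thesis by (simp add: Ph_def)
  qed
  have "(\<integral>s. indicator {0..<T} s * b s \<partial>exp1) = (\<integral>s. expectation (%w. Ph w s) \<partial>exp1)" by (simp add: b_eq)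
  also have "... = expectation (%w. \<integral>s. Ph w s \<partial>exp1)"
  proof -
   interpret pair_prob_space Q exp1 ..
   have [measurable]: "(%p. N (fst p) (snd p)) : bmeas (Q \<Otimes>\<^sub>M exp1)" using Npair by (simp add: case_prod_beta')
   have "integrable (Q \<Otimes>\<^sub>M exp1) (%(w, s). Ph w s)"
   proof (rule P.integrable_const_bound[where B=K])
    show "AE p in Q \<Otimes>\<^sub>M exp1. norm (case p of (w, s) => Ph w s) <= K"
    proof (rule AE_I2)
     fix p :: "(real => real) \<times> real"
     obtain w s where p: "p = (w, s)" by force
     have "\<bar>indicator {0..<T} s * exp (- mu * \<bar>s\<bar>) * N w s\<bar> <= 1" using mu0 by (auto simp: N_def indicator_def)
     from mult_mono[OF this mb[of w]] have "\<bar>Ph w s\<bar> <= 1 * K" unfolding Ph_def abs_mult[of _ "m w"] by simp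
     then show "norm (case p of (w, s) => Ph w s) <= K" by (simp add: p)
    qed
    show "(%(w, s). Ph w s) : bmeas (Q \<Otimes>\<^sub>M exp1)" unfolding Ph_def case_prod_beta' by measurable
   qed
   from Fubini_integral[OF this] show ?thesis by simp
  qed
  also have "... = expectation (%w. m w * ((1 - exp (- (1 + mu) * rh w)) / (1 + mu)))"
  proof (intro integral_congr refl)
   fix w assume w: "w : space Q"
   have "(\<integral>s. Ph w s \<partial>exp1) = (\<integral>s. m w * (indicator {..<rh w} s * exp (- mu * \<bar>s\<bar>)) \<partial>exp1)"
   proof (rule integral_cong_AE)
    show "AE s in exp1. Ph w s = m w * (indicator {..<rh w} s * exp (- mu * \<bar>s\<bar>))" by (rule AE_exp1I) (simp add: Ph_def Nst'[OF w, symmetric])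
    show "(%s. Ph w s) : bmeas exp1" using Ntm[OF w] unfolding Ph_def by measurable
   qed measurable
   also have "... = m w * ((1 - exp (- (1 + mu) * rh w)) / (1 + mu))" using exp1_discount[OF mu0 rh(1)[of w]] by simp
   finally show "(\<integral>s. Ph w s \<partial>exp1) = m w * ((1 - exp (- (1 + mu) * rh w)) / (1 + mu))" .
  qed
  finally have "(1 + mu) * (\<integral>s. indicator {0..<T} s * b s \<partial>exp1)
    = (1 + mu) * expectation (%w. m w * ((1 - exp (- (1 + mu) * rh w)) / (1 + mu)))" by simp
  also have "... = expectation (%w. (1 + mu) * (m w * ((1 - exp (- (1 + mu) * rh w)) / (1 + mu))))" by simp
  \<comment> \<open>The growth factor \<open>exp (mu * rh w)\<close> inside \<open>m w\<close> meets
    \<open>exp (- (1 + mu) * rh w)\<close> and leaves the plain discount at the exit.\<close>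
  also have "... = expectation (%w. m w - exp (- rh w) * h (w (rh w)))"
  proof (intro integral_congr refl)
   fix w
   have "exp (- (1 + mu) * rh w) * exp (mu * rh w) = exp (- rh w)" by (simp add: exp_add[symmetric] algebra_simps)
   then have "m w * exp (- (1 + mu) * rh w) = exp (- rh w) * h (w (rh w))" unfolding m_def wave_def h_def mu_def by (simp only: mult.commute mult.left_commute)
   moreover have "(1 + mu) * (m w * ((1 - exp (- (1 + mu) * rh w)) / (1 + mu))) = m w - m w * exp (- (1 + mu) * rh w)"
   proof -
    have "(1 + mu) * (x * (y / (1 + mu))) = x * y" for x y :: real using mu0 by simp
    then show ?thesis by (simp only: right_diff_distrib mult_1_right)
   qed
   ultimately show "(1 + mu) * (m w * ((1 - exp (- (1 + mu) * rh w)) / (1 + mu))) = m w - exp (- rh w) * h (w (rh w))" by simp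
  qed
  also have "... = h z - expectation (%w. exp (- rh w) * h (w (rh w)))"
  proof -
   have "(%w. w (rh w)) : bmeas Q" using measurable_stopped_at[OF cl measurable_ident_sets[OF refl], of "%_. T"] T0 unfolding Q_meas_iff rh_def stopped_hit by (simp add: measurable_restrict_space2_iff)
   from measurable_compose[OF this hm] have [measurable]: "(%w. h (w (rh w))) : bmeas Q" .
   have "integrable Q (%w. exp (- rh w) * h (w (rh w)))"
   proof (rule int_Q_bdd[where c="1 * 1"])
    show "\<bar>exp (- rh w) * h (w (rh w))\<bar> <= 1 * 1" for w unfolding abs_mult by (intro mult_mono hb) (auto simp: rh)
   qed measurable
   moreover have "integrable Q m" by (rule int_Q_bdd[OF mm mb])
   ultimately show ?thesis by (simp add: Em)
  qed
  finally have i: "(1 + mu) * (\<integral>s. indicator {0..<T} s * b s \<partial>exp1) = h z - expectation (%w. exp (- rh w) * h (w (rh w)))" .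
  have ii: "\<bar>expectation (pot V H1) - (\<integral>s. indicator {0..<T} s * b s \<partial>exp1)\<bar> <= exp (- T)"
  proof -
   have ib: "integrable exp1 b" by (rule exp1_bdd[OF bm bb])
   have i': "integrable exp1 (%s. indicator B s * b s)" if [measurable]: "B : sets borel" for B using bb by (intro exp1_bdd[of _ 1]) (auto simp: indicator_def)
   have "(\<integral>s. b s \<partial>exp1) = (\<integral>s. indicator {0..<T} s * b s + indicator {T..} s * b s \<partial>exp1)" by (rule integral_cong_AE) (use T0 in \<open>auto intro!: AE_exp1I simp: indicator_def\<close>)
   also have "... = (\<integral>s. indicator {0..<T} s * b s \<partial>exp1) + (\<integral>s. indicator {T..} s * b s \<partial>exp1)" by (intro Bochner_Integration.integral_add i') auto
   also have "(\<integral>s. indicator {T..} s * b s \<partial>exp1) = exp (- T) * (\<integral>s. b (T + s) \<partial>exp1)" by (rule integral_exp1_shift[OF bm T0])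
   finally have "expectation (pot V H1) - (\<integral>s. indicator {0..<T} s * b s \<partial>exp1) = exp (- T) * (\<integral>s. b (T + s) \<partial>exp1)" unfolding E1 by simp
   moreover have "\<bar>\<integral>s. b (T + s) \<partial>exp1\<bar> <= 1"
   proof -
    have ibT: "integrable exp1 (%s. b (T + s))" by (rule exp1_bdd[of _ 1]) (use bb in auto)
    have "\<bar>\<integral>s. b (T + s) \<partial>exp1\<bar> <= (\<integral>s. \<bar>b (T + s)\<bar> \<partial>exp1)" by (rule integral_abs_bound)
    also have "... <= 1" by (rule exp1.integral_le_const) (use bb ibT in auto)
    finally show ?thesis .
   qed
   ultimately show ?thesis by (simp add: abs_mult)
  qed
  have iii: "\<bar>expectation (pot V H2) - expectation (%w. exp (- rh w) * h (w (rh w)))\<bar> <= 2 * exp (- T)"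
  proof -
   have pt: "\<bar>pot V H2 w - exp (- rh w) * h (w (rh w))\<bar> <= 2 * exp (- T)" if w: "w : space Q" for w
   proof -
    have out: "w s ~: V" if "0 <= s" "s < rh w" for s using that unfolding rh_def by (cases rule: hit_cases[OF clw[OF w] T0]) auto
    have wS: "shift (rh w) w : space (path_space UNIV)" by (rule shift_in_path_space[OF path_Q[OF w] rh(1)])
    have "(\<integral>t. indicator {..<rh w} t * H2 (stopped V w t) \<partial>exp1) = (\<integral>t. 0 \<partial>exp1)"
    proof (rule integral_cong_AE)
     have [measurable]: "(%t. H2 (stopped V w t)) : bmeas borel" by (rule stopped_time_meas[OF cl H2m H2b path_Q[OF w]])
     show "(%t. indicator {..<rh w} t * H2 (stopped V w t)) : bmeas exp1" by measurable
     have "indicator {..<rh w} t * H2 (stopped V w t) = 0" if "0 <= t" for t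
     proof (cases "t < rh w")
      case True
      have "w s ~: V" if "0 <= s" "s < t" for s using out[OF that(1)] that(2) True by simp
      then have "stopped V w t = w t" using \<open>0 <= t\<close> by (intro stopped_stay)
      then show ?thesis using out[OF that True] by (simp add: H2_def)
     qed simp
     then show "AE t in exp1. indicator {..<rh w} t * H2 (stopped V w t) = 0" by (rule AE_exp1I)
    qed simp
    then have split: "pot V H2 w = exp (- rh w) * pot V H2 (shift (rh w) w)" using potential_split[OF cl H2m H2b path_Q[OF w] rh(1) out] by simp
    show ?thesis using clw[OF w] T0
    proof (cases rule: hit_cases)
     case stay
     then have "rh w = T" by (simp add: rh_def)
     moreover have "\<bar>pot V H2 (shift (rh w) w) - h (w (rh w))\<bar> <= 2" using potential_bound[OF cl H2m H2b wS] hb[of "w (rh w)"] by linarith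
     moreover have "pot V H2 w - exp (- rh w) * h (w (rh w)) = exp (- rh w) * (pot V H2 (shift (rh w) w) - h (w (rh w)))" unfolding split by (simp only: right_diff_distrib)
     ultimately show ?thesis by (simp add: abs_mult)
    next
     case hit
     then have "w (rh w) : V" by (simp add: rh_def)
     then have "pot V H2 (shift (rh w) w) = h (w (rh w))" unfolding pot_def by (subst stopped_start_in) (auto simp: H2_def)
     then show ?thesis unfolding split by simp
    qed
   qed
   have pm [measurable]: "pot V H2 : bmeas Q" by (rule mQ[OF potential_meas[OF cl H2m H2b]])
   have ip: "integrable Q (pot V H2)" by (rule int_Q_bdd[OF pm]) (rule potential_bound[OF cl H2m H2b path_Q])
   have "(%w. w (rh w)) : bmeas Q" using measurable_stopped_at[OF cl measurable_ident_sets[OF refl], of "%_. T"] T0 unfolding Q_meas_iff rh_def stopped_hit by (simp add: measurable_restrict_space2_iff)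
   from measurable_compose[OF this hm] have [measurable]: "(%w. h (w (rh w))) : bmeas Q" .
   have ih: "integrable Q (%w. exp (- rh w) * h (w (rh w)))"
   proof (rule int_Q_bdd[where c="1 * 1"])
    show "\<bar>exp (- rh w) * h (w (rh w))\<bar> <= 1 * 1" for w unfolding abs_mult by (intro mult_mono hb) (auto simp: rh)
   qed measurable
   have "\<bar>expectation (pot V H2) - expectation (%w. exp (- rh w) * h (w (rh w)))\<bar>
     = \<bar>expectation (%w. pot V H2 w - exp (- rh w) * h (w (rh w)))\<bar>" using ip ih by simp
   also have "... <= expectation (%w. \<bar>pot V H2 w - exp (- rh w) * h (w (rh w))\<bar>)" by (rule integral_abs_bound)
   also have "... <= 2 * exp (- T)" by (rule integral_le_const) (use ip ih pt in \<open>auto intro!: AE_I2\<close>)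
   finally show ?thesis .
  qed
  have "(1 + mu) * expectation (pot V H1) + expectation (pot V H2) - h z
    = (1 + mu) * (expectation (pot V H1) - (\<integral>s. indicator {0..<T} s * b s \<partial>exp1))
     + (expectation (pot V H2) - expectation (%w. exp (- rh w) * h (w (rh w))))" using i by (simp add: right_diff_distrib)
  also have "\<bar>...\<bar> <= (1 + mu) * exp (- T) + 2 * exp (- T)"
  proof (rule order_trans[OF abs_triangle_ineq add_mono[OF _ iii]])
   show "\<bar>(1 + mu) * (expectation (pot V H1) - (\<integral>s. indicator {0..<T} s * b s \<partial>exp1))\<bar> <= (1 + mu) * exp (- T)" unfolding abs_mult using mu0 ii by (intro mult_mono) auto
  qed
  finally show ?thesis by (simp add: T_def algebra_simps)
 qed
 have "(%n. (3 + mu) * exp (- real n)) \<longlonglongrightarrow> (3 + mu) * 0" by (intro tendsto_intros filterlim_compose[OF exp_at_bot] filterlim_uminus_at_bot_at_top[THEN filterlim_compose] filterlim_real_sequentially)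
 then have "\<bar>(1 + mu) * expectation (pot V H1) + expectation (pot V H2) - h z\<bar> <= (3 + mu) * 0" by (rule LIMSEQ_le_const) (use err in auto)
 then have "(1 + mu) * expectation (pot V H1) + expectation (pot V H2) = h z" by simp
 moreover have "expectation (pot V (%y. if y : V then h y else (1 + mu) * h y)) = (1 + mu) * expectation (pot V H1) + expectation (pot V H2)"
 proof -
  have p: "pot V (%y. if y : V then h y else (1 + mu) * h y) w = (1 + mu) * pot V H1 w + pot V H2 w" if w: "w : space Q" for w
  proof -
   have i: "integrable exp1 (%t. H1 (stopped V w t))" "integrable exp1 (%t. H2 (stopped V w t))" by (rule exp1_bdd[OF stopped_time_meas[OF cl H1m H1b path_Q[OF w]] H1b]
         exp1_bdd[OF stopped_time_meas[OF cl H2m H2b path_Q[OF w]] H2b])+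
   have "pot V (%y. if y : V then h y else (1 + mu) * h y) w = (\<integral>t. (1 + mu) * H1 (stopped V w t) + H2 (stopped V w t) \<partial>exp1)" unfolding pot_def by (intro integral_congr refl) (simp add: H1_def H2_def)
   also have "... = (1 + mu) * pot V H1 w + pot V H2 w" using i by (simp add: pot_def)
   finally show ?thesis .
  qed
  have "integrable Q (pot V H1)" "integrable Q (pot V H2)" by (rule int_Q_bdd[OF mQ[OF potential_meas[OF cl H1m H1b]] potential_bound[OF cl H1m H1b path_Q]]
        int_Q_bdd[OF mQ[OF potential_meas[OF cl H2m H2b]] potential_bound[OF cl H2m H2b path_Q]]; assumption)+
  moreover have "expectation (pot V (%y. if y : V then h y else (1 + mu) * h y))
    = expectation (%w. (1 + mu) * pot V H1 w + pot V H2 w)" by (rule integral_congr[OF refl p])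
  ultimately show ?thesis by simp
 qed
 ultimately show ?thesis unfolding h_def by simp
qed

end

context lbm
begin

lemma stopped_bdry:
 assumes w: "w : space Q" "w 0 = z" and z: "z : {c<..<d}" and st: "stopped (- {c<..<d}) w t ~: {c<..<d}"
 shows "stopped (- {c<..<d}) w t = c | stopped (- {c<..<d}) w t = d"
proof -
 let ?V = "- {c<..<d}"
 have wp: "w : space (path_space UNIV)" by (rule path_Q[OF w(1)])
 have clw: "closed {s. 0 <= s & w s : ?V}" by (rule closed_hits[OF wp]) (auto intro: closed_Compl)
 have "0 <= max 0 t" by simp
 with clw show ?thesis
 proof (cases rule: hit_cases)
  case stay
  then have "stopped ?V w t : {c<..<d}" by (subst stopped_max) (simp add: stopped_hit)
  with st show ?thesis by simp
 next
  case hit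
  have "w (hit ?V (max 0 t) w) = c | w (hit ?V (max 0 t) w) = d" by (rule exit_at_boundary[OF path_cont[OF wp] hit(1)]) (use hit w z in auto)
  then show ?thesis by (subst (1 2) stopped_max) (simp add: stopped_hit)
 qed
qed

text \<open>Matches the radial clause of \<open>walsh_at_vertex\<close>, which speaks of the
  absolute value stopped at \<open>r\<close>, with the two-sided exit problem to which
  \<open>dynkin\<close> applies.\<close>

lemma stopped_abs:
 assumes w: "w : space Q" "w 0 = 0" and r: "0 < r" and t: "0 <= t"
 shows "stopped {r} (%u. \<bar>w u\<bar>) t = \<bar>stopped (- {- r<..<r}) w t\<bar>"
proof -
 let ?V = "- {- r<..<r}"
 have wp: "w : space (path_space UNIV)" by (rule path_Q[OF w(1)])
 have clw: "closed {s. 0 <= s & w s : ?V}" by (rule closed_hits[OF wp]) (auto intro: closed_Compl)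
 have "hit {r} t (%u. \<bar>w u\<bar>) = hit ?V t w" using clw t
 proof (cases rule: hit_cases)
  case stay
  have "hit {r} t (%u. \<bar>w u\<bar>) = t"
  proof (rule hit_eqI)
   fix s assume "0 <= s" "s < t"
   then show "\<bar>w s\<bar> ~: {r}" using stay(1)[rule_format, of s] by auto
  qed (use t in auto)
  with stay show ?thesis by simp
 next
  case hit
  have "w (hit ?V t w) = - r | w (hit ?V t w) = r" by (rule exit_at_boundary[OF path_cont[OF wp] hit(1)]) (use hit w r in auto)
  then have "\<bar>w (hit ?V t w)\<bar> : {r}" using r by auto
  moreover have "\<bar>w s\<bar> ~: {r}" if "0 <= s" "s < hit ?V t w" for s using hit(4)[OF that] by auto
  ultimately show ?thesis using hit by (intro hit_eqI) auto
 qed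
 then show ?thesis by (simp add: stopped_hit)
qed

text \<open>\<open>pot V (indicator V)\<close> is \<open>exp (- tau)\<close> for the exit time
  \<open>tau\<close>. Dynkin's formula for a cosine centred in the interval bounds its mean: the
  cosine is at most 1 inside and equals \<open>cos (1 / 2)\<close> at both ends. The bound decreases
  linearly near the ends, which is all that the maximum principle uses of the exact quotient of
  hyperbolic cosines.\<close>

lemma exit_discount:
 assumes z: "z : {c<..<d}"
 defines "V \<equiv> - {c<..<d}" and "mu \<equiv> 1 / (2 * (d - c)^2)"
 shows "(1 + mu - cos (1 / 2)) * expectation (pot V (indicator V)) <= 1 + mu - cos ((z - (c + d) / 2) / (d - c))"
proof -
 define L where "L = d - c"
 have L: "L > 0" using z by (simp add: L_def)
 \<comment> \<open>The frequency makes the phase run over \<open>[- 1/2, 1/2]\<close>, whatever the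
   length of the interval; the shift by \<open>pi / 2\<close> turns the sine into a cosine.\<close>
 define th gmm where "th = 1 / L" and "gmm = pi / 2 - (c + d) / (2 * L)"
 have mu: "th^2 / 2 = mu" by (simp add: th_def mu_def L_def power_divide)
 have h: "sin (th * y + gmm) = cos ((y - (c + d) / 2) / L)" for y
 proof -
  have "th * y + gmm = (y - (c + d) / 2) / L + pi / 2" by (simp add: th_def gmm_def diff_divide_distrib)
  moreover have "sin (x + pi / 2) = cos x" for x :: real by (simp add: sin_add)
  ultimately show ?thesis by (simp only:)
 qed
 define H where "H y = (if y : V then sin (th * y + gmm) else (1 + mu) * sin (th * y + gmm))" for y
 have dyn: "expectation (pot V H) = cos ((z - (c + d) / 2) / L)" using dynkin[OF z, of th gmm] unfolding V_def[symmetric] mu H_def[abs_def] h[of z] .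
 have V: "closed V" unfolding V_def by (intro closed_Compl) simp
 then have cl: "closedin (top_of_set UNIV) (UNIV Int V)" by simp
 have [measurable]: "V : sets borel" using V by simp
 have mu0: "0 <= mu" by (simp add: mu_def)
 have Hm: "H : bmeas (rborel UNIV)"
  and Im: "(indicator V :: real => real) : bmeas (rborel UNIV)" unfolding H_def[abs_def] by (rule measurable_restrict_space1, measurable)+
 have Hb: "\<bar>H y\<bar> <= 1 + mu" for y
 proof -
  have "\<bar>sin (th * y + gmm)\<bar> <= 1 + mu" using abs_sin_le_one[of "th * y + gmm"] mu0 by linarith
  moreover have "(1 + mu) * \<bar>sin (th * y + gmm)\<bar> <= (1 + mu) * 1" using mu0 by (intro mult_left_mono) auto
  ultimately show ?thesis using mu0 by (simp add: H_def abs_mult)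
 qed
 have Ib: "\<bar>indicator V y :: real\<bar> <= 1" for y by (simp add: indicator_def)
 have mQ: "g : bmeas Q" if "g : bmeas (path_space UNIV)" for g :: "_ => real" using that by (simp add: Q_meas_iff)
 have iH: "integrable Q (pot V H)" by (rule int_Q_bdd[OF mQ[OF potential_meas[OF cl Hm Hb]] potential_bound[OF cl Hm Hb path_Q]])
 have iI: "integrable Q (pot V (indicator V))" by (rule int_Q_bdd[OF mQ[OF potential_meas[OF cl Im Ib]] potential_bound[OF cl Im Ib path_Q]])
 have "pot V H w <= (1 + mu) - (1 + mu - cos (1 / 2)) * pot V (indicator V) w" if w: "w : space Q" and w0: "w 0 = z" for w
 proof -
  have i: "integrable exp1 (%t. H (stopped V w t))" "integrable exp1 (%t. indicator V (stopped V w t) :: real)" by (rule exp1_bdd[OF stopped_time_meas[OF cl Hm Hb path_Q[OF w]] Hb]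
        exp1_bdd[OF stopped_time_meas[OF cl Im Ib path_Q[OF w]] Ib])+
  have pt: "H (stopped V w t) <= (1 + mu) - (1 + mu - cos (1 / 2)) * indicator V (stopped V w t)" for t
  proof (cases "stopped V w t : V")
   case True
   then have "stopped V w t = c | stopped V w t = d" using stopped_bdry[OF w w0 z, of t] by (auto simp: V_def)
   then have "(stopped V w t - (c + d) / 2) / L = - (1 / 2) | (stopped V w t - (c + d) / 2) / L = 1 / 2" using L by (auto simp: L_def field_simps)
   then have "sin (th * stopped V w t + gmm) = cos (1 / 2)" unfolding h by (elim disjE) (simp_all only: cos_minus)
   then show ?thesis using True by (simp add: H_def)
  next
   case False
   have "(1 + mu) * sin (th * stopped V w t + gmm) <= (1 + mu) * 1" using mu0 by (intro mult_left_mono) auto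
   then show ?thesis using False by (simp add: H_def)
  qed
  have "pot V H w <= (\<integral>t. (1 + mu) - (1 + mu - cos (1 / 2)) * indicator V (stopped V w t) \<partial>exp1)" unfolding pot_def by (rule integral_mono) (use i pt in auto)
  also have "... = (1 + mu) - (1 + mu - cos (1 / 2)) * pot V (indicator V) w" using i(2) by (simp add: pot_def)
  finally show ?thesis .
 qed
 then have "expectation (pot V H) <= expectation (%w. (1 + mu) - (1 + mu - cos (1 / 2)) * pot V (indicator V) w)" using iH iI start AE_space by (intro integral_mono_AE) (auto elim!: eventually_elim2)
 also have "... = (1 + mu) - (1 + mu - cos (1 / 2)) * expectation (pot V (indicator V))" using iI by (simp add: prob_space)
 finally show ?thesis unfolding dyn by (simp add: L_def)
qed

end

subsection \<open>The law of linear Brownian motion on path space\<close>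

lemma cprocD:
 assumes "continuous_process S M B"
 shows "prob_space M" "(%om. \<lambda>t\<in>{0..}. B t om) : M ->> path_space S"
  and "0 <= t ==> B t : M ->> borel"
  and "om : space M ==> (\<lambda>t\<in>{0..}. B t om) : space (path_space S)"
proof -
 show "prob_space M" and *: "(%om. \<lambda>t\<in>{0..}. B t om) : M ->> path_space S" using assms by (auto simp: continuous_process_def)
 show "B t : M ->> borel" if "0 <= t" using measurable_compose[OF * eval_borel[OF that]] that by simp
 show "(\<lambda>t\<in>{0..}. B t om) : space (path_space S)" if "om : space M" using measurable_space[OF * that] .
qed

text \<open>Both signs occur, because \<open>chart\<close> may run along an edge in either
  direction.\<close>

lemma rbm_affine:
 assumes W: "real_brownian_motion z M W" and sg: "sg = 1 | sg = - 1"
 shows "real_brownian_motion (sg * z + q) M (%t om. sg * W t om + q)"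
proof -
 have cp: "continuous_process UNIV M W" and W0: "!!om. om : space M ==> W 0 om = z"
  and nd: "!!s t. 0 <= s ==> s < t ==> distributed M lborel (%om. W t om - W s om) (normal_density 0 (sqrt (t - s)))"
  and ind: "!!(s::nat => real) n. 0 <= s 0 ==> mono s ==> prob_space.indep_vars M (%_. borel) (%i om. W (s (Suc i)) om - W (s i) om) {..<n}" using W unfolding real_brownian_motion_def by blast+
 interpret prob_space M by (rule cprocD(1)[OF cp])
 have inc: "sg * W t om + q - (sg * W s om + q) = 0 + sg * (W t om - W s om)" for s t om by (simp add: right_diff_distrib)
 show ?thesis unfolding real_brownian_motion_def inc
 proof (intro conjI allI impI ballI)
  have "(%om. \<lambda>t\<in>{0..}. sg * W t om + q) : M ->> path_space UNIV"
  proof (rule into_paths)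
   show "(%om. sg * W t om + q) : M ->> rborel UNIV" if "0 <= t" for t using cprocD(3)[OF cp that] by (intro measurable_restrict_space2) auto
   show "continuous_on {0..} (%t. sg * W t om + q)" if "om : space M" for om
   proof -
    have "continuous_on {0..} (\<lambda>t\<in>{0..}. W t om)" by (rule path_cont[OF cprocD(4)[OF cp that]])
    then have "continuous_on {0..} (%t. W t om)" by (rule continuous_on_eq) simp
    then show ?thesis by (intro continuous_intros)
   qed
  qed
  then show "continuous_process UNIV M (%t om. sg * W t om + q)" by (simp add: continuous_process_def prob_space_axioms)
  show "sg * W 0 om + q = sg * z + q" if "om : space M" for om by (simp add: W0[OF that])
  fix s t :: real assume st: "0 <= s & s < t"
  have "distributed M lborel (%om. 0 + sg * (W t om - W s om)) (normal_density (0 + sg * 0) (\<bar>sg\<bar> * sqrt (t - s)))" by (rule normal_density_affine[OF nd]) (use st sg in auto)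
  moreover have "\<bar>sg\<bar> = 1" using sg by auto
  ultimately show "distributed M lborel (%om. 0 + sg * (W t om - W s om)) (normal_density 0 (sqrt (t - s)))" by simp
 next
  fix s :: "nat => real" and n assume s: "0 <= s 0 & mono s"
  show "indep_vars (%_. borel) (%i om. 0 + sg * (W (s (Suc i)) om - W (s i) om)) {..<n}" by (rule indep_vars_compose2[OF ind, of s n "%_ x. 0 + sg * x"]) (use s in auto)
 qed
qed

text \<open>The target \<open>N\<close> is left open: \<open>lbm_law\<close> takes the whole path
  space, \<open>canonical_brownian_motion\<close> the subspace of paths from
  \<open>z\<close>.\<close>

lemma real_brownian_motion_distr:
 assumes W: "real_brownian_motion z M W" and La: "La : M ->> N"
  and ev: "!!t. 0 <= t ==> (%w. w t) : bmeas N"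
  and LaW: "!!t om. 0 <= t ==> om : space M ==> La om t = W t om"
 shows "prob_space (distr M N La)"
  and "0 <= s ==> s < t ==> distributed (distr M N La) lborel (%w. w t - w s) (normal_density 0 (sqrt (t - s)))"
  and "0 <= (u::nat => real) 0 ==> mono u ==> prob_space.indep_vars (distr M N La) (%_. borel) (%i w. w (u (Suc i)) - w (u i)) {..<n::nat}"
proof -
 have cp: "continuous_process UNIV M W"
  and nd: "!!s t. 0 <= s ==> s < t ==> distributed M lborel (%om. W t om - W s om) (normal_density 0 (sqrt (t - s)))"
  and ind: "!!(s::nat => real) n. 0 <= s 0 ==> mono s ==> prob_space.indep_vars M (%_. borel) (%i om. W (s (Suc i)) om - W (s i) om) {..<n}" using W unfolding real_brownian_motion_def by blast+
 interpret M: prob_space M by (rule cprocD(1)[OF cp])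
 show pN: "prob_space (distr M N La)" by (rule M.prob_space_distr[OF La])
 interpret N: prob_space "distr M N La" by (rule pN)
 have inc: "(%w. w t - w s) : bmeas N" if "0 <= s" "0 <= t" for s t by (intro borel_measurable_diff ev that)
 have incW: "(%om. W t om - W s om) : bmeas M" if "0 <= s" "0 <= t" for s t by (intro borel_measurable_diff cprocD(3)[OF cp] that)
 have di: "distr (distr M N La) L (%w. w t - w s) = distr M L (%om. W t om - W s om)"
  if "0 <= s" "0 <= t" "sets L = sets borel" for s t and L :: "real measure"
 proof -
  have "(%w. w t - w s) : N ->> L" using inc[OF that(1,2)] that(3) by (simp cong: measurable_cong_sets)
  then have "distr (distr M N La) L (%w. w t - w s) = distr M L ((%w. w t - w s) \<circ> La)" by (rule distr_distr[OF _ La])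
  also have "... = distr M L (%om. W t om - W s om)" by (rule distr_cong) (auto simp: LaW that)
  finally show ?thesis .
 qed
 show "distributed (distr M N La) lborel (%w. w t - w s) (normal_density 0 (sqrt (t - s)))" if "0 <= s" "s < t" using nd[OF that] inc[of s t] di[of s t lborel] that unfolding distributed_def by simp
 show "N.indep_vars (%_. borel) (%i w. w (u (Suc i)) - w (u i)) {..<n}" if u: "0 <= u 0" "mono u" for u :: "nat => real" and n
 proof (cases "n = 0")
  case True
  then show ?thesis by (simp add: N.indep_vars_def N.indep_sets_def)
 next
  case False
  then have ne: "{..<n} ~= {}" by auto
  have u0: "0 <= u i" for i using monoD[OF u(2), of 0 i] u(1) by simp
  have "distr (distr M N La) (Pi\<^sub>M {..<n} (%_. borel)) (%w. \<lambda>i\<in>{..<n}. w (u (Suc i)) - w (u i))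
    = distr M (Pi\<^sub>M {..<n} (%_. borel)) ((%w. \<lambda>i\<in>{..<n}. w (u (Suc i)) - w (u i)) \<circ> La)" by (rule distr_distr[OF _ La]) (intro measurable_restrict inc u0)
  also have "... = distr M (Pi\<^sub>M {..<n} (%_. borel)) (%om. \<lambda>i\<in>{..<n}. W (u (Suc i)) om - W (u i) om)" by (rule distr_cong) (auto simp: LaW u0 fun_eq_iff)
  also have "... = (\<Pi>\<^sub>M i\<in>{..<n}. distr M borel (%om. W (u (Suc i)) om - W (u i) om))" using ind[OF u, of n] M.indep_vars_iff_distr_eq_PiM'[OF ne, where M'="%_. borel" and X="%i om. W (u (Suc i)) om - W (u i) om"] incW[OF u0 u0] by simp
  also have "... = (\<Pi>\<^sub>M i\<in>{..<n}. distr (distr M N La) borel (%w. w (u (Suc i)) - w (u i)))" by (intro PiM_cong) (simp_all add: di u0)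
  finally show ?thesis using N.indep_vars_iff_distr_eq_PiM'[OF ne, where M'="%_. borel" and X="%i w. w (u (Suc i)) - w (u i)"] inc[OF u0 u0] by simp
 qed
qed

lemma lbm_law:
 assumes W: "real_brownian_motion z M W"
 shows "lbm (process_law UNIV M W) z"
proof -
 have cp: "continuous_process UNIV M W" and W0: "!!om. om : space M ==> W 0 om = z" using W unfolding real_brownian_motion_def by blast+
 define La where "La om = (\<lambda>t\<in>{0..}. W t om)" for om
 have La: "La : M ->> path_space UNIV" unfolding La_def[abs_def] by (rule cprocD(2)[OF cp])
 have Q: "process_law UNIV M W = distr M (path_space UNIV) La" by (simp add: process_law_def La_def[abs_def])
 have LaW: "La om t = W t om" if "0 <= t" "om : space M" for t om using that by (simp add: La_def)
 note D = real_brownian_motion_distr[OF W La eval_borel LaW]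
 interpret prob_space "distr M (path_space UNIV) La" by (rule D(1))
 show ?thesis unfolding Q
 proof unfold_locales
  show "sets (distr M (path_space UNIV) La) = sets (path_space UNIV)" by simp
  have "{w : space (path_space UNIV). w 0 = z} : sets (path_space (UNIV :: real set))" using measurable_sets[OF eval_borel[OF order_refl, of UNIV], of "{z}"] by (simp add: vimage_def Int_def conj_commute)
  then show "AE w in distr M (path_space UNIV) La. w 0 = z" by (subst AE_distr_iff[OF La]) (auto simp: LaW W0 intro!: AE_I2)
 qed (use D(2,3) in auto)
qed

text \<open>\<^const>\<open>real_brownian_motion\<close> asks for the starting point on the whole sample space, hence the restriction of the
 path space.\<close>

lemma canonical_brownian_motion:
 assumes W: "real_brownian_motion z M W"
 obtains Q where "real_brownian_motion z Q (%t w. w t)"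
  and "!!(N :: 'c measure) g. g : path_space (UNIV :: real set) ->> N ==> g : Q ->> N & distr Q N g = distr (process_law UNIV M W) N g"
proof -
 have cp: "continuous_process UNIV M W" and W0: "!!om. om : space M ==> W 0 om = z" using W unfolding real_brownian_motion_def by blast+
 define La where "La om = (\<lambda>t\<in>{0..}. W t om)" for om
 have La0: "La : M ->> path_space UNIV" unfolding La_def[abs_def] by (rule cprocD(2)[OF cp])
 have LaW: "La om t = W t om" if "0 <= t" "om : space M" for t om using that by (simp add: La_def)
 define N where "N = restrict_space (path_space (UNIV :: real set)) {w. w 0 = z}"
 have La: "La : M ->> N" unfolding N_def by (rule measurable_restrict_space2[OF _ La0]) (auto simp: LaW W0)
 have ev: "(%w. w t) : bmeas N" if "0 <= t" for t unfolding N_def by (intro measurable_restrict_space1 eval_borel that)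
 note D = real_brownian_motion_distr[OF W La ev LaW]
 have N_restrict: "(\<lambda>t\<in>{0..}. w t) = w" if "w : space N" for w using that by (auto simp: N_def space_restrict_space space_path_space fun_eq_iff PiE_def extensional_def)
 show ?thesis
 proof
  show "real_brownian_motion z (distr M N La) (%t w. w t)" unfolding real_brownian_motion_def
  proof (intro conjI allI impI ballI)
   have "(%w. \<lambda>t\<in>{0..}. w t) : N ->> path_space UNIV" using measurable_cong[of N "%w. \<lambda>t\<in>{0..}. w t" "%w. w" "path_space UNIV"] N_restrict by (simp add: N_def measurable_restrict_space1)
   then show "continuous_process UNIV (distr M N La) (%t w. w t)" by (simp add: continuous_process_def D(1))
   show "w 0 = z" if "w : space (distr M N La)" for w using that by (simp add: N_def space_restrict_space)
  qed (use D(2,3) in auto)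
  fix L :: "'c measure" and g assume g: "g : path_space (UNIV :: real set) ->> L"
  then have gN: "g : N ->> L" unfolding N_def by (rule measurable_restrict_space1)
  have "distr (distr M N La) L g = distr M L (g \<circ> La)" by (rule distr_distr[OF gN La])
  also have "... = distr (distr M (path_space UNIV) La) L g" by (rule distr_distr[OF g La0, symmetric])
  finally show "g : distr M N La ->> L & distr (distr M N La) L g = distr (process_law UNIV M W) L g" using gN by (simp add: process_law_def La_def[abs_def])
 qed
qed

subsection \<open>Test functions and killed laws\<close>

text \<open>Compact support inside \<open>(a,b)\<close>, expressed by a margin \<open>dl\<close>. It
  permits division by a sine that vanishes at \<open>a\<close> and \<open>b\<close>.\<close>

definition testf :: "real => real => (real => real) => bool" where
 "testf a b g \<longleftrightarrow> continuous_on UNIV g & (\<exists>dl>0. \<forall>x. g x ~= 0 --> a + dl <= x & x <= b - dl)"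

definition utest :: "real => real => (real => real) => bool" where
 "utest a b g \<longleftrightarrow> testf a b g & (\<forall>x. 0 <= g x & g x <= 1)"

lemma test_fun_measurable: "testf a b g ==> g : bmeas borel" by (auto simp: testf_def intro: borel_measurable_continuous_onI)

lemma test_fun_bounded:
 assumes "testf a b g"
 obtains c where "!!x. \<bar>g x\<bar> <= c"
proof -
 from assms obtain dl where dl: "dl > 0" "!!x. g x ~= 0 ==> a + dl <= x & x <= b - dl" and gc: "continuous_on UNIV g" unfolding testf_def by blast
 have s: "x : {a..b}" if "g x ~= 0" for x using dl(1) dl(2)[OF that] by simp
 have "compact (g ` {a..b})" by (intro compact_continuous_image continuous_on_subset[OF gc]) auto
 then obtain c where c: "!!y. y : g ` {a..b} ==> \<bar>y\<bar> <= c" using compact_imp_bounded[of "g ` {a..b}"] unfolding bounded_iff real_norm_def by blast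
 have "\<bar>g x\<bar> <= max c 0" for x
 proof (cases "g x = 0")
  case False
  then have "\<bar>g x\<bar> <= c" using s by (intro c) blast
  then show ?thesis by simp
 qed simp
 then show ?thesis by (rule that)
qed

lemma test_fun_mult: "testf a b g ==> continuous_on UNIV h ==> testf a b (%x. g x * h x)" unfolding testf_def by (auto intro!: continuous_intros)

text \<open>With the angle running over \<open>[0,pi]\<close> and \<open>u\<close> its cosine, the
  quotient of \<open>g\<close> by the sine is a continuous function of \<open>u\<close> on
  \<open>[-1,1]\<close> because of the compact support. Weierstrass gives a polynomial in
  \<open>u\<close>.\<close>

lemma test_fun_sine_polynomial:
 assumes g: "testf a b g" and ab: "a < b" and e: "0 < e"
 obtains c N where "!!x. x : {a..b} ==>
  \<bar>g x - (\<Sum>i\<le>N::nat. c i * (sin (pi * (x - a) / (b - a)) * cos (pi * (x - a) / (b - a)) ^ i))\<bar> <= e"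
proof -
 from g obtain dl where dl: "dl > 0" and supp: "!!x. g x ~= 0 ==> a + dl <= x & x <= b - dl" and gc: "continuous_on UNIV g" by (auto simp: testf_def)
 define ta where "ta x = pi * (x - a) / (b - a)" for x
 define X where "X u = a + (b - a) * u / pi" for u
 have Xta: "X (ta x) = x" for x using ab by (simp add: X_def ta_def)
 have ta_bounds: "0 <= ta x & ta x <= pi" if "x : {a..b}" for x using that ab by (auto simp: ta_def divide_le_eq mult_left_mono)
 have "\<exists>et>0. \<forall>x. g x ~= 0 --> et <= sin (ta x)"
 proof (cases "{a + dl..b - dl} = {}")
  case True
  have "g x = 0" for x
  proof (rule ccontr)
   assume "g x ~= 0"
   from supp[OF this] have "x : {a + dl..b - dl}" by simp
   with True show False by simp
  qed
  then show ?thesis by (intro exI[of _ 1]) auto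
 next
  case False
  have "continuous_on {a + dl..b - dl} (%x. sin (ta x))" unfolding ta_def using ab by (intro continuous_intros) auto
  from continuous_attains_inf[OF compact_Icc False this]
  obtain x0 where x0: "x0 : {a + dl..b - dl}" "!!x. x : {a + dl..b - dl} ==> sin (ta x0) <= sin (ta x)" by blast
  have "0 < ta x0" using x0(1) dl ab by (auto simp: ta_def)
  moreover have "ta x0 < pi" using x0(1) dl ab by (auto simp: ta_def divide_less_eq)
  ultimately have "0 < sin (ta x0)" by (rule sin_gt_zero)
  then show ?thesis using x0(2) supp by (intro exI[of _ "sin (ta x0)"]) auto
 qed
 then obtain et where et: "et > 0" "!!x. g x ~= 0 ==> et <= sin (ta x)" by blast
 \<comment> \<open>The maximum with \<open>et\<close> changes nothing on the support of
   \<open>g\<close> and keeps the denominator away from 0 elsewhere.\<close>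
 define G where "G u = g (X (arccos u)) / max et (sin (arccos u))" for u
 have "continuous_on {- 1..1} G" unfolding G_def X_def
 proof (intro continuous_intros continuous_on_compose2[OF gc])
  show "ALL u:{- 1..1}. max et (sin (arccos u)) ~= 0" using et(1) by (auto simp: max_def)
 qed auto
 then obtain p where p: "real_polynomial_function p" "!!u. u : {- 1..1} ==> \<bar>G u - p u\<bar> < e" using Stone_Weierstrass_real_polynomial_function[of "{- 1..1::real}" G e] e by auto
 from p(1) obtain c N where pc: "p = (%x. \<Sum>i\<le>N. c i * x ^ i)" by (auto simp: real_polynomial_function_iff_sum)
 show ?thesis
 proof
  fix x assume x: "x : {a..b}"
  have arc: "arccos (cos (ta x)) = ta x" using ta_bounds[OF x] by (intro arccos_cos) auto
  have "g x = sin (ta x) * G (cos (ta x))" using et(1) et(2)[of x] by (cases "g x = 0") (auto simp: G_def arc Xta max_def)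
  then have "\<bar>g x - sin (ta x) * p (cos (ta x))\<bar> = \<bar>sin (ta x)\<bar> * \<bar>G (cos (ta x)) - p (cos (ta x))\<bar>" by (simp add: right_diff_distrib[symmetric] abs_mult)
  also have "... <= 1 * e" using p(2)[of "cos (ta x)"] by (intro mult_mono) auto
  also have "sin (ta x) * p (cos (ta x)) = (\<Sum>i\<le>N. c i * (sin (ta x) * cos (ta x) ^ i))" unfolding pc sum_distrib_left by (intro sum.cong) auto
  finally show "\<bar>g x - (\<Sum>i\<le>N. c i * (sin (pi * (x - a) / (b - a)) * cos (pi * (x - a) / (b - a)) ^ i))\<bar> <= e" by (simp add: ta_def)
 qed
qed

section \<open>Killed processes with the Dirichlet sines as eigenfunctions\<close>

definition kext :: "'a set => ('a => real) => (real => real) => 'a => real" where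
 "kext A zt g y = (if y : A then 0 else g (zt y))"

text \<open>The Dirichlet eigenfunctions of \<open>(a,b)\<close> for half the second derivative; the
  eigenvalues appear in the exponent of \<open>eigen\<close> in \<open>kproc\<close>.\<close>

definition sinem :: "real => real => nat => real => real" where
 "sinem a b n x = sin (real n * (pi * (x - a) / (b - a)))"

text \<open>What a comparison of laws consumes: a real coordinate \<open>zt\<close> while the path
  is off \<open>A\<close>, and the eigenvalue relation for all Dirichlet sines under arbitrary
  bounded weights \<open>Z\<close> from the past. The process on the graph and linear Brownian
  motion both fit.\<close>

locale kproc = prob_space N for N :: "(real => 'a::metric_space) measure" +
 fixes S A :: "'a set" and zt :: "'a => real" and a b z :: real
 assumes sets_N: "sets N = sets (path_space S)"
  and A: "closedin (top_of_set S) (S Int A)"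
  and zt: "zt : bmeas (rborel S)"
  and zt_in: "y : S ==> y ~: A ==> zt y : {a<..<b}"
  and ab: "a < b"
  and start: "AE w in N. w 0 ~: A & zt (w 0) = z"
  and eigen: "0 <= s ==> s <= t ==> Z : bmeas (path_filtration S s) ==>
   (!!w. w : space (path_space S) ==> 0 <= Z w & Z w <= 1) ==>
   (\<integral>w. Z w * kext A zt (sinem a b n) (stopped A w t) \<partial>N)
   = exp (- ((real n * pi / (b - a))^2 / 2) * (t - s)) * (\<integral>w. Z w * kext A zt (sinem a b n) (stopped A w s) \<partial>N)"
begin

lemma space_N: "space N = space (path_space S)" by (rule sets_eq_imp_space_eq[OF sets_N])

lemma N_meas_iff: "N ->> L = path_space S ->> L" by (rule measurable_cong_sets[OF sets_N refl])

lemma measurable_killed_ext: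
 assumes "g : bmeas borel"
 shows "kext A zt g : bmeas (rborel S)" unfolding kext_def[abs_def]
proof (rule measurable_If)
 have "{y : space (rborel S). y : A} = S Int A" by (auto simp: space_restrict_space)
 then show "{y : space (rborel S). y : A} : sets (rborel S)" using sets_closedin[OF A] by simp
qed (use assms measurable_compose[OF zt] in auto)

lemma measurable_stopped_ext:
 assumes "g : bmeas borel" "0 <= t"
 shows "(%w. kext A zt g (stopped A w t)) : bmeas N" unfolding N_meas_iff by (rule measurable_compose[OF measurable_stopped_at[OF A measurable_ident_sets[OF refl]] measurable_killed_ext])
   (use assms in auto)

lemma killed_ext_le:
 assumes "!!x. x : {a<..<b} ==> \<bar>g x\<bar> <= c" "w : space N" "0 <= c"
 shows "\<bar>kext A zt g (stopped A w t)\<bar> <= c" using assms(1)[OF zt_in] stopped_in_space[of w S A t] assms(2,3) by (auto simp: kext_def space_N)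

definition weight :: "real set => (real => real => real) => (real => 'a) => real" where
 "weight J h w = (\<Prod>u\<in>J. h u (zt (w u)))"

definition kmean :: "real set => (real => real => real) => real => (real => real) => real" where
 "kmean J h t g = (\<integral>w. weight J h w * kext A zt g (stopped A w t) \<partial>N)"

lemma weight_bounds:
 "(!!u. u : J ==> utest a b (h u)) ==> 0 <= weight J h w & weight J h w <= 1" unfolding weight_def by (auto simp: utest_def intro!: prod_nonneg prod_le_1)

lemma measurable_weight:
 assumes "J <= {0..s}" "!!u. u : J ==> utest a b (h u)"
 shows "weight J h : bmeas (path_filtration S s)" unfolding weight_def[abs_def]
proof (rule borel_measurable_prod)
 fix u assume u: "u : J"
 have "(%w. zt (w u)) : bmeas (path_filtration S s)" using u assms(1) by (intro measurable_compose[OF eval_filt zt]) auto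
 moreover have "h u : bmeas borel" using assms(2)[OF u] by (auto simp: utest_def intro: test_fun_measurable)
 ultimately show "(%w. h u (zt (w u))) : bmeas (path_filtration S s)" by (rule measurable_compose)
qed

context
 fixes J :: "real set" and h :: "real => real => real" and t :: real
 assumes J: "J <= {0..t}" and h: "!!u. u : J ==> utest a b (h u)" and t: "0 <= t"
begin

lemma integrable_killed_mean:
 assumes g: "g : bmeas borel" "!!x. x : {a<..<b} ==> \<bar>g x\<bar> <= c"
 shows "integrable N (%w. weight J h w * kext A zt g (stopped A w t))"
proof (rule integrable_const_bound[where B="1 * max c 0"])
 show "AE w in N. norm (weight J h w * kext A zt g (stopped A w t)) <= 1 * max c 0"
 proof (rule AE_I2)
  fix w assume w: "w : space N"
  have "\<bar>kext A zt g (stopped A w t)\<bar> <= max c 0" by (rule killed_ext_le[OF _ w]) (use g(2) in \<open>auto intro: le_max_iff_disj[THEN iffD2]\<close>)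
  then have "\<bar>weight J h w\<bar> * \<bar>kext A zt g (stopped A w t)\<bar> <= 1 * max c 0" using weight_bounds[of J h w, OF h] by (intro mult_mono) auto
  then show "norm (weight J h w * kext A zt g (stopped A w t)) <= 1 * max c 0" by (simp add: abs_mult)
 qed
 have "weight J h : bmeas N" unfolding N_meas_iff by (rule filt_meas[OF measurable_weight[OF J h]])
 then show "(%w. weight J h w * kext A zt g (stopped A w t)) : bmeas N" by (intro borel_measurable_times measurable_stopped_ext g t)
qed

lemma killed_mean_add:
 assumes "g1 : bmeas borel" "!!x. x : {a<..<b} ==> \<bar>g1 x\<bar> <= c1"
  and "g2 : bmeas borel" "!!x. x : {a<..<b} ==> \<bar>g2 x\<bar> <= c2"
 shows "kmean J h t (%x. r1 * g1 x + r2 * g2 x) = r1 * kmean J h t g1 + r2 * kmean J h t g2"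
proof -
 have "kmean J h t (%x. r1 * g1 x + r2 * g2 x)
  = (\<integral>w. r1 * (weight J h w * kext A zt g1 (stopped A w t)) + r2 * (weight J h w * kext A zt g2 (stopped A w t)) \<partial>N)" unfolding kmean_def by (intro integral_congr refl) (simp add: kext_def algebra_simps)
 also have "... = r1 * kmean J h t g1 + r2 * kmean J h t g2" unfolding kmean_def using integrable_killed_mean[OF assms(1,2)] integrable_killed_mean[OF assms(3,4)] by simp
 finally show ?thesis .
qed

lemma killed_mean_diff_le:
 assumes g1: "g1 : bmeas borel" "!!x. x : {a<..<b} ==> \<bar>g1 x\<bar> <= c1"
  and g2: "g2 : bmeas borel" "!!x. x : {a<..<b} ==> \<bar>g2 x\<bar> <= c2"
  and e: "!!x. x : {a<..<b} ==> \<bar>g1 x - g2 x\<bar> <= e" "0 <= e"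
 shows "\<bar>kmean J h t g1 - kmean J h t g2\<bar> <= e"
proof -
 define d where "d = (%x. 1 * g1 x + (- 1) * g2 x)"
 have dm: "d : bmeas borel" unfolding d_def by (intro borel_measurable_add borel_measurable_times borel_measurable_const g1(1) g2(1))
 have de: "\<bar>d x\<bar> <= e" if "x : {a<..<b}" for x using e(1)[OF that] by (simp add: d_def)
 have "kmean J h t d = 1 * kmean J h t g1 + (- 1) * kmean J h t g2" unfolding d_def by (rule killed_mean_add[OF g1 g2])
 then have "\<bar>kmean J h t g1 - kmean J h t g2\<bar> = \<bar>kmean J h t d\<bar>" by simp
 also have "... <= (\<integral>w. \<bar>weight J h w * kext A zt d (stopped A w t)\<bar> \<partial>N)" unfolding kmean_def by (rule integral_abs_bound)
 also have "... <= e"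
 proof (rule integral_le_const)
  show "integrable N (%w. \<bar>weight J h w * kext A zt d (stopped A w t)\<bar>)" by (intro integrable_abs integrable_killed_mean[OF dm de])
  show "AE w in N. \<bar>weight J h w * kext A zt d (stopped A w t)\<bar> <= e"
  proof (rule AE_I2)
   fix w assume w: "w : space N"
   have "\<bar>weight J h w\<bar> * \<bar>kext A zt d (stopped A w t)\<bar> <= 1 * e" using weight_bounds[of J h w, OF h] killed_ext_le[OF de w e(2)] by (intro mult_mono) auto
   then show "\<bar>weight J h w * kext A zt d (stopped A w t)\<bar> <= e" by (simp add: abs_mult)
  qed
 qed
 finally show ?thesis .
qed

end

lemma killed_mean_empty: "kmean {} h 0 (sinem a b n) = sinem a b n z"
proof -
 have "kmean {} h 0 (sinem a b n) = (\<integral>w. sinem a b n z \<partial>N)" unfolding kmean_def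
 proof (rule integral_cong_AE)
  have "sinem a b n : bmeas borel" unfolding sinem_def[abs_def] by measurable
  then show "(%w. weight {} h w * kext A zt (sinem a b n) (stopped A w 0)) : bmeas N" using measurable_stopped_ext[of "sinem a b n" 0] by (simp add: weight_def)
  show "AE w in N. weight {} h w * kext A zt (sinem a b n) (stopped A w 0) = sinem a b n z" using start by eventually_elim (simp add: weight_def kext_def)
 qed simp
 then show ?thesis by (simp add: prob_space)
qed

text \<open>The integrand vanishes unless the path has survived up to \<open>s\<close>, and then the
  stopped path at \<open>s\<close> is the path itself; the factor at time \<open>s\<close> therefore
  acts on the same value as \<open>g\<close>.\<close>

lemma killed_mean_insert:
 assumes "finite J" "s ~: J" "0 <= s"
 shows "kmean (insert s J) h s g = kmean J h s (%x. h s x * g x)" unfolding kmean_def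
proof (intro integral_congr refl)
 fix w assume w: "w : space N"
 have cl: "closed {u. 0 <= u & w u : A}" by (rule closed_hits[OF _ A]) (use w in \<open>simp add: space_N\<close>)
 show "weight (insert s J) h w * kext A zt g (stopped A w s) = weight J h w * kext A zt (%x. h s x * g x) (stopped A w s)"
 proof (cases "stopped A w s : A")
  case False
  then have "w u ~: A" if "0 <= u" "u < s" for u using stopped_in_iff[OF cl assms(3)] that by auto
  then have "stopped A w s = w s" by (rule stopped_stay[OF _ assms(3)])
  with False assms show ?thesis by (simp add: weight_def kext_def)
 qed (simp add: kext_def)
qed

lemma killed_mean_eigen:
 assumes J: "J <= {0..s}" "!!u. u : J ==> utest a b (h u)" and st: "0 <= s" "s <= t"
 shows "kmean J h t (sinem a b n) = exp (- ((real n * pi / (b - a))^2 / 2) * (t - s)) * kmean J h s (sinem a b n)" unfolding kmean_def by (rule eigen[OF st], rule measurable_weight[OF J(1)], erule J(2), rule weight_bounds, erule J(2))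

end

lemma abs_sinem_le: "\<bar>sinem a b n x\<bar> <= 1" by (simp add: sinem_def)

locale killed_pair = N: kproc N S A zt a b z + M: kproc M S' A' zt' a b z
 for N :: "(real => 'a::metric_space) measure" and S A zt and M :: "(real => 'b::metric_space) measure" and S' A' zt' and a b z :: real
begin

text \<open>Equality for sines spreads by linearity to sines times powers of the cosine, then by
  uniform approximation to test functions, since the weights are bounded by 1.\<close>

lemma killed_mean_extend:
 assumes J: "J <= {0..t}" "!!u. u : J ==> utest a b (h u)" and t: "0 <= t"
  and modes: "!!n. N.kmean J h t (sinem a b n) = M.kmean J h t (sinem a b n)"
  and g: "testf a b g"
 shows "N.kmean J h t g = M.kmean J h t g"
proof -
 define ta where "ta x = pi * (x - a) / (b - a)" for x
 \<comment> \<open>The induction on \<open>k\<close> has to carry all \<open>n\<close>: one more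
   cosine replaces the frequency \<open>n\<close> by the mean of the frequencies
   \<open>n + 1\<close> and \<open>n - 1\<close>.\<close>
 define sc where "sc n k x = sin (real n * ta x) * cos (ta x) ^ k" for n k :: nat and x
 have scm: "sc n k : bmeas borel" for n k unfolding sc_def[abs_def] ta_def by measurable
 have scb: "\<bar>sc n k x\<bar> <= 1" for n k x
 proof -
  have "\<bar>cos (ta x)\<bar> ^ k <= 1" by (intro power_le_one) auto
  then have "\<bar>sin (real n * ta x)\<bar> * \<bar>cos (ta x)\<bar> ^ k <= 1 * 1" by (intro mult_mono) auto
  then show ?thesis by (simp add: sc_def abs_mult power_abs)
 qed
 have sc: "N.kmean J h t (sc n k) = M.kmean J h t (sc n k)" for n k
 proof (induction k arbitrary: n)
  case 0
  have "sc n 0 = sinem a b n" by (auto simp: sc_def sinem_def ta_def fun_eq_iff)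
  then show ?case by (simp add: modes)
 next
  case (Suc k)
  show ?case
  proof (cases n)
   case 0
   have "sc 0 (Suc k) = (%x. 0 * sc 0 k x + 0 * sc 0 k x)" by (simp add: sc_def fun_eq_iff)
   then show ?thesis unfolding 0 by (simp only: N.killed_mean_add[OF J t scm scb scm scb] M.killed_mean_add[OF J t scm scb scm scb])
  next
   case (Suc m)
   have "sc (Suc m) (Suc k) = (%x. (1/2) * sc (Suc (Suc m)) k x + (1/2) * sc m k x)"
   proof
    fix x
    have "sin (real (Suc (Suc m)) * ta x) + sin (real m * ta x) = 2 * sin (real (Suc m) * ta x) * cos (ta x)"
    proof -
     have "real (Suc (Suc m)) * ta x = real (Suc m) * ta x + ta x" "real m * ta x = real (Suc m) * ta x - ta x" by (auto simp: algebra_simps)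
     then show ?thesis by (simp only: sin_add sin_diff)
    qed
    then have "sin (real (Suc m) * ta x) * cos (ta x) = (1/2) * sin (real (Suc (Suc m)) * ta x) + (1/2) * sin (real m * ta x)" by simp
    then show "sc (Suc m) (Suc k) x = (1/2) * sc (Suc (Suc m)) k x + (1/2) * sc m k x" unfolding sc_def power_Suc by (simp only: mult.assoc[symmetric] distrib_right)
   qed
   then show ?thesis unfolding Suc by (simp only: N.killed_mean_add[OF J t scm scb scm scb] M.killed_mean_add[OF J t scm scb scm scb] Suc.IH)
  qed
 qed
 have poly: "N.kmean J h t (%x. \<Sum>i\<le>m. c i * sc 1 i x) = M.kmean J h t (%x. \<Sum>i\<le>m. c i * sc 1 i x)
   & (%x. \<Sum>i\<le>m. c i * sc 1 i x) : bmeas borel & (\<forall>x. \<bar>\<Sum>i\<le>m. c i * sc 1 i x\<bar> <= (\<Sum>i\<le>m. \<bar>c i\<bar>))" for m :: nat and c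
 proof (induction m)
  case 0
  have "(%x. \<Sum>i\<le>0. c i * sc 1 i x) = (%x. c 0 * sc 1 0 x + 0 * sc 1 0 x)" by (simp add: fun_eq_iff)
  moreover have "\<bar>c 0 * sc 1 0 x\<bar> <= \<bar>c 0\<bar>" for x using mult_left_mono[OF scb[of 1 0 x], of "\<bar>c 0\<bar>"] by (simp add: abs_mult)
  ultimately show ?case using scm[of 1 0] by (simp only: N.killed_mean_add[OF J t scm scb scm scb] M.killed_mean_add[OF J t scm scb scm scb] sc) simp
 next
  case (Suc m)
  let ?p = "%x. \<Sum>i\<le>m. c i * sc 1 i x"
  from Suc have pm: "?p : bmeas borel" and pb: "!!x. \<bar>?p x\<bar> <= (\<Sum>i\<le>m. \<bar>c i\<bar>)" and pe: "N.kmean J h t ?p = M.kmean J h t ?p" by auto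
  have eq: "(%x. \<Sum>i\<le>Suc m. c i * sc 1 i x) = (%x. 1 * ?p x + c (Suc m) * sc 1 (Suc m) x)" by (simp add: fun_eq_iff)
  have m: "(%x. \<Sum>i\<le>Suc m. c i * sc 1 i x) : bmeas borel" by (intro borel_measurable_sum borel_measurable_times borel_measurable_const scm)
  have b: "\<bar>\<Sum>i\<le>Suc m. c i * sc 1 i x\<bar> <= (\<Sum>i\<le>Suc m. \<bar>c i\<bar>)" for x
  proof (rule order_trans[OF sum_abs sum_mono])
   show "\<bar>c i * sc 1 i x\<bar> <= \<bar>c i\<bar>" for i using mult_left_mono[OF scb[of 1 i x], of "\<bar>c i\<bar>"] by (simp add: abs_mult)
  qed
  have "N.kmean J h t (%x. \<Sum>i\<le>Suc m. c i * sc 1 i x) = M.kmean J h t (%x. \<Sum>i\<le>Suc m. c i * sc 1 i x)" unfolding eq by (simp only: N.killed_mean_add[OF J t pm pb scm scb] M.killed_mean_add[OF J t pm pb scm scb] sc pe)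
  with m b show ?case by blast
 qed
 obtain cg where cg: "!!x. \<bar>g x\<bar> <= cg" using test_fun_bounded[OF g] by blast
 have "\<bar>N.kmean J h t g - M.kmean J h t g\<bar> <= e" if e: "0 < e" for e
 proof -
  have "0 < e / 2" using e by simp
  from test_fun_sine_polynomial[OF g N.ab this] obtain c m where
   "!!x. x : {a..b} ==> \<bar>g x - (\<Sum>i\<le>m::nat. c i * (sin (pi * (x - a) / (b - a)) * cos (pi * (x - a) / (b - a)) ^ i))\<bar> <= e / 2" by blast
  then have ap: "\<bar>g x - (\<Sum>i\<le>m. c i * sc 1 i x)\<bar> <= e / 2" if "x : {a<..<b}" for x using that by (simp add: sc_def ta_def)
  let ?p = "%x. \<Sum>i\<le>m. c i * sc 1 i x"
  from poly[of c m] have pm: "?p : bmeas borel" and pb: "!!x. \<bar>?p x\<bar> <= (\<Sum>i\<le>m. \<bar>c i\<bar>)" and pe: "N.kmean J h t ?p = M.kmean J h t ?p" by auto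
  have "\<bar>N.kmean J h t g - N.kmean J h t ?p\<bar> <= e / 2" by (rule N.killed_mean_diff_le[OF J t test_fun_measurable[OF g] cg pm pb ap]) (use e in auto)
  moreover have "\<bar>M.kmean J h t g - M.kmean J h t ?p\<bar> <= e / 2" by (rule M.killed_mean_diff_le[OF J t test_fun_measurable[OF g] cg pm pb ap]) (use e in auto)
  ultimately show ?thesis using pe by linarith
 qed
 then have "\<bar>N.kmean J h t g - M.kmean J h t g\<bar> <= 0" by (rule field_le_epsilon) auto
 then show ?thesis by simp
qed

text \<open>Induction on the times, the latest one \<open>s\<close> being added last. The eigenvalue
  relation moves the horizon from \<open>t\<close> down to \<open>s\<close>; there the factor
  \<open>h s\<close> joins the sine and makes it a test function, to which the induction hypothesis
  applies.\<close>

theorem kmean_eq: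
 assumes "finite J" "J <= {0..t}" "!!u. u : J ==> utest a b (h u)" "0 <= t" "testf a b g"
 shows "N.kmean J h t g = M.kmean J h t g" using assms
proof (induction J arbitrary: t g rule: finite_linorder_max_induct)
 case empty
 show ?case
 proof (rule killed_mean_extend)
  fix n
  show "N.kmean {} h t (sinem a b n) = M.kmean {} h t (sinem a b n)" using N.killed_mean_eigen[of "{}" 0 h t n] M.killed_mean_eigen[of "{}" 0 h t n] empty by (simp add: N.killed_mean_empty M.killed_mean_empty)
 qed (use empty in auto)
next
 case (insert s J)
 have s: "0 <= s" "s <= t" "s ~: J" using insert by auto
 have Js: "J <= {0..s}"
 proof
  fix x assume "x : J"
  then show "x : {0..s}" using insert.hyps(2) insert.prems(1) by (auto simp: less_imp_le)
 qed
 then have Js2: "insert s J <= {0..s}" using s by simp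
 show ?case
 proof (rule killed_mean_extend)
  fix n
  have "testf a b (h s)" using insert.prems(2)[of s] by (simp add: utest_def)
  then have "testf a b (%x. h s x * sinem a b n x)" unfolding sinem_def using N.ab by (intro test_fun_mult) (auto intro!: continuous_intros)
  then have "N.kmean J h s (%x. h s x * sinem a b n x) = M.kmean J h s (%x. h s x * sinem a b n x)" using insert.prems(2) by (intro insert.IH Js s) auto
  then have "N.kmean (insert s J) h s (sinem a b n) = M.kmean (insert s J) h s (sinem a b n)" by (simp only: N.killed_mean_insert[OF insert.hyps(1) s(3,1)] M.killed_mean_insert[OF insert.hyps(1) s(3,1)])
  then show "N.kmean (insert s J) h t (sinem a b n) = M.kmean (insert s J) h t (sinem a b n)" using N.killed_mean_eigen[where n=n and h=h, OF Js2 insert.prems(2) s(1,2)]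
    M.killed_mean_eigen[where n=n and h=h, OF Js2 insert.prems(2) s(1,2)] by simp
 qed (use insert.prems in auto)
qed

end

text \<open>Subtracting 1 keeps the support at distance at least \<open>1 / m\<close> from the
  complement, as \<open>testf\<close> demands. In the limit \<open>bump\<close> becomes the
  indicator of \<open>U Int {a<..<b}\<close>.\<close>

definition bump :: "real => real => real set => nat => real => real" where
 "bump a b U m x = min 1 (max 0 (real m * infdist x (- (U Int {a<..<b})) - 1))"

lemma utest_bump: "utest a b (bump a b U m)"
proof -
 have supp: "a + 1 / real m <= x & x <= b - 1 / real m & m ~= 0" if "bump a b U m x ~= 0" for x
 proof -
  let ?d = "infdist x (- (U Int {a<..<b}))"
  have 1: "1 < real m * ?d" using that by (auto simp: bump_def min_def max_def split: if_splits)
  then have m: "0 < m" by (cases m) auto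
  have d: "1 / real m <= ?d" using 1 m by (simp add: field_simps)
  have "0 < 1 / real m" using m by simp
  with d have "?d ~= 0" by linarith
  then have "x : {a<..<b}" using infdist_zero[of x "- (U Int {a<..<b})"] by blast
  moreover have "?d <= dist x a" "?d <= dist x b" by (auto intro!: infdist_le)
  ultimately show ?thesis using d m by (auto simp: dist_real_def)
 qed
 have "continuous_on UNIV (bump a b U m)" unfolding bump_def[abs_def] by (intro continuous_intros)
 moreover have "\<exists>dl>0. \<forall>x. bump a b U m x ~= 0 --> a + dl <= x & x <= b - dl"
 proof (cases "m = 0")
  case True
  then show ?thesis using supp by (intro exI[of _ 1]) auto
 next
  case False
  then show ?thesis using supp by (intro exI[of _ "1 / real m"]) auto
 qed
 ultimately show ?thesis by (simp add: utest_def testf_def bump_def)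
qed

lemma bump_lim:
 assumes "open U"
 shows "(%m. bump a b U m x) \<longlonglongrightarrow> indicator (U Int {a<..<b}) x"
proof (cases "x : U Int {a<..<b}")
 case True
 let ?d = "infdist x (- (U Int {a<..<b}))"
 have "closed (- (U Int {a<..<b}))" using assms by (intro closed_Compl open_Int) auto
 moreover have "- (U Int {a<..<b}) ~= {}" by auto
 ultimately have "?d ~= 0" using True in_closed_iff_infdist_zero by blast
 then have d: "0 < ?d" using infdist_nonneg[of x "- (U Int {a<..<b})"] by linarith
 obtain k :: nat where k: "2 / ?d <= real k" using real_arch_simple by blast
 have "bump a b U m x = 1" if "k <= m" for m
 proof -
  have "2 / ?d <= real m" using k that by linarith
  then have "2 <= real m * ?d" using d by (simp add: field_simps)
  then show ?thesis by (simp add: bump_def)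
 qed
 then have "\<forall>\<^sub>F m in sequentially. bump a b U m x = indicator (U Int {a<..<b}) x" using True by (auto simp: eventually_sequentially intro!: exI[of _ k])
 then show ?thesis by (rule tendsto_eventually)
next
 case False
 then have "infdist x (- (U Int {a<..<b})) = 0" by (intro infdist_zero) auto
 then show ?thesis using False by (simp add: bump_def)
qed

lemma bump_bounds: "0 <= bump a b U m x" "bump a b U m x <= 1" by (auto simp: bump_def)

lemma bump_measurable: "bump a b U m : bmeas borel" using utest_bump[of a b U m] test_fun_measurable unfolding utest_def by blast

lemma open_determined_by_tests:
 fixes N :: "'a measure"
 assumes "prob_space N" and X: "X : bmeas N" and Y: "Y : bmeas N"
  and X01: "!!w. w : space N ==> 0 <= X w & X w <= (1::real)"
  and XY: "!!w. w : space N ==> X w ~= 0 ==> Y w : {a<..<b}" and U: "open U"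
 shows "(%m. \<integral>w. X w * bump a b U m (Y w) \<partial>N) \<longlonglongrightarrow> (\<integral>w. X w * indicator U (Y w) \<partial>N)"
proof -
 interpret prob_space N by fact
 have [measurable]: "U : sets borel" using U by simp
 note [measurable] = X Y bump_measurable
 show ?thesis
 proof (rule integral_dominated_convergence[where w="%_. 1"])
  show "(%w. X w * indicator U (Y w)) : bmeas N" by measurable
  show "(%w. X w * bump a b U m (Y w)) : bmeas N" for m by (intro borel_measurable_times X measurable_compose[OF Y bump_measurable])
  show "AE w in N. (%m. X w * bump a b U m (Y w)) \<longlonglongrightarrow> X w * indicator U (Y w)"
  proof (rule AE_I2)
   fix w assume w: "w : space N"
   have "(%m. X w * bump a b U m (Y w)) \<longlonglongrightarrow> X w * indicator (U Int {a<..<b}) (Y w)" by (intro tendsto_intros bump_lim U)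
   moreover have "X w * indicator (U Int {a<..<b}) (Y w) = X w * indicator U (Y w)" using XY[OF w] by (cases "X w = 0") (auto simp: indicator_def)
   ultimately show "(%m. X w * bump a b U m (Y w)) \<longlonglongrightarrow> X w * indicator U (Y w)" by simp
  qed
  show "AE w in N. norm (X w * bump a b U m (Y w)) <= 1" for m
  proof (rule AE_I2)
   fix w assume w: "w : space N"
   have "X w * bump a b U m (Y w) <= 1 * 1" using X01[OF w] bump_bounds by (intro mult_mono) auto
   then show "norm (X w * bump a b U m (Y w)) <= 1" using X01[OF w] bump_bounds[of a b U m "Y w"] by simp
  qed
 qed simp
qed

lemma emeasure_weighted_distr:
 fixes N :: "'a measure"
 assumes "prob_space N" and X: "X : bmeas N" and Y: "Y : N ->> L"
  and X01: "!!w. w : space N ==> 0 <= X w & X w <= (1::real)" and B: "B : sets L"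
 shows "emeasure (distr (density N (%w. ennreal (X w))) L Y) B = ennreal (\<integral>w. X w * indicator B (Y w) \<partial>N)"
proof -
 interpret prob_space N by fact
 have "emeasure (distr (density N (%w. ennreal (X w))) L Y) B = emeasure (density N (%w. ennreal (X w))) (Y -` B Int space N)" using Y B by (subst emeasure_distr) auto
 also have "... = (\<integral>\<^sup>+w. ennreal (X w) * indicator (Y -` B Int space N) w \<partial>N)" using measurable_sets[OF Y B] X by (intro emeasure_density) auto
 also have "... = (\<integral>\<^sup>+w. ennreal (X w * indicator B (Y w)) \<partial>N)" using X01 by (intro nn_integral_cong) (auto simp: indicator_def)
 also have "... = ennreal (\<integral>w. X w * indicator B (Y w) \<partial>N)"
 proof (rule nn_integral_eq_integral)
  show "integrable N (%w. X w * indicator B (Y w))"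
  proof (rule integrable_const_bound[where B=1])
   show "AE w in N. norm (X w * indicator B (Y w)) <= 1" using X01 by (intro AE_I2) (auto simp: indicator_def)
   show "(%w. X w * indicator B (Y w)) : bmeas N" by (intro borel_measurable_times X measurable_compose[OF Y borel_measurable_indicator[OF B]])
  qed
  show "AE w in N. 0 <= X w * indicator B (Y w)" using X01 by (intro AE_I2) (auto simp: indicator_def)
 qed
 finally show ?thesis .
qed

text \<open>Bumps converge to indicators of open sets, an intersection-stable generator. No mass is
  lost at the ends of the interval, because the weights vanish unless the variable lies inside
  it.\<close>

lemma determined_by_tests:
 fixes N :: "'a measure" and M :: "'b measure"
 assumes N: "prob_space N" and X: "X : bmeas N" and Y: "Y : bmeas N"
  and X01: "!!w. w : space N ==> 0 <= X w & X w <= (1::real)"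
  and XY: "!!w. w : space N ==> X w ~= 0 ==> Y w : {a<..<b}"
  and M: "prob_space M" and X': "X' : bmeas M" and Y': "Y' : bmeas M"
  and X01': "!!w. w : space M ==> 0 <= X' w & X' w <= (1::real)"
  and XY': "!!w. w : space M ==> X' w ~= 0 ==> Y' w : {a<..<b}"
  and eq: "!!h. utest a b h ==> (\<integral>w. X w * h (Y w) \<partial>N) = (\<integral>w. X' w * h (Y' w) \<partial>M)"
  and B: "B : sets borel"
 shows "(\<integral>w. X w * indicator B (Y w) \<partial>N) = (\<integral>w. X' w * indicator B (Y' w) \<partial>M)"
proof -
 have op: "(\<integral>w. X w * indicator U (Y w) \<partial>N) = (\<integral>w. X' w * indicator U (Y' w) \<partial>M)" if U: "open U" for U
 proof (rule LIMSEQ_unique)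
  show "(%m. \<integral>w. X w * bump a b U m (Y w) \<partial>N) \<longlonglongrightarrow> (\<integral>w. X w * indicator U (Y w) \<partial>N)" by (rule open_determined_by_tests[OF N X Y X01 XY U])
  show "(%m. \<integral>w. X w * bump a b U m (Y w) \<partial>N) \<longlonglongrightarrow> (\<integral>w. X' w * indicator U (Y' w) \<partial>M)" unfolding eq[OF utest_bump] by (rule open_determined_by_tests[OF M X' Y' X01' XY' U])
 qed
 let ?D = "distr (density N (%w. ennreal (X w))) borel Y" and ?D' = "distr (density M (%w. ennreal (X' w))) borel Y'"
 have eD: "emeasure ?D C = ennreal (\<integral>w. X w * indicator C (Y w) \<partial>N)" if "C : sets borel" for C by (rule emeasure_weighted_distr[OF N X Y X01 that])
 have eD': "emeasure ?D' C = ennreal (\<integral>w. X' w * indicator C (Y' w) \<partial>M)" if "C : sets borel" for C by (rule emeasure_weighted_distr[OF M X' Y' X01' that])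
 have "?D = ?D'"
 proof (rule measure_eqI_generator_eq[where E="{U. open U}" and \<Omega>=UNIV and A="%_. UNIV"])
  show "Int_stable {U::real set. open U}" by (auto intro!: Int_stableI)
  show "sets ?D = sigma_sets UNIV {U. open U}" "sets ?D' = sigma_sets UNIV {U. open U}" by (auto simp: borel_def)
  show "emeasure ?D U = emeasure ?D' U" if "U : {U. open U}" for U using that by (simp add: eD eD' op)
  show "emeasure ?D UNIV ~= \<infinity>" by (simp add: eD)
 qed auto
 then have "ennreal (\<integral>w. X w * indicator B (Y w) \<partial>N) = ennreal (\<integral>w. X' w * indicator B (Y' w) \<partial>M)" using eD[OF B] eD'[OF B] by simp
 moreover have "0 <= (\<integral>w. X w * indicator B (Y w) \<partial>N)" using X01 by (intro Bochner_Integration.integral_nonneg_AE AE_I2) (simp add: indicator_def)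
 moreover have "0 <= (\<integral>w. X' w * indicator B (Y' w) \<partial>M)" using X01' by (intro Bochner_Integration.integral_nonneg_AE AE_I2) (simp add: indicator_def)
 ultimately show ?thesis by simp
qed

text \<open>Test functions are exchanged for Borel indicators one coordinate at a time, all other
  factors being absorbed into the weight. Cylinder sets then determine the two finite measures on
  the product.\<close>

lemma killed_law_eqI:
 fixes N :: "'a measure" and M :: "'b measure" and I :: "'i set"
 assumes N: "prob_space N" and K: "K : bmeas N" and Y: "!!u. u : I ==> Y u : bmeas N"
  and K01: "!!w. w : space N ==> 0 <= K w & K w <= (1::real)"
  and KY: "!!w u. w : space N ==> u : I ==> K w ~= 0 ==> Y u w : {a<..<b}"
  and M: "prob_space M" and K': "K' : bmeas M" and Y': "!!u. u : I ==> Y' u : bmeas M"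
  and K01': "!!w. w : space M ==> 0 <= K' w & K' w <= (1::real)"
  and KY': "!!w u. w : space M ==> u : I ==> K' w ~= 0 ==> Y' u w : {a<..<b}"
  and eq: "!!J h. finite J ==> J <= I ==> (!!u. u : J ==> utest a b (h u)) ==>
   (\<integral>w. K w * (\<Prod>u\<in>J. h u (Y u w)) \<partial>N) = (\<integral>w. K' w * (\<Prod>u\<in>J. h u (Y' u w)) \<partial>M)"
 shows "distr (density N (%w. ennreal (K w))) (Pi\<^sub>M I (%_. borel)) (%w. \<lambda>u\<in>I. Y u w)
    = distr (density M (%w. ennreal (K' w))) (Pi\<^sub>M I (%_. borel)) (%w. \<lambda>u\<in>I. Y' u w)"
proof -
 have step: "(\<integral>w. K w * (\<Prod>u\<in>J1. indicator (B u) (Y u w)) * (\<Prod>u\<in>J2. h u (Y u w)) \<partial>N)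
   = (\<integral>w. K' w * (\<Prod>u\<in>J1. indicator (B u) (Y' u w)) * (\<Prod>u\<in>J2. h u (Y' u w)) \<partial>M)"
  if "finite J1" "finite J2" "J1 <= I" "J2 <= I" "J1 Int J2 = {}" "!!u. u : J1 ==> B u : sets borel"
   "!!u. u : J2 ==> utest a b (h u)" for J1 J2 h and B :: "'i => real set" using that
 proof (induction J1 arbitrary: J2 h rule: finite_induct)
  case empty
  then show ?case using eq[of J2 h] by simp
 next
  case (insert v J1)
  define X where "X w = K w * (\<Prod>u\<in>J1. indicator (B u) (Y u w)) * (\<Prod>u\<in>J2. h u (Y u w))" for w
  define X' where "X' w = K' w * (\<Prod>u\<in>J1. indicator (B u) (Y' u w)) * (\<Prod>u\<in>J2. h u (Y' u w))" for w
  have hm: "h u : bmeas borel" if "u : J2" for u using insert.prems(6)[OF that] test_fun_measurable unfolding utest_def by blast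
  have h01: "0 <= h u x & h u x <= 1" if "u : J2" for u x using insert.prems(6)[OF that] by (simp add: utest_def)
  have v: "v : I" using insert.prems by auto
  have Bm: "B u : sets borel" if "u : J1" for u using insert.prems(5) that by simp
  have sub: "u : I" if "u : J1" for u using insert.prems(2) that by auto
  have sub2: "u : I" if "u : J2" for u using insert.prems(3) that by auto
  have Xm: "X : bmeas N" unfolding X_def[abs_def] by (intro borel_measurable_times borel_measurable_prod K measurable_compose[OF Y borel_measurable_indicator] measurable_compose[OF Y hm])
     (use Bm sub sub2 in simp_all)
  have Xm': "X' : bmeas M" unfolding X'_def[abs_def] by (intro borel_measurable_times borel_measurable_prod K' measurable_compose[OF Y' borel_measurable_indicator] measurable_compose[OF Y' hm])
     (use Bm sub sub2 in simp_all)
  have prod01: "0 <= k * p * q & k * p * q <= 1" if "0 <= k & k <= 1" "0 <= p & p <= 1" "0 <= q & q <= 1" for k p q :: real using that by (auto intro!: mult_nonneg_nonneg mult_le_one)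
  have i01: "0 <= (\<Prod>u\<in>J1. indicator (B u) (f u) :: real) & (\<Prod>u\<in>J1. indicator (B u) (f u) :: real) <= 1" for f by (auto simp: indicator_def intro!: prod_nonneg prod_le_1)
  have hh01: "0 <= (\<Prod>u\<in>J2. h u (f u)) & (\<Prod>u\<in>J2. h u (f u)) <= 1" for f using h01 by (auto intro!: prod_nonneg prod_le_1)
  have X01: "0 <= X w & X w <= 1" if "w : space N" for w unfolding X_def by (rule prod01[OF K01[OF that] i01 hh01])
  have X01': "0 <= X' w & X' w <= 1" if "w : space M" for w unfolding X'_def by (rule prod01[OF K01'[OF that] i01 hh01])
  have XY: "Y v w : {a<..<b}" if "w : space N" "X w ~= 0" for w using KY[OF that(1) v] that(2) by (auto simp: X_def)
  have XY': "Y' v w : {a<..<b}" if "w : space M" "X' w ~= 0" for w using KY'[OF that(1) v] that(2) by (auto simp: X'_def)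
  have test: "(\<integral>w. X w * g (Y v w) \<partial>N) = (\<integral>w. X' w * g (Y' v w) \<partial>M)" if g: "utest a b g" for g
  proof -
   define h' where "h' = h(v := g)"
   have vJ2: "v ~: J2" using insert.prems(4) by auto
   have P: "(\<Prod>u\<in>insert v J2. h' u (f u)) = g (f v) * (\<Prod>u\<in>J2. h u (f u))" for f :: "'i => real"
   proof -
    have "(\<Prod>u\<in>J2. h' u (f u)) = (\<Prod>u\<in>J2. h u (f u))" by (intro prod.cong refl) (use vJ2 in \<open>auto simp: h'_def\<close>)
    then show ?thesis using vJ2 insert.prems(1) by (simp add: h'_def)
   qed
   have "(\<integral>w. K w * (\<Prod>u\<in>J1. indicator (B u) (Y u w)) * (\<Prod>u\<in>insert v J2. h' u (Y u w)) \<partial>N)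
     = (\<integral>w. K' w * (\<Prod>u\<in>J1. indicator (B u) (Y' u w)) * (\<Prod>u\<in>insert v J2. h' u (Y' u w)) \<partial>M)"
   proof (rule insert.IH)
    show "utest a b (h' u)" if "u : insert v J2" for u using that g insert.prems(6)[of u] by (auto simp: h'_def)
   qed (use insert.prems insert.hyps v Bm in auto)
   then show ?thesis unfolding P X_def X'_def by (simp only: mult.assoc mult.left_commute mult.commute)
  qed
  have "B v : sets borel" using insert.prems(5) by simp
  from determined_by_tests[OF N Xm Y[OF v] X01 XY M Xm' Y'[OF v] X01' XY' test this]
  have "(\<integral>w. X w * indicator (B v) (Y v w) \<partial>N) = (\<integral>w. X' w * indicator (B v) (Y' v w) \<partial>M)" .
  then show ?case unfolding X_def X'_def using insert.hyps by (simp add: mult.assoc mult.left_commute mult.commute)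
 qed
 have Ym: "(%w. \<lambda>u\<in>I. Y u w) : N ->> Pi\<^sub>M I (%_. borel)" by (rule measurable_restrict[OF Y])
 have Ym': "(%w. \<lambda>u\<in>I. Y' u w) : M ->> Pi\<^sub>M I (%_. borel)" by (rule measurable_restrict[OF Y'])
 show ?thesis
 proof (rule measure_eqI_PiM_infinite)
  fix B :: "'i => real set" and J assume J: "finite J" "J <= I" and B: "!!i. i : J ==> B i : sets borel"
  let ?E = "prod_emb I (%_. borel :: real measure) J (Pi\<^sub>E J B)"
  have E: "?E : sets (Pi\<^sub>M I (%_. borel))" by (rule sets_PiM_I[OF J]) (use B in blast)
  have ind: "indicator ?E (\<lambda>u\<in>I. f u) = (\<Prod>u\<in>J. indicator (B u) (f u) :: real)" for f
  proof -
   have "restrict (restrict f I) J = restrict f J" using J(2) by (simp add: restrict_restrict Int_absorb1)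
   then have "(\<lambda>u\<in>I. f u) : ?E \<longleftrightarrow> (ALL u:J. f u : B u)" unfolding prod_emb_iff by (simp add: restrict_PiE_iff Pi_iff)
   then show ?thesis using J(1) by (auto simp: indicator_def)
  qed
  show "emeasure (distr (density N (%w. ennreal (K w))) (Pi\<^sub>M I (%_. borel)) (%w. \<lambda>u\<in>I. Y u w)) ?E
    = emeasure (distr (density M (%w. ennreal (K' w))) (Pi\<^sub>M I (%_. borel)) (%w. \<lambda>u\<in>I. Y' u w)) ?E"
  proof -
   have e1: "emeasure (distr (density N (%w. ennreal (K w))) (Pi\<^sub>M I (%_. borel)) (%w. \<lambda>u\<in>I. Y u w)) ?E
     = ennreal (\<integral>w. K w * indicator ?E (\<lambda>u\<in>I. Y u w) \<partial>N)" by (rule emeasure_weighted_distr[OF N K Ym K01 E])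
   have e2: "emeasure (distr (density M (%w. ennreal (K' w))) (Pi\<^sub>M I (%_. borel)) (%w. \<lambda>u\<in>I. Y' u w)) ?E
     = ennreal (\<integral>w. K' w * indicator ?E (\<lambda>u\<in>I. Y' u w) \<partial>M)" by (rule emeasure_weighted_distr[OF M K' Ym' K01' E])
   show ?thesis unfolding e1 e2 ind using step[of J "{}" B "%_ _. 0"] J B by simp
  qed
 next
  show "finite_measure (distr (density N (%w. ennreal (K w))) (Pi\<^sub>M I (%_. borel)) (%w. \<lambda>u\<in>I. Y u w))"
  proof (rule finite_measureI)
   show "emeasure (distr (density N (%w. ennreal (K w))) (Pi\<^sub>M I (%_. borel)) (%w. \<lambda>u\<in>I. Y u w))
     (space (distr (density N (%w. ennreal (K w))) (Pi\<^sub>M I (%_. borel)) (%w. \<lambda>u\<in>I. Y u w))) ~= \<infinity>"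
   proof -
    have "emeasure (distr (density N (%w. ennreal (K w))) (Pi\<^sub>M I (%_. borel)) (%w. \<lambda>u\<in>I. Y u w)) (space (Pi\<^sub>M I (%_. borel)))
      = ennreal (\<integral>w. K w * indicator (space (Pi\<^sub>M I (%_. borel))) (\<lambda>u\<in>I. Y u w) \<partial>N)" by (rule emeasure_weighted_distr[OF N K Ym K01 sets.top])
    then show ?thesis by simp
   qed
  qed
 qed simp_all
qed

subsection \<open>Arcs on which the process is Brownian away from finitely many points\<close>

text \<open>Mean value theorem: on \<open>[1/4, 1/2]\<close> the sine is at least
  \<open>sin (1 / 4)\<close>. This is the linear gain behind \<open>gap_decay\<close>.\<close>

lemma cos_half_gap:
 fixes x :: real
 assumes "0 < x" "x <= 1 / 4"
 shows "sin (1 / 4) * x <= cos (1 / 2 - x) - cos (1 / 2)"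
proof -
 have "\<exists>xi>1 / 2 - x. xi < 1 / 2 & cos (1 / 2) - cos (1 / 2 - x) = (1 / 2 - (1 / 2 - x)) * (- sin xi)" by (rule MVT2) (use assms in \<open>auto intro!: derivative_eq_intros\<close>)
 then obtain xi where xi: "1 / 2 - x < xi" "xi < 1 / 2" "cos (1 / 2 - x) - cos (1 / 2) = x * sin xi" by auto
 have "sin (1 / 4) <= sin xi" using xi assms pi_gt3 by (intro sin_monotone_2pi_le) auto
 then show ?thesis using xi(3) assms by (simp add: mult.commute)
qed

text \<open>\<open>io_open\<close> excludes branching: near an interior point of the arc,
  \<open>S\<close> consists of the arc alone. On graphs it forces interior vertices to have degree
  2.\<close>

locale open_arc =
 fixes S :: "'a::metric_space set" and a b :: real and io :: "real => 'a"
 assumes ab: "a < b" and io_cont: "continuous_on {a..b} io" and io_inj: "inj_on io {a..b}" and io_S: "io ` {a..b} <= S"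
  and io_open: "openin (top_of_set S) (io ` {a<..<b})"
begin

lemma io_in: "x : {a..b} ==> io x : S" using io_S by auto

lemma io_mem_iff: "x : {a..b} ==> U <= {a..b} ==> io x : io ` U \<longleftrightarrow> x : U" using inj_on_image_mem_iff[OF io_inj] by auto

text \<open>The complement of a subarc is what lies off the whole open arc, closed by
  \<open>io_open\<close>, together with two compact end pieces.\<close>

lemma closedin_arc:
 assumes "a <= c" "d <= b"
 shows "closedin (top_of_set S) (S Int - io ` {c<..<d})"
proof -
 have cl: "closed (io ` {x..y})" if "{x..y} <= {a..b}" for x y using that by (intro compact_imp_closed compact_continuous_image continuous_on_subset[OF io_cont]) auto
 have "S Int - io ` {c<..<d} = (S - io ` {a<..<b}) Un (S Int (io ` ({a..b} Int {..c}) Un io ` ({a..b} Int {d..})))"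
 proof (intro set_eqI iffI)
  fix y assume y: "y : S Int - io ` {c<..<d}"
  show "y : (S - io ` {a<..<b}) Un (S Int (io ` ({a..b} Int {..c}) Un io ` ({a..b} Int {d..})))"
  proof (cases "y : io ` {a<..<b}")
   case True
   then obtain x where x: "x : {a<..<b}" "y = io x" by blast
   have "x ~: {c<..<d}" using y x(2) by blast
   then have "x : {a..b} Int {..c} | x : {a..b} Int {d..}" using x(1) by auto
   then have "y : io ` ({a..b} Int {..c}) Un io ` ({a..b} Int {d..})" unfolding x(2) by blast
   then show ?thesis using y by blast
  qed (use y in blast)
 next
  fix y assume y: "y : (S - io ` {a<..<b}) Un (S Int (io ` ({a..b} Int {..c}) Un io ` ({a..b} Int {d..})))"
  have sub: "{c<..<d} <= {a..b}" "{c<..<d} <= {a<..<b}" using assms by auto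
  show "y : S Int - io ` {c<..<d}"
  proof (cases "y : io ` {a<..<b}")
   case False
   have yS: "y : S" using y by blast
   have "y ~: io ` {c<..<d}" using False sub(2) by blast
   then show ?thesis using yS by blast
  next
   case True
   with y obtain x where x: "x : {a..b}" "x <= c | d <= x" "y = io x" "y : S" by blast
   have "x ~: {c<..<d}" using x(2) by auto
   then have "y ~: io ` {c<..<d}" using io_mem_iff[OF x(1) sub(1)] x(3) by simp
   then show ?thesis using x(4) by blast
  qed
 qed
 moreover have "closedin (top_of_set S) (S - io ` {a<..<b})" by (rule closedin_diff[OF _ io_open]) simp
 moreover have "closedin (top_of_set S) (S Int (io ` ({a..b} Int {..c}) Un io ` ({a..b} Int {d..})))"
 proof (rule closedin_closed_Int)
  have e: "{a..b} Int {..c} = {a..min b c}" "{a..b} Int {d..} = {max a d..b}" by auto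
  show "closed (io ` ({a..b} Int {..c}) Un io ` ({a..b} Int {d..}))" unfolding e by (intro closed_Un cl) auto
 qed
 ultimately show ?thesis by (simp only: closedin_Un)
qed

lemma exit_arc:
 assumes cd: "a <= c" "c < d" "d <= b" and z: "z : {c<..<d}" and w: "w : space (path_space S)" "w 0 = io z"
  and out: "stopped (- io ` {c<..<d}) w t : - io ` {c<..<d}"
 shows "stopped (- io ` {c<..<d}) w t = io c | stopped (- io ` {c<..<d}) w t = io d"
proof -
 let ?B = "- io ` {c<..<d}"
 have clw: "closed {s. 0 <= s & w s : ?B}" by (rule closed_hits[OF w(1) closedin_arc[OF cd(1,3)]])
 have t0: "0 <= max 0 t" by simp
 define r where "r = hit ?B (max 0 t) w"
 have wr: "stopped ?B w t = w r" by (subst stopped_max) (simp add: stopped_hit r_def)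
 have before: "w s : io ` {c<..<d}" if "0 <= s" "s < r" for s using clw t0
 proof (cases rule: hit_cases)
  case stay
  then have "s : {0..max 0 t}" using that by (simp add: r_def)
  then show ?thesis using stay(1) by blast
 next
  case hit
  show ?thesis using hit(4)[OF that(1)] that(2) by (simp add: r_def)
 qed
 have r: "0 <= r" by (simp add: r_def hit_nonneg)
 have "r ~= 0"
 proof
  assume "r = 0"
  then show False using out z unfolding wr by (simp add: w(2))
 qed
 with r have r: "0 < r" by simp
 have clo: "closure {0..<r} = {0..r}" using closure_atLeastLessThan[OF r] .
 have "w ` closure {0..<r} <= io ` {c..d}"
 proof (rule image_closure_subset)
  show "continuous_on (closure {0..<r}) w" unfolding clo by (rule continuous_on_subset[OF path_cont[OF w(1)]]) auto
  show "closed (io ` {c..d})" using cd by (intro compact_imp_closed compact_continuous_image continuous_on_subset[OF io_cont]) auto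
  show "w ` {0..<r} <= io ` {c..d}"
  proof
   fix y assume "y : w ` {0..<r}"
   then obtain s where "s : {0..<r}" "y = w s" by blast
   then have "y : io ` {c<..<d}" using before[of s] by simp
   then show "y : io ` {c..d}" by auto
  qed
 qed
 then have "w r : io ` {c..d}" unfolding clo using r by (auto simp: image_subset_iff)
 then obtain x where x: "x : {c..d}" "w r = io x" by blast
 with out have "x ~: {c<..<d}" unfolding wr by auto
 with x show ?thesis unfolding wr by (auto simp: less_le)
qed

text \<open>Clamping extends \<open>io\<close> from \<open>[c,d]\<close> to the line. The stopped
  linear motion stays in \<open>[c,d]\<close> when it starts inside, which is only almost sure under
  its law.\<close>

lemma clamp_measurable:
 assumes cd: "a <= c" "c < d" "d <= b" and H: "H : bmeas (rborel S)"
 shows "(%x. H (io (max c (min d x))) :: real) : bmeas (rborel UNIV)"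
proof -
 have "(%x. io (max c (min d x))) : borel ->> rborel S"
 proof (rule measurable_restrict_space2)
  show "(%x. io (max c (min d x))) : space borel \<rightarrow> S" using cd by (auto intro!: io_in)
  have "continuous_on UNIV (%x. io (max c (min d x)))" by (rule continuous_on_compose2[OF io_cont]) (use cd in \<open>auto intro!: continuous_intros\<close>)
  then show "(%x. io (max c (min d x))) : bmeas borel" by (rule borel_measurable_continuous_onI)
 qed
 from measurable_compose[OF this H] show ?thesis by (rule measurable_restrict_space1)
qed

end

text \<open>The interface between graph and analysis. \<open>gap\<close> says that the process is
  linear between points of \<open>V\<close>. \<open>vertex\<close> is Dynkin's formula for a sine on
  the subarc of radius \<open>ep\<close> around \<open>v\<close>, up to an error
  o(\<open>ep\<close>): at this order it expresses that a function without a kink at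
  \<open>v\<close> is admissible.\<close>

locale arc_markov = path_markov S P + open_arc S a b io for S :: "'a::metric_space set" and P a b io +
 fixes V :: "real set" and Q :: "real => (real => real) measure"
 assumes V: "finite V" "V <= {a<..<b}"
  and Q: "!!z. lbm (Q z) z"
  and gap: "!!c d z H C t. a <= c ==> c < d ==> d <= b ==> {c<..<d} Int V = {} ==> z : {c<..<d} ==> 0 <= t ==>
   H : bmeas (rborel S) ==> (!!y. y : S ==> \<bar>H y\<bar> <= (C::real)) ==>
   (\<integral>w. H (stopped (- io ` {c<..<d}) w t) \<partial>P (io z))
   = (\<integral>w. H (io (max c (min d (stopped (- {c<..<d}) w t)))) \<partial>Q z)"
  and vertex: "!!v th gmm F et. v : V ==> 0 < et ==> F : bmeas (rborel S) ==>
   (!!y. y : S ==> \<bar>F y\<bar> <= 1) ==> (!!x. x : {a..b} ==> F (io x) = sin (th * x + gmm)) ==>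
   \<exists>ep0>0. \<forall>ep. 0 < ep & ep < ep0 -->
    \<bar>(\<integral>w. pot (- io ` {v - ep<..<v + ep}) (%y. if y : - io ` {v - ep<..<v + ep} then F y else (1 + th^2 / 2) * F y) w \<partial>P (io v))
     - sin (th * v + gmm)\<bar> <= et * ep"
begin

section \<open>The error of a Dirichlet sine under the killed resolvent, and the maximum
  principle\<close>

context
 fixes n :: nat
begin

definition "freq = real n * pi / (b - a)"

definition "rate = freq^2 / 2"

definition "A = - io ` {a<..<b}"

definition "zt = the_inv_into {a..b} io"

definition "f = kext A zt (sinem a b n)"

definition "R y = (\<integral>w. pot A f w \<partial>P y)"

text \<open>That \<open>g\<close> vanishes means that \<open>f\<close> is an eigenfunction of the
  killed resolvent with eigenvalue \<open>1 / (1 + rate)\<close>.\<close>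

definition "g y = (1 + rate) * R y - f y"

lemma zt_io: "x : {a..b} ==> zt (io x) = x" unfolding zt_def by (rule the_inv_into_f_f[OF io_inj])

lemma A_closed: "closedin (top_of_set S) (S Int A)" unfolding A_def by (rule closedin_arc) auto

lemma f_io: "x : {a..b} ==> f (io x) = sin (freq * x + - (freq * a))"
proof -
 assume x: "x : {a..b}"
 have eq: "freq * x + - (freq * a) = real n * (pi * (x - a) / (b - a))" for x by (simp add: freq_def diff_divide_distrib right_diff_distrib)
 show ?thesis
 proof (cases "x : {a<..<b}")
  case True
  then have "io x ~: A" by (simp add: A_def)
  then show ?thesis using x unfolding eq by (simp add: f_def kext_def zt_io sinem_def)
 next
  case False
  have "{a<..<b} <= {a..b}" by auto
  from io_mem_iff[OF x this] False have "io x : A" by (simp add: A_def)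
  moreover have "x = a | x = b" using False x by auto
  then have "sin (real n * (pi * (x - a) / (b - a))) = 0" using ab by (auto simp: sin_npi)
  ultimately show ?thesis unfolding eq by (simp add: f_def kext_def)
 qed
qed

lemma f_A: "y : A ==> f y = 0" by (simp add: f_def kext_def)

lemma abs_f: "\<bar>f y\<bar> <= 1" using abs_sinem_le by (simp add: f_def kext_def)

lemma zt_measurable_arc:
 assumes "h : bmeas borel"
 shows "kext A zt h : bmeas (rborel S)"
proof -
 have iso: "continuous_on (io ` {a..b}) zt" unfolding zt_def by (rule continuous_on_inv_into[OF io_cont compact_Icc io_inj])
 have cl: "closed (io ` {a..b})" by (intro compact_imp_closed compact_continuous_image io_cont compact_Icc)
 have "(%y. if y : io ` {a..b} then zt y else 0) : bmeas borel" using iso cl by (intro borel_measurable_continuous_on_if) auto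
 then have m: "(%y. if y : io ` {a..b} then zt y else 0) : bmeas (rborel S)" by (rule measurable_restrict_space1)
 have eq: "kext A zt h = (%y. if y : A then 0 else h (if y : io ` {a..b} then zt y else 0))"
 proof
  fix y
  show "kext A zt h y = (if y : A then 0 else h (if y : io ` {a..b} then zt y else 0))"
  proof (cases "y : A")
   case False
   then have "y : io ` {a..b}" by (auto simp: A_def)
   with False show ?thesis by (simp add: kext_def)
  qed (simp add: kext_def)
 qed
 show ?thesis unfolding eq
 proof (rule measurable_If)
  have "{y : space (rborel S). y : A} = S Int A" by (auto simp: space_restrict_space)
  then show "{y : space (rborel S). y : A} : sets (rborel S)" using sets_closedin[OF A_closed] by simp
  show "(%y. h (if y : io ` {a..b} then zt y else 0)) : bmeas (rborel S)" by (rule measurable_compose[OF m assms])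
 qed simp
qed

lemma f_measurable: "f : bmeas (rborel S)" unfolding f_def by (rule zt_measurable_arc) (simp add: sinem_def[abs_def])

lemma R_measurable: "R : bmeas (rborel S)" unfolding R_def[abs_def] by (rule measurable_kernel_integral[OF potential_meas[OF A_closed f_measurable abs_f]])

lemma mean_potential_le:
 assumes y: "y : S" and B: "closedin (top_of_set S) (S Int B)" and H: "H : bmeas (rborel S)"
  and Hb: "!!y. y : S ==> \<bar>H y\<bar> <= c"
 shows "\<bar>\<integral>w. pot B H w \<partial>P y\<bar> <= c" "integrable (P y) (pot B H)"
proof -
 interpret Py: prob_space "P y" by (rule prob_space_P[OF y])
 have b: "\<bar>pot B H w\<bar> <= c" if "w : space (P y)" for w using potential_bound[OF B H Hb] that by (simp add: space_P[OF y])
 have m: "pot B H : bmeas (P y)" unfolding P_meas_iff[OF y] by (rule potential_meas[OF B H Hb])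
 show i: "integrable (P y) (pot B H)" by (rule Py.integrable_const_bound[OF _ m, where B=c]) (use b in \<open>auto intro!: AE_I2\<close>)
 have "\<bar>\<integral>w. pot B H w \<partial>P y\<bar> <= (\<integral>w. \<bar>pot B H w\<bar> \<partial>P y)" by (rule integral_abs_bound)
 also have "... <= c" by (rule Py.integral_le_const) (use i b in \<open>auto intro!: AE_I2\<close>)
 finally show "\<bar>\<integral>w. pot B H w \<partial>P y\<bar> <= c" .
qed

lemma abs_R: "y : S ==> \<bar>R y\<bar> <= 1" unfolding R_def by (rule mean_potential_le(1)[OF _ A_closed f_measurable abs_f])

lemma rate_nonneg: "0 <= rate" by (simp add: rate_def)

lemma scaled_bound:
 fixes x :: real
 assumes "\<bar>x\<bar> <= 1"
 shows "\<bar>if E then x else (1 + rate) * x\<bar> <= 2 + rate"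
proof (cases E)
 case True
 then have "(if E then x else (1 + rate) * x) = x" by simp
 then show ?thesis using assms rate_nonneg by linarith
next
 case False
 then have e: "\<bar>if E then x else (1 + rate) * x\<bar> = (1 + rate) * \<bar>x\<bar>" using rate_nonneg by (simp add: abs_mult)
 have "(1 + rate) * \<bar>x\<bar> <= (1 + rate) * 1" using assms rate_nonneg by (intro mult_left_mono) auto
 also have "(1 + rate) * 1 <= 2 + rate" by simp
 finally show ?thesis unfolding e .
qed

lemma abs_g: "y : S ==> \<bar>g y\<bar> <= 2 + rate"
proof -
 assume "y : S"
 then have "(1 + rate) * \<bar>R y\<bar> <= (1 + rate) * 1" using abs_R rate_nonneg by (intro mult_left_mono) auto
 then have "\<bar>(1 + rate) * R y\<bar> <= 1 + rate" using rate_nonneg by (simp add: abs_mult)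
 then show ?thesis using abs_f[of y] unfolding g_def by linarith
qed

lemma g_measurable: "g : bmeas (rborel S)" unfolding g_def[abs_def] using R_measurable f_measurable by measurable

lemma g_A: "y : S ==> y : A ==> g y = 0"
proof -
 assume y: "y : S" "y : A"
 have "R y = (\<integral>w. 0 \<partial>P y)" unfolding R_def
 proof (rule integral_cong_AE)
  show "pot A f : bmeas (P y)" unfolding P_meas_iff[OF y(1)] by (rule potential_meas[OF A_closed f_measurable abs_f])
  show "AE w in P y. pot A f w = 0" using AE_start[OF y(1)]
  proof eventually_elim
   case (elim w)
   then show ?case unfolding pot_def by (subst stopped_start_in) (auto simp: y(2) f_A)
  qed
 qed simp
 then show ?thesis using y by (simp add: g_def f_A)
qed

lemma measurable_on_closed:
 assumes B: "closedin (top_of_set S) (S Int B)" and "h1 : bmeas (rborel S)" "h2 : bmeas (rborel S)"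
 shows "(%y. if y : B then h1 y else h2 y) : bmeas (rborel S)"
proof (rule measurable_If)
 have "{y : space (rborel S). y : B} = S Int B" by (auto simp: space_restrict_space)
 then show "{y : space (rborel S). y : B} : sets (rborel S)" using sets_closedin[OF B] by simp
qed (rule assms)+

text \<open>On \<open>B\<close> the data \<open>(1 + rate) * R\<close> equals \<open>f + g\<close>.
  Hence \<open>g\<close> is the defect of \<open>f\<close> in Dynkin's formula off \<open>B\<close>
  plus the discounted mean of \<open>g\<close> at the entrance into \<open>B\<close>.\<close>

lemma g_decomposition:
 assumes y: "y : S" and B: "closedin (top_of_set S) (S Int B)" "A <= B"
 shows "g y = ((\<integral>w. pot B (%y. if y : B then f y else (1 + rate) * f y) w \<partial>P y) - f y)
       + (\<integral>w. pot B (%y. if y : B then g y else 0) w \<partial>P y)"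
proof -
 let ?H1 = "%y. if y : B then f y else (1 + rate) * f y" and ?H2 = "%y. if y : B then g y else 0"
 have H1m: "?H1 : bmeas (rborel S)" by (rule measurable_on_closed[OF B(1) f_measurable]) (use f_measurable in measurable)
 have H2m: "?H2 : bmeas (rborel S)" by (rule measurable_on_closed[OF B(1) g_measurable]) simp
 have H1b: "\<bar>?H1 y\<bar> <= 2 + rate" for y by (rule scaled_bound[OF abs_f])
 have H2b: "\<bar>?H2 y\<bar> <= 2 + rate" if "y : S" for y using abs_g[OF that] rate_nonneg by simp
 have "(1 + rate) * R y = (1 + rate) * (\<integral>w. pot B (%y. if y : B then R y else f y) w \<partial>P y)" using potential_decomposition[OF A_closed B f_measurable abs_f y] unfolding R_def by simp
 also have "... = (\<integral>w. (1 + rate) * pot B (%y. if y : B then R y else f y) w \<partial>P y)" by simp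
 also have "... = (\<integral>w. pot B ?H1 w + pot B ?H2 w \<partial>P y)"
 proof (intro integral_congr refl)
  fix w assume "w : space (P y)"
  then have w: "w : space (path_space S)" by (simp add: space_P[OF y])
  have i: "integrable exp1 (%t. ?H1 (stopped B w t))" "integrable exp1 (%t. ?H2 (stopped B w t))" by (rule exp1_bdd[OF stopped_time_meas[OF B(1) H1m H1b w] abs_stopped_le[OF B(1) H1m H1b w]]
        exp1_bdd[OF stopped_time_meas[OF B(1) H2m H2b w] abs_stopped_le[OF B(1) H2m H2b w]]; assumption)+
  have "(1 + rate) * pot B (%y. if y : B then R y else f y) w
    = (\<integral>t. (1 + rate) * (if stopped B w t : B then R (stopped B w t) else f (stopped B w t)) \<partial>exp1)" by (simp add: pot_def)
  also have "... = (\<integral>t. ?H1 (stopped B w t) + ?H2 (stopped B w t) \<partial>exp1)" by (intro integral_congr refl) (simp add: g_def)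
  also have "... = pot B ?H1 w + pot B ?H2 w" unfolding pot_def by (rule Bochner_Integration.integral_add[OF i])
  finally show "(1 + rate) * pot B (%y. if y : B then R y else f y) w = pot B ?H1 w + pot B ?H2 w" .
 qed
 also have "... = (\<integral>w. pot B ?H1 w \<partial>P y) + (\<integral>w. pot B ?H2 w \<partial>P y)" by (intro Bochner_Integration.integral_add mean_potential_le(2)[OF y B(1) H1m H1b] mean_potential_le(2)[OF y B(1) H2m H2b])
 finally show ?thesis unfolding g_def[of y] by linarith
qed

lemma gap_potential:
 assumes cd: "a <= c" "c < d" "d <= b" and no: "{c<..<d} Int V = {}" and z: "z : {c<..<d}"
  and H: "H : bmeas (rborel S)" "!!y. y : S ==> \<bar>H y\<bar> <= C"
 defines "k \<equiv> %x. H (io (max c (min d x)))"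
 shows "(\<integral>w. pot (- io ` {c<..<d}) H w \<partial>P (io z)) = (\<integral>w. pot (- {c<..<d}) k w \<partial>Q z)"
  and "pot (- {c<..<d}) k : bmeas (Q z)" "w : space (Q z) ==> (%t. k (stopped (- {c<..<d}) w t)) : bmeas borel"
  and "integrable (Q z) (pot (- {c<..<d}) k)" "w : space (Q z) ==> integrable exp1 (%t. k (stopped (- {c<..<d}) w t))"
proof -
 interpret Q: lbm "Q z" z by (rule Q)
 let ?B = "- io ` {c<..<d}"
 have zS: "io z : S" using cd z by (intro io_in) auto
 have Bc: "closedin (top_of_set S) (S Int ?B)" by (rule closedin_arc[OF cd(1,3)])
 have Vc: "closedin (top_of_set UNIV) (UNIV Int - {c<..<d})" by (simp add: closed_Compl)
 have km: "k : bmeas (rborel UNIV)" unfolding k_def by (rule clamp_measurable[OF cd H(1)])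
 have kb: "\<bar>k x\<bar> <= C" for x unfolding k_def by (intro H(2) io_in) (use cd in auto)
 show pm: "pot (- {c<..<d}) k : bmeas (Q z)" unfolding Q.Q_meas_iff by (rule potential_meas[OF Vc km kb])
 show "integrable (Q z) (pot (- {c<..<d}) k)" by (rule Q.int_Q_bdd[OF pm]) (rule potential_bound[OF Vc km kb Q.path_Q])
 show m: "(%t. k (stopped (- {c<..<d}) w t)) : bmeas borel" if "w : space (Q z)" for w by (rule stopped_time_meas[OF Vc km kb Q.path_Q[OF that]])
 show "integrable exp1 (%t. k (stopped (- {c<..<d}) w t))" if "w : space (Q z)" for w by (rule exp1_bdd[OF m[OF that] kb])
 have "(\<integral>w. pot ?B H w \<partial>P (io z)) = (\<integral>t. (\<integral>w. H (stopped ?B w t) \<partial>P (io z)) \<partial>exp1)" by (rule int_pot[OF Bc H prob_space_P[OF zS] sets_P[OF zS]])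
 also have "... = (\<integral>t. (\<integral>w. k (stopped (- {c<..<d}) w t) \<partial>Q z) \<partial>exp1)"
 proof (rule integral_cong_AE)
  show "(%t. \<integral>w. H (stopped ?B w t) \<partial>P (io z)) : bmeas exp1" using pot_Fubini(2)[OF Bc H prob_space_P[OF zS] sets_P[OF zS], of "%_. 0" 0] by (simp cong: measurable_cong_sets)
  show "(%t. \<integral>w. k (stopped (- {c<..<d}) w t) \<partial>Q z) : bmeas exp1" using pot_Fubini(2)[OF Vc km kb Q.prob_space_axioms Q.sets_Q, of "%_. 0" 0] by (simp cong: measurable_cong_sets)
  show "AE t in exp1. (\<integral>w. H (stopped ?B w t) \<partial>P (io z)) = (\<integral>w. k (stopped (- {c<..<d}) w t) \<partial>Q z)" unfolding k_def by (rule AE_exp1I, rule gap[OF cd no z _ H])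
 qed
 also have "... = (\<integral>w. pot (- {c<..<d}) k w \<partial>Q z)" by (rule int_pot[OF Vc km kb Q.prob_space_axioms Q.sets_Q, symmetric])
 finally show "(\<integral>w. pot ?B H w \<partial>P (io z)) = (\<integral>w. pot (- {c<..<d}) k w \<partial>Q z)" .
qed

text \<open>In a gap the defect is 0 by Dynkin's formula for linear Brownian motion, so
  \<open>g\<close> is the discounted mean of its values at the two ends.\<close>

lemma gap_value:
 assumes cd: "a <= c" "c < d" "d <= b" and no: "{c<..<d} Int V = {}" and z: "z : {c<..<d}"
 defines "B \<equiv> - io ` {c<..<d}"
 shows "g (io z) = (\<integral>w. pot B (%y. if y : B then g y else 0) w \<partial>P (io z))"
proof -
 interpret Q: lbm "Q z" z by (rule Q)
 let ?H = "%y. if y : B then f y else (1 + rate) * f y"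
 let ?gmm = "- (freq * a)"
 let ?D = "%x. if x : - {c<..<d} then sin (freq * x + ?gmm) else (1 + freq^2 / 2) * sin (freq * x + ?gmm)"
 have zab: "z : {a..b}" using cd z by auto
 have Bc: "closedin (top_of_set S) (S Int B)" unfolding B_def by (rule closedin_arc[OF cd(1,3)])
 have AB: "A <= B" unfolding A_def B_def using cd by auto
 have Hm: "?H : bmeas (rborel S)" by (rule measurable_on_closed[OF Bc f_measurable]) (use f_measurable in measurable)
 have Hb: "\<bar>?H y\<bar> <= 2 + rate" for y by (rule scaled_bound[OF abs_f])
 let ?k = "%x. ?H (io (max c (min d x)))"
 note gp = gap_potential[OF cd no z Hm Hb, folded B_def]
 have pt: "?k (stopped (- {c<..<d}) w t) = ?D (stopped (- {c<..<d}) w t)" if w: "w : space (Q z)" "w 0 = z" for w t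
 proof -
  let ?x = "stopped (- {c<..<d}) w t"
  have sub: "{c<..<d} <= {a..b}" using cd by auto
  consider "?x : {c<..<d}" | "?x = c | ?x = d" using Q.stopped_bdry[OF w z, of t] by blast
  then show ?thesis
  proof cases
   case 1
   then have x: "?x : {a..b}" using sub by auto
   have "io ?x ~: B" using 1 by (simp add: B_def)
   moreover have "max c (min d ?x) = ?x" using 1 by auto
   ultimately show ?thesis using 1 f_io[OF x] by (simp add: rate_def)
  next
   case 2
   then have x: "?x : {a..b}" and nx: "?x ~: {c<..<d}" using cd by auto
   have "io ?x : B" using nx io_mem_iff[OF x sub] by (simp add: B_def)
   moreover have "max c (min d ?x) = ?x" using 2 cd by auto
   ultimately show ?thesis using nx f_io[OF x] by simp
  qed
 qed
 have "(\<integral>w. pot B ?H w \<partial>P (io z)) = (\<integral>w. pot (- {c<..<d}) ?k w \<partial>Q z)" by (rule gp(1))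
 also have "... = (\<integral>w. pot (- {c<..<d}) ?D w \<partial>Q z)"
 proof (rule integral_cong_AE[OF gp(2)])
  have Dm: "?D : bmeas (rborel UNIV)" by (rule measurable_restrict_space1) measurable
  have Db: "\<bar>?D x\<bar> <= 2 + rate" for x unfolding rate_def[symmetric] by (rule scaled_bound[OF abs_sin_le_one])
  show "pot (- {c<..<d}) ?D : bmeas (Q z)" unfolding Q.Q_meas_iff by (rule potential_meas[OF _ Dm Db]) (simp add: closed_Compl)
  show "AE w in Q z. pot (- {c<..<d}) ?k w = pot (- {c<..<d}) ?D w" using Q.start AE_space
  proof eventually_elim
   case (elim w)
   show ?case unfolding pot_def by (intro integral_congr refl pt elim)
  qed
 qed
 also have "... = sin (freq * z + ?gmm)" by (rule Q.dynkin[OF z])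
 also have "... = f (io z)" by (rule f_io[OF zab, symmetric])
 finally have "(\<integral>w. pot B ?H w \<partial>P (io z)) = f (io z)" .
 then show ?thesis using g_decomposition[OF io_in[OF zab] Bc AB] by simp
qed

lemma gap_bound:
 assumes cd: "a <= c" "c < d" "d <= b" and no: "{c<..<d} Int V = {}" and z: "z : {c<..<d}"
  and M: "\<bar>g (io c)\<bar> <= M" "\<bar>g (io d)\<bar> <= M"
 shows "\<bar>g (io z)\<bar> <= M * (\<integral>w. pot (- {c<..<d}) (indicator (- {c<..<d})) w \<partial>Q z)"
proof -
 interpret Q: lbm "Q z" z by (rule Q)
 define B where "B = - io ` {c<..<d}"
 have Bc: "closedin (top_of_set S) (S Int B)" unfolding B_def by (rule closedin_arc[OF cd(1,3)])
 let ?H = "%y. if y : B then g y else 0" and ?I = "indicator (- {c<..<d}) :: real => real"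
 let ?k = "%x. ?H (io (max c (min d x)))"
 have Hm: "?H : bmeas (rborel S)" by (rule measurable_on_closed[OF Bc g_measurable]) simp
 have Hb: "\<bar>?H y\<bar> <= 2 + rate" if "y : S" for y using abs_g[OF that] rate_nonneg by simp
 note gp = gap_potential[OF cd no z Hm Hb, folded B_def]
 have Vc: "closedin (top_of_set UNIV) (UNIV Int - {c<..<d})" by (simp add: closed_Compl)
 have Im: "?I : bmeas (rborel UNIV)" by (rule measurable_restrict_space1) measurable
 have Ib: "\<bar>?I x\<bar> <= 1" for x by (simp add: indicator_def)
 have Ipm: "pot (- {c<..<d}) ?I : bmeas (Q z)" unfolding Q.Q_meas_iff by (rule potential_meas[OF Vc Im Ib])
 have Ii: "integrable (Q z) (pot (- {c<..<d}) ?I)" by (rule Q.int_Q_bdd[OF Ipm]) (rule potential_bound[OF Vc Im Ib Q.path_Q])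
 have pt: "\<bar>pot (- {c<..<d}) ?k w\<bar> <= M * pot (- {c<..<d}) ?I w" if w: "w : space (Q z)" "w 0 = z" for w
 proof -
  have ik: "integrable exp1 (%t. ?k (stopped (- {c<..<d}) w t))" by (rule gp(5)[OF _ w(1)])
  have iI: "integrable exp1 (%t. ?I (stopped (- {c<..<d}) w t))" by (rule exp1_bdd[OF stopped_time_meas[OF Vc Im Ib Q.path_Q[OF w(1)]] Ib])
  have le: "\<bar>?k (stopped (- {c<..<d}) w t)\<bar> <= M * ?I (stopped (- {c<..<d}) w t)" for t
  proof -
   let ?x = "stopped (- {c<..<d}) w t"
   consider "?x : {c<..<d}" | "?x = c | ?x = d" using Q.stopped_bdry[OF w z, of t] by blast
   then show ?thesis
   proof cases
    case 1
    then have "max c (min d ?x) = ?x" "io ?x ~: B" by (auto simp: B_def)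
    then show ?thesis using 1 by simp
   next
    case 2
    then have "max c (min d ?x) = ?x" "?x ~: {c<..<d}" using cd by auto
    moreover have "\<bar>g (io ?x)\<bar> <= M" "0 <= M" using 2 M by auto
    ultimately show ?thesis by simp
   qed
  qed
  have "\<bar>pot (- {c<..<d}) ?k w\<bar> <= (\<integral>t. \<bar>?k (stopped (- {c<..<d}) w t)\<bar> \<partial>exp1)" unfolding pot_def by (rule integral_abs_bound)
  also have "... <= (\<integral>t. M * ?I (stopped (- {c<..<d}) w t) \<partial>exp1)" by (rule integral_mono[OF integrable_abs[OF ik] integrable_mult_right[OF iI] le])
  also have "... = M * pot (- {c<..<d}) ?I w" unfolding pot_def by simp
  finally show ?thesis .
 qed
 have ik4: "integrable (Q z) (pot (- {c<..<d}) ?k)" by (rule gp(4))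
 have gz: "g (io z) = (\<integral>w. pot (- {c<..<d}) ?k w \<partial>Q z)" by (rule trans[OF gap_value[OF cd no z, folded B_def] gp(1)])
 have "\<bar>g (io z)\<bar> <= (\<integral>w. \<bar>pot (- {c<..<d}) ?k w\<bar> \<partial>Q z)" unfolding gz by (rule integral_abs_bound)
 also have "... <= (\<integral>w. M * pot (- {c<..<d}) ?I w \<partial>Q z)"
 proof (rule integral_mono_AE[OF integrable_abs[OF ik4] integrable_mult_right[OF Ii]])
  show "AE w in Q z. \<bar>pot (- {c<..<d}) ?k w\<bar> <= M * pot (- {c<..<d}) ?I w" using Q.start AE_space by eventually_elim (rule pt)
 qed
 also have "... = M * (\<integral>w. pot (- {c<..<d}) ?I w \<partial>Q z)" by simp
 finally show ?thesis .
qed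

lemma gap_bound_simple:
 assumes cd: "a <= c" "c < d" "d <= b" and no: "{c<..<d} Int V = {}" and z: "z : {c<..<d}"
  and M: "\<bar>g (io c)\<bar> <= M" "\<bar>g (io d)\<bar> <= M"
 shows "\<bar>g (io z)\<bar> <= M"
proof -
 interpret Q: lbm "Q z" z by (rule Q)
 let ?I = "indicator (- {c<..<d}) :: real => real"
 have Vc: "closedin (top_of_set UNIV) (UNIV Int - {c<..<d})" by (simp add: closed_Compl)
 have Im: "?I : bmeas (rborel UNIV)" by (rule measurable_restrict_space1) measurable
 have Ib: "\<bar>?I x\<bar> <= 1" for x by (simp add: indicator_def)
 have Ipm: "pot (- {c<..<d}) ?I : bmeas (Q z)" unfolding Q.Q_meas_iff by (rule potential_meas[OF Vc Im Ib])
 have b: "\<bar>pot (- {c<..<d}) ?I w\<bar> <= 1" if "w : space (Q z)" for w by (rule potential_bound[OF Vc Im Ib Q.path_Q[OF that]])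
 have "(\<integral>w. pot (- {c<..<d}) ?I w \<partial>Q z) <= 1" by (rule Q.integral_le_const[OF Q.int_Q_bdd[OF Ipm b]]) (use b in \<open>auto intro!: AE_I2 simp: abs_le_iff\<close>)
 then have "M * (\<integral>w. pot (- {c<..<d}) ?I w \<partial>Q z) <= M * 1" using M by (intro mult_left_mono) auto
 with gap_bound[OF assms] show ?thesis by simp
qed

text \<open>Discounting makes the bound strictly smaller inside a gap, and by
  \<open>exit_discount\<close> the loss at distance \<open>ep\<close> from an end is at least linear
  in \<open>ep\<close>.\<close>

lemma gap_decay:
 assumes cd: "a <= c" "c < d" "d <= b" and no: "{c<..<d} Int V = {}"
  and M: "\<bar>g (io c)\<bar> <= M" "\<bar>g (io d)\<bar> <= M"
 shows "\<exists>kp>0. \<exists>ep1>0. \<forall>ep. 0 < ep & ep < ep1 --> \<bar>g (io (c + ep))\<bar> <= M * (1 - kp * ep) & \<bar>g (io (d - ep))\<bar> <= M * (1 - kp * ep)"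
proof -
 define L where "L = d - c"
 define D where "D = 1 + 1 / (2 * L^2) - cos (1 / 2)"
 \<comment> \<open>The slope from \<open>cos_half_gap\<close>, divided by the length of the gap and
   by the factor \<open>D\<close> that stands in front of the mean in
   \<open>exit_discount\<close>.\<close>
 define kp where "kp = sin (1 / 4) / (L * D)"
 have L: "L > 0" using cd by (simp add: L_def)
 have "0 < 1 / (2 * L^2)" using L by simp
 then have D: "D > 0" unfolding D_def using cos_le_one[of "1 / 2"] by linarith
 have s: "0 < sin (1 / 4 :: real)" using pi_gt3 by (intro sin_gt_zero) auto
 have kp: "kp > 0" using L D s by (simp add: kp_def)
 have main: "\<bar>g (io z)\<bar> <= M * (1 - kp * ep)"
  if ep: "0 < ep" "ep < L / 4" and z: "z : {c<..<d}" and cz: "cos ((z - (c + d) / 2) / L) = cos (1 / 2 - ep / L)" for z ep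
 proof -
  interpret Q: lbm "Q z" z by (rule Q)
  define p where "p = (\<integral>w. pot (- {c<..<d}) (indicator (- {c<..<d})) w \<partial>Q z)"
  have "D * p <= D + cos (1 / 2) - cos (1 / 2 - ep / L)" using Q.exit_discount[OF z] cz unfolding L_def[symmetric] p_def D_def by simp
  moreover have "sin (1 / 4) * (ep / L) <= cos (1 / 2 - ep / L) - cos (1 / 2)" by (rule cos_half_gap) (use ep L in \<open>auto simp: field_simps\<close>)
  ultimately have "D * p <= D - sin (1 / 4) * (ep / L)" by linarith
  also have "... = D * (1 - kp * ep)" using D L by (simp add: kp_def right_diff_distrib)
  finally have "p <= 1 - kp * ep" using D by simp
  then have "M * p <= M * (1 - kp * ep)" using M by (intro mult_left_mono) auto
  with gap_bound[OF cd no z M] show ?thesis by (simp add: p_def)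
 qed
 have "\<forall>ep. 0 < ep & ep < L / 4 --> \<bar>g (io (c + ep))\<bar> <= M * (1 - kp * ep) & \<bar>g (io (d - ep))\<bar> <= M * (1 - kp * ep)"
 proof (intro conjI allI impI)
  fix ep assume "0 < ep & ep < L / 4"
  then have ep: "0 < ep" "ep < L / 4" by auto
  have in_gap: "c + ep : {c<..<d}" "d - ep : {c<..<d}" using ep L by (auto simp: L_def)
  have "(c + ep - (c + d) / 2) / L = - (1 / 2 - ep / L)" "(d - ep - (c + d) / 2) / L = 1 / 2 - ep / L" using L by (simp_all add: L_def field_simps)
  then have cs: "cos ((c + ep - (c + d) / 2) / L) = cos (1 / 2 - ep / L)" "cos ((d - ep - (c + d) / 2) / L) = cos (1 / 2 - ep / L)" by (simp_all only: cos_minus)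
  show "\<bar>g (io (c + ep))\<bar> <= M * (1 - kp * ep)" by (rule main[OF ep in_gap(1) cs(1)])
  show "\<bar>g (io (d - ep))\<bar> <= M * (1 - kp * ep)" by (rule main[OF ep in_gap(2) cs(2)])
 qed
 moreover have "0 < L / 4" using L by simp
 ultimately show ?thesis using kp by blast
qed

lemma vertex_bound:
 assumes cd: "a <= c" "c < d" "d <= b" and v: "v : {c<..<d}"
  and err: "\<bar>(\<integral>w. pot (- io ` {c<..<d}) (%y. if y : - io ` {c<..<d} then f y else (1 + rate) * f y) w \<partial>P (io v)) - f (io v)\<bar> <= e"
  and M: "\<bar>g (io c)\<bar> <= M" "\<bar>g (io d)\<bar> <= M"
 shows "\<bar>g (io v)\<bar> <= e + M"
proof -
 define B where "B = - io ` {c<..<d}"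
 have vab: "v : {a..b}" using cd v by auto
 have vS: "io v : S" by (rule io_in[OF vab])
 interpret Pv: prob_space "P (io v)" by (rule prob_space_P[OF vS])
 have Bc: "closedin (top_of_set S) (S Int B)" unfolding B_def by (rule closedin_arc[OF cd(1,3)])
 have AB: "A <= B" unfolding A_def B_def using cd by auto
 let ?H = "%y. if y : B then g y else 0"
 have Hm: "?H : bmeas (rborel S)" by (rule measurable_on_closed[OF Bc g_measurable]) simp
 have Hb: "\<bar>?H y\<bar> <= 2 + rate" if "y : S" for y using abs_g[OF that] rate_nonneg by simp
 have i: "integrable (P (io v)) (pot B ?H)" by (rule mean_potential_le(2)[OF vS Bc Hm Hb])
 have "AE w in P (io v). \<bar>pot B ?H w\<bar> <= M" using AE_start[OF vS] AE_space
 proof eventually_elim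
  case (elim w)
  then have w: "w : space (path_space S)" "w 0 = io v" by (auto simp: space_P[OF vS])
  have pt: "\<bar>?H (stopped B w t)\<bar> <= M" for t
  proof (cases "stopped B w t : B")
   case True
   then have "stopped B w t = io c | stopped B w t = io d" using exit_arc[OF cd v w] by (simp add: B_def)
   then show ?thesis using M True by auto
  next
   case False
   then show ?thesis using M by auto
  qed
  have ii: "integrable exp1 (%t. ?H (stopped B w t))" by (rule exp1_bdd[OF stopped_time_meas[OF Bc Hm Hb w(1)] pt])
  have "\<bar>pot B ?H w\<bar> <= (\<integral>t. \<bar>?H (stopped B w t)\<bar> \<partial>exp1)" unfolding pot_def by (rule integral_abs_bound)
  also have "... <= M" by (rule exp1.integral_le_const[OF integrable_abs[OF ii]]) (use pt in auto)
  finally show ?case .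
 qed
 then have "\<bar>\<integral>w. pot B ?H w \<partial>P (io v)\<bar> <= M" using integral_abs_bound[of "P (io v)" "pot B ?H"] Pv.integral_le_const[OF integrable_abs[OF i]] by (blast intro: order_trans)
 moreover have "g (io v) = ((\<integral>w. pot B (%y. if y : B then f y else (1 + rate) * f y) w \<partial>P (io v)) - f (io v))
   + (\<integral>w. pot B ?H w \<partial>P (io v))" by (rule g_decomposition[OF vS Bc AB])
 ultimately show ?thesis using err unfolding B_def[symmetric] by linarith
qed

lemma neighbours:
 assumes z: "z : {a<..<b}"
 obtains c d where "a <= c" "c < z" "z < d" "d <= b" "c = a | c : V" "d = b | d : V" "{c<..<z} Int V = {}" "{z<..<d} Int V = {}"
proof -
 let ?L = "insert a {v : V. v < z}" and ?U = "insert b {v : V. z < v}"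
 have fin: "finite ?L" "finite ?U" using V by auto
 define m where "m = Max ?L"
 define k where "k = Min ?U"
 have m1: "m : ?L" unfolding m_def by (rule Max_in[OF fin(1)]) simp
 have m2: "v <= m" if "v : ?L" for v unfolding m_def by (rule Max_ge[OF fin(1) that])
 have k1: "k : ?U" unfolding k_def by (rule Min_in[OF fin(2)]) simp
 have k2: "k <= v" if "v : ?U" for v unfolding k_def by (rule Min_le[OF fin(2) that])
 show ?thesis
 proof (rule that[of m k])
  show "a <= m" by (rule m2) simp
  show "k <= b" by (rule k2) simp
  show "m < z" "m = a | m : V" using m1 z by auto
  show "z < k" "k = b | k : V" using k1 z by auto
  show "{m<..<z} Int V = {}"
  proof (rule equals0I)
   fix v assume v: "v : {m<..<z} Int V"
   then have "v : ?L" by auto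
   from m2[OF this] v show False by simp
  qed
  show "{z<..<k} Int V = {}"
  proof (rule equals0I)
   fix v assume v: "v : {z<..<k} Int V"
   then have "v : ?U" by auto
   from k2[OF this] v show False by simp
  qed
 qed
qed

lemma g_ends: "g (io a) = 0" "g (io b) = 0"
proof -
 have "io a : A" "io b : A" unfolding A_def using io_mem_iff[OF _ greaterThanLessThan_subseteq_atLeastAtMost_iff[THEN iffD2], of a a b] 
   io_mem_iff[OF _ greaterThanLessThan_subseteq_atLeastAtMost_iff[THEN iffD2], of b a b] ab by auto
 then show "g (io a) = 0" "g (io b) = 0" using ab by (auto intro!: g_A io_in)
qed

text \<open>Maximum principle. At a vertex where the absolute value of \<open>g\<close> has its
  largest value \<open>M > 0\<close>, the points at distance \<open>ep\<close> on both sides satisfy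
  the bound \<open>M * (1 - kp * ep)\<close>, and the defect at the vertex is at most
  \<open>et * ep\<close>. For small \<open>et\<close> this contradicts the value
  \<open>M\<close>.\<close>

lemma g_vertex: "v : V ==> g (io v) = 0"
proof (rule ccontr)
 assume v0: "v : V" "g (io v) ~= 0"
 define M where "M = Max ((%v. \<bar>g (io v)\<bar>) ` V)"
 have fin: "finite ((%v. \<bar>g (io v)\<bar>) ` V)" "(%v. \<bar>g (io v)\<bar>) ` V ~= {}" using V v0 by auto
 have M_ge: "\<bar>g (io v)\<bar> <= M" if "v : V" for v unfolding M_def using fin that by (intro Max_ge) auto
 have M0: "0 < M" using M_ge[OF v0(1)] v0(2) by linarith
 obtain v where v: "v : V" "\<bar>g (io v)\<bar> = M" using Max_in[OF fin] unfolding M_def by auto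
 have vab: "v : {a<..<b}" using V v by auto
 obtain c d where cd: "a <= c" "c < v" "v < d" "d <= b" "c = a | c : V" "d = b | d : V" "{c<..<v} Int V = {}" "{v<..<d} Int V = {}" using neighbours[OF vab] by blast
 have Mc: "\<bar>g (io c)\<bar> <= M" using cd(5)
 proof
  assume "c = a" then show ?thesis using g_ends(1) M0 by simp
 qed (rule M_ge)
 have Md: "\<bar>g (io d)\<bar> <= M" using cd(6)
 proof
  assume "d = b" then show ?thesis using g_ends(2) M0 by simp
 qed (rule M_ge)
 have Mv: "\<bar>g (io v)\<bar> <= M" using v(2) by simp
 have vb: "v <= b" and av: "a <= v" using vab by auto
 obtain kp1 e1 where k1: "kp1 > 0" "e1 > 0" "!!ep. 0 < ep ==> ep < e1 ==> \<bar>g (io (v - ep))\<bar> <= M * (1 - kp1 * ep)" using gap_decay[OF cd(1,2) vb cd(7) Mc Mv] by blast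
 obtain kp2 e2 where k2: "kp2 > 0" "e2 > 0" "!!ep. 0 < ep ==> ep < e2 ==> \<bar>g (io (v + ep))\<bar> <= M * (1 - kp2 * ep)" using gap_decay[OF av cd(3,4,8) Mv Md] by blast
 define kp where "kp = min kp1 kp2"
 have kp: "kp > 0" "kp <= kp1" "kp <= kp2" using k1 k2 by (auto simp: kp_def)
 \<comment> \<open>Half of the linear gain \<open>M * kp\<close>, so that the defect cannot use it
   up.\<close>
 define et where "et = M * kp / 2"
 have et: "et > 0" using M0 kp by (simp add: et_def)
 obtain e0 where e0: "e0 > 0" "!!ep. 0 < ep ==> ep < e0 ==>
    \<bar>(\<integral>w. pot (- io ` {v - ep<..<v + ep}) (%y. if y : - io ` {v - ep<..<v + ep} then f y else (1 + freq^2 / 2) * f y) w \<partial>P (io v))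
     - sin (freq * v + - (freq * a))\<bar> <= et * ep" using vertex[OF v(1) et f_measurable abs_f f_io] by blast
 define ep where "ep = min (min e0 (min e1 e2)) (min (v - a) (b - v)) / 2"
 have ep: "0 < ep" "ep < e0" "ep < e1" "ep < e2" "ep < v - a" "ep < b - v" using e0(1) k1(2) k2(2) vab by (auto simp: ep_def min_def)
 have fv: "f (io v) = sin (freq * v + - (freq * a))" using vab by (intro f_io) auto
 have "M * (1 - kp1 * ep) <= M * (1 - kp * ep)" "M * (1 - kp2 * ep) <= M * (1 - kp * ep)" using M0 kp ep(1) by (auto intro!: mult_left_mono mult_right_mono)
 then have b1: "\<bar>g (io (v - ep))\<bar> <= M * (1 - kp * ep)" and b2: "\<bar>g (io (v + ep))\<bar> <= M * (1 - kp * ep)" using k1(3)[OF ep(1,3)] k2(3)[OF ep(1,4)] by linarith+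
 have "\<bar>g (io v)\<bar> <= et * ep + M * (1 - kp * ep)"
 proof (rule vertex_bound[OF _ _ _ _ _ b1 b2])
  show "\<bar>(\<integral>w. pot (- io ` {v - ep<..<v + ep}) (%y. if y : - io ` {v - ep<..<v + ep} then f y else (1 + rate) * f y) w \<partial>P (io v)) - f (io v)\<bar> <= et * ep" unfolding fv rate_def by (rule e0(2)[OF ep(1,2)])
 qed (use ep in auto)
 then have "M * kp * ep <= M * kp * ep / 2" unfolding v(2) et_def by (simp add: algebra_simps)
 moreover have "0 < M * kp * ep" using M0 kp ep by simp
 ultimately show False by linarith
qed

lemma g_zero:
 assumes y: "y : S"
 shows "g y = 0"
proof (cases "y : A")
 case True
 with y show ?thesis by (rule g_A)
next
 case False
 then obtain z where z: "z : {a<..<b}" "y = io z" by (auto simp: A_def)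
 show ?thesis
 proof (cases "z : V")
  case False
  obtain c d where cd: "a <= c" "c < z" "z < d" "d <= b" "c = a | c : V" "d = b | d : V" "{c<..<z} Int V = {}" "{z<..<d} Int V = {}" using neighbours[OF z(1)] by blast
  have no: "{c<..<d} Int V = {}"
  proof (rule equals0I)
   fix x assume x: "x : {c<..<d} Int V"
   then have "x ~= z" using False by auto
   then have "x : {c<..<z} Int V | x : {z<..<d} Int V" using x by auto
   then show False unfolding cd(7,8) by blast
  qed
  have gc: "g (io c) = 0" using cd(5) g_ends(1) g_vertex[of c] by blast
  have gd: "g (io d) = 0" using cd(6) g_ends(2) g_vertex[of d] by blast
  have zz: "c < d" "z : {c<..<d}" using cd(2,3) by auto
  have "\<bar>g (io z)\<bar> <= 0" by (rule gap_bound_simple[OF cd(1) zz(1) cd(4) no zz(2)]) (simp_all only: gc gd abs_zero order_refl)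
  then show ?thesis unfolding z(2) by simp
 next
  case True
  from g_vertex[OF this] show ?thesis unfolding z(2) .
 qed
qed

lemma killed_eigenfunction:
 assumes y: "y : S" and t: "0 <= t"
 shows "(\<integral>w. f (stopped A w t) \<partial>P y) = exp (- rate * t) * f y"
proof -
 have "R x = 1 / (1 + rate) * f x" if "x : S" for x using g_zero[OF that] rate_nonneg by (simp add: g_def field_simps)
 then have "(\<integral>w. f (stopped A w t) \<partial>P y) = exp (- (1 / (1 / (1 + rate)) - 1) * t) * f y" unfolding R_def using rate_nonneg by (intro resolvent_eigenfunction[OF A_closed f_measurable abs_f f_A _ _ y t]) auto
 then show ?thesis by simp
qed

end

lemma inverse_measurable:
 "(%y. if y : io ` {a..b} then the_inv_into {a..b} io y else 0) : bmeas (rborel S)"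
proof (rule measurable_restrict_space1)
 have "continuous_on (io ` {a..b}) (the_inv_into {a..b} io)" by (rule continuous_on_inv_into[OF io_cont compact_Icc io_inj])
 moreover have "closed (io ` {a..b})" by (intro compact_imp_closed compact_continuous_image io_cont compact_Icc)
 ultimately show "(%y. if y : io ` {a..b} then the_inv_into {a..b} io y else 0) : bmeas borel" by (intro borel_measurable_continuous_on_if) auto
qed

text \<open>The coordinate is extended by 0 off the closed arc to be Borel on \<open>S\<close>;
  \<open>kext\<close> discards it there.\<close>

lemma killed_process_arc:
 assumes z: "z : {a<..<b}"
 shows "kproc (P (io z)) S (- io ` {a<..<b}) (%y. if y : io ` {a..b} then the_inv_into {a..b} io y else 0) a b z"
proof -
 define xi where "xi = (%y. if y : io ` {a..b} then the_inv_into {a..b} io y else 0)"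
 have xiio: "xi (io x) = x" if "x : {a..b}" for x using that the_inv_into_f_f[OF io_inj that] by (simp add: xi_def)
 have zS: "io z : S" using z by (intro io_in) auto
 interpret Pz: prob_space "P (io z)" by (rule prob_space_P[OF zS])
 have "kproc (P (io z)) S A xi a b z"
 proof unfold_locales
  show "sets (P (io z)) = sets (path_space S)" by (rule sets_P[OF zS])
  show "closedin (top_of_set S) (S Int A)" by (rule A_closed)
  show "xi : bmeas (rborel S)" unfolding xi_def by (rule inverse_measurable)
  show "xi y : {a<..<b}" if "y : S" "y ~: A" for y
  proof -
   from that(2) obtain x where x: "x : {a<..<b}" "y = io x" by (auto simp: A_def)
   then show ?thesis using xiio[of x] by simp
  qed
  show "a < b" by (rule ab)
  show "AE w in P (io z). w 0 ~: A & xi (w 0) = z" using AE_start[OF zS] by eventually_elim (use z xiio[of z] in \<open>simp add: A_def\<close>)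
  fix s t :: real and Z :: "(real => 'a) => real" and n :: nat
  assume st: "0 <= s" "s <= t" and Z: "Z : bmeas (path_filtration S s)"
   and Z01: "!!w. w : space (path_space S) ==> 0 <= Z w & Z w <= 1"
  have eq: "kext A xi (sinem a b n) = f n"
  proof
   fix y
   show "kext A xi (sinem a b n) y = f n y"
   proof (cases "y : A")
    case False
    then have "y : io ` {a..b}" by (auto simp: A_def)
    then show ?thesis by (simp add: f_def kext_def xi_def zt_def)
   qed (simp add: f_def kext_def)
  qed
  have "(\<integral>w. Z w * f n (stopped A w t) \<partial>P (io z)) = exp (- rate n * (t - s)) * (\<integral>w. Z w * f n (stopped A w s) \<partial>P (io z))"
  proof (rule killed_markov[OF A_closed f_measurable abs_f f_A zS st Z])
   show "(\<integral>w. f n (stopped A w (t - s)) \<partial>P y) = exp (- rate n * (t - s)) * f n y" if "y : S" for y by (rule killed_eigenfunction[OF that]) (use st in simp)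
  qed (use Z01 in auto)
  then show "(\<integral>w. Z w * kext A xi (sinem a b n) (stopped A w t) \<partial>P (io z))
   = exp (- ((real n * pi / (b - a))^2 / 2) * (t - s)) * (\<integral>w. Z w * kext A xi (sinem a b n) (stopped A w s) \<partial>P (io z))" unfolding eq rate_def freq_def .
 qed
 then show ?thesis by (simp add: xi_def A_def)
qed

end

subsection \<open>Arc length and charts\<close>

lemma polygon_rev:
 fixes f :: "nat => 'a::metric_space"
 shows "(\<Sum>i<n. ennreal (dist (f i) (f (Suc i)))) = (\<Sum>i<n. ennreal (dist (f (n - i)) (f (n - Suc i))))"
proof -
 have "(\<Sum>i<n. ennreal (dist (f i) (f (Suc i)))) = (\<Sum>i<n. ennreal (dist (f (n - Suc i)) (f (Suc (n - Suc i)))))" by (rule sum.nat_diff_reindex[symmetric])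
 also have "... = (\<Sum>i<n. ennreal (dist (f (n - i)) (f (n - Suc i))))" by (intro sum.cong refl) (simp add: Suc_diff_Suc dist_commute)
 finally show ?thesis .
qed

text \<open>A monotone map carries a partition to a partition with the same polygon. An antimonotone
  one reverses the order, which leaves the sum unchanged by symmetry of \<open>dist\<close>.\<close>

lemma reparam_le:
 fixes g :: "real => 'a::metric_space"
 assumes eq: "!!x. x : {s..t} ==> h x = g (\<phi> x)"
  and mono: "(mono_on {s..t} \<phi> & \<phi> ` {s..t} <= {p..q}) | (antimono_on {s..t} \<phi> & \<phi> ` {s..t} <= {p..q})"
 shows "curve_length h s t <= curve_length g p q" unfolding curve_length_def
proof (rule SUP_mono)
 fix xs :: "real list" assume "xs : {xs. sorted xs & set xs <= {s..t}}"
 then have xs: "sorted xs" "set xs <= {s..t}" by auto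
 have nth: "xs ! i : {s..t}" if "i < length xs" for i using xs(2) nth_mem[OF that] by auto
 have hg: "h (xs ! i) = g (map \<phi> xs ! i)" if "i < length xs" for i using eq[OF nth[OF that]] that by simp
 from mono show "EX ys:{xs. sorted xs & set xs <= {p..q}}.
   (\<Sum>i<length xs - 1. ennreal (dist (h (xs ! i)) (h (xs ! Suc i)))) <= (\<Sum>i<length ys - 1. ennreal (dist (g (ys ! i)) (g (ys ! Suc i))))"
 proof
  assume m: "mono_on {s..t} \<phi> & \<phi> ` {s..t} <= {p..q}"
  have "sorted (map \<phi> xs)" unfolding sorted_iff_nth_mono using m nth sorted_nth_mono[OF xs(1)] by (auto simp: mono_on_def)
  moreover have "set (map \<phi> xs) <= {p..q}" using m xs(2) by auto
  moreover have "(\<Sum>i<length xs - 1. ennreal (dist (h (xs ! i)) (h (xs ! Suc i)))) = (\<Sum>i<length (map \<phi> xs) - 1. ennreal (dist (g (map \<phi> xs ! i)) (g (map \<phi> xs ! Suc i))))" by (intro sum.cong) (auto simp only: length_map lessThan_iff hg intro!: arg_cong[where f=ennreal] arg_cong2[where f=dist] hg)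
  ultimately show ?thesis by (intro bexI[of _ "map \<phi> xs"]) auto
 next
  assume m: "antimono_on {s..t} \<phi> & \<phi> ` {s..t} <= {p..q}"
  let ?ys = "rev (map \<phi> xs)" and ?n = "length xs - 1"
  have "sorted ?ys" unfolding sorted_rev_iff_nth_mono using m nth sorted_nth_mono[OF xs(1)] by (auto simp: monotone_on_def)
  moreover have "set ?ys <= {p..q}" using m xs(2) by auto
  moreover have "(\<Sum>i<?n. ennreal (dist (h (xs ! i)) (h (xs ! Suc i)))) = (\<Sum>i<length ?ys - 1. ennreal (dist (g (?ys ! i)) (g (?ys ! Suc i))))"
  proof -
   have r: "g (?ys ! i) = h (xs ! (?n - i))" if "i < length xs" for i using that hg[of "?n - i"] by (simp add: rev_nth Suc_diff_Suc)
   have "(\<Sum>i<length ?ys - 1. ennreal (dist (g (?ys ! i)) (g (?ys ! Suc i)))) = (\<Sum>i<?n. ennreal (dist (h (xs ! (?n - i))) (h (xs ! (?n - Suc i)))))" by (rule sum.cong) (auto simp: r)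
   then show ?thesis using polygon_rev[of "%i. h (xs ! i)" ?n] by simp
  qed
  ultimately show ?thesis by (intro bexI[of _ ?ys]) auto
 qed
qed

text \<open>The transition map \<open>u\<close> between the two parametrisations is continuous and
  injective, hence monotone on each subinterval. As both are by length, \<open>u\<close> preserves
  distances, so it is a translation or a reflection.\<close>

lemma arc_length_chart:
 fixes io ps :: "real => 'a::metric_space"
 assumes cd: "c < d" and io: "continuous_on {c..d} io" "inj_on io {c..d}"
  and ps: "continuous_on {0..l} ps" "inj_on ps {0..l}" and sub: "io ` {c..d} <= ps ` {0..l}"
  and lenio: "!!s t. c <= s ==> s <= t ==> t <= d ==> curve_length io s t = ennreal (t - s)"
  and lenps: "!!s t. 0 <= s ==> s <= t ==> t <= l ==> curve_length ps s t = ennreal (t - s)"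
 shows "\<exists>sg q. (sg = 1 | sg = - 1) & (ALL x:{c..d}. sg * x + q : {0..l} & ps (sg * x + q) = io x)"
proof -
 define h where "h = the_inv_into {0..l} ps"
 define u where "u x = h (io x)" for x
 have hc: "continuous_on (ps ` {0..l}) h" unfolding h_def by (rule continuous_on_inv_into[OF ps(1) compact_Icc ps(2)])
 have hps: "h (ps y) = y" if "y : {0..l}" for y unfolding h_def by (rule the_inv_into_f_f[OF ps(2) that])
 have u_in: "u x : {0..l} & ps (u x) = io x" if "x : {c..d}" for x
 proof -
  from that sub obtain y where "y : {0..l}" "io x = ps y" by blast
  then show ?thesis using hps[of y] by (simp add: u_def)
 qed
 have uc: "continuous_on {c..d} u" unfolding u_def by (rule continuous_on_compose2[OF hc io(1) sub])
 have ui: "inj_on u {c..d}"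
 proof (rule inj_onI)
  fix x y assume xy: "x : {c..d}" "y : {c..d}" "u x = u y"
  then have "io x = io y" using u_in[of x] u_in[of y] by simp
  then show "x = y" using inj_onD[OF io(2)] xy by blast
 qed
 have len: "u t - u s = t - s | u s - u t = t - s" if st: "c <= s" "s <= t" "t <= d" for s t
 proof (cases "s = t")
  case False
  with st have st: "c <= s" "s < t" "t <= d" by auto
  have sub_st: "{s..t} <= {c..d}" using st by auto
  have uc': "continuous_on {s..t} u" and ui': "inj_on u {s..t}" using continuous_on_subset[OF uc sub_st] inj_on_subset[OF ui sub_st] by auto
  have ne: "u s ~= u t" using inj_onD[OF ui', of s t] st by auto
  have btw: "u s < u x & u x < u t | u t < u x & u x < u s" if "s < x" "x < t" for x using continuous_inj_imp_mono[OF that uc' ui'] by auto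
  define v where "v = the_inv_into {s..t} u"
  have vu: "v (u x) = x" if "x : {s..t}" for x unfolding v_def by (rule the_inv_into_f_f[OF ui' that])
  show ?thesis
  proof (cases "u s < u t")
   case True
   have bnd: "u s <= u x & u x <= u t" if "x : {s..t}" for x using btw[of x] that True by (cases "x = s"; cases "x = t") (auto simp: less_le)
   have m: "u x <= u y" if xy: "x : {s..t}" "y : {s..t}" "x <= y" for x y
   proof (cases "x = y")
    case False
    show ?thesis
    proof (cases "y = t")
     case True then show ?thesis using bnd[OF xy(1)] by simp
    next
     case F: False
     have "continuous_on {x..t} u" "inj_on u {x..t}" using continuous_on_subset[OF uc', of "{x..t}"] inj_on_subset[OF ui', of "{x..t}"] xy by auto
     from continuous_inj_imp_mono[OF _ _ this, of y] xy False F bnd[OF xy(1)] show ?thesis by auto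
    qed
   qed simp
   have im: "u ` {s..t} = {u s..u t}"
   proof
    show "u ` {s..t} <= {u s..u t}" using bnd by auto
    show "{u s..u t} <= u ` {s..t}"
    proof
     fix y assume "y : {u s..u t}"
     then show "y : u ` {s..t}" using IVT'[of u s y t] uc' st by auto
    qed
   qed
   have vm: "mono_on {u s..u t} v"
   proof (rule mono_onI)
    fix y1 y2 assume y: "y1 : {u s..u t}" "y2 : {u s..u t}" "y1 <= y2"
    then obtain x1 x2 where x: "x1 : {s..t}" "y1 = u x1" "x2 : {s..t}" "y2 = u x2" using im by blast
    then show "v y1 <= v y2" using vu m[of x2 x1] y(3) by (cases "x1 <= x2") auto
   qed
   have bl: "0 <= u s" "u t <= l" using u_in[of s] u_in[of t] st by auto
   have "curve_length io s t <= curve_length ps (u s) (u t)" by (rule reparam_le[where \<phi>=u]) (use u_in sub_st m im in \<open>auto simp: mono_on_def\<close>)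
   moreover have "curve_length ps (u s) (u t) <= curve_length io s t"
   proof (rule reparam_le[where \<phi>=v])
    fix y assume "y : {u s..u t}"
    then obtain x where x: "x : {s..t}" "y = u x" using im by blast
    then show "ps y = io (v y)" using u_in[of x] vu sub_st by auto
   next
    have "v ` {u s..u t} <= {s..t}" unfolding im[symmetric] using vu by auto
    then show "mono_on {u s..u t} v & v ` {u s..u t} <= {s..t} | antimono_on {u s..u t} v & v ` {u s..u t} <= {s..t}" using vm by blast
   qed
   ultimately have "ennreal (t - s) = ennreal (u t - u s)" using lenio[of s t] lenps[of "u s" "u t"] st bl True by simp
   then show ?thesis using st True by simp
  next
   case False
   then have lt: "u t < u s" using ne by simp
   have bnd: "u t <= u x & u x <= u s" if "x : {s..t}" for x using btw[of x] that lt by (cases "x = s"; cases "x = t") (auto simp: less_le)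
   have m: "u y <= u x" if xy: "x : {s..t}" "y : {s..t}" "x <= y" for x y
   proof (cases "x = y")
    case False
    show ?thesis
    proof (cases "y = t")
     case True then show ?thesis using bnd[OF xy(1)] by simp
    next
     case F: False
     have "continuous_on {x..t} u" "inj_on u {x..t}" using continuous_on_subset[OF uc', of "{x..t}"] inj_on_subset[OF ui', of "{x..t}"] xy by auto
     from continuous_inj_imp_mono[OF _ _ this, of y] xy False F bnd[OF xy(1)] show ?thesis by auto
    qed
   qed simp
   have im: "u ` {s..t} = {u t..u s}"
   proof
    show "u ` {s..t} <= {u t..u s}" using bnd by auto
    show "{u t..u s} <= u ` {s..t}"
    proof
     fix y assume "y : {u t..u s}"
     then show "y : u ` {s..t}" using IVT2'[of u t y s] uc' st by auto
    qed
   qed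
   have vm: "antimono_on {u t..u s} v"
   proof (rule monotone_onI)
    fix y1 y2 assume y: "y1 : {u t..u s}" "y2 : {u t..u s}" "y1 <= y2"
    then obtain x1 x2 where x: "x1 : {s..t}" "y1 = u x1" "x2 : {s..t}" "y2 = u x2" using im by blast
    then show "v y2 <= v y1" using vu m[of x1 x2] y(3) by (cases "x2 <= x1") auto
   qed
   have bl: "0 <= u t" "u s <= l" using u_in[of s] u_in[of t] st by auto
   have "curve_length io s t <= curve_length ps (u t) (u s)" by (rule reparam_le[where \<phi>=u]) (use u_in sub_st m im in \<open>auto simp: monotone_on_def\<close>)
   moreover have "curve_length ps (u t) (u s) <= curve_length io s t"
   proof (rule reparam_le[where \<phi>=v])
    fix y assume "y : {u t..u s}"
    then obtain x where x: "x : {s..t}" "y = u x" using im by blast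
    then show "ps y = io (v y)" using u_in[of x] vu sub_st by auto
   next
    have "v ` {u t..u s} <= {s..t}" unfolding im[symmetric] using vu by auto
    then show "mono_on {u t..u s} v & v ` {u t..u s} <= {s..t} | antimono_on {u t..u s} v & v ` {u t..u s} <= {s..t}" using vm by blast
   qed
   ultimately have "ennreal (t - s) = ennreal (u s - u t)" using lenio[of s t] lenps[of "u t" "u s"] st bl lt by simp
   then show ?thesis using st lt by simp
  qed
 qed simp
 \<comment> \<open>The sign in \<open>len\<close> could depend on the pair of points. At the pair
   \<open>c\<close>, \<open>d\<close> it decides for all: the increments over \<open>[c,x]\<close>
   and \<open>[x,d]\<close> must add up to the full length in absolute value.\<close>
 have "(ALL x:{c..d}. u x = 1 * x + (u c - c)) | (ALL x:{c..d}. u x = (- 1) * x + (u c + c))"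
 proof (cases "u d - u c = d - c")
  case True
  have "u x = 1 * x + (u c - c)" if "x : {c..d}" for x using len[of c x] len[of x d] True that cd by auto
  then show ?thesis by blast
 next
  case False
  then have "u c - u d = d - c" using len[of c d] cd by auto
  then have "u x = (- 1) * x + (u c + c)" if "x : {c..d}" for x using len[of c x] len[of x d] that cd by auto
  then show ?thesis by blast
 qed
 then show ?thesis
 proof
  assume *: "ALL x:{c..d}. u x = 1 * x + (u c - c)"
  show ?thesis
  proof (intro exI conjI ballI)
   show "1 = (1::real) | 1 = - (1::real)" by simp
   fix x assume x: "x : {c..d}"
   show "1 * x + (u c - c) : {0..l}" "ps (1 * x + (u c - c)) = io x" using u_in[OF x] bspec[OF * x] by simp_all
  qed
 next
  assume *: "ALL x:{c..d}. u x = (- 1) * x + (u c + c)"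
  show ?thesis
  proof (intro exI conjI ballI)
   show "- 1 = (1::real) | - 1 = - (1::real)" by simp
   fix x assume x: "x : {c..d}"
   show "- 1 * x + (u c + c) : {0..l}" "ps (- 1 * x + (u c + c)) = io x" using u_in[OF x] bspec[OF * x] by simp_all
  qed
 qed
qed

subsection \<open>Arcs in finite metric graphs\<close>

lemma stopped_cases:
 assumes cl: "closed {s. 0 <= s & w s : A}" and t: "0 <= t"
 obtains r where "0 <= r" "r <= t" "!!s. 0 <= s ==> s < r ==> w s ~: A" "r = t | w r : A" "stopped A w t = w r" using cl t
proof (cases rule: hit_cases)
 case stay
 then show ?thesis using that[of t] t by (simp add: stopped_hit)
next
 case hit
 then show ?thesis using that[of "hit A t w"] by (simp add: stopped_hit)
qed

lemma stopped_eqI: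
 assumes "0 <= r" "r <= t" "!!s. 0 <= s ==> s < r ==> w s ~: A" "r = t | w r : A"
 shows "stopped A w t = w r"
proof -
 have "hit A t w = r" by (rule hit_eqI) (simp_all add: assms)
 then show ?thesis by (simp add: stopped_hit)
qed

text \<open>Allows the behaviour in a gap to be read off the process stopped only at the ends of its
  edge, which is what \<open>brownian_inside_edge\<close> describes.\<close>

lemma stopped_stopped:
 assumes clB: "closed {s. 0 <= s & w s : B}" and AB: "A <= B" and t: "0 <= t"
 shows "stopped B (\<lambda>t\<in>{0..}. stopped A w t) t = stopped B w t"
proof -
 obtain r where r: "0 <= r" "r <= t" and before: "!!s. 0 <= s ==> s < r ==> w s ~: B"
  and at: "r = t | w r : B" and st: "stopped B w t = w r" using stopped_cases[OF clB t] by metis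
 have same: "stopped A w s = w s" if s: "0 <= s" "s <= r" for s
 proof (rule stopped_stay[OF _ s(1)])
  fix s' assume "0 <= s'" "s' < s"
  then have "w s' ~: B" using s(2) by (intro before) simp_all
  then show "w s' ~: A" using AB by blast
 qed
 have "stopped B (\<lambda>t\<in>{0..}. stopped A w t) t = (\<lambda>t\<in>{0..}. stopped A w t) r"
 proof (rule stopped_eqI[OF r])
  show "(\<lambda>t\<in>{0..}. stopped A w t) s ~: B" if "0 <= s" "s < r" for s using before[OF that] same[of s] that by simp
  show "r = t | (\<lambda>t\<in>{0..}. stopped A w t) r : B" using at same[of r] r by simp
 qed
 then show ?thesis using same[of r] r st by simp
qed

lemma stopped_restrict:
 assumes "0 <= t"
 shows "stopped A (\<lambda>u\<in>{0..}. w u) t = stopped A w t"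
proof -
 have "{t. 0 <= t & (\<lambda>u\<in>{0..}. w u) t : A} = {t. 0 <= t & w t : A}" by (auto simp: restrict_def)
 then have "hit A t (\<lambda>u\<in>{0..}. w u) = hit A t w" by (simp only: hit_def hitting_time_def)
 then show ?thesis using hit_nonneg[of A t w] by (simp add: stopped_hit)
qed

lemma measurable_path_image:
 fixes S :: "'a::metric_space set" and T :: "'b::metric_space set"
 assumes f: "continuous_on S f" "f ` S <= T"
 shows "(%w. \<lambda>t\<in>{0..}. f (w t)) : path_space S ->> path_space T"
proof (rule into_paths)
 have fm: "f : rborel S ->> rborel T" by (rule measurable_restrict_space2)
    (use f in \<open>auto simp: space_restrict_space intro!: borel_measurable_continuous_on_restrict\<close>)
 show "(%w. f (w t)) : path_space S ->> rborel T" if "0 <= t" for t by (rule measurable_compose[OF measurable_eval[OF that] fm])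
 show "continuous_on {0..} (%t. f (w t))" if "w : space (path_space S)" for w by (rule continuous_on_compose2[OF f(1) path_cont[OF that]]) (use path_space_in[OF that] in auto)
qed

lemma measurable_stopped_image:
 fixes S :: "'a::metric_space set" and T :: "'b::metric_space set"
 assumes f: "continuous_on S f" "f ` S <= T" and A: "closedin (top_of_set T) (T Int A)"
 shows "(%w. \<lambda>t\<in>{0..}. stopped A (%u. f (w u)) t) : path_space S ->> path_space T"
proof -
 have eq: "(%w. \<lambda>t\<in>{0..}. stopped A (%u. f (w u)) t) = (%w. \<lambda>t\<in>{0..}. stopped A (\<lambda>t\<in>{0..}. f (w t)) t)" by (rule ext, rule restrict_ext) (simp only: stopped_restrict atLeast_iff)
 show ?thesis unfolding eq by (rule measurable_compose[OF measurable_path_image[OF f] stopped_path_meas[OF A]])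
qed

text \<open>A statement about single paths: until \<open>u\<close> leaves \<open>(c,d)\<close> its
  affine image stays strictly between 0 and \<open>l\<close>, so neither the stopping at
  \<open>{0, l}\<close> nor the truncation has acted.\<close>

lemma (in open_arc) stopped_chart:
 fixes ps :: "real => 'a"
 assumes cd: "a <= c" "c < d" "d <= b" and sg: "sg = 1 | sg = - 1"
  and ps: "!!x. x : {c..d} ==> sg * x + q : {0..l} & ps (sg * x + q) = io x"
  and u: "continuous_on {0..} u" "u 0 : {c<..<d}" and t: "0 <= t"
  and y: "!!s. 0 <= s ==> y s = sg * u s + q"
  and g: "!!s. 0 <= s ==> g s = ps (max 0 (min l (stopped {0, l} y s)))"
 shows "stopped (- io ` {c<..<d}) g t = io (max c (min d (stopped (- {c<..<d}) u t)))"
proof -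
 have sub: "{c<..<d} <= {a..b}" using cd by auto
 have "u : {0..} \<rightarrow> UNIV" by simp
 have "closed ({0..} Int u -` (- {c<..<d}))" by (rule continuous_closed_preimage[OF u(1)]) (auto simp: closed_Compl)
 also have "{0..} Int u -` (- {c<..<d}) = {s. 0 <= s & u s : - {c<..<d}}" by auto
 finally have clu: "closed {s. 0 <= s & u s : - {c<..<d}}" .
 obtain r where r: "0 <= r" "r <= t" and before0: "!!s. 0 <= s ==> s < r ==> u s ~: - {c<..<d}"
  and at: "r = t | u r : - {c<..<d}" and st: "stopped (- {c<..<d}) u t = u r" using stopped_cases[OF clu t] by metis
 have before: "u s : {c<..<d}" if "0 <= s" "s < r" for s using before0[OF that] by blast
 have ur: "u r : {c..d}"
 proof (cases "u r : {c<..<d}")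
  case False
  from exit_at_boundary[OF u(1) r(1) False before u(2)] show ?thesis using cd by auto
 qed auto
 have us: "u s : {c..d}" if "0 <= s" "s <= r" for s
 proof (cases "s < r")
  case True
  from before[OF that(1) this] show ?thesis by auto
 qed (use ur that in simp)
 have inner: "sg * x + q : {0<..<l}" if "x : {c<..<d}" for x using ps[of c] ps[of d] sg that cd by auto
 have ys: "stopped {0, l} y s = y s" if s: "0 <= s" "s <= r" for s
 proof (rule stopped_stay[OF _ s(1)])
  fix s' assume s': "0 <= s'" "s' < s"
  have "u s' : {c<..<d}" by (rule before[OF s'(1)]) (use s s' in simp)
  from inner[OF this] show "y s' ~: {0, l}" using y[OF s'(1)] by auto
 qed
 have gs: "g s = io (u s)" if s: "0 <= s" "s <= r" for s
 proof -
  have "y s : {0..l}" "ps (y s) = io (u s)" using ps[OF us[OF s]] y[OF s(1)] by auto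
  moreover from this(1) have "max 0 (min l (y s)) = y s" by auto
  ultimately show ?thesis using g[OF s(1)] ys[OF s] by simp
 qed
 have "stopped (- io ` {c<..<d}) g t = g r"
 proof (rule stopped_eqI[OF r])
  show "g s ~: - io ` {c<..<d}" if "0 <= s" "s < r" for s using gs[of s] before[OF that] that by simp
  have "u r : {a..b}" using ur cd by auto
  from io_mem_iff[OF this sub] show "r = t | g r : - io ` {c<..<d}" using at gs[of r] r by auto
 qed
 also have "... = io (max c (min d (stopped (- {c<..<d}) u t)))" using gs[of r] r ur st by auto
 finally show ?thesis .
qed

lemma fmg_edge:
 assumes "finite_metric_graph G" "e : edges G"
 shows "0 < len G e" "continuous_on {0..len G e} (chart G e)" "inj_on (chart G e) {0..len G e}"
  "chart G e ` {0<..<len G e} = e" "ends G e <= verts G" "e Int verts G = {}" using assms unfolding finite_metric_graph_def by blast+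

lemma chart_in:
 assumes G: "finite_metric_graph G" "e : edges G" and s: "s : {0..len G e}"
 shows "chart G e s : e | (chart G e s : verts G & (s = 0 | s = len G e))" "chart G e s : points G"
proof -
 show *: "chart G e s : e | (chart G e s : verts G & (s = 0 | s = len G e))"
 proof (cases "s : {0<..<len G e}")
  case True
  then have "chart G e s : chart G e ` {0<..<len G e}" by (rule imageI)
  then show ?thesis unfolding fmg_edge(4)[OF G] ..
 next
  case False
  then have "s = 0 | s = len G e" using s by auto
  moreover have "chart G e 0 : verts G" "chart G e (len G e) : verts G" using fmg_edge(5)[OF G] by (auto simp: ends_def)
  ultimately show ?thesis by auto
 qed
 then show "chart G e s : points G" using G(2) by (auto simp: points_def)
qed

locale graph_arc = open_arc "points G" a b io for G :: "'a::metric_space mgraph" and a b io +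
 fixes P :: "'a => (real => 'a) measure" and MW :: "'w measure" and W :: "real => 'w => real" and x0 :: real
 assumes graph: "finite_metric_graph G" and bm: "graph_brownian_motion G P"
  and chart_len: "!!e s t. e : edges G ==> 0 <= s ==> s <= t ==> t <= len G e ==> curve_length (chart G e) s t = ennreal (t - s)"
  and io_len: "!!s t. a <= s ==> s <= t ==> t <= b ==> curve_length io s t = ennreal (t - s)"
  and W: "real_brownian_motion x0 MW W"

sublocale graph_arc \<subseteq> path_markov "points G" P using bm by unfold_locales (simp add: graph_brownian_motion_def)

context graph_arc
begin

definition "V = {x : {a<..<b}. io x : verts G}"

text \<open>All linear motions in the comparison are affine images of the given \<open>W\<close>, so
  their existence comes with the hypotheses.\<close>

definition "Q z = process_law UNIV MW (%t om. W t om + (z - x0))"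

lemma V: "finite V" "V <= {a<..<b}"
proof -
 have "inj_on io V" by (rule inj_on_subset[OF io_inj]) (auto simp: V_def)
 moreover have "finite (io ` V)" by (rule finite_subset[of _ "verts G"]) (use graph in \<open>auto simp: V_def finite_metric_graph_def\<close>)
 ultimately show "finite V" by (simp add: finite_image_iff)
qed (auto simp: V_def)

lemma W_shift: "real_brownian_motion z MW (%t om. W t om + (z - x0))" using rbm_affine[OF W, of 1 "z - x0"] by simp

lemma linear_bm_Q: "lbm (Q z) z" unfolding Q_def by (rule lbm_law[OF W_shift])

text \<open>A gap is connected and free of vertices. Finitely many closed edges cover it, and a
  closed edge meets the union of the others only at vertices, so the gap stays in one edge. There
  \<open>arc_length_chart\<close> compares the parametrisations.\<close>

lemma edge_gap:
 assumes cd: "a <= c" "c < d" "d <= b" and no: "{c<..<d} Int V = {}"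
 shows "EX e:edges G. \<exists>sg q. (sg = 1 | sg = - 1) & (ALL x:{c..d}. sg * x + q : {0..len G e} & chart G e (sg * x + q) = io x)"
proof -
 let ?K = "%e. chart G e ` {0..len G e}" and ?U = "io ` {c<..<d}"
 have sub: "{c<..<d} <= {a..b}" "{c<..<d} <= {a<..<b}" "{c..d} <= {a..b}" using cd by auto
 have clK: "closed (?K e)" if "e : edges G" for e by (intro compact_imp_closed compact_continuous_image fmg_edge[OF graph that] compact_Icc)
 have nv: "p ~: verts G" if "p : ?U" for p
 proof
  assume v: "p : verts G"
  from that obtain x where x: "x : {c<..<d}" "p = io x" by blast
  then have "x : V" using v sub(2) by (auto simp: V_def)
  with no x(1) show False by blast
 qed
 have mem: "p : e" if e: "e : edges G" and p: "p : ?K e" "p ~: verts G" for e p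
 proof -
  from p(1) obtain s where "s : {0..len G e}" "p = chart G e s" by blast
  with chart_in(1)[OF graph e this(1)] p(2) show ?thesis by auto
 qed
 have Kin: "e <= ?K e" if "e : edges G" for e
 proof -
  have "chart G e ` {0<..<len G e} <= ?K e" by (rule image_mono) auto
  then show ?thesis unfolding fmg_edge(4)[OF graph that] .
 qed
 have cover: "EX e:edges G. p : e" if "p : ?U" for p
 proof -
  have "p : points G" using that sub(1) io_S by blast
  then show ?thesis using nv[OF that] by (auto simp: points_def)
 qed
 define m where "m = (c + d) / 2"
 have mU: "io m : ?U" using cd by (auto simp: m_def)
 obtain e where e: "e : edges G" "io m : e" using cover[OF mU] by blast
 define C where "C = (\<Union>e'\<in>edges G - {e}. ?K e')"
 have clC: "closed C" unfolding C_def by (rule closed_UN) (use graph clK in \<open>auto simp: finite_metric_graph_def\<close>)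
 have conn: "connected ?U" by (intro connected_continuous_image continuous_on_subset[OF io_cont sub(1)]) simp
 have dis: "?K e Int C Int ?U = {}"
 proof (rule equals0I)
  fix p assume p: "p : ?K e Int C Int ?U"
  then obtain e' where e': "e' : edges G" "e' ~= e" "p : ?K e'" by (auto simp: C_def)
  have pn: "p ~: verts G" by (rule nv) (use p in blast)
  have "p : e" "p : e'" using mem[OF e(1) _ pn] mem[OF e'(1,3) pn] p by blast+
  moreover have "disjnt e e'" using graph e(1) e'(1,2) unfolding finite_metric_graph_def pairwise_def by metis
  ultimately show False by (auto simp: disjnt_iff)
 qed
 have UKC: "?U <= ?K e Un C"
 proof
  fix p assume "p : ?U"
  from cover[OF this] obtain e' where e': "e' : edges G" "p : e'" by blast
  then have "p : ?K e'" using Kin by blast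
  then show "p : ?K e Un C" using e'(1) by (cases "e' = e") (auto simp: C_def)
 qed
 have "?K e Int ?U = {} | C Int ?U = {}" by (rule connected_closedD[OF conn dis UKC clK[OF e(1)] clC])
 moreover have "io m : ?K e Int ?U" using mU e Kin by blast
 ultimately have UK: "?U <= ?K e" using UKC by blast
 have "io ` closure {c<..<d} <= ?K e" by (rule image_closure_subset) (use cd sub UK clK[OF e(1)] in \<open>auto intro: continuous_on_subset[OF io_cont]\<close>)
 then have sub': "io ` {c..d} <= ?K e" using cd by simp
 have "\<exists>sg q. (sg = 1 | sg = - 1) & (ALL x:{c..d}. sg * x + q : {0..len G e} & chart G e (sg * x + q) = io x)" by (rule arc_length_chart[OF cd(2) continuous_on_subset[OF io_cont sub(3)] inj_on_subset[OF io_inj sub(3)]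
     fmg_edge(2,3)[OF graph e(1)] sub'])
    (use cd in \<open>auto intro!: io_len chart_len e(1)\<close>)
 then show ?thesis using e(1) by blast
qed

text \<open>The ends of the edge lie outside the open gap, so stopping there first is harmless.
  \<open>brownian_inside_edge\<close> then gives the law, and \<open>stopped_chart\<close> rewrites
  it path by path.\<close>

lemma gap_law:
 assumes cd: "a <= c" "c < d" "d <= b" and no: "{c<..<d} Int V = {}" and z: "z : {c<..<d}" and t: "0 <= t"
  and H: "H : bmeas (rborel (points G))" "!!y. y : points G ==> \<bar>H y\<bar> <= (C::real)"
 shows "(\<integral>w. H (stopped (- io ` {c<..<d}) w t) \<partial>P (io z))
    = (\<integral>w. H (io (max c (min d (stopped (- {c<..<d}) w t)))) \<partial>Q z)"
proof -
 let ?S = "points G" and ?B = "- io ` {c<..<d}" and ?D = "- {c<..<d}"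
 obtain e sg q where e: "e : edges G" and sg: "sg = 1 | sg = - 1"
  and ps: "!!x. x : {c..d} ==> sg * x + q : {0..len G e} & chart G e (sg * x + q) = io x" using edge_gap[OF cd no] by blast
 note ed = fmg_edge[OF graph e]
 define l where "l = len G e"
 define s0 where "s0 = sg * z + q"
 have s0: "s0 : {0<..<l}" using ps[of c] ps[of d] sg z cd by (auto simp: s0_def l_def)
 have chart_s0: "chart G e s0 = io z" using ps[of z] z by (auto simp: s0_def)
 have zS: "io z : ?S" using z cd by (intro io_in) auto
 \<comment> \<open>The image of the translate of \<open>W\<close> started at \<open>z\<close> under
   the affine map from arc parameter to edge parameter; it therefore starts at \<open>s0\<close>,
   the edge parameter of \<open>io z\<close>.\<close>
 define Wq where "Wq = (%t om. sg * W t om + (sg * (z - x0) + q))"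
 have Wq: "real_brownian_motion s0 MW Wq"
 proof -
  have "sg * x0 + (sg * (z - x0) + q) = s0" by (simp add: s0_def algebra_simps)
  then show ?thesis using rbm_affine[OF W sg, of "sg * (z - x0) + q"] by (simp add: Wq_def)
 qed
 obtain Q' where Q': "real_brownian_motion s0 Q' (%t w. w t)"
  and Q'_law: "!!(N :: (real => 'a) measure) g. g : path_space (UNIV :: real set) ->> N ==>
   g : Q' ->> N & distr Q' N g = distr (process_law UNIV MW Wq) N g" by (rule canonical_brownian_motion[OF Wq]) blast
 let ?g = "%w. \<lambda>t\<in>{0..}. chart G e (max 0 (min l (stopped {0, l} w t)))"
 have cont: "continuous_on UNIV (%x. chart G e (max 0 (min l x)))" by (rule continuous_on_compose2[OF ed(2)]) (use ed(1) in \<open>auto intro!: continuous_intros simp: l_def\<close>)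
 have img: "range (%x. chart G e (max 0 (min l x))) <= ?S"
 proof
  fix p assume "p : range (%x. chart G e (max 0 (min l x)))"
  then obtain x where x: "p = chart G e (max 0 (min l x))" by blast
  show "p : ?S" unfolding x by (rule chart_in(2)[OF graph e]) (use ed(1) in \<open>auto simp: l_def\<close>)
 qed
 have cl2: "closedin (top_of_set UNIV) (UNIV Int {0, l})" by simp
 have g_eq: "?g = (%w. \<lambda>t\<in>{0..}. chart G e (max 0 (min l ((\<lambda>t\<in>{0..}. stopped {0, l} w t) t))))" by (intro ext) (simp add: restrict_def)
 have gm: "?g : path_space UNIV ->> path_space ?S" unfolding g_eq by (rule measurable_compose[OF stopped_path_meas[OF cl2] measurable_path_image[OF cont img]])
 let ?E = "ends G e"
 have EB: "?E <= ?B"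
 proof
  fix p assume p: "p : ?E"
  show "p : ?B"
  proof
   assume "p : io ` {c<..<d}"
   then obtain x where x: "x : {c<..<d}" "p = io x" by blast
   then have "x : V" using p ed(5) cd by (auto simp: V_def)
   with no x show False by blast
  qed
 qed
 have Bc: "closedin (top_of_set ?S) (?S Int ?B)" by (rule closedin_arc[OF cd(1,3)])
 have Ec: "closedin (top_of_set ?S) (?S Int ?E)" by (rule closedin_closed_Int) (auto simp: ends_def intro: finite_imp_closed)
 define h where "h = (%w. H (stopped ?B w t))"
 have hm: "h : bmeas (path_space ?S)" unfolding h_def by (rule stopped_fun_meas[OF Bc H])
 have Em: "(%w. \<lambda>t\<in>{0..}. stopped ?E w t) : P (io z) ->> path_space ?S" unfolding P_meas_iff[OF zS] by (rule stopped_path_meas[OF Ec])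
 have Wqm: "(%om. \<lambda>t\<in>{0..}. Wq t om) : MW ->> path_space UNIV" using Wq by (intro cprocD(2)) (simp add: real_brownian_motion_def)
 have Wz: "(%om. \<lambda>t\<in>{0..}. W t om + (z - x0)) : MW ->> path_space UNIV" using W_shift[of z] by (intro cprocD(2)) (simp add: real_brownian_motion_def)
 have km: "(%w. H (io (max c (min d (stopped ?D w t))))) : bmeas (path_space UNIV)"
 proof (rule stopped_fun_meas)
  show "closedin (top_of_set UNIV) (UNIV Int ?D)" by (simp add: closed_Compl)
  show "(%x. H (io (max c (min d x)))) : bmeas (rborel UNIV)" by (rule clamp_measurable[OF cd H(1)])
  show "\<bar>H (io (max c (min d x)))\<bar> <= C" for x using cd by (intro H(2) io_in) auto
 qed
 have "(\<integral>w. h w \<partial>P (io z)) = (\<integral>w. h (\<lambda>t\<in>{0..}. stopped ?E w t) \<partial>P (io z))"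
 proof (rule integral_congr[OF refl])
  fix w assume "w : space (P (io z))"
  then have w: "w : space (path_space ?S)" by (simp add: space_P[OF zS])
  show "h w = h (\<lambda>t\<in>{0..}. stopped ?E w t)" unfolding h_def by (simp only: stopped_stopped[OF closed_hits[OF w Bc] EB t])
 qed
 also have "... = (\<integral>w. h w \<partial>process_law ?S (P (io z)) (%t w. stopped ?E w t))" unfolding process_law_def by (rule integral_distr[OF Em hm, symmetric])
 also have "process_law ?S (P (io z)) (%t w. stopped ?E w t)
   = process_law ?S Q' (%t w. chart G e (max 0 (min l (stopped {0, l} w t))))" using bm e s0 Q' unfolding graph_brownian_motion_def brownian_inside_edge_def l_def chart_s0[symmetric] by blast
 also have "... = distr (process_law UNIV MW Wq) (path_space ?S) ?g" using Q'_law[OF gm] unfolding process_law_def by blast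
 also have "(\<integral>w. h w \<partial>distr (process_law UNIV MW Wq) (path_space ?S) ?g) = (\<integral>w. h (?g w) \<partial>process_law UNIV MW Wq)" by (rule integral_distr[OF _ hm]) (use gm in \<open>simp add: process_law_def\<close>)
 also have "... = (\<integral>om. h (?g (\<lambda>t\<in>{0..}. Wq t om)) \<partial>MW)" unfolding process_law_def by (rule integral_distr[OF Wqm measurable_compose[OF gm hm]])
 also have "... = (\<integral>om. H (io (max c (min d (stopped ?D (\<lambda>t\<in>{0..}. W t om + (z - x0)) t)))) \<partial>MW)"
 proof (rule integral_congr[OF refl])
  fix om assume om: "om : space MW"
  have u: "continuous_on {0..} (\<lambda>t\<in>{0..}. W t om + (z - x0))" by (rule path_cont[OF measurable_space[OF Wz om]])
  have "W 0 om = x0" using W om by (simp add: real_brownian_motion_def)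
  then have u0: "(\<lambda>t\<in>{0..}. W t om + (z - x0)) 0 : {c<..<d}" using z by simp
  have "stopped ?B (?g (\<lambda>t\<in>{0..}. Wq t om)) t = io (max c (min d (stopped ?D (\<lambda>t\<in>{0..}. W t om + (z - x0)) t)))"
  proof (rule stopped_chart[OF cd sg _ u u0 t])
   show "sg * x + q : {0..l} & chart G e (sg * x + q) = io x" if "x : {c..d}" for x unfolding l_def by (rule ps[OF that])
   show "(\<lambda>t\<in>{0..}. Wq t om) s = sg * (\<lambda>t\<in>{0..}. W t om + (z - x0)) s + q" if "0 <= s" for s using that by (simp add: Wq_def algebra_simps)
   show "?g (\<lambda>t\<in>{0..}. Wq t om) s = chart G e (max 0 (min l (stopped {0, l} (\<lambda>t\<in>{0..}. Wq t om) s)))" if "0 <= s" for s using that by (simp only: restrict_apply' atLeast_iff)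
  qed
  then show "h (?g (\<lambda>t\<in>{0..}. Wq t om)) = H (io (max c (min d (stopped ?D (\<lambda>t\<in>{0..}. W t om + (z - x0)) t))))" unfolding h_def by (simp only:)
 qed
 also have "... = (\<integral>w. H (io (max c (min d (stopped ?D w t)))) \<partial>Q z)" unfolding Q_def process_law_def by (rule integral_distr[OF Wz km, symmetric])
 finally show ?thesis by (simp add: h_def)
qed

end

text \<open>A vertex is not a point of an open edge, so a unit-speed run from \<open>v\<close>
  begins at an end of \<open>e\<close>, and the range of the parameter forces its direction.
  Injectivity of the chart tells the two ends apart.\<close>

lemma leg_param:
 assumes G: "finite_metric_graph G" "e : edges G" and v: "v : verts G" and dl: "0 < dl"
  and sg: "sg = 1 | sg = - (1::real)"
  and k: "!!s. s : {0..dl} ==> p + sg * s : {0..len G e} & chart G e (p + sg * s) = k s" and k0: "k 0 = v"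
 shows "e : incident G v" "dl <= len G e" "!!s. s : {0..dl} ==> leg G v e s = k s"
proof -
 note ed = fmg_edge[OF G]
 have p: "p : {0..len G e}" "chart G e p = v" using k[of 0] k0 dl by auto
 have "chart G e p ~: e" using v ed(6) unfolding p(2) by blast
 then have p0: "p = 0 | p = len G e" using chart_in(1)[OF G p(1)] by blast
 then show "e : incident G v" using G(2) p(2) by (auto simp: incident_def ends_def)
 have kdl: "p + sg * dl : {0..len G e}" using k[of dl] dl by auto
 from p0 show "dl <= len G e" using kdl sg dl by auto
 show "leg G v e s = k s" if s: "s : {0..dl}" for s using p0
 proof
  assume "p = 0"
  then have "sg = 1" using kdl sg dl by auto
  then show ?thesis using k[OF s] \<open>p = 0\<close> p(2) by (simp add: leg_def)
 next
  assume pl: "p = len G e"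
  then have "sg = - 1" using kdl sg dl by auto
  moreover have "chart G e 0 ~= v"
  proof
   assume "chart G e 0 = v"
   then have "chart G e 0 = chart G e (len G e)" using p(2) pl by simp
   then have "0 = len G e" by (rule inj_onD[OF ed(3)]) (use ed(1) in auto)
   then show False using ed(1) by simp
  qed
  ultimately show ?thesis using k[OF s] pl by (simp add: leg_def)
 qed
qed

lemma leg_range:
 assumes G: "finite_metric_graph G" and e: "e : incident G v" and s: "s : {0..len G e}"
 shows "leg G v e s : chart G e ` {0..len G e}" "0 < s ==> s < len G e ==> leg G v e s : e" "leg G v e 0 = v"
  "continuous_on {0..len G e} (leg G v e)"
proof -
 have eG: "e : edges G" "v : ends G e" using e by (auto simp: incident_def)
 note ed = fmg_edge[OF G eG(1)]
 show "leg G v e s : chart G e ` {0..len G e}" using s by (auto simp: leg_def)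
 have "leg G v e s : chart G e ` {0<..<len G e}" if "0 < s" "s < len G e" using that by (auto simp: leg_def)
 then show "0 < s ==> s < len G e ==> leg G v e s : e" unfolding ed(4) .
 show "leg G v e 0 = v" using eG(2) by (auto simp: leg_def ends_def)
 have "continuous_on {0..len G e} (%s. chart G e (len G e - s))" by (rule continuous_on_compose2[OF ed(2)]) (auto intro!: continuous_intros)
 then show "continuous_on {0..len G e} (leg G v e)" using ed(2) by (cases "chart G e 0 = v") (simp_all add: leg_def[abs_def])
qed

context graph_arc
begin

text \<open>The radius \<open>dl\<close> avoids the other vertices and the ends of the arc, so each
  side of \<open>v\<close> is a gap and lies in a single edge. That there is no third edge comes
  from openness of the arc in the graph.\<close>

lemma two_legs:
 assumes v: "v : V"
 obtains dl e1 e2 where "0 < dl" "a <= v - dl" "v + dl <= b" "incident G (io v) = {e1, e2}" "e1 ~= e2"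
  "dl <= len G e1" "dl <= len G e2"
  "ALL s:{0..dl}. leg G (io v) e1 s = io (v + s)" "ALL s:{0..dl}. leg G (io v) e2 s = io (v - s)"
proof -
 have vG: "io v : verts G" and vab: "v : {a<..<b}" using v by (auto simp: V_def)
 obtain dl0 where dl0: "dl0 > 0" "!!x. x : V ==> x ~= v ==> dl0 <= dist v x" using finite_set_avoid[OF V(1), of v] by blast
 define dl where "dl = min dl0 (min (v - a) (b - v))"
 have dl: "0 < dl" "dl <= dl0" "a <= v - dl" "v + dl <= b" using dl0(1) vab by (auto simp: dl_def)
 have no: "x ~: V" if "x ~= v" "\<bar>x - v\<bar> < dl" for x
 proof
  assume "x : V"
  from dl0(2)[OF this that(1)] show False using that(2) dl(2) by (simp add: dist_real_def abs_minus_commute)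
 qed
 have no1: "{v<..<v + dl} Int V = {}"
 proof (rule equals0I)
  fix x assume "x : {v<..<v + dl} Int V"
  then show False using no[of x] by auto
 qed
 have no2: "{v - dl<..<v} Int V = {}"
 proof (rule equals0I)
  fix x assume "x : {v - dl<..<v} Int V"
  then show False using no[of x] by auto
 qed
 have av: "a <= v" "v < v + dl" "v - dl < v" "v <= b" using vab dl by auto
 obtain e1 sg1 q1 where e1: "e1 : edges G" "sg1 = 1 | sg1 = - 1"
  and ps1: "!!x. x : {v..v + dl} ==> sg1 * x + q1 : {0..len G e1} & chart G e1 (sg1 * x + q1) = io x" using edge_gap[OF av(1,2) dl(4) no1] by blast
 obtain e2 sg2 q2 where e2: "e2 : edges G" "sg2 = 1 | sg2 = - 1"
  and ps2: "!!x. x : {v - dl..v} ==> sg2 * x + q2 : {0..len G e2} & chart G e2 (sg2 * x + q2) = io x" using edge_gap[OF dl(3) av(3,4) no2] by blast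
 have k1: "(sg1 * v + q1) + sg1 * s : {0..len G e1} & chart G e1 ((sg1 * v + q1) + sg1 * s) = io (v + s)" if "s : {0..dl}" for s
 proof -
  have eq: "sg1 * v + q1 + sg1 * s = sg1 * (v + s) + q1" by (simp add: algebra_simps)
  show ?thesis unfolding eq by (rule ps1) (use that in auto)
 qed
 have k2: "(sg2 * v + q2) + (- sg2) * s : {0..len G e2} & chart G e2 ((sg2 * v + q2) + (- sg2) * s) = io (v - s)" if "s : {0..dl}" for s
 proof -
  have eq: "sg2 * v + q2 + (- sg2) * s = sg2 * (v - s) + q2" by (simp add: algebra_simps)
  show ?thesis unfolding eq by (rule ps2) (use that in auto)
 qed
 have msg2: "- sg2 = 1 | - sg2 = - 1" using e2(2) by auto
 have z1: "io (v + 0) = io v" and z2: "io (v - 0) = io v" by simp_all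
 note l1 = leg_param[OF graph e1(1) vG dl(1) e1(2) k1 z1]
 note l2 = leg_param[OF graph e2(1) vG dl(1) msg2 k2 z2]
 \<comment> \<open>A common edge would make both sides the same leg, against injectivity of
   \<open>io\<close>.\<close>
 have ne: "e1 ~= e2"
 proof
  assume "e1 = e2"
  then have "io (v + dl) = io (v - dl)" using l1(3)[of dl] l2(3)[of dl] dl(1) by simp
  then have "v + dl = v - dl" by (rule inj_onD[OF io_inj]) (use dl in auto)
  then show False using dl(1) by simp
 qed
 \<comment> \<open>Points of an incident edge close to \<open>v\<close> lie in the open arc and are
   not vertices, hence belong to \<open>e1\<close> or \<open>e2\<close>; distinct edges are
   disjoint.\<close>
 have inc: "e : {e1, e2}" if e: "e : incident G (io v)" for e
 proof -
  have eG: "e : edges G" using e by (simp add: incident_def)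
  note ed = fmg_edge[OF graph eG]
  have "openin (top_of_set (points G)) (points G - points G Int - io ` {v - dl<..<v + dl})" by (rule openin_diff[OF _ closedin_arc[OF dl(3,4)]]) simp
  moreover have "io v : points G - points G Int - io ` {v - dl<..<v + dl}" using dl(1) vab by (auto intro!: io_in)
  ultimately obtain r where r: "r > 0" "ball (io v) r Int points G <= points G - points G Int - io ` {v - dl<..<v + dl}" unfolding openin_contains_ball by blast
  have l0: "0 : {0..len G e}" using ed(1) by simp
  have "\<exists>d>0. ALL s:{0..len G e}. dist s 0 < d --> dist (leg G (io v) e s) (leg G (io v) e 0) < r" using leg_range(4)[OF graph e l0] l0 r(1) unfolding continuous_on_iff by blast
  then obtain d where d: "d > 0" "!!s. s : {0..len G e} ==> dist s 0 < d ==> dist (leg G (io v) e s) (io v) < r" unfolding leg_range(3)[OF graph e l0] by blast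
  define s where "s = min d (len G e) / 2"
  have s: "s : {0..len G e}" "0 < s" "s < len G e" "s < d" using d(1) ed(1) by (auto simp: s_def min_def)
  have ine: "leg G (io v) e s : e" by (rule leg_range(2)[OF graph e s(1,2,3)])
  have "leg G (io v) e s : ball (io v) r Int points G" using d(2)[OF s(1)] s ine eG by (auto simp: dist_commute points_def)
  then have "leg G (io v) e s : io ` {v - dl<..<v + dl}" using r(2) by blast
  then obtain x where x: "x : {v - dl<..<v + dl}" "leg G (io v) e s = io x" by blast
  have xn: "io x ~: verts G" using ine ed(6) x(2) by auto
  then have "x ~= v" using vG by auto
  have "io x : e1 | io x : e2"
  proof (cases "v < x")
   case True
   then have "x : {v..v + dl}" using x(1) by auto
   from ps1[OF this] chart_in(1)[OF graph e1(1), of "sg1 * x + q1"] xn show ?thesis by auto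
  next
   case False
   then have "x : {v - dl..v}" using x(1) by auto
   from ps2[OF this] chart_in(1)[OF graph e2(1), of "sg2 * x + q2"] xn show ?thesis by auto
  qed
  moreover have "e = e'" if "e' : edges G" "io x : e'" for e'
  proof (rule ccontr)
   assume "e ~= e'"
   then have "disjnt e e'" using graph eG that(1) unfolding finite_metric_graph_def pairwise_def by metis
   then show False using ine that(2) x(2) by (auto simp: disjnt_iff)
  qed
  ultimately show ?thesis using e1(1) e2(1) by blast
 qed
 have "incident G (io v) = {e1, e2}" using inc l1(1) l2(1) by blast
 moreover have "ALL s:{0..dl}. leg G (io v) e1 s = io (v + s)" "ALL s:{0..dl}. leg G (io v) e2 s = io (v - s)" using l1(3) l2(3) by blast+
 ultimately show ?thesis using that[OF dl(1,3,4) _ ne l1(2) l2(2)] by blast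
qed

text \<open>With these two legs the points at distance \<open>d\<close> from the vertex are
  \<open>io (v + d)\<close> and \<open>io (v - d)\<close>. Off the arc only the inserted
  \<open>r\<close> remains in the infimum.\<close>

lemma radius_arc:
 assumes v: "a <= v - dl" "v + dl <= b" and inc: "incident G (io v) = {e1, e2}"
  and leg1: "ALL s:{0..dl}. leg G (io v) e1 s = io (v + s)" and leg2: "ALL s:{0..dl}. leg G (io v) e2 s = io (v - s)"
  and r: "0 < r" "r < dl"
 shows "y : {a..b} ==> radius G (io v) r (io y) = min r \<bar>y - v\<bar>"
  and "p ~: io ` {a..b} ==> radius G (io v) r p = r"
proof -
 have D: "{d : {0..r}. EX e:incident G (io v). p = leg G (io v) e d} = {d : {0..r}. p = io (v + d) | p = io (v - d)}" for p unfolding inc using leg1 leg2 r by auto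
 show "radius G (io v) r p = r" if "p ~: io ` {a..b}"
 proof -
  have "{d : {0..r}. p = io (v + d) | p = io (v - d)} = {}" using that v r by auto
  from this show ?thesis unfolding radius_def D by (simp only: cInf_singleton)
 qed
 show "radius G (io v) r (io y) = min r \<bar>y - v\<bar>" if y: "y : {a..b}"
 proof -
  have iff: "(io y = io (v + d) | io y = io (v - d)) \<longleftrightarrow> \<bar>y - v\<bar> = d" if "d : {0..r}" for d
  proof -
   have "v + d : {a..b}" "v - d : {a..b}" using that v r by auto
   then have "io y = io (v + d) \<longleftrightarrow> y = v + d" "io y = io (v - d) \<longleftrightarrow> y = v - d" using inj_on_eq_iff[OF io_inj y] by simp_all
   then show ?thesis using that by auto
  qed
  have "{d : {0..r}. io y = io (v + d) | io y = io (v - d)} = {d : {0..r}. \<bar>y - v\<bar> = d}" using iff by blast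
  also have "... = (if \<bar>y - v\<bar> <= r then {\<bar>y - v\<bar>} else {})" by auto
  finally show ?thesis unfolding radius_def D by (simp add: cInf_eq_Min min_def)
 qed
qed

text \<open>About \<open>v\<close>, with \<open>bt = th * v + gmm\<close>, the sine is
  \<open>sin bt * cos (th * xi) + cos bt * sin (th * xi)\<close>. The even part depends on the
  radius alone, and Dynkin's formula for the reflected motion evaluates it exactly. The odd part
  leaves the ball with two opposite, equally likely values; before that it is of order
  \<open>ep\<close>, and the expected exit time tends to 0.\<close>

lemma vertex_law:
 assumes v: "v : V" and et: "0 < et" and Fm: "F : bmeas (rborel (points G))"
  and F1: "!!y. y : points G ==> \<bar>F y\<bar> <= 1" and Fio: "!!x. x : {a..b} ==> F (io x) = sin (th * x + gmm)"
 shows "\<exists>ep0>0. \<forall>ep. 0 < ep & ep < ep0 -->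
    \<bar>(\<integral>w. pot (- io ` {v - ep<..<v + ep}) (%y. if y : - io ` {v - ep<..<v + ep} then F y else (1 + th^2 / 2) * F y) w \<partial>P (io v))
     - sin (th * v + gmm)\<bar> <= et * ep"
proof -
 let ?S = "points G" and ?P = "P (io v)"
 obtain dl e1 e2 where dl: "0 < dl" "a <= v - dl" "v + dl <= b" and inc: "incident G (io v) = {e1, e2}" and ne: "e1 ~= e2"
  and len: "dl <= len G e1" "dl <= len G e2"
  and legs: "ALL s:{0..dl}. leg G (io v) e1 s = io (v + s)" "ALL s:{0..dl}. leg G (io v) e2 s = io (v - s)" by (rule two_legs[OF v]) (rule that; assumption)
 have leg1: "leg G (io v) e1 s = io (v + s)" and leg2: "leg G (io v) e2 s = io (v - s)" if "s : {0..dl}" for s using legs that by blast+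
 have vG: "io v : verts G" using v by (simp add: V_def)
 have vS: "io v : ?S" using vG by (simp add: points_def)
 interpret Pv: prob_space ?P by (rule prob_space_P[OF vS])
 have walsh: "walsh_at_vertex G P (io v)" using bm vG by (simp add: graph_brownian_motion_def)
 define mu where "mu = th^2 / 2"
 have mu0: "0 <= mu" by (simp add: mu_def)
 \<comment> \<open>Bounds what the odd part contributes before the exit, per unit of
   \<open>ep\<close>: \<open>(1 + mu) * \<bar>th\<bar>\<close> for the running value and
   \<open>\<bar>th\<bar>\<close> for the exit value subtracted from it.\<close>
 define K where "K = (2 + mu) * \<bar>th\<bar>"
 have K0: "0 <= K" using mu0 by (simp add: K_def)
 define ta where "ta = (%r. \<integral>\<^sup>+w. hitting_time {p : ?S. \<not> radius G (io v) r p < r} w \<partial>?P)"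
 have inc_ne: "incident G (io v) ~= {}" using inc by simp
 note w1 = mp[OF walsh[unfolded walsh_at_vertex_def] inc_ne]
 have "(ta \<longlongrightarrow> 0) (at_right 0)" unfolding ta_def by (rule conjunct2[OF conjunct2[OF w1]])
 moreover have "0 < ennreal (et / (K + 1))" using et K0 by simp
 ultimately have "\<forall>\<^sub>F r in at_right 0. ta r < ennreal (et / (K + 1))" by (rule order_tendstoD(2))
 then obtain r0 where r0: "r0 > 0" "!!r. 0 < r ==> r < r0 ==> ta r < ennreal (et / (K + 1))" unfolding eventually_at_right_field by blast
 have main: "\<bar>(\<integral>w. pot (- io ` {v - ep<..<v + ep}) (%y. if y : - io ` {v - ep<..<v + ep} then F y else (1 + th^2 / 2) * F y) w \<partial>?P)
     - sin (th * v + gmm)\<bar> <= et * ep" if ep: "0 < ep" "ep < dl" "ep < r0" for ep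
 proof -
  define B where "B = - io ` {v - ep<..<v + ep}"
  define R where "R = radius G (io v) ep"
  have abep: "a <= v - ep" "v + ep <= b" "v - ep < v + ep" "v : {v - ep<..<v + ep}" using dl ep by auto
  have sub: "{v - ep<..<v + ep} <= {a..b}" "{v - ep..v + ep} <= {a..b}" using abep by auto
  have Bc: "closedin (top_of_set ?S) (?S Int B)" unfolding B_def by (rule closedin_arc[OF abep(1,2)])
  note rad = radius_arc[OF dl(2,3) inc legs ep(1,2), folded R_def]
  have R_lt: "R p < ep \<longleftrightarrow> p ~: B" if "p : ?S" for p
  proof (cases "p : io ` {a..b}")
   case True
   then obtain y where y: "y : {a..b}" "p = io y" by blast
   have "p ~: B \<longleftrightarrow> y : {v - ep<..<v + ep}" using io_mem_iff[OF y(1) sub(1)] by (simp add: B_def y(2))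
   then show ?thesis using rad(1)[OF y(1)] by (auto simp: y(2))
  next
   case False
   then have "p : B" using sub(1) by (auto simp: B_def)
   then show ?thesis using rad(2)[OF False] by simp
  qed
  have R_le: "R p <= ep" for p
  proof (cases "p : io ` {a..b}")
   case True
   then obtain y where "y : {a..b}" "p = io y" by blast
   then show ?thesis using rad(1)[of y] by simp
  next
   case False
   from rad(2)[OF this] show ?thesis by simp
  qed
  have R_B: "R p = ep" if "p : ?S" "p : B" for p using R_lt[OF that(1)] R_le[of p] that(2) by auto
  have R_cont: "continuous_on ?S R"
  proof -
   have clK: "closedin (top_of_set ?S) (io ` {v - ep..v + ep})" by (rule closed_subset) (use sub io_S in \<open>auto intro!: compact_imp_closed compact_continuous_image continuous_on_subset[OF io_cont]\<close>)
   have un: "?S = io ` {v - ep..v + ep} Un (?S Int B)"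
   proof -
    have "io ` {v - ep<..<v + ep} <= io ` {v - ep..v + ep}" by (rule image_mono) auto
    moreover have "io ` {v - ep..v + ep} <= ?S" using sub io_S by blast
    ultimately show ?thesis unfolding B_def by blast
   qed
   have c1: "continuous_on (io ` {v - ep..v + ep}) R"
   proof -
    have "continuous_on (io ` {a..b}) (the_inv_into {a..b} io)" by (rule continuous_on_inv_into[OF io_cont compact_Icc io_inj])
    then have "continuous_on (io ` {v - ep..v + ep}) (%p. min ep \<bar>the_inv_into {a..b} io p - v\<bar>)" by (intro continuous_intros) (rule continuous_on_subset, use sub in auto)
    then show ?thesis
    proof (rule continuous_on_eq)
     fix p assume "p : io ` {v - ep..v + ep}"
     then obtain y where y: "y : {a..b}" "p = io y" using sub by blast
     show "min ep \<bar>the_inv_into {a..b} io p - v\<bar> = R p" using rad(1)[OF y(1)] the_inv_into_f_f[OF io_inj y(1)] by (simp add: y(2))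
    qed
   qed
   have c2: "continuous_on (?S Int B) R" by (rule continuous_on_eq[OF continuous_on_const[of _ ep]]) (use R_B in auto)
   have "continuous_on (io ` {v - ep..v + ep} Un (?S Int B)) R" by (rule continuous_on_Un_local) (use clK Bc un c1 c2 in auto)
   then show ?thesis using un by simp
  qed
  have Rm: "R : bmeas (rborel ?S)" by (rule borel_measurable_continuous_on_restrict[OF R_cont])
  have stR: "stopped {ep} (%u. R (w u)) t = R (stopped B w t)" if w: "w : space (path_space ?S)" and t: "0 <= t" for w t
  proof -
   obtain r where r: "0 <= r" "r <= t" and before: "!!s. 0 <= s ==> s < r ==> w s ~: B"
    and at: "r = t | w r : B" and st: "stopped B w t = w r" using stopped_cases[OF closed_hits[OF w Bc] t] by metis
   show ?thesis unfolding st
   proof (rule stopped_eqI[OF r])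
    show "R (w s) ~: {ep}" if "0 <= s" "s < r" for s using R_lt[OF path_space_in[OF w that(1)]] before[OF that] by auto
    show "r = t | R (w r) : {ep}" using at R_B[OF path_space_in[OF w r(1)]] by auto
   qed
  qed
  have start: "AE w in ?P. w : space (path_space ?S) & w 0 = io v" using AE_start[OF vS] AE_space by eventually_elim (simp add: space_P[OF vS])
  interpret Q0: lbm "Q 0" 0 by (rule linear_bm_Q)
  let ?D = "- {- ep<..<ep}"
  have Dc: "closedin (top_of_set UNIV) (UNIV Int ?D)" by (simp add: closed_Compl)
  \<comment> \<open>The integrand of Dynkin's formula for the cosine as a function of the radius,
    with the factor \<open>1 + mu\<close> strictly inside the ball.\<close>
  define k where "k s = (if s < ep then (1 + mu) * cos (th * s) else cos (th * s))" for s :: real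
  have km [measurable]: "k : bmeas borel" unfolding k_def by measurable
  have kb: "\<bar>k s\<bar> <= 2 + mu" for s
  proof -
   have "(1 + mu) * \<bar>cos (th * s)\<bar> <= (1 + mu) * 1" using mu0 by (intro mult_left_mono) auto
   also have "... <= 2 + mu" by simp
   finally have "(1 + mu) * \<bar>cos (th * s)\<bar> <= 2 + mu" .
   moreover have "\<bar>cos (th * s)\<bar> <= 2 + mu" using mu0 abs_cos_le_one[of "th * s"] by linarith
   moreover have "\<bar>k s\<bar> = (if s < ep then (1 + mu) * \<bar>cos (th * s)\<bar> else \<bar>cos (th * s)\<bar>)" using mu0 by (simp add: k_def abs_mult)
   ultimately show ?thesis by (cases "s < ep") simp_all
  qed
  have kR: "(%y. k (R y)) : bmeas (rborel ?S)" by (rule measurable_compose[OF Rm km])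
  have kRb: "\<bar>k (R y)\<bar> <= 2 + mu" for y by (rule kb)
  have kabs: "(%x. k \<bar>x\<bar>) : bmeas (rborel (UNIV :: real set))" by (rule measurable_restrict_space1) measurable
  have kabsb: "\<bar>k \<bar>x\<bar>\<bar> <= 2 + mu" for x by (rule kb)
  have law: "(\<integral>w. k (R (stopped B w t)) \<partial>?P) = (\<integral>w. k \<bar>stopped ?D w t\<bar> \<partial>Q 0)" if t: "0 <= t" for t
  proof -
   obtain Q' where Q': "real_brownian_motion 0 Q' (%t w. w t)"
    and Q'_law: "!!(N :: (real => real) measure) g. g : path_space (UNIV :: real set) ->> N ==>
     g : Q' ->> N & distr Q' N g = distr (process_law UNIV MW (%t om. W t om + (0 - x0))) N g" by (rule canonical_brownian_motion[OF W_shift[of 0]]) blast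
   let ?f1 = "%w. \<lambda>t\<in>{0..}. stopped {ep} (%u. R (w u)) t" and ?f2 = "%w :: real => real. \<lambda>t\<in>{0..}. stopped {ep} (%u. \<bar>w u\<bar>) t"
   have cep: "closedin (top_of_set UNIV) (UNIV Int {ep})" by simp
   have f1m: "?f1 : ?P ->> path_space UNIV" unfolding P_meas_iff[OF vS] by (rule measurable_stopped_image[OF R_cont _ cep]) simp
   have f2m: "?f2 : path_space UNIV ->> path_space UNIV" by (rule measurable_stopped_image[OF _ _ cep]) (auto intro!: continuous_intros)
   have hm: "(%w. k (w t)) : bmeas (path_space UNIV)" by (rule measurable_compose[OF eval_borel[OF t] km])
   have "(\<integral>w. k (R (stopped B w t)) \<partial>?P) = (\<integral>w. k (?f1 w t) \<partial>?P)" by (rule integral_congr[OF refl]) (use t stR in \<open>simp add: space_P[OF vS]\<close>)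
   also have "... = (\<integral>w. k (w t) \<partial>process_law UNIV ?P (%t w. stopped {ep} (%u. R (w u)) t))" unfolding process_law_def by (rule integral_distr[OF f1m hm, symmetric])
   also have "process_law UNIV ?P (%t w. stopped {ep} (%u. R (w u)) t) = process_law UNIV Q' (%t w. stopped {ep} (%u. \<bar>w u\<bar>) t)"
   proof -
    have "ALL e:incident G (io v). ep < len G e" using len ep unfolding inc by auto
    from conjunct1[OF w1, THEN spec, THEN mp, OF ep(1), THEN mp, OF this, THEN spec, THEN mp, OF Q']
    show ?thesis unfolding R_def .
   qed
   also have "... = distr (Q 0) (path_space UNIV) ?f2" using Q'_law[OF f2m] unfolding process_law_def Q_def by blast
   also have "(\<integral>w. k (w t) \<partial>distr (Q 0) (path_space UNIV) ?f2) = (\<integral>w. k (?f2 w t) \<partial>Q 0)" by (rule integral_distr[OF _ hm]) (use f2m in \<open>simp add: Q0.Q_meas_iff\<close>)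
   also have "... = (\<integral>w. k \<bar>stopped ?D w t\<bar> \<partial>Q 0)"
   proof (rule integral_cong_AE)
    show "(%w. k (?f2 w t)) : bmeas (Q 0)" unfolding Q0.Q_meas_iff by (rule measurable_compose[OF f2m hm])
    show "(%w. k \<bar>stopped ?D w t\<bar>) : bmeas (Q 0)" unfolding Q0.Q_meas_iff by (rule stopped_fun_meas[OF Dc kabs kabsb])
    show "AE w in Q 0. k (?f2 w t) = k \<bar>stopped ?D w t\<bar>" using Q0.start AE_space
    proof eventually_elim
     case (elim w)
     then show ?case using Q0.stopped_abs[OF elim(2,1) ep(1) t] t by simp
    qed
   qed
   finally show ?thesis .
  qed
  \<comment> \<open>The cosine does not see the sign, so \<open>k\<close> of the absolute value is
    Dynkin's integrand with phase \<open>pi / 2\<close> started at 0; its value is the cosine of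
    0.\<close>
  have even: "(\<integral>w. pot B (%y. k (R y)) w \<partial>?P) = 1"
  proof -
   have "(\<integral>w. pot B (%y. k (R y)) w \<partial>?P) = (\<integral>t. (\<integral>w. k (R (stopped B w t)) \<partial>?P) \<partial>exp1)" by (rule int_pot[OF Bc kR kRb Pv.prob_space_axioms sets_P[OF vS]])
   also have "... = (\<integral>t. (\<integral>w. k \<bar>stopped ?D w t\<bar> \<partial>Q 0) \<partial>exp1)"
   proof (rule integral_cong_AE)
    show "(%t. \<integral>w. k (R (stopped B w t)) \<partial>?P) : bmeas exp1" using pot_Fubini(2)[OF Bc kR kRb Pv.prob_space_axioms sets_P[OF vS], of "%_. 0" 0] by simp
    show "(%t. \<integral>w. k \<bar>stopped ?D w t\<bar> \<partial>Q 0) : bmeas exp1" using pot_Fubini(2)[OF Dc kabs kabsb Q0.prob_space_axioms Q0.sets_Q, of "%_. 0" 0] by simp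
   qed (rule AE_exp1I[OF law])
   also have "... = (\<integral>w. pot ?D (%x. k \<bar>x\<bar>) w \<partial>Q 0)" by (rule int_pot[OF Dc kabs kabsb Q0.prob_space_axioms Q0.sets_Q, symmetric])
   also have "(%x. k \<bar>x\<bar>) = (%y. if y : ?D then sin (th * y + pi / 2) else (1 + th^2 / 2) * sin (th * y + pi / 2))"
   proof
    fix x :: real
    have "cos (th * \<bar>x\<bar>) = cos (th * x)" by (cases "0 <= x") (auto simp: abs_if)
    then show "k \<bar>x\<bar> = (if x : ?D then sin (th * x + pi / 2) else (1 + th^2 / 2) * sin (th * x + pi / 2))" by (auto simp: k_def mu_def sin_add)
   qed
   also have "(\<integral>w. pot ?D (%y. if y : ?D then sin (th * y + pi / 2) else (1 + th^2 / 2) * sin (th * y + pi / 2)) w \<partial>Q 0) = sin (th * 0 + pi / 2)" by (rule Q0.dynkin) (use ep in simp)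
   finally show ?thesis by simp
  qed
  define bt where "bt = th * v + gmm"
  define Hp where "Hp y = (if y : B then F y else (1 + th^2 / 2) * F y)" for y
  \<comment> \<open>The odd part: the even part, weighted by \<open>sin bt\<close>, is
    removed.\<close>
  define Od where "Od y = Hp y - sin bt * k (R y)" for y
  have Hpm: "Hp : bmeas (rborel ?S)" unfolding Hp_def
  proof (rule measurable_If)
   have "{y : space (rborel ?S). y : B} = ?S Int B" by (auto simp: space_restrict_space)
   then show "{y : space (rborel ?S). y : B} : sets (rborel ?S)" using sets_closedin[OF Bc] by simp
  qed (use Fm in measurable)
  have Hpb: "\<bar>Hp y\<bar> <= 2 + mu" if "y : ?S" for y
  proof -
   have "(1 + mu) * \<bar>F y\<bar> <= (1 + mu) * 1" using mu0 F1[OF that] by (intro mult_left_mono) auto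
   also have "... <= 2 + mu" by simp
   finally have "(1 + mu) * \<bar>F y\<bar> <= 2 + mu" .
   moreover have "\<bar>F y\<bar> <= 2 + mu" using mu0 F1[OF that] by linarith
   moreover have "\<bar>Hp y\<bar> = (if y : B then \<bar>F y\<bar> else (1 + mu) * \<bar>F y\<bar>)" using mu0 by (simp add: Hp_def abs_mult mu_def)
   ultimately show ?thesis by (cases "y : B") simp_all
  qed
  have Odm: "Od : bmeas (rborel ?S)" unfolding Od_def using Hpm kR by measurable
  have Odb: "\<bar>Od y\<bar> <= 4 + 2 * mu" if "y : ?S" for y
  proof -
   have "\<bar>sin bt\<bar> * \<bar>k (R y)\<bar> <= 1 * (2 + mu)" using kRb[of y] by (intro mult_mono) auto
   then have "\<bar>sin bt * k (R y)\<bar> <= 2 + mu" by (simp add: abs_mult)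
   then show ?thesis using Hpb[OF that] unfolding Od_def by linarith
  qed
  have int: "integrable ?P (pot B H)" if "H : bmeas (rborel ?S)" "!!y. y : ?S ==> \<bar>H y\<bar> <= c" for H c
  proof (rule Pv.integrable_const_bound[where B=c])
   show "pot B H : bmeas ?P" unfolding P_meas_iff[OF vS] by (rule potential_meas[OF Bc that])
   show "AE w in ?P. norm (pot B H w) <= c" using potential_bound[OF Bc that] by (intro AE_I2) (simp add: space_P[OF vS])
  qed
  have Od_pot: "pot B Od w = pot B Hp w - sin bt * pot B (%y. k (R y)) w" if w: "w : space ?P" for w
  proof -
   have w': "w : space (path_space ?S)" using w by (simp add: space_P[OF vS])
   have i1: "integrable exp1 (%t. Hp (stopped B w t))" by (rule exp1_bdd[OF stopped_time_meas[OF Bc Hpm Hpb w'] abs_stopped_le[OF Bc Hpm Hpb w']])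
   have i2: "integrable exp1 (%t. k (R (stopped B w t)))" by (rule exp1_bdd[OF stopped_time_meas[OF Bc kR kRb w'] kRb])
   show ?thesis unfolding pot_def Od_def using i1 i2 by simp
  qed
  have split: "(\<integral>w. pot B Hp w \<partial>?P) - sin bt = (\<integral>w. pot B Od w \<partial>?P)"
  proof -
   have "(\<integral>w. pot B Od w \<partial>?P) = (\<integral>w. pot B Hp w - sin bt * pot B (%y. k (R y)) w \<partial>?P)" by (rule integral_congr[OF refl Od_pot])
   also have "... = (\<integral>w. pot B Hp w \<partial>?P) - sin bt * (\<integral>w. pot B (%y. k (R y)) w \<partial>?P)" using int[OF Hpm Hpb] int[OF kR kRb] by simp
   finally show ?thesis unfolding even by simp
  qed
  let ?pp = "io (v + ep)" and ?pm = "io (v - ep)"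
  define Ap where "Ap = {w : space ?P. hitting_time {?pp} w < hitting_time {?pm} w}"
  define Am where "Am = {w : space ?P. hitting_time {?pm} w < hitting_time {?pp} w}"
  have legs: "leg G (io v) e1 ep = ?pp" "leg G (io v) e2 ep = ?pm" using leg1 leg2 ep by auto
  have lenep: "ALL e:incident G (io v). 0 < ep & ep < len G e" using len ep unfolding inc by auto
  have clause2: "measure ?P {w : space ?P. hitting_time {leg G (io v) j ep} w
        < hitting_time ((%e. leg G (io v) e ep) ` ({e1, e2} - {j})) w} = (1 / ep) / (\<Sum>e\<in>{e1, e2}. 1 / ep)" if "j : {e1, e2}" for j using conjunct1[OF conjunct2[OF w1], THEN spec[of _ "%_. ep"], THEN mp, OF lenep, THEN bspec, of j] that unfolding inc by blast
  have d1: "{e1, e2} - {e1} = {e2}" "{e1, e2} - {e2} = {e1}" using ne by auto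
  have sum2: "(1 / ep) / (\<Sum>e\<in>{e1, e2}. 1 / ep) = 1 / 2" using ne ep by simp
  have half: "measure ?P Ap = 1 / 2" "measure ?P Am = 1 / 2" using clause2[of e1] clause2[of e2] unfolding d1 sum2 Ap_def Am_def by (simp_all add: legs)
  \<comment> \<open>Measurability comes for free: \<open>measure\<close> of a set outside the
    sigma-algebra is 0, but here it is \<open>1 / 2\<close>.\<close>
  have "Ap : sets ?P" by (rule ccontr) (use half(1) in \<open>simp add: measure_notin_sets\<close>)
  moreover have "Am : sets ?P" by (rule ccontr) (use half(2) in \<open>simp add: measure_notin_sets\<close>)
  ultimately have Aps: "Ap : sets ?P" "Am : sets ?P" by blast+
  \<comment> \<open>The exit value of the odd part, read off from which of the two boundary points
    is hit first. Equal probabilities give it mean 0.\<close>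
  define X where "X w = cos bt * sin (th * ep) * (indicator Ap w - indicator Am w)" for w
  have Xi: "integrable ?P X" unfolding X_def using Aps by (intro integrable_mult_right Bochner_Integration.integrable_diff) (simp_all add: Pv.emeasure_finite less_top[symmetric])
  have X0: "(\<integral>w. X w \<partial>?P) = 0"
  proof -
   have "(\<integral>w. X w \<partial>?P) = cos bt * sin (th * ep) * (measure ?P Ap - measure ?P Am)" unfolding X_def using Aps by (subst Bochner_Integration.integral_mult_right_zero, subst Bochner_Integration.integral_diff)
      (simp_all add: Pv.emeasure_finite less_top[symmetric])
   then show ?thesis by (simp add: half)
  qed
  have sin_le: "\<bar>sin (th * xi)\<bar> <= \<bar>th\<bar> * ep" if "\<bar>xi\<bar> <= ep" for xi
  proof -
   have "\<bar>sin (th * xi)\<bar> <= \<bar>th * xi\<bar>" by (rule abs_sin_x_le_abs_x)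
   also have "... <= \<bar>th\<bar> * ep" using that by (simp add: abs_mult mult_left_mono)
   finally show ?thesis .
  qed
  have Od_in: "Od (io (v + xi)) = (if \<bar>xi\<bar> < ep then (1 + mu) * (cos bt * sin (th * xi)) else cos bt * sin (th * xi))" if xi: "\<bar>xi\<bar> <= ep" for xi
  proof -
   have y: "v + xi : {a..b}" using xi abep by auto
   have Rx: "R (io (v + xi)) = \<bar>xi\<bar>" using rad(1)[OF y] xi by simp
   have inB: "io (v + xi) : B \<longleftrightarrow> \<not> \<bar>xi\<bar> < ep" using R_lt[OF io_in[OF y]] Rx by auto
   have c: "cos (th * \<bar>xi\<bar>) = cos (th * xi)" by (cases "0 <= xi") (auto simp: abs_if)
   have "th * (v + xi) + gmm = bt + th * xi" by (simp add: bt_def algebra_simps)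
   then have Fx: "F (io (v + xi)) = sin bt * cos (th * xi) + cos bt * sin (th * xi)" using Fio[OF y] by (simp add: sin_add)
   show ?thesis unfolding Od_def Hp_def inB Rx k_def Fx c mu_def by (simp add: algebra_simps)
  qed
  let ?N = "%y. if y : B then 0 else 1 :: real"
  have Nm: "?N : bmeas (rborel ?S)"
  proof (rule measurable_If)
   have "{y : space (rborel ?S). y : B} = ?S Int B" by (auto simp: space_restrict_space)
   then show "{y : space (rborel ?S). y : B} : sets (rborel ?S)" using sets_closedin[OF Bc] by simp
  qed simp_all
  have Nb: "\<bar>?N y\<bar> <= 1" for y by simp
  \<comment> \<open>After the exit the two terms coincide. Before it, each is bounded by a multiple
    of \<open>ep\<close>.\<close>
  have close: "\<bar>Od (stopped B w t) - X w\<bar> <= K * ep * ?N (stopped B w t)"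
   if w: "w : space (path_space ?S)" "w 0 = io v" for w t
  proof (cases "stopped B w t : B")
   case False
   then obtain y where y: "y : {v - ep<..<v + ep}" "stopped B w t = io y" by (auto simp: B_def)
   define xi where "xi = y - v"
   have xi: "\<bar>xi\<bar> < ep" "y = v + xi" using y(1) by (auto simp: xi_def)
   have "\<bar>cos bt * sin (th * xi)\<bar> <= 1 * (\<bar>th\<bar> * ep)" unfolding abs_mult by (intro mult_mono sin_le abs_cos_le_one) (use xi ep in auto)
   then have "(1 + mu) * \<bar>cos bt * sin (th * xi)\<bar> <= (1 + mu) * (\<bar>th\<bar> * ep)" using mu0 by (intro mult_left_mono) auto
   moreover have "Od (stopped B w t) = (1 + mu) * (cos bt * sin (th * xi))" using Od_in[of xi] xi y(2) by simp
   ultimately have o: "\<bar>Od (stopped B w t)\<bar> <= (1 + mu) * (\<bar>th\<bar> * ep)" using mu0 by (simp add: abs_mult)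
   have "\<bar>X w\<bar> <= 1 * (\<bar>th\<bar> * ep) * 1" unfolding X_def abs_mult by (intro mult_mono sin_le abs_cos_le_one) (use ep in \<open>auto simp: indicator_def\<close>)
   with o have "\<bar>Od (stopped B w t) - X w\<bar> <= (1 + mu) * (\<bar>th\<bar> * ep) + \<bar>th\<bar> * ep" by linarith
   also have "... = K * ep" by (simp add: K_def algebra_simps)
   finally show ?thesis using False by simp
  next
   case True
   have t0: "0 <= max 0 t" by simp
   obtain r where r: "0 <= r" "r <= max 0 t" and before: "!!s. 0 <= s ==> s < r ==> w s ~: B"
    and st: "stopped B w (max 0 t) = w r" using stopped_cases[OF closed_hits[OF w(1) Bc] t0] by metis
   have st: "stopped B w t = w r" using st by (simp only: stopped_max[symmetric])
   have inB: "?pp : B" "?pm : B" "?pp ~= ?pm"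
   proof -
    have m: "v + ep : {a..b}" "v - ep : {a..b}" using abep ep by auto
    show "?pp : B" "?pm : B" using io_mem_iff[OF m(1) sub(1)] io_mem_iff[OF m(2) sub(1)] by (simp_all add: B_def)
    show "?pp ~= ?pm" using inj_on_eq_iff[OF io_inj m] ep by simp
   qed
   have less: "hitting_time {p} w < hitting_time {q} w" if "w r = p" "q : B" "p ~= q" for p q
   proof -
    have "hitting_time {p} w <= ennreal r" unfolding hitting_time_def by (rule INF_lower) (use r that in simp)
    also have "ennreal r < hitting_time {q} w"
    proof (subst less_hit_iff[OF w(1) _ r(1)])
     show "closedin (top_of_set ?S) (?S Int {q})" by (rule closedin_closed_Int) simp
     show "ALL s:{0..r}. w s ~: {q}"
     proof
      fix s assume "s : {0..r}"
      then show "w s ~: {q}" using before[of s] that by (cases "s = r") auto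
     qed
    qed
    finally show ?thesis .
   qed
   have wP: "w : space ?P" using w(1) by (simp add: space_P[OF vS])
   have "w r = ?pm | w r = ?pp" using exit_arc[OF abep(1,3,2,4) w, of t] True st unfolding B_def by simp
   then have "Od (w r) = X w"
   proof
    assume e: "w r = ?pm"
    have l: "hitting_time {?pm} w < hitting_time {?pp} w" using less[OF e inB(1)] inB(3) by simp
    then have "w : Am" "w ~: Ap" using wP by (auto simp: Ap_def Am_def)
    moreover have "Od ?pm = - (cos bt * sin (th * ep))" using Od_in[of "- ep"] ep by simp
    ultimately show ?thesis by (simp add: X_def e)
   next
    assume e: "w r = ?pp"
    have l: "hitting_time {?pp} w < hitting_time {?pm} w" using less[OF e inB(2)] inB(3) by simp
    then have "w ~: Am" "w : Ap" using wP by (auto simp: Ap_def Am_def)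
    moreover have "Od ?pp = cos bt * sin (th * ep)" using Od_in[of ep] ep by simp
    ultimately show ?thesis by (simp add: X_def e)
   qed
   then show ?thesis using True by (simp add: st)
  qed
  have pot_close: "\<bar>pot B Od w - X w\<bar> <= K * ep * pot B ?N w"
   if w: "w : space (path_space ?S)" "w 0 = io v" for w
  proof -
   have i1: "integrable exp1 (%t. Od (stopped B w t))" by (rule exp1_bdd[OF stopped_time_meas[OF Bc Odm Odb w(1)] abs_stopped_le[OF Bc Odm Odb w(1)]])
   have i2: "integrable exp1 (%t. ?N (stopped B w t))" by (rule exp1_bdd[OF stopped_time_meas[OF Bc Nm Nb w(1)] Nb])
   have i3: "integrable exp1 (%_. X w)" by (rule exp1_bdd[where c="\<bar>X w\<bar>"]) simp_all
   have "pot B Od w - X w = (\<integral>t. Od (stopped B w t) - X w \<partial>exp1)" unfolding pot_def using i1 i3 by simp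
   then have "\<bar>pot B Od w - X w\<bar> <= (\<integral>t. \<bar>Od (stopped B w t) - X w\<bar> \<partial>exp1)" by (simp only: integral_abs_bound)
   also have "... <= (\<integral>t. K * ep * ?N (stopped B w t) \<partial>exp1)" by (rule integral_mono[OF integrable_abs[OF Bochner_Integration.integrable_diff[OF i1 i3]] integrable_mult_right[OF i2] close[OF w]])
   also have "... = K * ep * pot B ?N w" unfolding pot_def by (rule Bochner_Integration.integral_mult_right_zero)
   finally show ?thesis .
  qed
  have N_int: "integrable ?P (pot B ?N)" by (rule int[OF Nm Nb])
  have N_nonneg: "0 <= pot B ?N w" for w unfolding pot_def by (rule integral_nonneg_AE) simp
  \<comment> \<open>For an exit time \<open>tau\<close> the left side is
    \<open>1 - exp (- tau)\<close>, which is at most \<open>tau\<close>; this brings in the exit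
    time clause of \<open>walsh_at_vertex\<close>.\<close>
  have N_tau: "ennreal (pot B ?N w) <= hitting_time {p : ?S. \<not> radius G (io v) ep p < ep} w" if w: "w : space ?P" for w
  proof -
   have w': "w : space (path_space ?S)" using w by (simp add: space_P[OF vS])
   have "{t. 0 <= t & w t : {p : ?S. \<not> radius G (io v) ep p < ep}} = {t. 0 <= t & w t : B}" using R_lt path_space_in[OF w'] unfolding R_def by blast
   then have ht: "hitting_time {p : ?S. \<not> radius G (io v) ep p < ep} w = hitting_time B w" by (simp only: hitting_time_def)
   show ?thesis unfolding ht
   proof (cases "hitting_time B w")
    case (real r)
    have clw: "closed {s. 0 <= s & w s : B}" by (rule closed_hits[OF w' Bc])
    have le: "?N (stopped B w t) <= indicator {..<r} t * exp (- 0 * \<bar>t\<bar>)" if t: "0 <= t" for t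
    proof (cases "stopped B w t : B")
     case False
     then have "ALL s:{0..t}. w s ~: B" using stopped_in_iff[OF clw t] by blast
     then have "ennreal t < ennreal r" using less_hit_iff[OF w' Bc t] real by simp
     then have "t < r" using t by (simp add: ennreal_less_iff)
     then show ?thesis by simp
    qed simp
    have "pot B ?N w <= (\<integral>t. indicator {..<r} t * exp (- 0 * \<bar>t\<bar>) \<partial>exp1)" unfolding pot_def
    proof (rule integral_mono_AE)
     show "integrable exp1 (%t. ?N (stopped B w t))" by (rule exp1_bdd[OF stopped_time_meas[OF Bc Nm Nb w'] Nb])
     show "integrable exp1 (%t. indicator {..<r} t * exp (- 0 * \<bar>t\<bar>) :: real)" by (rule exp1_bdd[where c=1]) (auto simp: indicator_def)
    qed (rule AE_exp1I[OF le])
    also have "... = (1 - exp (- (1 + 0) * r)) / (1 + 0)" using real by (intro exp1_discount) auto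
    also have "... <= r" using exp_ge_add_one_self[of "- r"] by simp
    finally show "ennreal (pot B ?N w) <= hitting_time B w" unfolding real(2) by (rule ennreal_leI)
   qed simp
  qed
  have "ennreal (\<integral>w. pot B ?N w \<partial>?P) = (\<integral>\<^sup>+w. ennreal (pot B ?N w) \<partial>?P)" by (rule nn_integral_eq_integral[symmetric, OF N_int]) (simp add: N_nonneg)
  also have "... <= ta ep" unfolding ta_def by (rule nn_integral_mono[OF N_tau])
  also have "... < ennreal (et / (K + 1))" by (rule r0(2)[OF ep(1,3)])
  finally have EN: "(\<integral>w. pot B ?N w \<partial>?P) < et / (K + 1)" using et K0 by (subst (asm) ennreal_less_iff) (auto intro!: integral_nonneg_AE simp: N_nonneg)
  have Od_int: "integrable ?P (pot B Od)" by (rule int[OF Odm Odb])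
  have "(\<integral>w. pot B Od w \<partial>?P) = (\<integral>w. pot B Od w - X w \<partial>?P)" using Od_int Xi X0 by simp
  then have "\<bar>\<integral>w. pot B Od w \<partial>?P\<bar> <= (\<integral>w. \<bar>pot B Od w - X w\<bar> \<partial>?P)" by (simp only: integral_abs_bound)
  also have "... <= (\<integral>w. K * ep * pot B ?N w \<partial>?P)"
  proof (rule integral_mono_AE[OF integrable_abs[OF Bochner_Integration.integrable_diff[OF Od_int Xi]] integrable_mult_right[OF N_int]])
   show "AE w in ?P. \<bar>pot B Od w - X w\<bar> <= K * ep * pot B ?N w" using start by eventually_elim (rule pot_close, simp_all)
  qed
  also have "... = K * ep * (\<integral>w. pot B ?N w \<partial>?P)" by simp
  also have "... <= K * ep * (et / (K + 1))" using EN K0 ep by (intro mult_left_mono) auto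
  also have "... = K / (K + 1) * (et * ep)" by simp
  also have "... <= 1 * (et * ep)" using K0 et ep by (intro mult_right_mono) auto
  finally show ?thesis using split unfolding Hp_def[abs_def] bt_def B_def by simp
 qed
 show ?thesis
 proof (intro exI[of _ "min dl r0"] conjI allI impI)
  show "0 < min dl r0" using dl r0 by simp
 qed (rule main, auto)
qed

lemma arc_markov_Q: "arc_markov (points G) P a b io V Q"
proof (intro arc_markov.intro arc_markov_axioms.intro)
 show "path_markov (points G) P" by (rule path_markov_axioms)
 show "open_arc (points G) a b io" by (rule open_arc_axioms)
 show "finite V" "V <= {a<..<b}" by (rule V)+
 show "lbm (Q z) z" for z by (rule linear_bm_Q)
 show "(\<integral>w. H (stopped (- io ` {c<..<d}) w t) \<partial>P (io z)) = (\<integral>w. H (io (max c (min d (stopped (- {c<..<d}) w t)))) \<partial>Q z)"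
  if "a <= c" "c < d" "d <= b" "{c<..<d} Int V = {}" "z : {c<..<d}" "0 <= t"
   "H : bmeas (rborel (points G))" "!!y. y : points G ==> \<bar>H y\<bar> <= C" for c d z H t and C :: real by (rule gap_law[where C=C, OF that(1-7)]) (rule that(8))
 show "\<exists>ep0>0. \<forall>ep. 0 < ep & ep < ep0 -->
    \<bar>(\<integral>w. pot (- io ` {v - ep<..<v + ep}) (%y. if y : - io ` {v - ep<..<v + ep} then F y else (1 + th^2 / 2) * F y) w \<partial>P (io v))
     - sin (th * v + gmm)\<bar> <= et * ep"
  if "v : V" "0 < et" "F : bmeas (rborel (points G))" "!!y. y : points G ==> \<bar>F y\<bar> <= 1"
   "!!x. x : {a..b} ==> F (io x) = sin (th * x + gmm)" for v th gmm F et by (rule vertex_law[OF that(1-3)]) (rule that(4,5); assumption)+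
qed

end

subsection \<open>Arc-length parametrisation of an edge\<close>

lemma curve_length_refl: "curve_length g s s = 0"
proof -
 have "(\<Sum>i<length xs - 1. ennreal (dist (g (xs ! i)) (g (xs ! Suc i)))) = 0" if xs: "set xs <= {s..s}" for xs
 proof (rule sum.neutral, rule ballI)
  fix i assume "i : {..<length xs - 1}"
  then have "xs ! i : set xs" "xs ! Suc i : set xs" by (auto intro: nth_mem)
  then have "xs ! i = s" "xs ! Suc i = s" using xs by auto
  then show "ennreal (dist (g (xs ! i)) (g (xs ! Suc i))) = 0" by simp
 qed
 then have "curve_length g s s <= 0" unfolding curve_length_def by (intro SUP_least) auto
 then show ?thesis by simp
qed

lemma reparam_mono:
 fixes g :: "real => 'a::metric_space"
 assumes "!!x. x : {s..t} ==> h x = g (\<phi> x)" "!!x y. x : {s..t} ==> y : {s..t} ==> x <= y ==> \<phi> x <= \<phi> y"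
  and "p <= \<phi> s" "\<phi> t <= q"
 shows "curve_length h s t <= curve_length g p q"
proof (rule reparam_le[where \<phi>=\<phi>])
 have "\<phi> ` {s..t} <= {p..q}"
 proof
  fix y assume "y : \<phi> ` {s..t}"
  then obtain x where x: "x : {s..t}" "y = \<phi> x" by blast
  then show "y : {p..q}" using assms(2)[of s x] assms(2)[of x t] assms(3,4) by auto
 qed
 moreover have "mono_on {s..t} \<phi>" by (rule mono_onI) (rule assms(2))
 ultimately show "(mono_on {s..t} \<phi> & \<phi> ` {s..t} <= {p..q}) | (antimono_on {s..t} \<phi> & \<phi> ` {s..t} <= {p..q})" by blast
qed (rule assms(1))

text \<open>\<open>arclength_isometry\<close> speaks of arcs parametrised by \<open>[0,1]\<close>,
  so the piece of \<open>gmm\<close> over \<open>[p,q]\<close> is rescaled affinely, which leaves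
  curve lengths unchanged.\<close>

lemma edge_length:
 fixes e :: "'a::metric_space set"
 assumes gmm: "homeomorphism {0<..<1::real} e gmm gmm'" and F: "arclength_isometry e F" and pq: "0 < p" "p < q" "q < 1"
 shows "curve_length gmm p q = ennreal \<bar>F (gmm q) - F (gmm p)\<bar>"
proof -
 define g where "g s = gmm (p + s * (q - p))" for s
 have inI: "p + s * (q - p) : {0<..<1}" if "s : {0..1}" for s
 proof -
  have "0 <= s * (q - p)" using that pq by simp
  moreover have "s * (q - p) <= q - p" using mult_right_mono[of s 1 "q - p"] that pq by simp
  ultimately have "0 < p + s * (q - p)" "p + s * (q - p) < 1" using pq by linarith+
  then show ?thesis by simp
 qed
 have "continuous_on {0..1} g" unfolding g_def by (rule continuous_on_compose2[OF homeomorphism_cont1[OF gmm]]) (use inI in \<open>auto intro!: continuous_intros\<close>)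
 moreover have "inj_on g {0..1}"
 proof (rule inj_onI)
  fix s t assume st: "s : {0..1}" "t : {0..1}" "g s = g t"
  then have "gmm' (gmm (p + s * (q - p))) = gmm' (gmm (p + t * (q - p)))" by (simp add: g_def)
  then have "p + s * (q - p) = p + t * (q - p)" unfolding homeomorphism_apply1[OF gmm inI[OF st(1)]] homeomorphism_apply1[OF gmm inI[OF st(2)]] .
  then show "s = t" using pq by simp
 qed
 ultimately have "arc g" by (simp add: arc_def path_def)
 moreover have "path_image g <= e" using inI homeomorphism_image1[OF gmm] by (auto simp: path_image_def g_def)
 ultimately have "curve_length g 0 1 = ennreal \<bar>F (g 1) - F (g 0)\<bar>" using F by (auto simp: arclength_isometry_def pathfinish_def pathstart_def)
 moreover have "curve_length g 0 1 <= curve_length gmm p q" by (rule reparam_mono[where \<phi>="%s. p + s * (q - p)"]) (use pq in \<open>auto simp: g_def mult_right_mono\<close>)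
 moreover have "curve_length gmm p q <= curve_length g 0 1" by (rule reparam_mono[where \<phi>="%s. (s - p) / (q - p)"]) (use pq in \<open>auto simp: g_def divide_right_mono\<close>)
 ultimately show ?thesis by (simp add: g_def)
qed

text \<open>Lengths of nondegenerate pieces are positive and grow with the piece, so
  \<open>F\<close> along \<open>gmm\<close> is injective and cannot turn back. Its direction is read
  off at \<open>1/3\<close> and \<open>1/2\<close>, and a decreasing parametrisation is
  reversed.\<close>

lemma edge_oriented:
 fixes e :: "'a::metric_space set"
 assumes hom: "e homeomorphic {0<..<1::real}" and F: "arclength_isometry e F"
 obtains gmm gmm' where "homeomorphism {0<..<1::real} e gmm gmm'" "!!p q. 0 < p ==> p < q ==> q < 1 ==> F (gmm p) < F (gmm q)"
proof -
 obtain gmm gmm' where gmm: "homeomorphism {0<..<1::real} e gmm gmm'" using hom homeomorphism_symD unfolding homeomorphic_def by blast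
 define u where "u p = F (gmm p)" for p
 note len = edge_length[OF gmm F, folded u_def]
 have ne: "u p ~= u q" if pq: "0 < p" "p < q" "q < 1" for p q
 proof
  assume "u p = u q"
  then have "curve_length gmm p q = 0" using len[OF pq] by simp
  moreover have "ennreal (dist (gmm p) (gmm q)) <= curve_length gmm p q" unfolding curve_length_def by (rule SUP_upper2[of "[p, q]"]) (use pq in auto)
  ultimately have "gmm p = gmm q" by simp
  then have "gmm' (gmm p) = gmm' (gmm q)" by simp
  then show False using homeomorphism_apply1[OF gmm, of p] homeomorphism_apply1[OF gmm, of q] pq by simp
 qed
 have betw: "\<bar>u q' - u p'\<bar> <= \<bar>u q - u p\<bar>" if "0 < p" "p <= p'" "p' <= q'" "q' <= q" "q < 1" for p p' q' q
 proof (cases "p' = q'")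
  case False
  then have "p' < q'" using that by simp
  have "curve_length gmm p' q' <= curve_length gmm p q" by (rule reparam_mono[where \<phi>="%x. x"]) (use that in auto)
  then show ?thesis using len[of p' q'] len[of p q] that \<open>p' < q'\<close> by simp
 qed simp
 have mono: "(u c < u d --> u p < u q) & (u d < u c --> u q < u p)" if "0 < c" "c <= p" "p < q" "q <= d" "d < 1" for c p q d using betw[of c c p d] betw[of c p d d] betw[of p p q d] betw[of p q d d] ne[of p q] that by auto
 have dich: "u p < u q \<longleftrightarrow> u (1/3) < u (1/2)" if pq: "0 < p" "p < q" "q < 1" for p q
 proof -
  define c where "c = min p (1/3)"
  define d where "d = max q (1/2)"
  have cd: "0 < c" "c <= p" "c <= 1/3" "q <= d" "1/2 <= d" "d < 1" using pq by (auto simp: c_def d_def)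
  then have "c < d" using pq by linarith
  then show ?thesis using mono[of c p q d] mono[of c "1/3" "1/2" d] ne[of c d] cd pq by auto
 qed
 show ?thesis
 proof (cases "u (1/3) < u (1/2)")
  case True
  show ?thesis
  proof (rule that[OF gmm])
   show "F (gmm p) < F (gmm q)" if "0 < p" "p < q" "q < 1" for p q using dich[OF that] True by (simp add: u_def)
  qed
 next
  case False
  have r: "homeomorphism {0<..<1::real} {0<..<1} (%s. 1 - s) (%s. 1 - s)" by (rule homeomorphismI) (auto intro!: continuous_intros)
  from homeomorphism_compose[OF r gmm] show ?thesis
  proof (rule that)
   fix p q :: real assume pq: "0 < p" "p < q" "q < 1"
   show "F ((gmm \<circ> (%s. 1 - s)) p) < F ((gmm \<circ> (%s. 1 - s)) q)" using dich[of "1 - q" "1 - p"] ne[of "1 - q" "1 - p"] False pq by (simp add: u_def)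
  qed
 qed
qed

locale edge_chart =
 fixes X e :: "'a::metric_space set" and F :: "'a => real" and io :: "real => 'a"
 assumes e_open: "openin (top_of_set X) e" and F_cont: "continuous_on e F" and io_cont: "continuous_on (F ` e) io"
  and io_F: "!!x. x : e ==> io (F x) = x" and U_open: "open (F ` e)" and U_interval: "is_interval (F ` e)"
  and io_len: "!!s t. s : F ` e ==> t : F ` e ==> s <= t ==> curve_length io s t = ennreal (t - s)"

text \<open>Continuity of \<open>F\<close> is a consequence: along an oriented parametrisation it is
  increasing with an open image, and such monotone maps are continuous. The same argument serves its
  inverse, which yields \<open>io\<close>.\<close>

lemma edge_chart_exists:
 fixes e :: "'a::metric_space set"
 assumes e: "is_edge X e" and F: "arclength_isometry e F" and U: "open (F ` e)" "is_interval (F ` e)"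
 shows "\<exists>io. edge_chart X e F io"
proof -
 let ?I = "{0<..<1::real}"
 obtain gmm gmm' where gmm: "homeomorphism ?I e gmm gmm'" and inc: "!!p q. 0 < p ==> p < q ==> q < 1 ==> F (gmm p) < F (gmm q)" using e edge_oriented[OF _ F] unfolding is_edge_def by metis
 define u where "u p = F (gmm p)" for p
 have mono: "u p <= u q \<longleftrightarrow> p <= q" if "p : ?I" "q : ?I" for p q using inc[of p q] inc[of q p] that unfolding u_def by (cases p q rule: linorder_cases) auto
 have inj: "inj_on u ?I" by (rule inj_onI) (use mono in \<open>metis order_antisym order_refl\<close>)
 have uI: "u ` ?I = F ` e" unfolding homeomorphism_image1[OF gmm, symmetric] u_def by (simp add: image_image)
 define v where "v = the_inv_into ?I u"
 have vu: "v (u p) = p" if "p : ?I" for p unfolding v_def by (rule the_inv_into_f_f[OF inj that])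
 have vI: "v s : ?I" "u (v s) = s" if "s : F ` e" for s
 proof -
  from that uI obtain p where "p : ?I" "s = u p" by blast
  then show "v s : ?I" "u (v s) = s" using vu by simp_all
 qed
 have vU: "v ` F ` e = ?I" unfolding uI[symmetric] image_image using vu by simp
 have vmono: "v s <= v t" if "s : F ` e" "t : F ` e" "s <= t" for s t using mono[OF vI(1)[OF that(1)] vI(1)[OF that(2)]] vI(2)[OF that(1)] vI(2)[OF that(2)] that(3) by simp
 have vc: "continuous_on (F ` e) v" by (rule continuous_onI_mono) (use vU vmono in auto)
 have uc: "continuous_on ?I u" by (rule continuous_onI_mono) (use uI U mono in auto)
 have "edge_chart X e F (gmm \<circ> v)"
 proof
  show "openin (top_of_set X) e" using e by (simp add: is_edge_def)
  have "continuous_on e (%x. u (gmm' x))" by (rule continuous_on_compose2[OF uc homeomorphism_cont2[OF gmm]]) (use homeomorphism_image2[OF gmm] in auto)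
  then show "continuous_on e F" by (rule continuous_on_eq) (simp add: u_def homeomorphism_apply2[OF gmm])
  show "continuous_on (F ` e) (gmm \<circ> v)" by (rule continuous_on_compose[OF vc]) (use homeomorphism_cont1[OF gmm] vU in simp)
  show "(gmm \<circ> v) (F x) = x" if "x : e" for x
  proof -
   have x: "gmm' x : ?I" "gmm (gmm' x) = x" using homeomorphism_image2[OF gmm] homeomorphism_apply2[OF gmm that] that by auto
   then show ?thesis using vu[OF x(1)] by (simp add: u_def)
  qed
  fix s t assume st: "s : F ` e" "t : F ` e" "s <= t"
  show "curve_length (gmm \<circ> v) s t = ennreal (t - s)"
  proof (cases "s = t")
   case False
   then have lt: "v s < v t" using vmono[OF st] vI(2)[OF st(1)] vI(2)[OF st(2)] by (metis order_le_imp_less_or_eq)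
   have sub: "{s..t} <= F ` e" using U(2) st unfolding is_interval_1 by (meson atLeastAtMost_iff subsetI)
   have p: "0 < v s" "v t < 1" using vI(1)[OF st(1)] vI(1)[OF st(2)] by auto
   have "curve_length (gmm \<circ> v) s t <= curve_length gmm (v s) (v t)" by (rule reparam_mono[where \<phi>=v]) (auto intro!: vmono sub[THEN subsetD])
   moreover have "curve_length gmm (v s) (v t) <= curve_length (gmm \<circ> v) s t" by (rule reparam_mono[where \<phi>=u]) (use vu mono p vI(2)[OF st(1)] vI(2)[OF st(2)] in auto)
   moreover have "curve_length gmm (v s) (v t) = ennreal (t - s)" using edge_length[OF gmm F p(1) lt p(2)] vI(2)[OF st(1)] vI(2)[OF st(2)] st(3) by (simp add: u_def)
   ultimately show ?thesis by simp
  qed (simp add: curve_length_refl)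
 qed (use U in auto)
 then show ?thesis by (rule exI[of _ "gmm \<circ> v"])
qed

context edge_chart
begin

lemma e_sub: "e <= X" using openin_imp_subset[OF e_open] .

lemma io_in: "s : F ` e ==> io s : e" and F_io: "s : F ` e ==> F (io s) = s" using io_F by auto

lemma io_inj: "inj_on io (F ` e)" by (rule inj_on_inverseI[of _ F]) (rule F_io)

lemma sub_U: "s : F ` e ==> t : F ` e ==> {s..t} <= F ` e" using U_interval unfolding is_interval_1 by (meson atLeastAtMost_iff subsetI)

lemma io_image: "V <= F ` e ==> io ` V = e Int F -` V"
proof
 assume V: "V <= F ` e"
 then show "io ` V <= e Int F -` V" using io_in F_io by auto
 show "e Int F -` V <= io ` V"
 proof
  fix y assume "y : e Int F -` V"
  then show "y : io ` V" using io_F[of y] by (auto intro!: image_eqI[of _ _ "F y"])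
 qed
qed

lemma io_openin: "open V ==> V <= F ` e ==> openin (top_of_set X) (io ` V)" unfolding io_image by (rule openin_trans[OF continuous_openin_preimage_gen[OF F_cont] e_open])

lemma io_compact: "{c..d} <= F ` e ==> compact (io ` {c..d})" by (intro compact_continuous_image continuous_on_subset[OF io_cont]) auto

lemma io_mem: "s : F ` e ==> V <= F ` e ==> io s : io ` V \<longleftrightarrow> s : V" using inj_on_image_mem_iff[OF io_inj] by blast

text \<open>The end points stay inside the image of \<open>F\<close>, so the closure in
  \<open>X\<close> is a compact arc. Segments thus qualify for the finite edge-sets in
  \<open>graph_approximation\<close>.\<close>

lemma is_edge_segment:
 assumes ab: "alp < bt" "{alp..bt} <= F ` e"
 shows "is_edge X (io ` {alp<..<bt})"
proof -
 define g where "g s = alp + s * (bt - alp)" for s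
 have g: "g s : {alp..bt}" if "s : {0..1}" for s
 proof -
  have "0 <= s * (bt - alp)" "s * (bt - alp) <= 1 * (bt - alp)" using that ab by (auto intro!: mult_right_mono)
  then show ?thesis by (auto simp: g_def)
 qed
 have hom: "io ` g ` S homeomorphic S" if S: "S <= {0..1}" for S
 proof (rule homeomorphicI)
  have gU: "g s : F ` e" if "s : S" for s using g S ab(2) that by blast
  show "(%y. (F y - alp) / (bt - alp)) ` io ` g ` S = S" unfolding image_image using gU ab by (simp add: F_io g_def cong: image_cong_simp)
  show "(%s. io (g s)) ` S = io ` g ` S" by (simp add: image_image)
  show "continuous_on (io ` g ` S) (%y. (F y - alp) / (bt - alp))" by (intro continuous_intros continuous_on_subset[OF F_cont]) (use gU io_in ab in auto)
  show "continuous_on S (%s. io (g s))" by (rule continuous_on_compose2[OF io_cont]) (use gU in \<open>auto simp: g_def intro!: continuous_intros\<close>)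
  show "io (g ((F y - alp) / (bt - alp))) = y" if "y : io ` g ` S" for y using that gU ab by (auto simp: F_io g_def)
  show "(F (io (g s)) - alp) / (bt - alp) = s" if "s : S" for s using F_io[OF gU[OF that]] ab by (simp add: g_def)
 qed
 have unscale: "g ((x - alp) / (bt - alp)) = x" for x using ab by (simp add: g_def)
 have im: "g ` {0<..<1} = {alp<..<bt}" "g ` {0..1} = {alp..bt}"
 proof -
  have "g s : {alp<..<bt}" if "s : {0<..<1}" for s
  proof -
   have "0 < s * (bt - alp)" "s * (bt - alp) < 1 * (bt - alp)" using that ab by (auto intro!: mult_strict_right_mono)
   then show ?thesis by (auto simp: g_def)
  qed
  moreover have "x : g ` {0<..<1}" if "x : {alp<..<bt}" for x by (rule image_eqI[where x="(x - alp) / (bt - alp)"]) (use that ab unscale in auto)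
  ultimately show "g ` {0<..<1} = {alp<..<bt}" by blast
  have "x : g ` {0..1}" if "x : {alp..bt}" for x by (rule image_eqI[where x="(x - alp) / (bt - alp)"]) (use that ab unscale in auto)
  then show "g ` {0..1} = {alp..bt}" using g by blast
 qed
 have "closure (io ` {alp<..<bt}) = io ` {alp..bt}"
 proof
  show "closure (io ` {alp<..<bt}) <= io ` {alp..bt}" by (rule closure_minimal) (auto intro: compact_imp_closed io_compact[OF ab(2)])
  have "io ` closure {alp<..<bt} <= closure (io ` {alp<..<bt})" by (rule image_closure_subset) (use ab in \<open>auto intro: continuous_on_subset[OF io_cont] closure_subset[THEN subsetD]\<close>)
  then show "io ` {alp..bt} <= closure (io ` {alp<..<bt})" using ab by simp
 qed
 moreover have sub: "{alp<..<bt} <= F ` e" using ab(2) by auto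
 moreover have "io ` {alp..bt} <= X" using io_in ab(2) e_sub by blast
 moreover have "io ` {alp<..<bt} <= X" using io_in sub e_sub by blast
 ultimately have cl: "top_of_set X closure_of (io ` {alp<..<bt}) = io ` {alp..bt}" by (simp add: closure_of_subtopology Int_absorb1)
 have "{0<..<1} <= {0..1::real}" by auto
 then show ?thesis unfolding is_edge_def cl using hom[of "{0<..<1}"] hom[of "{0..1}"] io_openin[OF _ sub] by (simp add: im)
qed

text \<open>Removing an open segment on either side isolates the closed segment between them: it is
  clopen in its component of the rest, hence a whole component. The uniqueness clause of
  \<open>graph_approximation\<close> then leaves a single component of the graph in it.\<close>

lemma segment_connected:
 assumes approx: "graph_approximation X G" and ab: "alp < p" "p <= q" "q < bt" "{alp..bt} <= F ` e"
 shows "\<forall>\<^sub>F n in sequentially. connected (points (G n) Int io ` {p..q}) & points (G n) Int io ` {p..q} ~= {}"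
proof -
 let ?I = "io ` {alp<..<p}" and ?J = "io ` {q<..<bt}" and ?C = "io ` {p..q}"
 have sub: "{alp..p} <= F ` e" "{q..bt} <= F ` e" "{p..q} <= F ` e" "{alp<..<bt} <= F ` e" using ab by auto
 define E where "E = {?I, ?J}"
 have dis: "io ` A Int io ` B = {}" if "A Int B = {}" "A <= F ` e" "B <= F ` e" for A B using inj_on_image_Int[OF io_inj that(2,3)] that(1) by simp
 have sub': "{alp<..<p} <= F ` e" "{q<..<bt} <= F ` e" using sub by auto
 have IJ: "?I Int ?J = {}" "?C Int ?I = {}" "?C Int ?J = {}" by (rule dis; use ab sub sub' in auto)+
 have "edge_set X E" unfolding edge_set_def E_def using is_edge_segment[OF ab(1) sub(1)] is_edge_segment[OF ab(3) sub(2)] IJ by (auto simp: pairwise_def disjnt_def)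
 have "?C <= X" using io_in sub(3) e_sub by blast
 then have CX: "?C <= X - \<Union>E" using IJ by (auto simp: E_def)
 have conC: "connected ?C" by (intro connected_continuous_image continuous_on_subset[OF io_cont sub(3)]) simp
 have Cne: "?C ~= {}" using ab by auto
 obtain K where K: "K : components (X - \<Union>E)" "?C <= K" using exists_component_superset[OF CX _ conC] CX Cne by blast
 have KX: "K <= X - \<Union>E" by (rule in_components_subset[OF K(1)])
 have "io ` {alp<..<bt} Int (X - \<Union>E) = ?C"
 proof -
  have "{alp<..<bt} = {alp<..<p} Un {p..q} Un {q<..<bt}" using ab by auto
  then have "io ` {alp<..<bt} = ?I Un ?C Un ?J" by (simp only: image_Un)
  then show ?thesis using CX by (auto simp: E_def)
 qed
 then have "K Int io ` {alp<..<bt} = ?C" using K(2) KX by blast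
 moreover have "openin (top_of_set K) (K Int io ` {alp<..<bt})"
 proof -
  obtain T where "open T" "io ` {alp<..<bt} = X Int T" using io_openin[OF _ sub(4)] by (auto simp: openin_open)
  then show ?thesis using KX by (auto simp: openin_open intro!: exI[of _ T])
 qed
 ultimately have "openin (top_of_set K) ?C" by simp
 moreover have "closedin (top_of_set K) ?C" by (rule closed_subset[OF K(2) compact_imp_closed[OF io_compact[OF sub(3)]]])
 ultimately have "?C = K" using in_components_connected[OF K(1)] Cne unfolding connected_clopen by blast
 with K(1) have CC: "?C : components (X - \<Union>E)" by simp
 have "finite E & edge_set X E" using \<open>edge_set X E\<close> by (simp add: E_def)
 from approx[unfolded graph_approximation_def, THEN conjunct2, THEN conjunct2, THEN spec, THEN mp, OF this, THEN bspec, OF CC]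
 show ?thesis
 proof eventually_elim
  case (elim n)
  then obtain D where D: "D : components (points (G n) - \<Union>E)" "D Int ?C ~= {}"
   and uniq: "!!D'. D' : components (points (G n) - \<Union>E) ==> D' Int ?C ~= {} ==> D' = D" by blast
  have GX: "points (G n) <= X" using approx by (simp add: graph_approximation_def)
  have Dsub: "D <= points (G n) - \<Union>E" by (rule in_components_subset[OF D(1)])
  have "D <= ?C" by (rule components_maximal[OF CC in_components_connected[OF D(1)]]) (use Dsub GX D(2) in blast)+
  moreover have "points (G n) Int ?C <= D"
  proof
   fix y assume y: "y : points (G n) Int ?C"
   then have "y : points (G n) - \<Union>E" using CX by blast
   then obtain D' where D': "D' : components (points (G n) - \<Union>E)" "y : D'" using Union_components[of "points (G n) - \<Union>E"] by blast
   then show "y : D" using uniq[OF D'(1)] y by blast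
  qed
  ultimately have "points (G n) Int ?C = D" using Dsub by blast
  then show ?case using in_components_connected[OF D(1)] in_components_nonempty[OF D(1)] by simp
 qed
qed

text \<open>\<open>G n\<close> meets a short segment on each side of \<open>[a,b]\<close> and is
  connected over their hull. The image of that part under \<open>F\<close> is connected with points
  on both sides, so it contains \<open>[a,b]\<close>.\<close>

lemma segment_covered:
 assumes approx: "graph_approximation X G" and ab: "a <= b" "{a..b} <= F ` e"
 shows "\<forall>\<^sub>F n in sequentially. io ` {a..b} <= points (G n)"
proof -
 have "a : F ` e" "b : F ` e" using ab by auto
 then obtain r1 r2 where r: "r1 > 0" "ball a r1 <= F ` e" "r2 > 0" "ball b r2 <= F ` e" using U_open unfolding open_contains_ball by metis
 \<comment> \<open>A third, so that margins of \<open>2 * dl\<close> fit: one \<open>dl\<close> for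
   the segment that has to be met, one for the open segment removed beyond it.\<close>
 define dl where "dl = min r1 r2 / 3"
 have dl: "dl > 0" using r by (simp add: dl_def)
 have "a - 2 * dl : ball a r1" "b + 2 * dl : ball b r2" using r by (auto simp: dist_real_def dl_def)
 then have m: "a - 2 * dl : F ` e" "b + 2 * dl : F ` e" using r by blast+
 have S: "{a - 2 * dl..b + 2 * dl} <= F ` e" by (rule sub_U[OF m])
 have mid: "a <= (a + b) / 2" "(a + b) / 2 <= b" using ab(1) by auto
 have S1: "{a - 2 * dl..(a + b) / 2 + dl} <= F ` e" and S2: "{(a + b) / 2 - dl..b + 2 * dl} <= F ` e"
 proof -
  have "s : F ` e" if "a - 2 * dl <= s" "s <= b + 2 * dl" for s using S that by auto
  moreover have "s <= b + 2 * dl" if "s <= (a + b) / 2 + dl" for s using that mid dl by linarith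
  moreover have "a - 2 * dl <= s" if "(a + b) / 2 - dl <= s" for s using that mid dl by linarith
  ultimately show "{a - 2 * dl..(a + b) / 2 + dl} <= F ` e" "{(a + b) / 2 - dl..b + 2 * dl} <= F ` e" by (meson atLeastAtMost_iff subsetI)+
 qed
 have "\<forall>\<^sub>F n in sequentially. connected (points (G n) Int io ` {a - dl..a}) & points (G n) Int io ` {a - dl..a} ~= {}" by (rule segment_connected[OF approx _ _ _ S1]; use dl ab(1) mid in linarith)
 moreover have "\<forall>\<^sub>F n in sequentially. connected (points (G n) Int io ` {b..b + dl}) & points (G n) Int io ` {b..b + dl} ~= {}" by (rule segment_connected[OF approx _ _ _ S2]; use dl ab(1) mid in linarith)
 moreover have "\<forall>\<^sub>F n in sequentially. connected (points (G n) Int io ` {a - dl..b + dl}) & points (G n) Int io ` {a - dl..b + dl} ~= {}" by (rule segment_connected[OF approx _ _ _ S]; use dl ab(1) mid in linarith)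
 ultimately show ?thesis
 proof eventually_elim
  case (elim n)
  let ?D = "points (G n) Int io ` {a - dl..b + dl}"
  obtain p q where p: "p : {a - dl..a}" "io p : points (G n)" and q: "q : {b..b + dl}" "io q : points (G n)" using elim by blast
  have pq: "io p : ?D" "io q : ?D" "p : F ` e" "q : F ` e" using p q S ab dl by (auto simp: subset_iff)
  have "?D <= e" using S dl by (auto intro!: io_in)
  then have "connected (F ` ?D)" using elim by (intro connected_continuous_image continuous_on_subset[OF F_cont]) auto
  moreover have "p : F ` ?D" "q : F ` ?D" using pq F_io by (metis imageI)+
  ultimately have pqD: "{p..q} <= F ` ?D" by (simp add: connected_contains_Icc)
  show ?case
  proof
   fix y assume "y : io ` {a..b}"
   then obtain s where s: "s : {a..b}" "y = io s" by blast
   then have "s : {p..q}" using p q by auto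
   then obtain y' where "y' : ?D" "s = F y'" using pqD by blast
   then show "y : points (G n)" using s(2) io_F[of y'] \<open>?D <= e\<close> by auto
  qed
 qed
qed

lemma graph_arc_eventually:
 assumes approx: "graph_approximation X G" and ab: "a < b" "{a..b} <= F ` e"
  and P: "!!n. graph_brownian_motion (G n) (P n)" and W: "real_brownian_motion x0 MW W"
 shows "\<forall>\<^sub>F n in sequentially. graph_arc (G n) a b io (P n) MW W x0"
proof -
 have "a <= b" using ab by simp
 from segment_covered[OF approx this ab(2)] show ?thesis
 proof eventually_elim
  case (elim n)
  have sub: "{a<..<b} <= F ` e" using ab(2) by auto
  show ?case
  proof
   show "a < b" by (rule ab)
   show "continuous_on {a..b} io" "inj_on io {a..b}" using continuous_on_subset[OF io_cont ab(2)] inj_on_subset[OF io_inj ab(2)] by auto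
   show "io ` {a..b} <= points (G n)" by (rule elim)
   show "openin (top_of_set (points (G n))) (io ` {a<..<b})"
   proof (rule openin_subset_trans[OF io_openin[OF _ sub]])
    have "io ` {a<..<b} <= io ` {a..b}" by (rule image_mono) auto
    then show "io ` {a<..<b} <= points (G n)" using elim by blast
   qed (use approx in \<open>auto simp: graph_approximation_def\<close>)
   show "finite_metric_graph (G n)" using approx by (simp add: graph_approximation_def)
   show "curve_length (chart (G n) e) s t = ennreal (t - s)" if "e : edges (G n)" "0 <= s" "s <= t" "t <= len (G n) e" for e s t using approx that unfolding graph_approximation_def by blast
   show "curve_length io s t = ennreal (t - s)" if "a <= s" "s <= t" "t <= b" for s t by (rule io_len) (use that ab(2) in auto)
  qed (use P W in auto)
 qed
qed

end

subsection \<open>Existence of approximations\<close>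

text \<open>Without any approximation the last clause of \<open>graph_limit_law\<close> would be
  vacuous, and point masses at all paths from \<open>x\<close> would be limit laws. Uniqueness would
  then identify \<open>w\<close> with the constant path, although they differ at
  \<open>t\<close>.\<close>

lemma approximation_exists:
 fixes X :: "'a::metric_space set"
 assumes B: "brownian_motion X x MB B" and w: "w : space (path_space X)" "w 0 = x" and t: "0 <= t" "w t ~= x"
 shows "\<exists>G P y. graph_approximation X G & (\<forall>n. graph_brownian_motion (G n) (P n) & y n : points (G n)) & y \<longlonglongrightarrow> x"
proof (rule ccontr)
 assume no: "\<not> ?thesis"
 have pred: "{v : space (path_space X). v s = x} : sets (path_space X)" if "0 <= s" for s
 proof -
  have "(%v. v s) -` {x} Int space (path_space X) : sets (path_space X)" by (rule measurable_sets[OF eval_borel[OF that]]) simp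
  also have "(%v. v s) -` {x} Int space (path_space X) = {v : space (path_space X). v s = x}" by auto
  finally show ?thesis .
 qed
 have lim: "return (path_space X) v = process_law X MB B" if v: "v : space (path_space X)" "v 0 = x" for v
 proof -
  have "AE u in return (path_space X) v. u 0 = x" by (subst AE_return[OF v(1)]) (use pred[of 0] v(2) in \<open>auto simp: pred_def\<close>)
  moreover have "return (path_space X) v : space (prob_algebra (path_space X))" using v(1) by (simp add: space_prob_algebra prob_space_return)
  ultimately have "graph_limit_law X x (return (path_space X) v)" unfolding graph_limit_law_def using no by blast
  then show ?thesis using B by (simp add: brownian_motion_def)
 qed
 have x: "x : X" using path_space_in[OF w(1), of 0] w(2) by simp
 have "continuous_on {0..} (\<lambda>t\<in>{0::real..}. x)" by (rule continuous_on_eq[OF continuous_on_const[of _ x]]) simp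
 then have c: "(\<lambda>t\<in>{0..}. x) : space (path_space X)" using x by (simp add: space_path_space)
 have eq: "return (path_space X) w = return (path_space X) (\<lambda>t\<in>{0..}. x)" using lim[OF w] lim[OF c] by simp
 have "emeasure (return (path_space X) (\<lambda>t\<in>{0..}. x)) {v : space (path_space X). v t = x} = 1" using pred[OF t(1)] c t by simp
 moreover have "emeasure (return (path_space X) w) {v : space (path_space X). v t = x} = 0" using pred[OF t(1)] t by simp
 ultimately show False using eq by simp
qed

subsection \<open>Expectations of killed processes\<close>

lemma kproc_linear:
 assumes Q: "lbm Q z" and z: "z : {a<..<b}"
 shows "kproc Q UNIV (- {a<..<b}) (%x. x) a b z"
proof -
 interpret lbm Q z by (rule Q)
 show ?thesis
 proof unfold_locales
  show "sets Q = sets (path_space UNIV)" by (rule sets_Q)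
  show "closedin (top_of_set UNIV) (UNIV Int - {a<..<b})" by (simp add: closed_Compl)
  show "(%x::real. x) : bmeas (rborel UNIV)" by (rule measurable_restrict_space1) simp
  show "y : {a<..<b}" if "y : UNIV" "y ~: - {a<..<b}" for y using that by simp
  show "a < b" using z by simp
  show "AE w in Q. w 0 ~: - {a<..<b} & w 0 = z" using start by eventually_elim (use z in simp)
  fix s t :: real and Z :: "(real => real) => real" and n :: nat
  assume st: "0 <= s" "s <= t" and Z: "Z : bmeas (path_filtration UNIV s)"
   and Zb: "!!w. w : space (path_space UNIV) ==> 0 <= Z w & Z w <= 1"
  define th where "th = real n * pi / (b - a)"
  have lin: "real n * (pi * (y - a) / (b - a)) = th * y + - (th * a)" for y by (simp add: th_def diff_divide_distrib right_diff_distrib)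
  have eq: "kext (- {a<..<b}) (%x. x) (sinem a b n) = (%y. if y : {a<..<b} then sin (th * y + - (th * a)) else 0)" by (rule ext) (unfold kext_def sinem_def lin, auto)
  have sa: "sin (th * a + - (th * a)) = 0" by simp
  have sb: "sin (th * b + - (th * a)) = 0" unfolding lin[symmetric] using z by simp
  have Zb1: "\<bar>Z w\<bar> <= 1" if "w : space Q" for w using Zb[of w] that by (simp add: space_Q)
  show "(\<integral>w. Z w * kext (- {a<..<b}) (%x. x) (sinem a b n) (stopped (- {a<..<b}) w t) \<partial>Q)
   = exp (- ((real n * pi / (b - a))^2 / 2) * (t - s)) * (\<integral>w. Z w * kext (- {a<..<b}) (%x. x) (sinem a b n) (stopped (- {a<..<b}) w s) \<partial>Q)" unfolding eq th_def[symmetric] by (rule killed_wave[OF st Z Zb1 z sa sb])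
 qed
qed

lemma unit_test_fun_bump_mult:
 assumes "continuous_on UNIV h" "!!x. 0 <= h x & h x <= 1"
 shows "utest a b (%x. bump a b UNIV m x * h x)" using test_fun_mult[of a b "bump a b UNIV m" h] utest_bump[of a b UNIV m] assms by (auto simp: utest_def intro!: mult_nonneg_nonneg mult_le_one)

text \<open>A factor \<open>bump\<close> turns any continuous function with values in
  \<open>[0,1]\<close> into a test function. Along a surviving path all these factors tend to 1, and
  the last one supplies the survival indicator.\<close>

lemma (in kproc) kmean_bump_lim:
 assumes J: "finite J" "J <= {0..T}" and T: "0 <= T"
  and h: "!!u. continuous_on UNIV (h u)" "!!u x. 0 <= h u x & h u x <= 1"
 shows "(%m. kmean J (%u x. bump a b UNIV m x * h u x) T (bump a b UNIV m))
  \<longlonglongrightarrow> (\<integral>w. (\<Prod>u\<in>J. h u (zt (w u))) * indicator {w. ALL s:{0..T}. w s ~: A} w \<partial>N)" unfolding kmean_def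
proof (rule integral_dominated_convergence[where w="%_. 1"])
 let ?f = "%m w. weight J (%u x. bump a b UNIV m x * h u x) w * kext A zt (bump a b UNIV m) (stopped A w T)"
 note unit = unit_test_fun_bump_mult[OF h, of a b]
 have pt: "(%m. ?f m w) \<longlonglongrightarrow> (\<Prod>u\<in>J. h u (zt (w u))) * indicator {w. ALL s:{0..T}. w s ~: A} w" if w: "w : space N" for w
 proof -
  have w': "w : space (path_space S)" using w by (simp add: space_N)
  show ?thesis
  proof (cases "ALL s:{0..T}. w s ~: A")
   case True
   have st: "stopped A w T = w T" by (rule stopped_stay) (use True T in auto)
   have lim: "(%m. bump a b UNIV m (zt (w s))) \<longlonglongrightarrow> 1" if s: "s : {0..T}" for s
   proof -
    have "w s : S" by (rule path_space_in[OF w']) (use s in simp)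
    then have "zt (w s) : {a<..<b}" using True s by (intro zt_in) auto
    then show ?thesis using bump_lim[OF open_UNIV, of a b "zt (w s)"] by simp
   qed
   have "(%m. (\<Prod>u\<in>J. bump a b UNIV m (zt (w u)) * h u (zt (w u))) * bump a b UNIV m (zt (w T)))
     \<longlonglongrightarrow> (\<Prod>u\<in>J. 1 * h u (zt (w u))) * 1" by (intro tendsto_mult tendsto_prod tendsto_const lim) (use J T in auto)
   moreover have "w T ~: A" using True T by simp
   ultimately show ?thesis using True by (simp add: weight_def kext_def st)
  next
   case False
   then have "stopped A w T : A" using stopped_in_iff[OF closed_hits[OF w' A] T] by blast
   moreover have "w ~: {w. ALL s:{0..T}. w s ~: A}" using False by blast
   ultimately show ?thesis by (simp add: kext_def)
  qed
 qed
 have b1: "\<bar>bump a b UNIV m x\<bar> <= 1" for m x using bump_bounds[where a=a and b=b and U=UNIV and m=m and x=x] by simp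
 show m: "?f m : bmeas N" for m
 proof (rule borel_measurable_times)
  show "weight J (%u x. bump a b UNIV m x * h u x) : bmeas N" unfolding N_meas_iff by (rule filt_meas[OF measurable_weight[OF J(2)]]) (rule unit)
 qed (rule measurable_stopped_ext[OF bump_measurable T])
 show "(%w. (\<Prod>u\<in>J. h u (zt (w u))) * indicator {w. ALL s:{0..T}. w s ~: A} w) : bmeas N" by (rule borel_measurable_LIMSEQ_real[OF pt m])
 show "AE w in N. (%m. ?f m w) \<longlonglongrightarrow> (\<Prod>u\<in>J. h u (zt (w u))) * indicator {w. ALL s:{0..T}. w s ~: A} w" by (rule AE_I2[OF pt])
 show "AE w in N. norm (?f m w) <= 1" for m
 proof (rule AE_I2)
  fix w assume w: "w : space N"
  have "0 <= weight J (%u x. bump a b UNIV m x * h u x) w" "weight J (%u x. bump a b UNIV m x * h u x) w <= 1" using weight_bounds[of J "%u x. bump a b UNIV m x * h u x"] unit by blast+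
  moreover have "\<bar>kext A zt (bump a b UNIV m) (stopped A w T)\<bar> <= 1" by (rule killed_ext_le[OF _ w]) (rule b1, simp)
  ultimately show "norm (?f m w) <= 1" by (simp add: abs_mult mult_le_one)
 qed
qed simp

lemma (in killed_pair) killed_weight_eq:
 fixes h :: "real => real => real"
 assumes J: "finite J" "J <= {0..T}" and T: "0 <= T"
  and h: "!!u. continuous_on UNIV (h u)" "!!u x. 0 <= h u x & h u x <= 1"
 shows "(\<integral>w. (\<Prod>u\<in>J. h u (zt (w u))) * indicator {w. ALL s:{0..T}. w s ~: A} w \<partial>N)
    = (\<integral>w. (\<Prod>u\<in>J. h u (zt' (w u))) * indicator {w. ALL s:{0..T}. w s ~: A'} w \<partial>M)"
proof -
 have "N.kmean J (%u x. bump a b UNIV m x * h u x) T (bump a b UNIV m)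
   = M.kmean J (%u x. bump a b UNIV m x * h u x) T (bump a b UNIV m)" for m by (rule kmean_eq[OF J _ T]) (use unit_test_fun_bump_mult[OF h] utest_bump in \<open>auto simp: utest_def\<close>)
 then show ?thesis using LIMSEQ_unique[OF N.kmean_bump_lim[OF J T h] ] M.kmean_bump_lim[OF J T h] by simp
qed

subsection \<open>Functionals of paths\<close>

lemma inf_on_path:
 fixes R :: "'a::metric_space => real" and T :: real
 assumes "continuous_on UNIV R" "continuous_on {0..T} w" "0 <= T"
 obtains s0 where "s0 : {0..T}" "(INF s\<in>{0..T}. R (w s)) = R (w s0)" "!!s. s : {0..T} ==> R (w s0) <= R (w s)"
proof -
 have "continuous_on {0..T} (%s. R (w s))" by (rule continuous_on_compose2[OF assms(1,2)]) simp
 from continuous_attains_inf[OF compact_Icc _ this] assms(3)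
 obtain s0 where s0: "s0 : {0..T}" "!!s. s : {0..T} ==> R (w s0) <= R (w s)" by fastforce
 have "(INF s\<in>{0..T}. R (w s)) = R (w s0)" by (rule cInf_eq_minimum) (use s0 in auto)
 with s0 that show ?thesis by blast
qed

lemma measurable_inf_on_path:
 fixes R :: "'a::metric_space => real" and T :: real
 assumes R: "continuous_on UNIV R" and T: "0 <= T"
 shows "(%w. INF s\<in>{0..T}. R (w s)) : bmeas (path_space S)" unfolding borel_measurable_iff_greater
proof
 fix r
 have cl: "closedin (top_of_set S) (S Int {y. R y <= r})" by (intro closedin_closed_Int closed_Collect_le R continuous_on_const)
 have "{w : space (path_space S). r < (INF s\<in>{0..T}. R (w s))} = {w : space (path_space S). ALL s:{0..T}. w s ~: {y. R y <= r}}"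
 proof (intro Collect_cong conj_cong refl)
  fix w assume "w : space (path_space S)"
  then have "continuous_on {0..T} w" by (intro continuous_on_subset[OF path_cont]) auto
  then obtain s0 where s0: "s0 : {0..T}" "(INF s\<in>{0..T}. R (w s)) = R (w s0)" "!!s. s : {0..T} ==> R (w s0) <= R (w s)" using inf_on_path[OF R _ T] by metis
  show "r < (INF s\<in>{0..T}. R (w s)) \<longleftrightarrow> (ALL s:{0..T}. w s ~: {y. R y <= r})"
  proof
   assume r: "r < (INF s\<in>{0..T}. R (w s))"
   show "ALL s:{0..T}. w s ~: {y. R y <= r}"
   proof
    fix s assume "s : {0..T}"
    from s0(3)[OF this] r show "w s ~: {y. R y <= r}" unfolding s0(2) by simp
   qed
  next
   assume "ALL s:{0..T}. w s ~: {y. R y <= r}"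
   then have "w s0 ~: {y. R y <= r}" using s0(1) by blast
   then show "r < (INF s\<in>{0..T}. R (w s))" unfolding s0(2) by simp
  qed
 qed
 also have "... : sets (path_space S)" using sets_stay[OF cl] filt_subset by blast
 finally show "{w : space (path_space S). r < (INF s\<in>{0..T}. R (w s))} : sets (path_space S)" .
qed

lemma continuous_map_realI:
 assumes "!!p ep. p : mspace m ==> 0 < ep ==> \<exists>dl>0. ALL q:mspace m. mdist m p q < dl --> \<bar>f p - f q\<bar> < ep"
 shows "continuous_map (mtopology_of m) euclideanreal f"
proof -
 have "ALL a:mspace m. \<forall>ep>0. \<exists>dl>0. \<forall>x. x : mspace m & mdist m a x < dl --> dist (f a) (f x) < ep"
 proof (intro ballI allI impI)
  fix a and ep :: real assume "a : mspace m" "0 < ep"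
  from assms[OF this] show "\<exists>dl>0. \<forall>x. x : mspace m & mdist m a x < dl --> dist (f a) (f x) < ep" unfolding dist_real_def by blast
 qed
 then show ?thesis unfolding mtopology_of_def using Metric_space.metric_continuous_map[OF Metric_space_mspace_mdist Met_TC.Metric_space_axioms, of m f] by simp
qed

context
 fixes X :: "'a::metric_space set" and T :: real
 assumes X: "compact X" and T: "0 < T"
begin

lemma cfunspace_close:
 assumes "p : mspace (cfunspace (top_of_set {0..T}) (submetric euclidean_metric X))"
  "q : mspace (cfunspace (top_of_set {0..T}) (submetric euclidean_metric X))"
  "mdist (cfunspace (top_of_set {0..T}) (submetric euclidean_metric X)) p q < dl" "u : {0..T}"
 shows "dist (p u) (q u) < dl" "p u : X" "continuous_on {0..T} p"
proof -
 have "compactin (top_of_set {0..T}) (topspace (top_of_set {0..T}))" by (simp add: compactin_subtopology)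
 from cfunspace_mdist_lt[OF this assms(1-3)] assms(4) show "dist (p u) (q u) < dl" by simp
 show "p u : X" "continuous_on {0..T} p" using assms(1,4) by (auto simp: mtopology_of_submetric continuous_map_in_subtopology)
qed

lemma continuous_map_evaluation:
 assumes H: "continuous_on X H" and u: "u : {0..T}"
 shows "continuous_map (mtopology_of (cfunspace (top_of_set {0..T}) (submetric euclidean_metric X))) euclideanreal (%w. H (w u))"
proof (rule continuous_map_realI)
 let ?C = "cfunspace (top_of_set {0..T}) (submetric euclidean_metric X)"
 fix p ep assume p: "p : mspace ?C" and "0 < (ep::real)"
 then obtain dl where dl: "dl > 0" "!!y y'. y : X ==> y' : X ==> dist y' y < dl ==> dist (H y') (H y) < ep" using compact_uniformly_continuous[OF H X] unfolding uniformly_continuous_on_def by metis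
 have "\<bar>H (p u) - H (q u)\<bar> < ep" if q: "q : mspace ?C" "mdist ?C p q < dl" for q
 proof -
  have "mdist ?C q p < dl" using q(2) by (simp add: mdist_commute)
  from cfunspace_close(2)[OF q(1) p this u] cfunspace_close(1,2)[OF p q u] show ?thesis using dl(2)[of "q u" "p u"] by (simp add: dist_real_def)
 qed
 then show "\<exists>dl>0. ALL q:mspace ?C. mdist ?C p q < dl --> \<bar>H (p u) - H (q u)\<bar> < ep" using dl(1) by blast
qed

text \<open>The infimum of a 1-Lipschitz function along a path is itself 1-Lipschitz in the uniform
  distance of paths.\<close>

lemma continuous_map_inf:
 assumes R: "!!y y'. \<bar>R y - R y'\<bar> <= dist y y'"
 shows "continuous_map (mtopology_of (cfunspace (top_of_set {0..T}) (submetric euclidean_metric X))) euclideanreal (%w. INF s\<in>{0..T}. R (w s))"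
proof (rule continuous_map_realI)
 let ?C = "cfunspace (top_of_set {0..T}) (submetric euclidean_metric X)"
 have Rc: "continuous_on UNIV R"
 proof (rule continuous_onI)
  fix y e assume "0 < (e::real)"
  moreover have "dist (R y') (R y) <= e" if "dist y' y < e" for y' using R[of y' y] that by (simp add: dist_real_def)
  ultimately show "\<exists>d>0. \<forall>y'\<in>UNIV. dist y' y < d --> dist (R y') (R y) <= e" by blast
 qed
 have half: "(INF s\<in>{0..T}. R (p s)) <= (INF s\<in>{0..T}. R (q s)) + dl"
  if p: "p : mspace ?C" and q: "q : mspace ?C" and d: "mdist ?C p q < dl" for p q dl
 proof -
  have T0: "0 <= T" "0 : {0..T}" using T by auto
  have pc: "continuous_on {0..T} p" by (rule cfunspace_close(3)[OF p q d T0(2)])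
  have qc: "continuous_on {0..T} q" by (rule cfunspace_close(3)[OF q p _ T0(2), where dl=dl]) (use d in \<open>simp add: mdist_commute\<close>)
  obtain s1 where s1: "(INF s\<in>{0..T}. R (p s)) = R (p s1)" "!!s. s : {0..T} ==> R (p s1) <= R (p s)" using inf_on_path[OF Rc pc T0(1)] by metis
  obtain s2 where s2: "s2 : {0..T}" "(INF s\<in>{0..T}. R (q s)) = R (q s2)" using inf_on_path[OF Rc qc T0(1)] by metis
  have "R (p s1) <= R (p s2)" by (rule s1(2)[OF s2(1)])
  then show ?thesis using R[of "p s2" "q s2"] cfunspace_close(1)[OF p q d s2(1)] unfolding s1(1) s2(2) by linarith
 qed
 fix p ep assume p: "p : mspace ?C" and ep: "0 < (ep::real)"
 have "\<bar>(INF s\<in>{0..T}. R (p s)) - (INF s\<in>{0..T}. R (q s))\<bar> < ep" if q: "q : mspace ?C" "mdist ?C p q < ep / 2" for q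
 proof -
  have "mdist ?C q p < ep / 2" using q(2) by (simp add: mdist_commute)
  from half[OF p q] half[OF q(1) p this] show ?thesis using ep by linarith
 qed
 then show "\<exists>dl>0. ALL q:mspace ?C. mdist ?C p q < dl --> \<bar>(INF s\<in>{0..T}. R (p s)) - (INF s\<in>{0..T}. R (q s))\<bar> < ep" using ep by (intro exI[of _ "ep / 2"]) auto
qed

end

subsection \<open>Passing to the limit\<close>

lemma stay_ind_meas:
 fixes S :: "'a::metric_space set"
 assumes "closedin (top_of_set S) (S Int - V)"
 shows "(indicator {w. ALL s:{0..T}. w s : V} :: _ => real) : bmeas (path_space S)"
proof -
 have "{w. ALL s:{0..T}. w s : V} Int space (path_space S) = {w : space (path_space S). ALL s:{0..T}. w s ~: - V}" by auto
 also have "... : sets (path_space S)" using sets_stay[OF assms] filt_subset by blast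
 finally show ?thesis by (simp only: borel_measurable_indicator_iff)
qed

lemma prod_eval_meas:
 fixes S :: "'a::metric_space set"
 assumes "!!u. u : J ==> 0 <= u" "!!u. H u : bmeas (rborel S)"
 shows "(%w. \<Prod>u\<in>J. H u (w u) :: real) : bmeas (path_space S)" by (rule borel_measurable_prod) (rule measurable_compose[OF measurable_eval[OF assms(1)] assms(2)])

text \<open>Hulls of a compact exhaustion treat bounded and unbounded intervals alike. Each compact
  set lies in the interior of the next one, so the hulls grow strictly at both ends.\<close>

lemma interval_exhaustion:
 fixes U :: "real set"
 assumes U: "open U" "is_interval U" "x0 : U"
 obtains a b :: "nat => real"
 where "\<forall>k. a (Suc k) < a k & b k < b (Suc k) & {a k..b k} <= U & x0 : {a (Suc k)<..<b (Suc k)}"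
  "\<forall>K. compact K --> K <= U --> (\<forall>\<^sub>F k in sequentially. K <= {a k<..<b k})"
proof -
 obtain D where D: "!!n::nat. compact (D n)" "!!n. D n <= U" "!!n. D n <= interior (D (Suc n))"
  and ex: "!!K. compact K ==> K <= U ==> \<exists>N. \<forall>n\<ge>N. K <= D n" using open_Union_compact_subsets[OF U(1)] by metis
 obtain M where M: "!!n. n >= M ==> x0 : D n" using ex[of "{x0}"] U(3) by auto
 define a where "a k = Inf (D (M + k))" for k
 define b where "b k = Sup (D (M + k))" for k
 have ne: "D (M + k) ~= {}" for k using M[of "M + k"] by auto
 have bd: "bdd_below (D n)" "bdd_above (D n)" "closed (D n)" for n by (rule bounded_imp_bdd_below[OF compact_imp_bounded[OF D(1)]] bounded_imp_bdd_above[OF compact_imp_bounded[OF D(1)]] compact_imp_closed[OF D(1)])+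
 have aD: "a k : D (M + k)" and bD: "b k : D (M + k)" for k unfolding a_def b_def by (rule closed_contains_Inf closed_contains_Sup; rule ne bd)+
 have le: "a k <= s" "s <= b k" if "s : D (M + k)" for s k unfolding a_def b_def using that bd by (auto intro: cInf_lower cSup_upper)
 have strict: "a (Suc k) < s" "s < b (Suc k)" if "s : D (M + k)" for s k
 proof -
  have "s : interior (D (M + Suc k))" using that D(3)[of "M + k"] by auto
  then obtain r where r: "r > 0" "cball s r <= D (M + Suc k)" unfolding mem_interior_cball by blast
  have "s - r : D (M + Suc k)" "s + r : D (M + Suc k)" using r by (auto simp: dist_real_def subset_iff)
  then show "a (Suc k) < s" "s < b (Suc k)" using le[of "s - r" "Suc k"] le[of "s + r" "Suc k"] r(1) by auto
 qed
 show ?thesis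
 proof (rule that[of a b]; intro allI conjI impI)
  show "a (Suc k) < a k" "b k < b (Suc k)" for k using strict(1)[OF aD[of k]] strict(2)[OF bD[of k]] by auto
  show "{a k..b k} <= U" for k
  proof
   fix s assume "s : {a k..b k}"
   then show "s : U" using U(2) aD[of k] bD[of k] D(2)[of "M + k"] unfolding is_interval_1 by (metis atLeastAtMost_iff subsetD)
  qed
  show "x0 : {a (Suc k)<..<b (Suc k)}" for k using strict[OF M, of k] by auto
  fix K :: "real set" assume "compact K" "K <= U"
  from ex[OF this] obtain n0 where n0: "!!n. n >= n0 ==> K <= D n" by blast
  show "\<forall>\<^sub>F k in sequentially. K <= {a k<..<b k}" using eventually_gt_at_top[of n0]
  proof eventually_elim
   case (elim k)
   then obtain k' where k': "k = Suc k'" "n0 <= k'" by (cases k) auto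
   have "s : {a k<..<b k}" if "s : K" for s using strict[of s k'] n0[of "M + k'"] that k' by auto
   then show ?case by blast
  qed
 qed
qed

context edge_chart
begin

text \<open>Extension by 0 off \<open>e\<close>. For \<open>h\<close> with compact support in the
  image of \<open>F\<close> it is continuous on all of \<open>X\<close>, so it may enter a
  functional tested by weak convergence.\<close>

definition lift :: "(real => real) => 'a => real" where
 "lift h y = (if y : e then h (F y) else 0)"

lemma continuous_on_lift:
 assumes h: "testf c d h" and cd: "{c..d} <= F ` e"
 shows "continuous_on X (lift h)"
proof -
 let ?K = "io ` {c..d}"
 from h obtain dl where hc: "continuous_on UNIV h" and dl: "dl > 0" "!!x. h x ~= 0 ==> c + dl <= x & x <= d - dl" unfolding testf_def by blast
 have zero: "lift h y = 0" if "y ~: ?K" for y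
 proof (rule ccontr)
  assume "lift h y ~= 0"
  then have y: "y : e" "h (F y) ~= 0" by (auto simp: lift_def split: if_splits)
  then have "F y : {c..d}" using dl by force
  then have "io (F y) : ?K" by (rule imageI)
  with that io_F[OF y(1)] show False by simp
 qed
 have "?K <= e" using cd io_in by blast
 then have un: "e Un (X - ?K) = X" using e_sub by blast
 have "openin (top_of_set X) (X Int - ?K)" by (rule openin_open_Int) (use compact_imp_closed[OF io_compact[OF cd]] in auto)
 then have op: "openin (top_of_set X) (X - ?K)" by (simp add: Diff_eq)
 have "continuous_on e (%y. h (F y))" by (rule continuous_on_compose2[OF hc F_cont]) simp
 then have c1: "continuous_on e (lift h)" by (rule continuous_on_eq) (simp add: lift_def)
 have c2: "continuous_on (X - ?K) (lift h)" by (rule continuous_on_eq[OF continuous_on_const[of _ 0]]) (simp add: zero)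
 have "continuous_on (e Un (X - ?K)) (lift h)" by (rule continuous_on_Un_local_open[OF _ _ c1 c2]) (use un e_open op in simp_all)
 then show ?thesis by (simp only: un)
qed

lemma closedin_compl_segment:
 assumes "open V" "V <= F ` e" "S <= X"
 shows "closedin (top_of_set S) (S Int - io ` V)"
proof -
 obtain D where D: "open D" "io ` V = X Int D" using io_openin[OF assms(1,2)] by (auto simp: openin_open)
 then have eq: "S Int - io ` V = S Int - D" using assms(3) by blast
 show ?thesis unfolding eq by (rule closedin_closed_Int[OF closed_Compl[OF D(1)]])
qed

end

text \<open>One passage to the limit, with fixed times \<open>J\<close>, horizon \<open>T\<close>
  and test functions \<open>h\<close>. Their common support in \<open>[c,d]\<close> makes the lifts
  continuous on \<open>X\<close>.\<close>

locale edge_limit = edge_chart X e F io for X e :: "'a::metric_space set" and F io +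
 fixes G :: "nat => 'a mgraph" and P :: "nat => 'a => (real => 'a) measure" and y :: "nat => 'a" and N :: "(real => 'a) measure"
  and MW :: "'w measure" and W :: "real => 'w => real" and x :: 'a
  and J :: "real set" and T :: real and h :: "real => real => real" and c d :: real
 assumes X: "compact X" and approx: "graph_approximation X G" and P: "!!n. graph_brownian_motion (G n) (P n)"
  and y: "!!n. y n : points (G n)" "y \<longlonglongrightarrow> x" and x: "x : e"
  and N: "prob_space N" "sets N = sets (path_space X)" and weak: "weakly_converges X (%n. P n (y n)) N"
  and W: "real_brownian_motion (F x) MW W"
  and J: "finite J" "J <= {0..T}" and T: "0 < T" and h: "!!u. utest c d (h u)" and cd: "{c..d} <= F ` e"
begin

definition "pweight V w = (\<Prod>u\<in>J. lift (h u) (w u)) * indicator {w. ALL s:{0..T}. w s : io ` V} w"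

definition "rweight V w = (\<Prod>u\<in>J. h u (w u)) * indicator {w. ALL s:{0..T}. w s : V} w"

definition "W_path et om = (\<lambda>t\<in>{0..}. W t om + et)"

lemma h01: "0 <= h u s" "h u s <= 1" and h_cont: "continuous_on UNIV (h u)" using h[of u] by (auto simp: utest_def testf_def)

lemma lift01: "0 <= lift (h u) z" "lift (h u) z <= 1" using h01 by (auto simp: lift_def)

lemma J0: "u : J ==> 0 <= u" and JT: "u : J ==> u : {0..T}" using J by auto

lemma prod01:
 assumes "!!u. 0 <= p u" "!!u. p u <= (1::real)"
 shows "0 <= (\<Prod>u\<in>J. p u)" "(\<Prod>u\<in>J. p u) <= 1" using assms by (auto intro: prod_nonneg prod_le_1)

lemma path_weight01: "0 <= pweight V w" "pweight V w <= 1" using prod01[of "%u. lift (h u) (w u)"] lift01 by (auto simp: pweight_def indicator_def)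

lemma real_weight01: "0 <= rweight V w" "rweight V w <= 1" using prod01[of "%u. h u (w u)"] h01 by (auto simp: rweight_def indicator_def)

lemma lift_cont: "continuous_on X (lift (h u))" using continuous_on_lift[OF _ cd] h by (simp add: utest_def)

lemma prod_lift_measurable:
 "S <= X ==> (%w. \<Prod>u\<in>J. lift (h u) (w u)) : bmeas (path_space S)" by (rule prod_eval_meas[OF J0]) (auto intro!: borel_measurable_continuous_on_restrict continuous_on_subset[OF lift_cont])

lemma pw_meas:
 assumes "open V" "V <= F ` e" "S <= X"
 shows "pweight V : bmeas (path_space S)" unfolding pweight_def[abs_def] by (rule borel_measurable_times[OF prod_lift_measurable[OF assms(3)] stay_ind_meas[OF closedin_compl_segment[OF assms]]])

lemma rw_meas:
 assumes "open V"
 shows "rweight V : bmeas (path_space UNIV)" unfolding rweight_def[abs_def]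
proof (rule borel_measurable_times[OF prod_eval_meas[OF J0] stay_ind_meas])
 show "h u : bmeas (rborel UNIV)" for u by (rule measurable_restrict_space1[OF borel_measurable_continuous_onI[OF h_cont]])
qed (use assms in \<open>auto simp: closed_Compl\<close>)

lemma W_path_measurable: "W_path et : MW ->> path_space UNIV" unfolding W_path_def[abs_def] using rbm_affine[OF W, of 1 et] by (intro cprocD(2)) (simp add: real_brownian_motion_def)

lemma W_prob: "prob_space MW" using W cprocD(1) unfolding real_brownian_motion_def by blast

lemma P_law: "prob_space (P n (y n))" "sets (P n (y n)) = sets (path_space (points (G n)))" "points (G n) <= X"
proof -
 interpret path_markov "points (G n)" "P n" using P[of n] by unfold_locales (simp add: graph_brownian_motion_def)
 show "prob_space (P n (y n))" "sets (P n (y n)) = sets (path_space (points (G n)))" by (rule prob_space_P sets_P; rule y)+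
 show "points (G n) <= X" using approx by (simp add: graph_approximation_def)
qed

lemma integrable_unit:
 assumes "prob_space M" "sets M = sets L" "f : bmeas L" "!!w. 0 <= f w" "!!w. f w <= (1::real)"
 shows "integrable M f" using assms by (intro finite_measure.integrable_const_bound[OF prob_space.finite_measure[OF assms(1)], where B=1])
  (auto simp: measurable_cong_sets[OF assms(2) refl])

text \<open>An equality for each late \<open>n\<close>, not a limit: once \<open>G n\<close>
  contains the closed subarc and \<open>y n\<close> lies on it, both killed processes have the same
  sine eigenfunctions and rates.\<close>

lemma weight_at_graph:
 assumes ab: "a < b" "{a..b} <= F ` e" and Fx: "F x : {a<..<b}"
 shows "\<forall>\<^sub>F n in sequentially. (\<integral>w. pweight {a<..<b} w \<partial>P n (y n)) = (\<integral>om. rweight {a<..<b} (W_path (F (y n) - F x) om) \<partial>MW)"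
proof -
 have sub: "{a<..<b} <= F ` e" using ab by auto
 obtain D where D: "open D" "io ` {a<..<b} = X Int D" using io_openin[OF _ sub] by (auto simp: openin_open)
 have "x : io ` {a<..<b}" using Fx io_F[OF x] by (metis imageI)
 then have "\<forall>\<^sub>F n in sequentially. y n : D" using topological_tendstoD[OF y(2) D(1)] D(2) by blast
 moreover have "\<forall>\<^sub>F n in sequentially. graph_arc (G n) a b io (P n) MW W (F x)" by (rule graph_arc_eventually[OF approx ab P W])
 ultimately show ?thesis
 proof eventually_elim
  case (elim n)
  interpret A: graph_arc "G n" a b io "P n" MW W "F x" by (rule elim)
  have "y n : io ` {a<..<b}" using elim(1) y(1)[of n] P_law(3)[of n] D(2) by blast
  then obtain z where z: "z : {a<..<b}" "y n = io z" by blast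
  have Fy: "F (y n) = z" using z sub F_io by auto
  define zt where "zt = (%y. if y : io ` {a..b} then the_inv_into {a..b} io y else 0)"
  have kG: "kproc (P n (y n)) (points (G n)) (- io ` {a<..<b}) zt a b z" unfolding z(2) zt_def by (rule arc_markov.killed_process_arc[OF A.arc_markov_Q z(1)])
  define M where "M = process_law UNIV MW (%t om. W t om + (z - F x))"
  have "lbm M z" unfolding M_def using rbm_affine[OF W, of 1 "z - F x"] by (intro lbm_law) simp
  from kproc_linear[OF this z(1)] have kM: "kproc M UNIV (- {a<..<b}) (%x. x) a b z" .
  interpret K: killed_pair "P n (y n)" "points (G n)" "- io ` {a<..<b}" zt M UNIV "- {a<..<b}" "%x. x" a b z by (rule killed_pair.intro[OF kG kM])
  have T0: "0 <= T" using T by simp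
  have hh: "!!u x. 0 <= h u x & h u x <= 1" using h01 by blast
  have "(\<integral>w. pweight {a<..<b} w \<partial>P n (y n))
    = (\<integral>w. (\<Prod>u\<in>J. h u (zt (w u))) * indicator {w. ALL s:{0..T}. w s ~: - io ` {a<..<b}} w \<partial>P n (y n))"
  proof (rule integral_congr[OF refl])
   fix w
   show "pweight {a<..<b} w = (\<Prod>u\<in>J. h u (zt (w u))) * indicator {w. ALL s:{0..T}. w s ~: - io ` {a<..<b}} w"
   proof (cases "ALL s:{0..T}. w s : io ` {a<..<b}")
    case True
    have "lift (h u) (w u) = h u (zt (w u))" if "u : J" for u
    proof -
     have "w u : io ` {a<..<b}" using True JT[OF that] by blast
     then obtain s where s: "s : {a<..<b}" "w u = io s" by blast
     then have "s : {a..b}" "s : F ` e" using sub by auto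
     then show ?thesis using the_inv_into_f_f[OF A.io_inj, of s] by (simp add: zt_def s(2) lift_def F_io io_in)
    qed
    then show ?thesis using True by (simp add: pweight_def)
   next
    case False
    then have "w ~: {w. ALL s:{0..T}. w s : io ` {a<..<b}}" "w ~: {w. ALL s:{0..T}. w s ~: - io ` {a<..<b}}" by blast+
    then show ?thesis by (simp add: pweight_def)
   qed
  qed
  also have "... = (\<integral>w. rweight {a<..<b} w \<partial>M)" using K.killed_weight_eq[OF J T0 h_cont hh] by (simp add: rweight_def)
  also have "... = (\<integral>om. rweight {a<..<b} (W_path (z - F x) om) \<partial>MW)" unfolding M_def process_law_def W_path_def[symmetric] by (rule integral_distr[OF W_path_measurable rw_meas]) simp
  finally show ?case by (simp add: Fy)
 qed
qed

text \<open>The displacement \<open>et\<close> enters the continuous factors but not the survival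
  indicator, which is discontinuous in it. So \<open>et\<close> can tend to 0 by dominated
  convergence, the displacement of the path being absorbed by a change of \<open>V\<close>.\<close>

definition "smean V et = (\<integral>om. (\<Prod>u\<in>J. h u (W u om + et)) * indicator {w. ALL s:{0..T}. w s : V} (W_path 0 om) \<partial>MW)"

lemma smean_meas:
 assumes "open V"
 shows "(%om. (\<Prod>u\<in>J. h u (W u om + et)) * indicator {w. ALL s:{0..T}. w s : V} (W_path 0 om) :: real) : bmeas MW"
proof (rule borel_measurable_times)
 have "(%w. \<Prod>u\<in>J. h u (w u)) : bmeas (path_space UNIV)" by (rule prod_eval_meas[OF J0]) (auto intro: measurable_restrict_space1 borel_measurable_continuous_onI h_cont)
 from measurable_compose[OF W_path_measurable[of et] this]
 show "(%om. \<Prod>u\<in>J. h u (W u om + et)) : bmeas MW" by (rule subst[of _ _ "%f. f : _", rotated]) (auto simp: W_path_def J0 intro!: prod.cong)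
 have "closedin (top_of_set UNIV) (UNIV Int - V)" using assms by (simp add: closed_Compl)
 from measurable_compose[OF W_path_measurable stay_ind_meas[OF this]]
 show "(%om. indicator {w. ALL s:{0..T}. w s : V} (W_path 0 om) :: real) : bmeas MW" .
qed

lemma smean_lim:
 assumes V: "open V"
 shows "(%n. smean V (F (y n) - F x)) \<longlonglongrightarrow> (\<integral>om. rweight V (W_path 0 om) \<partial>MW)"
proof -
 obtain D where D: "open D" "e = X Int D" using e_open by (auto simp: openin_open)
 have "\<forall>\<^sub>F n in sequentially. y n : e" using topological_tendstoD[OF y(2) D(1)] x D(2) y(1) P_law(3) by (auto elim!: eventually_mono)
 then have "(%n. F (y n)) \<longlonglongrightarrow> F x" by (rule continuous_on_tendsto_compose[OF F_cont y(2) x])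
 then have F0: "(%n. F (y n) - F x) \<longlonglongrightarrow> 0" by (simp add: LIM_zero)
 have "(%n. smean V (F (y n) - F x)) \<longlonglongrightarrow> smean V 0" unfolding smean_def
 proof (rule integral_dominated_convergence[where w="%_. 1"])
  show "AE om in MW. (%n. (\<Prod>u\<in>J. h u (W u om + (F (y n) - F x))) * indicator {w. ALL s:{0..T}. w s : V} (W_path 0 om))
    \<longlonglongrightarrow> (\<Prod>u\<in>J. h u (W u om + 0)) * indicator {w. ALL s:{0..T}. w s : V} (W_path 0 om)" by (intro AE_I2 tendsto_mult tendsto_prod tendsto_const continuous_on_tendsto_compose[OF h_cont] tendsto_add F0) auto
  show "AE om in MW. norm ((\<Prod>u\<in>J. h u (W u om + (F (y n) - F x))) * indicator {w. ALL s:{0..T}. w s : V} (W_path 0 om)) <= 1" for n using prod01[of "%u. h u (W u _ + (F (y n) - F x))"] h01 by (intro AE_I2) (auto simp: indicator_def)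
  show "integrable MW (%_. 1::real)" by (rule finite_measure.integrable_const[OF prob_space.finite_measure[OF W_prob]])
 qed (rule smean_meas[OF V])+
 moreover have "smean V 0 = (\<integral>om. rweight V (W_path 0 om) \<partial>MW)" unfolding smean_def rweight_def by (intro integral_congr refl arg_cong2[where f="(*)"] prod.cong) (simp add: W_path_def J0)
 ultimately show ?thesis by simp
qed

lemma shifted_mean_le:
 assumes V: "open V" "open V'" and sub: "!!s. s : V ==> s + et : V'"
 shows "smean V et <= (\<integral>om. rweight V' (W_path et om) \<partial>MW)"
  and "(!!s. s + et : V' ==> s : V2) ==> open V2 ==> (\<integral>om. rweight V' (W_path et om) \<partial>MW) <= smean V2 et"
proof -
 have i1: "integrable MW (%om. rweight V' (W_path et om))" by (rule integrable_unit[OF W_prob refl measurable_compose[OF W_path_measurable rw_meas[OF V(2)]] real_weight01])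
 have i2: "integrable MW (%om. (\<Prod>u\<in>J. h u (W u om + et)) * indicator {w. ALL s:{0..T}. w s : V} (W_path 0 om))" if "open V" for V by (rule integrable_unit[OF W_prob refl smean_meas[OF that]])
    (use prod01[of "%u. h u (W u _ + et)"] h01 in \<open>auto simp: indicator_def\<close>)
 have rw: "rweight V' (W_path et om) = (\<Prod>u\<in>J. h u (W u om + et)) * indicator {w. ALL s:{0..T}. w s : V'} (W_path et om)" for om unfolding rweight_def by (intro arg_cong2[where f="(*)"] prod.cong refl) (simp add: W_path_def J0)
 have p0: "0 <= (\<Prod>u\<in>J. h u (W u om + et))" for om using prod01(1)[of "%u. h u (W u om + et)"] h01 by simp
 show "smean V et <= (\<integral>om. rweight V' (W_path et om) \<partial>MW)" unfolding smean_def
 proof (rule integral_mono[OF i2[OF V(1)] i1])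
  show "(\<Prod>u\<in>J. h u (W u om + et)) * indicator {w. ALL s:{0..T}. w s : V} (W_path 0 om) <= rweight V' (W_path et om)" for om unfolding rw by (rule mult_left_mono[OF _ p0]) (use sub in \<open>auto simp: indicator_def W_path_def\<close>)
 qed
 show "(\<integral>om. rweight V' (W_path et om) \<partial>MW) <= smean V2 et" if s: "!!s. s + et : V' ==> s : V2" and o: "open V2" unfolding smean_def
 proof (rule integral_mono[OF i1 i2[OF o]])
  show "rweight V' (W_path et om) <= (\<Prod>u\<in>J. h u (W u om + et)) * indicator {w. ALL s:{0..T}. w s : V2} (W_path 0 om)" for om unfolding rw by (rule mult_left_mono[OF _ p0]) (use s in \<open>auto simp: indicator_def W_path_def\<close>)
 qed
qed

lemma small_shift: "0 < ep ==> \<forall>\<^sub>F n in sequentially. \<bar>F (y n) - F x\<bar> < ep"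
proof -
 assume ep: "0 < ep"
 obtain D where D: "open D" "e = X Int D" using e_open by (auto simp: openin_open)
 have "\<forall>\<^sub>F n in sequentially. y n : e" using topological_tendstoD[OF y(2) D(1)] x D(2) y(1) P_law(3) by (auto elim!: eventually_mono)
 then have "(%n. F (y n)) \<longlonglongrightarrow> F x" by (rule continuous_on_tendsto_compose[OF F_cont y(2) x])
 from tendstoD[OF this ep] show ?thesis by (simp add: dist_real_def)
qed

section \<open>Continuous cutoffs of the survival indicator\<close>

context
 fixes a b :: real
 assumes ab: "a < b" "{a..b} <= F ` e"
begin

definition "depth z = infdist z (X - io ` {a<..<b})"

text \<open>Survival is replaced by a function of the least depth along the path, which is
  continuous in the uniform metric, lies below the indicator and converges to it as \<open>m\<close>
  grows.\<close>

definition "cutoff m w = (\<Prod>u\<in>J. lift (h u) (w u)) * min 1 (real m * (INF s\<in>{0..T}. depth (w s)))"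

lemma sub: "{a<..<b} <= F ` e" using ab by auto

lemma depth_cont: "continuous_on UNIV depth" unfolding depth_def[abs_def] by (intro continuous_intros)

lemma depth_pos: "z : X ==> 0 < depth z \<longleftrightarrow> z : io ` {a<..<b}"
proof -
 assume z: "z : X"
 have "closedin (top_of_set X) (X - io ` {a<..<b})" by (rule closedin_diff[OF _ io_openin[OF _ sub]]) auto
 then have cl: "closed (X - io ` {a<..<b})" by (rule closedin_closed_trans) (rule compact_imp_closed[OF X])
 have aU: "a : F ` e" using ab by auto
 have "io a : X - io ` {a<..<b}" using io_mem[OF aU sub] io_in[OF aU] e_sub by auto
 then have "z : X - io ` {a<..<b} \<longleftrightarrow> depth z = 0" unfolding depth_def by (intro in_closed_iff_infdist_zero[OF cl]) auto
 then show ?thesis using z infdist_nonneg[of z "X - io ` {a<..<b}"] unfolding depth_def by auto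
qed

lemma inf_depth:
 assumes w: "w : space (path_space X)"
 obtains s0 where "s0 : {0..T}" "(INF s\<in>{0..T}. depth (w s)) = depth (w s0)"
  "(ALL s:{0..T}. w s : io ` {a<..<b}) \<longleftrightarrow> 0 < depth (w s0)"
proof -
 have "continuous_on {0..T} w" by (rule continuous_on_subset[OF path_cont[OF w]]) auto
 then obtain s0 where s0: "s0 : {0..T}" "(INF s\<in>{0..T}. depth (w s)) = depth (w s0)"
   "!!s. s : {0..T} ==> depth (w s0) <= depth (w s)" using inf_on_path[OF depth_cont] T by (metis less_imp_le)
 have "w s : io ` {a<..<b} \<longleftrightarrow> 0 < depth (w s)" if "s : {0..T}" for s using depth_pos path_space_in[OF w] that by auto
 then have "(ALL s:{0..T}. w s : io ` {a<..<b}) \<longleftrightarrow> 0 < depth (w s0)" using s0(1,3) less_le_trans by blast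
 with s0 that show ?thesis by blast
qed

lemma cutoff01: "0 <= cutoff m w" "cutoff m w <= 1"
proof -
 have "0 <= (INF s\<in>{0..T}. depth (w s))" by (rule cINF_greatest) (use T in \<open>auto simp: depth_def infdist_nonneg\<close>)
 then have "0 <= min 1 (real m * (INF s\<in>{0..T}. depth (w s)))" by simp
 then show "0 <= cutoff m w" "cutoff m w <= 1" using prod01[of "%u. lift (h u) (w u)"] lift01 unfolding cutoff_def by (auto intro!: mult_le_one mult_nonneg_nonneg)
qed

lemma cutoff_measurable: "S <= X ==> cutoff m : bmeas (path_space S)" unfolding cutoff_def[abs_def] using T by (intro borel_measurable_times prod_lift_measurable borel_measurable_min borel_measurable_const measurable_inf_on_path depth_cont) auto

lemma cutoff_mean_lim: "(%n. \<integral>w. cutoff m w \<partial>P n (y n)) \<longlonglongrightarrow> (\<integral>w. cutoff m w \<partial>N)"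
proof -
 let ?C = "cfunspace (top_of_set {0..T}) (submetric euclidean_metric X)"
 have r: "cutoff m (restrict w {0..T}) = cutoff m w" for w
 proof -
  have "(INF s\<in>{0..T}. depth (restrict w {0..T} s)) = (INF s\<in>{0..T}. depth (w s))" by (rule INF_cong) auto
  moreover have "(\<Prod>u\<in>J. lift (h u) (restrict w {0..T} u)) = (\<Prod>u\<in>J. lift (h u) (w u))" by (rule prod.cong) (auto dest: JT)
  ultimately show ?thesis by (simp only: cutoff_def)
 qed
 have "continuous_map (mtopology_of ?C) euclideanreal (cutoff m)" unfolding cutoff_def[abs_def] by (intro continuous_map_real_mult continuous_map_real_min continuous_map_prod[OF J(1)] continuous_map_canonical_const
    continuous_map_evaluation[OF X T lift_cont JT] continuous_map_inf[OF X T])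
    (auto simp: depth_def infdist_triangle_abs)
 moreover have "bounded (cutoff m ` mspace ?C)" using cutoff01 by (auto intro!: boundedI[where B=1])
 ultimately show ?thesis using weak[unfolded weakly_converges_def Let_def, THEN spec, THEN mp, OF T, THEN spec[of _ "cutoff m"]] by (simp add: r)
qed

lemma cutoff_le: "w : space (path_space X) ==> cutoff m w <= pweight {a<..<b} w"
proof -
 assume w: "w : space (path_space X)"
 obtain s0 where s0: "s0 : {0..T}" "(INF s\<in>{0..T}. depth (w s)) = depth (w s0)"
  "(ALL s:{0..T}. w s : io ` {a<..<b}) \<longleftrightarrow> 0 < depth (w s0)" using inf_depth[OF w] by metis
 have "min 1 (real m * depth (w s0)) <= indicator {w. ALL s:{0..T}. w s : io ` {a<..<b}} w" using s0(3) infdist_nonneg[of "w s0" "X - io ` {a<..<b}"] unfolding depth_def indicator_def by auto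
 then show ?thesis unfolding cutoff_def pweight_def s0(2) using prod01(1)[of "%u. lift (h u) (w u)"] lift01 by (intro mult_left_mono) auto
qed

lemma cutoff_lim:
 assumes w: "w : space (path_space X)"
 shows "(%m. cutoff m w) \<longlonglongrightarrow> pweight {a<..<b} w"
proof -
 obtain s0 where s0: "s0 : {0..T}" "(INF s\<in>{0..T}. depth (w s)) = depth (w s0)"
  "(ALL s:{0..T}. w s : io ` {a<..<b}) \<longleftrightarrow> 0 < depth (w s0)" using inf_depth[OF w] by metis
 show ?thesis
 proof (cases "0 < depth (w s0)")
  case True
  obtain m0 where m0: "1 / depth (w s0) < real m0" using reals_Archimedean2 by blast
  have "cutoff m w = pweight {a<..<b} w" if "m0 <= m" for m
  proof -
   have "1 / depth (w s0) < real m" using m0 that by linarith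
   then have "1 <= real m * depth (w s0)" using True by (simp add: field_simps)
   then show ?thesis using s0(3) True by (simp add: cutoff_def pweight_def s0(2))
  qed
  then have "\<forall>\<^sub>F m in sequentially. cutoff m w = pweight {a<..<b} w" by (auto simp: eventually_sequentially)
  then show ?thesis by (rule tendsto_eventually)
 next
  case False
  then have "depth (w s0) = 0" using infdist_nonneg[of "w s0" "X - io ` {a<..<b}"] by (simp add: depth_def)
  moreover have "w ~: {w. ALL s:{0..T}. w s : io ` {a<..<b}}" using s0(3) False by blast
  ultimately show ?thesis by (simp add: cutoff_def pweight_def s0(2))
 qed
qed

text \<open>\<open>depth\<close> has a positive minimum on the compact smaller arc; any
  \<open>m\<close> above its reciprocal makes the \<open>min\<close> equal to 1 there.\<close>

lemma cutoff_ge: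
 assumes ab': "a < a'" "a' < b'" "b' < b"
 obtains m where "!!w. w : space (path_space X) ==> pweight {a'<..<b'} w <= cutoff m w"
proof -
 have sub': "{a'..b'} <= F ` e" "{a'..b'} <= {a<..<b}" using ab ab' by auto
 obtain z0 where z0: "z0 : io ` {a'..b'}" "!!z. z : io ` {a'..b'} ==> depth z0 <= depth z" using continuous_attains_inf[OF io_compact[OF sub'(1)] _ continuous_on_subset[OF depth_cont]] ab' by (metis atLeastatMost_empty_iff2 image_is_empty less_imp_le not_less subset_UNIV)
 have "z0 : io ` {a<..<b}" using z0(1) sub'(2) by blast
 moreover from this have "z0 : X" using sub io_in e_sub by blast
 ultimately have pos: "0 < depth z0" using depth_pos by blast
 obtain m where m: "1 / depth z0 < real m" using reals_Archimedean2 by blast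
 have "pweight {a'<..<b'} w <= cutoff m w" if w: "w : space (path_space X)" for w
 proof (cases "ALL s:{0..T}. w s : io ` {a'<..<b'}")
  case True
  obtain s0 where s0: "s0 : {0..T}" "(INF s\<in>{0..T}. depth (w s)) = depth (w s0)" using inf_depth[OF w] by metis
  have "w s0 : io ` {a'<..<b'}" using True s0(1) by blast
  then have "w s0 : io ` {a'..b'}" by auto
  then have "1 / depth z0 * depth z0 <= real m * depth (w s0)" using z0(2) m pos by (intro mult_mono) auto
  then have "1 <= real m * depth (w s0)" using pos by simp
  then show ?thesis using True by (simp add: cutoff_def pweight_def s0(2))
 next
  case False
  then have "w ~: {w. ALL s:{0..T}. w s : io ` {a'<..<b'}}" by blast
  then show ?thesis using cutoff01(1) by (simp add: pweight_def)
 qed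
 then show ?thesis by (rule that)
qed

end

lemma space_law: "w : space N ==> w : space (path_space X)" "w : space (P n (y n)) ==> w : space (path_space X)" using sets_eq_imp_space_eq[OF N(2)] sets_eq_imp_space_eq[OF P_law(2)[of n]] P_law(3)[of n] by (auto simp: space_path_space PiE_iff)

text \<open>For late \<open>n\<close> the displacement of the start is smaller than the margins
  between the nested intervals. Thus the cutoff is bounded by survival in \<open>(a,b)\<close>, and
  this by survival of the undisplaced motion in \<open>(a2,b2)\<close>; first \<open>n\<close> and
  then \<open>m\<close> tends to infinity.\<close>

lemma weight_upper:
 assumes ab: "a2 < a" "a < b" "b < b2" "{a2..b2} <= F ` e" and Fx: "F x : {a<..<b}"
 shows "(\<integral>w. pweight {a<..<b} w \<partial>N) <= (\<integral>om. rweight {a2<..<b2} (W_path 0 om) \<partial>MW)"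
proof -
 have sub: "{a..b} <= F ` e" "{a<..<b} <= F ` e" using ab by (auto simp: subset_iff)
 have le: "(\<integral>w. cutoff a b m w \<partial>N) <= (\<integral>om. rweight {a2<..<b2} (W_path 0 om) \<partial>MW)" for m
 proof (rule tendsto_le[OF trivial_limit_sequentially smean_lim cutoff_mean_lim[OF ab(2) sub(1)]])
  have "0 < min (a - a2) (b2 - b)" using ab by simp
  from small_shift[OF this] weight_at_graph[OF ab(2) sub(1) Fx]
  show "\<forall>\<^sub>F n in sequentially. (\<integral>w. cutoff a b m w \<partial>P n (y n)) <= smean {a2<..<b2} (F (y n) - F x)"
  proof eventually_elim
   case (elim n)
   have "(\<integral>w. cutoff a b m w \<partial>P n (y n)) <= (\<integral>w. pweight {a<..<b} w \<partial>P n (y n))" by (intro integral_mono integrable_unit[OF P_law(1,2)] cutoff_measurable[OF ab(2) sub(1) P_law(3)] cutoff01[OF ab(2) sub(1)]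
      pw_meas[OF _ sub(2) P_law(3)] path_weight01 cutoff_le[OF ab(2) sub(1) space_law(2)]) auto
   also have "... <= smean {a2<..<b2} (F (y n) - F x)" unfolding elim(2) by (rule shifted_mean_le(2)[of "{}"]) (use elim(1) in auto)
   finally show ?case .
  qed
 qed simp
 have "(%m. \<integral>w. cutoff a b m w \<partial>N) \<longlonglongrightarrow> (\<integral>w. pweight {a<..<b} w \<partial>N)"
 proof (rule integral_dominated_convergence[where w="%_. 1"])
  show "pweight {a<..<b} : bmeas N" using pw_meas[OF _ sub(2) order_refl] by (simp add: measurable_cong_sets[OF N(2) refl])
  show "cutoff a b m : bmeas N" for m using cutoff_measurable[OF ab(2) sub(1) order_refl] by (simp add: measurable_cong_sets[OF N(2) refl])
  show "integrable N (%_. 1::real)" by (rule finite_measure.integrable_const[OF prob_space.finite_measure[OF N(1)]])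
  show "AE w in N. (%m. cutoff a b m w) \<longlonglongrightarrow> pweight {a<..<b} w" by (rule AE_I2[OF cutoff_lim[OF ab(2) sub(1) space_law(1)]])
  show "AE w in N. norm (cutoff a b m w) <= 1" for m using cutoff01[OF ab(2) sub(1)] by (intro AE_I2) simp
 qed
 then show ?thesis by (rule LIMSEQ_le_const2) (use le in blast)
qed

lemma weight_lower:
 assumes ab: "a < a1" "a1 < b1" "b1 < b" "{a..b} <= F ` e" and Fx: "F x : {a1<..<b1}"
 shows "(\<integral>om. rweight {a1<..<b1} (W_path 0 om) \<partial>MW) <= (\<integral>w. pweight {a<..<b} w \<partial>N)"
proof -
 \<comment> \<open>Midpoints divide each margin: the outer half is spent on the cutoff, the inner
   half on the displacement of the starting point.\<close>
 define a' b' where "a' = (a + a1) / 2" and "b' = (b + b1) / 2"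
 have ab': "a < a'" "a' < a1" "b1 < b'" "b' < b" "a' < b'" "a < b" using ab by (auto simp: a'_def b'_def)
 have sub: "{a'..b'} <= F ` e" "{a'<..<b'} <= F ` e" "{a<..<b} <= F ` e" using ab ab' by (auto simp: subset_iff)
 have Fx': "F x : {a'<..<b'}" using Fx ab' by auto
 obtain m where m: "!!w. w : space (path_space X) ==> pweight {a'<..<b'} w <= cutoff a b m w" using cutoff_ge[OF ab'(6) ab(4) ab'(1,5,4)] by blast
 have "(\<integral>om. rweight {a1<..<b1} (W_path 0 om) \<partial>MW) <= (\<integral>w. cutoff a b m w \<partial>N)"
 proof (rule tendsto_le[OF trivial_limit_sequentially cutoff_mean_lim[OF ab'(6) ab(4)] smean_lim])
  have "0 < min (a1 - a') (b' - b1)" using ab' by simp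
  from small_shift[OF this] weight_at_graph[OF ab'(5) sub(1) Fx']
  show "\<forall>\<^sub>F n in sequentially. smean {a1<..<b1} (F (y n) - F x) <= (\<integral>w. cutoff a b m w \<partial>P n (y n))"
  proof eventually_elim
   case (elim n)
   have "smean {a1<..<b1} (F (y n) - F x) <= (\<integral>w. pweight {a'<..<b'} w \<partial>P n (y n))" unfolding elim(2) by (rule shifted_mean_le(1)) (use elim(1) in auto)
   also have "... <= (\<integral>w. cutoff a b m w \<partial>P n (y n))" by (intro integral_mono integrable_unit[OF P_law(1,2)] cutoff_measurable[OF ab'(6) ab(4) P_law(3)] cutoff01[OF ab'(6) ab(4)]
      pw_meas[OF _ sub(2) P_law(3)] path_weight01 m space_law(2)) auto
   finally show ?case .
  qed
 qed simp
 also have "... <= (\<integral>w. pweight {a<..<b} w \<partial>N)" by (intro integral_mono integrable_unit[OF N] cutoff_measurable[OF ab'(6) ab(4) order_refl] cutoff01[OF ab'(6) ab(4)]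
    pw_meas[OF _ sub(3) order_refl] path_weight01 cutoff_le[OF ab'(6) ab(4) space_law(1)]) auto
 finally show ?thesis .
qed

text \<open>The upper and lower bounds on neighbouring members of an exhaustion become equal in the
  limit, since both weights converge to those of the full edge.\<close>

lemma weight_eq: "(\<integral>w. pweight (F ` e) w \<partial>N) = (\<integral>om. rweight (F ` e) (W_path 0 om) \<partial>MW)"
proof -
 obtain a b :: "nat => real"
  where ab: "\<forall>k. a (Suc k) < a k & b k < b (Suc k) & {a k..b k} <= F ` e & F x : {a (Suc k)<..<b (Suc k)}"
   and ex: "\<forall>K. compact K --> K <= F ` e --> (\<forall>\<^sub>F k in sequentially. K <= {a k<..<b k})" by (rule interval_exhaustion[OF U_open U_interval imageI[OF x]]) (rule that; assumption)
 have mono: "a (Suc k) < a k" "b k < b (Suc k)" and sub: "{a k..b k} <= F ` e"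
  and Fx: "F x : {a (Suc k)<..<b (Suc k)}" for k using ab[THEN spec[of _ k]] by simp_all
 define V where "V k = {a k<..<b k}" for k
 have VU: "open (V k)" "V k <= F ` e" for k using sub[of k] by (auto simp: V_def)
 have lt: "a (Suc k) < b (Suc k)" for k using Fx[of k] by auto
 \<comment> \<open>A path that stays in the open interval up to \<open>T\<close> has compact range
   there, hence lies in all late members of the exhaustion.\<close>
 have ind: "(%k. indicator {w. ALL s:{0..T}. w s : V k} (%s. q (w s)) :: real) \<longlonglongrightarrow> indicator {w. ALL s:{0..T}. w s : F ` e} (%s. q (w s))"
  if q: "(ALL s:{0..T}. q (w s) : F ` e) ==> continuous_on {0..T} (%s. q (w s))" for q and w :: "real => 'z"
 proof (cases "ALL s:{0..T}. q (w s) : F ` e")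
  case True
  have "\<forall>\<^sub>F k in sequentially. (%s. q (w s)) ` {0..T} <= {a k<..<b k}" by (rule ex[THEN spec, THEN mp, THEN mp, OF compact_continuous_image[OF q[OF True] compact_Icc]]) (use True in blast)
  then have "\<forall>\<^sub>F k in sequentially. indicator {w. ALL s:{0..T}. w s : V k} (%s. q (w s)) = (1::real)" by eventually_elim (auto simp: V_def image_subset_iff)
  then show ?thesis using True by (simp add: tendsto_eventually)
 next
  case False
  then have "(%s. q (w s)) ~: {w. ALL s:{0..T}. w s : V k}" for k using VU(2)[of k] by blast
  then show ?thesis using False by simp
 qed
 have l1: "(%k. \<integral>w. pweight (V k) w \<partial>N) \<longlonglongrightarrow> (\<integral>w. pweight (F ` e) w \<partial>N)"
 proof (rule integral_dominated_convergence[where w="%_. 1"])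
  show "pweight (F ` e) : bmeas N" "!!k. pweight (V k) : bmeas N" using pw_meas[OF _ _ order_refl] VU U_open by (simp_all add: measurable_cong_sets[OF N(2) refl])
  show "integrable N (%_. 1::real)" by (rule finite_measure.integrable_const[OF prob_space.finite_measure[OF N(1)]])
  show "AE w in N. norm (pweight (V k) w) <= 1" for k using path_weight01 by (intro AE_I2) simp
  show "AE w in N. (%k. pweight (V k) w) \<longlonglongrightarrow> pweight (F ` e) w"
  proof (rule AE_I2)
   fix w assume "w : space N"
   then have w: "w : space (path_space X)" by (rule space_law)
   have e: "io ` F ` e = e" using io_F by (auto simp: image_image)
   have wc: "continuous_on {0..T} w" by (rule continuous_on_subset[OF path_cont[OF w]]) auto
   have eqi: "(indicator {w. ALL s:{0..T}. w s : io ` V} w :: real)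
     = indicator {w. ALL s:{0..T}. w s : e} w * indicator {w. ALL s:{0..T}. w s : V} (%s. F (w s))" if "V <= F ` e" for V unfolding io_image[OF that] by (auto simp: indicator_def)
   show "(%k. pweight (V k) w) \<longlonglongrightarrow> pweight (F ` e) w"
   proof (cases "ALL s:{0..T}. w s : e")
    case True
    have "continuous_on {0..T} (%s. F (w s))" by (rule continuous_on_compose2[OF F_cont wc]) (use True in auto)
    from ind[of F w, OF this] show ?thesis unfolding pweight_def eqi[OF VU(2)] eqi[OF order_refl] by (intro tendsto_mult tendsto_const)
   next
    case False
    then have "w ~: {w. ALL s:{0..T}. w s : e}" by blast
    then show ?thesis unfolding pweight_def eqi[OF VU(2)] eqi[OF order_refl] by simp
   qed
  qed
 qed
 have l2: "(%k. \<integral>om. rweight (V k) (W_path 0 om) \<partial>MW) \<longlonglongrightarrow> (\<integral>om. rweight (F ` e) (W_path 0 om) \<partial>MW)"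
 proof (rule integral_dominated_convergence[where w="%_. 1"])
  show "(%om. rweight (F ` e) (W_path 0 om)) : bmeas MW" "!!k. (%om. rweight (V k) (W_path 0 om)) : bmeas MW" using measurable_compose[OF W_path_measurable rw_meas] VU U_open by blast+
  show "integrable MW (%_. 1::real)" by (rule finite_measure.integrable_const[OF prob_space.finite_measure[OF W_prob]])
  show "AE om in MW. norm (rweight (V k) (W_path 0 om)) <= 1" for k using real_weight01 by (intro AE_I2) simp
  show "AE om in MW. (%k. rweight (V k) (W_path 0 om)) \<longlonglongrightarrow> rweight (F ` e) (W_path 0 om)"
  proof (rule AE_I2)
   fix om assume "om : space MW"
   from measurable_space[OF W_path_measurable this] have "continuous_on {0..T} (W_path 0 om)" by (intro continuous_on_subset[OF path_cont]) auto
   from ind[of "%s. s" "W_path 0 om", OF this] show "(%k. rweight (V k) (W_path 0 om)) \<longlonglongrightarrow> rweight (F ` e) (W_path 0 om)" unfolding rweight_def by (intro tendsto_mult tendsto_const)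
  qed
 qed
 show ?thesis
 \<comment> \<open>Successive stages provide the strict margins that the bounds demand, and
   \<open>F x\<close> is known to lie inside from stage 1 on; hence \<open>Suc k\<close> against
   \<open>Suc (Suc k)\<close>.\<close>
 proof (rule order_antisym)
  show "(\<integral>w. pweight (F ` e) w \<partial>N) <= (\<integral>om. rweight (F ` e) (W_path 0 om) \<partial>MW)"
  proof (rule LIMSEQ_le[OF LIMSEQ_Suc[OF l1] LIMSEQ_Suc[OF LIMSEQ_Suc[OF l2]]], intro exI allI impI)
   show "(\<integral>w. pweight (V (Suc k)) w \<partial>N) <= (\<integral>om. rweight (V (Suc (Suc k))) (W_path 0 om) \<partial>MW)" for k unfolding V_def by (rule weight_upper[OF mono(1) lt mono(2) sub Fx])
  qed
  show "(\<integral>om. rweight (F ` e) (W_path 0 om) \<partial>MW) <= (\<integral>w. pweight (F ` e) w \<partial>N)"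
  proof (rule LIMSEQ_le[OF LIMSEQ_Suc[OF l2] LIMSEQ_Suc[OF LIMSEQ_Suc[OF l1]]], intro exI allI impI)
   show "(\<integral>om. rweight (V (Suc k)) (W_path 0 om) \<partial>MW) <= (\<integral>w. pweight (V (Suc (Suc k))) w \<partial>N)" for k unfolding V_def by (rule weight_lower[OF mono(1) lt mono(2) sub Fx])
  qed
 qed
qed

end

subsection \<open>The identity\<close>

text \<open>The range of a path over an interval of time is connected, so it cannot lead out of
  \<open>e\<close> without meeting the frontier; an open set is disjoint from its frontier.\<close>

lemma stay_iff_before_frontier:
 fixes S e :: "'a::metric_space set"
 assumes w: "w : space (path_space S)" "w 0 : e" and e: "openin (top_of_set S) e" and T: "0 <= T"
 shows "ennreal T < hitting_time (top_of_set S frontier_of e) w \<longleftrightarrow> (ALL s:{0..T}. w s : e)"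
proof -
 let ?A = "top_of_set S frontier_of e"
 have AS: "?A <= S" using frontier_of_subset_topspace[of "top_of_set S" e] by simp
 have cl: "closedin (top_of_set S) (S Int ?A)" using closedin_frontier_of[of "top_of_set S" e] AS by (simp add: Int_absorb1)
 have dis: "e Int ?A = {}" using frontier_of_disjoint_eq[of e "top_of_set S"] openin_imp_subset[OF e] e by (simp add: Int_commute)
 show ?thesis unfolding less_hit_iff[OF w(1) cl T]
 proof
  assume no: "ALL s:{0..T}. w s ~: ?A"
  show "ALL s:{0..T}. w s : e"
  proof (rule ballI, rule ccontr)
   fix s assume s: "s : {0..T}" "w s ~: e"
   have "connected (w ` {0..s})" by (intro connected_continuous_image continuous_on_subset[OF path_cont[OF w(1)]]) auto
   moreover have "w ` {0..s} <= S" using path_space_in[OF w(1)] by auto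
   ultimately have "connectedin (top_of_set S) (w ` {0..s})" by (simp add: connectedin_subtopology)
   moreover have "w 0 : w ` {0..s}" "w s : w ` {0..s}" using s(1) by auto
   then have "w ` {0..s} Int e ~= {}" "w ` {0..s} - e ~= {}" using w(2) s(2) by blast+
   ultimately have "w ` {0..s} Int ?A ~= {}" by (rule connectedin_Int_frontier_of)
   then obtain r where "r : {0..s}" "w r : ?A" by blast
   then show False using no s(1) by auto
  qed
 next
  assume "ALL s:{0..T}. w s : e"
  then show "ALL s:{0..T}. w s ~: ?A" using dis by blast
 qed
qed

lemma hitting_time_restrict: "hitting_time A (\<lambda>s\<in>{0..}. w s) = hitting_time A w"
proof -
 have "{t. 0 <= t & (\<lambda>u\<in>{0..}. w u) t : A} = {t. 0 <= t & w t : A}" by (auto simp: restrict_def)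
 then show ?thesis by (simp only: hitting_time_def)
qed

lemma bounded_open_interval:
 fixes U :: "real set"
 assumes U: "open U" "is_interval U" "U ~= {}" "bounded U"
 shows "U = {Inf U<..<Sup U}"
proof (intro set_eqI iffI)
 fix s assume "s : U"
 then obtain r where r: "r > 0" "cball s r <= U" using U(1) open_contains_cball by blast
 have "s - r : U" "s + r : U" using r by (auto simp: dist_real_def subset_iff)
 then have "Inf U <= s - r" "s + r <= Sup U" using U(4) by (auto intro: cInf_lower cSup_upper bounded_imp_bdd_below bounded_imp_bdd_above)
 then show "s : {Inf U<..<Sup U}" using r(1) by auto
next
 fix s assume "s : {Inf U<..<Sup U}"
 then obtain p q where "p : U" "p < s" "q : U" "s < q" using cInf_lessD[OF U(3), of s] less_cSupD[OF U(3), of s] by auto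
 then show "s : U" using U(2) unfolding is_interval_1 by (meson less_imp_le)
qed

text \<open>\<open>killed_law_eqI\<close> works on an interval with real end points, while the image
  of \<open>F\<close> may be a half-line or the whole line.\<close>

lemma arctan_open_interval:
 assumes U: "open U" "is_interval U" "U ~= {}"
 obtains alp bt where "arctan ` U = {alp<..<bt}"
proof -
 have "arctan ` U = {- (pi / 2)<..<pi / 2} Int tan -` U"
 proof (intro set_eqI iffI)
  fix s assume "s : {- (pi / 2)<..<pi / 2} Int tan -` U"
  then have "arctan (tan s) = s" "tan s : U" using arctan_tan[of s] by auto
  then show "s : arctan ` U" by (metis imageI)
 next
  fix s assume "s : arctan ` U"
  then obtain r where "r : U" "s = arctan r" by blast
  then show "s : {- (pi / 2)<..<pi / 2} Int tan -` U" using arctan_lbound[of r] arctan_ubound[of r] tan_arctan[of r] by simp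
 qed
 moreover have "open ({- (pi / 2)<..<pi / 2} Int tan -` U)"
 proof (rule continuous_open_preimage[OF _ _ U(1)])
  show "continuous_on {- (pi / 2)<..<pi / 2} (tan :: real => real)" using cos_gt_zero_pi by (intro continuous_on_tan continuous_on_id) (force simp: less_le)
 qed simp
 ultimately have "open (arctan ` U)" by simp
 moreover have "is_interval (arctan ` U)" using U(2) unfolding is_interval_connected_1 by (intro connected_continuous_image continuous_on_arctan continuous_on_id)
 moreover have "bounded (arctan ` U)"
 proof (rule bounded_subset[of "{- (pi / 2)..pi / 2}"], simp, rule subsetI)
  fix y assume "y : arctan ` U"
  then obtain s where "y = arctan s" by blast
  then show "y : {- (pi / 2)..pi / 2}" using arctan_lbound[of s] arctan_ubound[of s] by simp
 qed
 ultimately show ?thesis using bounded_open_interval[of "arctan ` U"] U(3) that by blast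
qed

lemma weighted_law_integral:
 fixes K :: "'m => real" and ps :: "'l => real"
 assumes K: "K : bmeas M" "!!om. 0 <= K om" and Y: "Y : M ->> L" and ps: "ps : bmeas L"
 shows "integrable M (%om. K om * ps (Y om)) \<longleftrightarrow> integrable (distr (density M (%om. ennreal (K om))) L Y) ps"
  and "(\<integral>om. K om * ps (Y om) \<partial>M) = (\<integral>z. ps z \<partial>distr (density M (%om. ennreal (K om))) L Y)"
proof -
 have Y': "Y : density M (%om. ennreal (K om)) ->> L" using Y by simp
 have psY: "(%om. ps (Y om)) : bmeas M" by (rule measurable_compose[OF Y ps])
 show "integrable M (%om. K om * ps (Y om)) \<longleftrightarrow> integrable (distr (density M (%om. ennreal (K om))) L Y) ps" unfolding integrable_distr_eq[OF Y' ps] using integrable_density[OF psY K(1)] K(2) by simp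
 show "(\<integral>om. K om * ps (Y om) \<partial>M) = (\<integral>z. ps z \<partial>distr (density M (%om. ennreal (K om))) L Y)" unfolding integral_distr[OF Y' ps] using integral_density[OF psY K(1)] K(2) by simp
qed

text \<open>The path that runs along \<open>e\<close> from \<open>x\<close> for a time
  \<open>dl\<close> and then rests is a non-constant path for
  \<open>approximation_exists\<close>.\<close>

lemma (in edge_chart) approximations_at:
 assumes B: "brownian_motion X x MB B" and x: "x : e"
 obtains G P y where "graph_approximation X G" "\<forall>n. graph_brownian_motion (G n) (P n) & y n : points (G n)" "y \<longlonglongrightarrow> x"
proof -
 obtain dl where dl: "dl > 0" "cball (F x) dl <= F ` e" using U_open x open_contains_cball by blast
 define w where "w = (\<lambda>s\<in>{0..}. io (F x + min s dl))"
 have m: "F x + min s dl : F ` e" if "0 <= s" for s by (rule subsetD[OF dl(2)]) (use that dl(1) in \<open>auto simp: dist_real_def\<close>)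
 have "continuous_on {0..} (%s. io (F x + min s dl))" by (rule continuous_on_compose2[OF io_cont]) (use m in \<open>auto intro!: continuous_intros\<close>)
 then have "continuous_on {0..} w" by (rule continuous_on_eq) (simp add: w_def)
 then have w: "w : space (path_space X)" using m io_in e_sub by (auto simp: space_path_space w_def)
 have w0: "w 0 = x" using io_F[OF x] dl(1) by (simp add: w_def)
 have "w dl ~= x"
 proof
  assume "w dl = x"
  then have "F (io (F x + dl)) = F x" using dl(1) by (simp add: w_def)
  then show False using F_io[OF m[of dl]] dl(1) by simp
 qed
 from approximation_exists[OF B w w0 less_imp_le[OF dl(1)] this] show ?thesis using that by blast
qed

text \<open>Finitely many margins have a common one in the \<open>arctan\<close> coordinate; strict
  monotonicity turns it into a margin around points \<open>c\<close> and \<open>d\<close> of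
  \<open>U\<close>. Outside \<open>J\<close> the zero function completes the family.\<close>

lemma unit_test_fun_arctan:
 assumes U: "arctan ` U = {alp<..<bt}" "U ~= {}" and J: "finite J" "ALL u:J. utest alp bt (h u)"
 obtains c d where "c : U" "d : U" "\<forall>u. utest c d (%s. if u : J then h u (arctan s) else 0)"
proof -
 have "ALL u:J. \<exists>dl>0. \<forall>s. h u s ~= 0 --> alp + dl <= s & s <= bt - dl" using J(2) by (simp add: utest_def testf_def)
 then have "\<exists>D. ALL u:J. D u > 0 & (\<forall>s. h u s ~= 0 --> alp + D u <= s & s <= bt - D u)" by (rule bchoice)
 then obtain D where D: "!!u. u : J ==> D u > 0" "!!u s. u : J ==> h u s ~= 0 ==> alp + D u <= s & s <= bt - D u" by blast
 \<comment> \<open>The inserted value keeps the minimum defined for empty \<open>J\<close> and makes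
   \<open>alp + dl / 2\<close> and \<open>bt - dl / 2\<close> points of the interval.\<close>
 define dl where "dl = Min (insert ((bt - alp) / 2) (D ` J))"
 have "{alp<..<bt} ~= {}" unfolding U(1)[symmetric] using U(2) by simp
 then have "alp < bt" by simp
 have fin: "finite (insert ((bt - alp) / 2) (D ` J))" using J(1) by simp
 have "dl : insert ((bt - alp) / 2) (D ` J)" unfolding dl_def by (rule Min_in[OF fin]) simp
 then have "0 < dl" using D(1) \<open>alp < bt\<close> by auto
 moreover have "dl <= (bt - alp) / 2" unfolding dl_def by (rule Min_le[OF fin]) simp
 moreover have "dl <= D u" if "u : J" for u unfolding dl_def by (rule Min_le[OF fin]) (use that in simp)
 ultimately have dl: "0 < dl" "dl <= (bt - alp) / 2" "!!u. u : J ==> dl <= D u" by blast+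
 have inU: "s : arctan ` U" if "alp < s" "s < bt" for s unfolding U(1) using that by simp
 obtain c where c: "alp + dl / 2 = arctan c" "c : U" by (rule imageE[OF inU[of "alp + dl / 2"]]) (use dl(1,2) \<open>alp < bt\<close> in auto)
 obtain c' where c': "alp + dl = arctan c'" by (rule imageE[OF inU[of "alp + dl"]]) (use dl(1,2) \<open>alp < bt\<close> in auto)
 obtain d' where d': "bt - dl = arctan d'" by (rule imageE[OF inU[of "bt - dl"]]) (use dl(1,2) \<open>alp < bt\<close> in auto)
 obtain d where d: "bt - dl / 2 = arctan d" "d : U" by (rule imageE[OF inU[of "bt - dl / 2"]]) (use dl(1,2) \<open>alp < bt\<close> in auto)
 note cd = c(2) c(1)[symmetric] c'[symmetric] d'[symmetric] d(2) d(1)[symmetric]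
 have lt: "c < c'" "d' < d" using arctan_less_iff[of c c'] arctan_less_iff[of d' d] cd dl(1) by auto
 have "utest c d (%s. if u : J then h u (arctan s) else 0)" for u
 proof (cases "u : J")
  case True
  have c: "continuous_on UNIV (h u)" and b: "!!s. 0 <= h u s & h u s <= 1" using J(2) True by (auto simp: utest_def testf_def)
  have "continuous_on UNIV (%s. h u (arctan s))" by (rule continuous_on_compose2[OF c continuous_on_arctan[OF continuous_on_id]]) simp
  moreover have "c + min (c' - c) (d - d') <= s & s <= d - min (c' - c) (d - d')" if "h u (arctan s) ~= 0" for s
  proof -
   have "arctan c' <= arctan s" "arctan s <= arctan d'" using D(2)[OF True that] dl(3)[OF True] cd by auto
   then have "c' <= s" "s <= d'" by (simp_all add: arctan_le_iff)
   then show ?thesis by auto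
  qed
  moreover have "0 < min (c' - c) (d - d')" using lt by simp
  ultimately have "testf c d (%s. h u (arctan s))" unfolding testf_def by blast
  then show ?thesis using True b by (simp add: utest_def)
 qed (auto simp: utest_def testf_def intro: exI[of _ 1])
 then show ?thesis using that cd(1,5) by blast
qed

text \<open>\<open>\<phi>\<close> is continuous only on a product set, which is Borel; the value 0
  elsewhere makes it a Borel function, and \<open>tan\<close> undoes the bounded coordinate.\<close>

lemma restricted_function_measurable:
 fixes \<phi> :: "(nat => real) => real"
 assumes U: "open U" and \<phi>: "continuous_on (I \<rightarrow>\<^sub>E U) \<phi>" and t: "!!i. i : I ==> t i : R"
 shows "(%z. if (\<lambda>i\<in>I. tan (z (t i))) : I \<rightarrow>\<^sub>E U then \<phi> (\<lambda>i\<in>I. tan (z (t i))) else 0) : bmeas (Pi\<^sub>M R (%_. borel))"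
proof -
 \<comment> \<open>An extensional function has the single value \<open>undefined\<close> off
   \<open>I\<close>, so the product is a countable intersection of conditions on single
   coordinates.\<close>
 have pe: "I \<rightarrow>\<^sub>E U = (\<Inter>i. (%f. f i) -` (if i : I then U else {undefined}))" by (auto simp: PiE_iff extensional_def split: if_splits)
 have "(%f. f i) -` (if i : I then U else {undefined}) : sets (borel :: (nat => real) measure)" for i
 proof -
  have c: "(%f. f i) : bmeas (borel :: (nat => real) measure)" by (intro borel_measurable_continuous_onI continuous_on_product_coordinates)
  have "(if i : I then U else {undefined}) : sets borel" using U by simp
  from measurable_sets[OF c this] show ?thesis by simp
 qed
 then have "I \<rightarrow>\<^sub>E U : sets (borel :: (nat => real) measure)" unfolding pe by (intro sets.countable_INT'') auto
 then have m: "(%f. if f : I \<rightarrow>\<^sub>E U then \<phi> f else 0) : bmeas borel" by (rule borel_measurable_continuous_on_if[OF _ \<phi>]) simp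
 have tm: "(tan :: real => real) : bmeas borel" unfolding tan_def[abs_def] by (intro borel_measurable_divide borel_measurable_continuous_onI continuous_intros)
 have "(%z. \<lambda>i\<in>I. tan (z (t i))) : Pi\<^sub>M R (%_. borel) ->> (borel :: (nat => real) measure)"
 proof (rule measurable_coordinatewise_then_product)
  fix i
  show "(%z. (\<lambda>i\<in>I. tan (z (t i) :: real)) i) : bmeas (Pi\<^sub>M R (%_. borel))"
  proof (cases "i : I")
   case True
   have "(%z. z (t i)) : Pi\<^sub>M R (%_. borel) ->> (borel :: real measure)" using measurable_component_singleton[OF t[OF True], of "%_. borel :: real measure"] by simp
   from measurable_compose[OF this tm] show ?thesis using True by simp
  qed simp
 qed
 from measurable_compose[OF this m] show ?thesis .
qed

text \<open>\<open>\<phi>\<close> may be unbounded, so the two sides are compared through equality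
  of the survival-weighted laws of all coordinates up to \<open>t k\<close>. This transfers
  integrability along with the integral.\<close>

theorem proposition8p1:
  fixes X :: "'a::metric_space set" and e :: "'a set" and F :: "'a \<Rightarrow> real" and x :: 'a
    and MB :: "'b measure" and B :: "real \<Rightarrow> 'b \<Rightarrow> 'a"
    and MW :: "'c measure" and W :: "real \<Rightarrow> 'c \<Rightarrow> real"
    and k :: nat and \<phi> :: "(nat \<Rightarrow> real) \<Rightarrow> real" and t :: "nat \<Rightarrow> real"
  defines "f \<equiv> \<lambda>\<omega>. if ennreal (t k) < hitting_time (top_of_set X frontier_of e) (\<lambda>s. B s \<omega>)
                     then \<phi> (\<lambda>i\<in>{1..<k}. F (B (t i) \<omega>)) else 0"
    and "g \<equiv> \<lambda>\<omega>. if ennreal (t k) < hitting_time (frontier (F ` e)) (\<lambda>s. W s \<omega>)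
                     then \<phi> (\<lambda>i\<in>{1..<k}. W (t i) \<omega>) else 0"
  assumes "graph_like_continuum X" and "hausdorff_measure1 X < \<infinity>"
    and "is_edge X e"
    and "arclength_isometry e F" and "open (F ` e)" and "is_interval (F ` e)"
    and "1 \<le> k"
    and "continuous_on ({1..<k} \<rightarrow>\<^sub>E F ` e) \<phi>"
    and "0 \<le> t 1" and "mono_on {1..k} t"
    and "x \<in> e"
    and "brownian_motion X x MB B"
    and "real_brownian_motion (F x) MW W"
  shows "(integrable MB f \<longleftrightarrow> integrable MW g) \<and> (\<integral>\<omega>. f \<omega> \<partial>MB) = (\<integral>\<omega>. g \<omega> \<partial>MW)"
proof -
 note U = \<open>open (F ` e)\<close> \<open>is_interval (F ` e)\<close> and x = \<open>x : e\<close>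
 note BM = \<open>brownian_motion X x MB B\<close> and WM = \<open>real_brownian_motion (F x) MW W\<close>
 have X: "compact X" using \<open>graph_like_continuum X\<close> by (simp add: graph_like_continuum_def)
 obtain io where io: "edge_chart X e F io" using edge_chart_exists[OF \<open>is_edge X e\<close> \<open>arclength_isometry e F\<close> U] by blast
 interpret E: edge_chart X e F io by (rule io)
 have Une: "F ` e ~= {}" using x by blast
 obtain alp bt where ab: "arctan ` F ` e = {alp<..<bt}" using arctan_open_interval[OF U Une] by blast
 define T where "T = t k"
 have tmono: "t i <= t j" if "i : {1..k}" "j : {1..k}" "i <= j" for i j using \<open>mono_on {1..k} t\<close> that by (simp add: mono_on_def)
 have T0: "0 <= T" using tmono[of 1 k] \<open>1 <= k\<close> \<open>0 <= t 1\<close> by (simp add: T_def)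
 have tT: "t i : {0..T}" if "i : {1..<k}" for i using tmono[of 1 i] tmono[of i k] that \<open>0 <= t 1\<close> by (simp add: T_def)
 define N where "N = process_law X MB B"
 have Bc: "continuous_process X MB B" and B0: "!!om. om : space MB ==> B 0 om = x" and lim: "graph_limit_law X x N" using BM by (auto simp: brownian_motion_def N_def)
 have Wc: "continuous_process UNIV MW W" and W0: "!!om. om : space MW ==> W 0 om = F x" using WM by (auto simp: real_brownian_motion_def)
 interpret MB: prob_space MB by (rule cprocD(1)[OF Bc])
 interpret MW: prob_space MW by (rule cprocD(1)[OF Wc])
 define Bp where "Bp om = (\<lambda>s\<in>{0..}. B s om)" for om
 define Wp where "Wp om = (\<lambda>s\<in>{0..}. W s om)" for om
 have Bp: "Bp : MB ->> path_space X" unfolding Bp_def[abs_def] by (rule cprocD(2)[OF Bc])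
 have Wp: "Wp : MW ->> path_space UNIV" unfolding Wp_def[abs_def] by (rule cprocD(2)[OF Wc])
 \<comment> \<open>Indicators of survival in the open edge or interval up to \<open>T\<close>; by
   \<open>stay_iff_before_frontier\<close> they are those of the two events in the
   statement.\<close>
 define KB :: "'b => real" where "KB om = indicator {w. ALL s:{0..T}. w s : e} (Bp om)" for om
 define KW :: "'c => real" where "KW om = indicator {w. ALL s:{0..T}. w s : F ` e} (Wp om)" for om
 have KB_iff: "KB om = (if ALL s:{0..T}. B s om : e then 1 else 0)" for om by (auto simp: KB_def Bp_def indicator_def)
 have KW_iff: "KW om = (if ALL s:{0..T}. W s om : F ` e then 1 else 0)" for om by (auto simp: KW_def Wp_def indicator_def)
 obtain D where D: "open D" "e = X Int D" using E.e_open by (auto simp: openin_open)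
 have "X Int - e = X Int - D" using D(2) by blast
 then have "closedin (top_of_set X) (X Int - e)" using closedin_closed_Int[OF closed_Compl[OF D(1)], of X] by simp
 from measurable_compose[OF Bp stay_ind_meas[OF this]]
 have KBm: "KB : bmeas MB" unfolding KB_def[abs_def] .
 have "closedin (top_of_set UNIV) (UNIV Int - F ` e)" using closed_Compl[OF U(1)] by simp
 from measurable_compose[OF Wp stay_ind_meas[OF this]]
 have KWm: "KW : bmeas MW" unfolding KW_def[abs_def] .
 have eb: "e : sets borel" unfolding D(2) using compact_imp_closed[OF X] D(1) by auto
 have "continuous_on e (%y. arctan (F y))" by (intro continuous_on_arctan E.F_cont)
 then have lm: "E.lift arctan : bmeas borel" unfolding E.lift_def[abs_def] by (intro borel_measurable_continuous_on_if[OF eb]) auto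
 \<comment> \<open>Coordinates with values in the bounded interval \<open>(alp,bt)\<close> during
   survival. The value 0 of \<open>lift\<close> off \<open>e\<close> is suppressed by
   \<open>KB\<close>.\<close>
 define YB where "YB u om = E.lift arctan (B u om)" for u om
 define YW where "YW u om = arctan (W u om)" for u om
 have YBm: "YB u : bmeas MB" if "u : {0..T}" for u unfolding YB_def[abs_def] by (rule measurable_compose[OF cprocD(3)[OF Bc] lm]) (use that in simp)
 have am: "arctan : bmeas borel" by (intro borel_measurable_continuous_onI continuous_on_arctan continuous_on_id)
 have YWm: "YW u : bmeas MW" if "u : {0..T}" for u unfolding YW_def[abs_def] by (rule measurable_compose[OF cprocD(3)[OF Wc] am]) (use that in simp)
 have tests: "(\<integral>om. KB om * (\<Prod>u\<in>J. h u (YB u om)) \<partial>MB) = (\<integral>om. KW om * (\<Prod>u\<in>J. h u (YW u om)) \<partial>MW)"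
  if J: "finite J" "J <= {0..T}" and h: "!!u. u : J ==> utest alp bt (h u)" for J h
 proof (cases "T = 0")
  \<comment> \<open>Weak convergence is available for positive horizons only. For
    \<open>T = 0\<close> both processes are at their starting points and \<open>J\<close> contains
    no other time.\<close>
  case True
  have J0: "u = 0" if "u : J" for u using J(2) True that by auto
  have pB: "(\<Prod>u\<in>J. h u (YB u om)) = (\<Prod>u\<in>J. h u (arctan (F x)))" if "om : space MB" for om
  proof (rule prod.cong[OF refl])
   fix u assume "u : J"
   then have "u = 0" by (rule J0)
   then show "h u (YB u om) = h u (arctan (F x))" using B0[OF that] x by (simp add: YB_def E.lift_def)
  qed
  have pW: "(\<Prod>u\<in>J. h u (YW u om)) = (\<Prod>u\<in>J. h u (arctan (F x)))" if "om : space MW" for om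
  proof (rule prod.cong[OF refl])
   fix u assume "u : J"
   then have "u = 0" by (rule J0)
   then show "h u (YW u om) = h u (arctan (F x))" using W0[OF that] by (simp add: YW_def)
  qed
  have "(\<integral>om. KB om * (\<Prod>u\<in>J. h u (YB u om)) \<partial>MB) = (\<integral>om. (\<Prod>u\<in>J. h u (arctan (F x))) \<partial>MB)" by (rule integral_congr[OF refl]) (use B0 x True pB in \<open>simp add: KB_iff\<close>)
  moreover have "(\<integral>om. KW om * (\<Prod>u\<in>J. h u (YW u om)) \<partial>MW) = (\<integral>om. (\<Prod>u\<in>J. h u (arctan (F x))) \<partial>MW)" by (rule integral_congr[OF refl]) (use W0 x True pW in \<open>simp add: KW_iff\<close>)
  ultimately show ?thesis by (simp add: MB.prob_space MW.prob_space)
 next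
  case False
  have hJ: "ALL u:J. utest alp bt (h u)" using h by blast
  obtain c d where cd: "c : F ` e" "d : F ` e" "\<forall>u. utest c d (%s. if u : J then h u (arctan s) else 0)" by (rule unit_test_fun_arctan[OF ab Une J(1) hJ]) (rule that; assumption)
  obtain G P y where G: "graph_approximation X G" "\<forall>n. graph_brownian_motion (G n) (P n) & y n : points (G n)" "y \<longlonglongrightarrow> x" by (rule E.approximations_at[OF BM x]) (rule that; assumption)
  have N: "prob_space N" "sets N = sets (path_space X)" using lim by (auto simp: graph_limit_law_def space_prob_algebra)
  have wc: "weakly_converges X (%n. P n (y n)) N"  by (rule conjunct2[OF conjunct2[OF lim[unfolded graph_limit_law_def]], THEN spec[of _ G], THEN spec[of _ P], THEN spec[of _ y],
      THEN mp, OF conjI[OF G(1) conjI[OF G(2,3)]]])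
  have Tpos: "0 < T" using False T0 by simp
  \<comment> \<open>The locale asks for a test function at every \<open>u\<close>, while
    \<open>h u\<close> is one only for \<open>u\<close> in \<open>J\<close>; elsewhere it is
    replaced by 0, which the products over \<open>J\<close> do not see.\<close>
  interpret L: edge_limit X e F io G P y N MW W x J T "%u s. if u : J then h u (arctan s) else 0" c d
  proof (intro edge_limit.intro edge_limit_axioms.intro)
   show "graph_brownian_motion (G n) (P n)" "y n : points (G n)" for n using G(2) by simp_all
   show "utest c d (%s. if u : J then h u (arctan s) else 0)" for u using cd(3) by (rule spec)
   show "{c..d} <= F ` e" by (rule E.sub_U[OF cd(1,2)])
  qed (fact io X G x N wc WM J Tpos)+
  have e: "io ` F ` e = e" using E.io_F by (auto simp: image_image)
  have "(\<integral>om. KB om * (\<Prod>u\<in>J. h u (YB u om)) \<partial>MB) = (\<integral>om. L.pweight (F ` e) (Bp om) \<partial>MB)"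
  proof (rule integral_congr[OF refl])
   fix om
   have "(\<Prod>u\<in>J. h u (YB u om)) = (\<Prod>u\<in>J. E.lift (%s. if u : J then h u (arctan s) else 0) (Bp om u))" if "ALL s:{0..T}. B s om : e"
   proof (rule prod.cong[OF refl])
    fix u assume u: "u : J"
    then have "u : {0..T}" using J(2) by blast
    with that u show "h u (YB u om) = E.lift (%s. if u : J then h u (arctan s) else 0) (Bp om u)" by (simp add: YB_def E.lift_def Bp_def)
   qed
   then show "KB om * (\<Prod>u\<in>J. h u (YB u om)) = L.pweight (F ` e) (Bp om)" unfolding L.pweight_def e KB_def[symmetric] KB_iff by auto
  qed
  also have "... = (\<integral>w. L.pweight (F ` e) w \<partial>N)" unfolding N_def process_law_def Bp_def[symmetric] by (rule integral_distr[symmetric, OF Bp L.pw_meas[OF U(1) order_refl order_refl]])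
  also have "... = (\<integral>om. L.rweight (F ` e) (L.W_path 0 om) \<partial>MW)" by (rule L.weight_eq)
  also have "... = (\<integral>om. KW om * (\<Prod>u\<in>J. h u (YW u om)) \<partial>MW)"
  proof (rule integral_congr[OF refl])
   fix om
   have Wp_eq: "L.W_path 0 om = Wp om" unfolding L.W_path_def Wp_def by simp
   have "(\<Prod>u\<in>J. if u : J then h u (arctan (Wp om u)) else 0) = (\<Prod>u\<in>J. h u (YW u om))" by (rule prod.cong[OF refl]) (use L.J0 in \<open>simp add: Wp_def YW_def\<close>)
   then show "L.rweight (F ` e) (L.W_path 0 om) = KW om * (\<Prod>u\<in>J. h u (YW u om))" unfolding L.rweight_def Wp_eq KW_def by simp
  qed
  finally show ?thesis .
 qed
 let ?L = "Pi\<^sub>M {0..T} (%_. borel) :: (real => real) measure"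
 have law: "distr (density MB (%om. ennreal (KB om))) ?L (%om. \<lambda>u\<in>{0..T}. YB u om)
   = distr (density MW (%om. ennreal (KW om))) ?L (%om. \<lambda>u\<in>{0..T}. YW u om)"
 proof (rule killed_law_eqI[where a=alp and b=bt])
  show "YB u om : {alp<..<bt}" if "om : space MB" "u : {0..T}" "KB om ~= 0" for om u unfolding ab[symmetric] using that by (auto simp: KB_iff YB_def E.lift_def split: if_splits)
  show "YW u om : {alp<..<bt}" if "om : space MW" "u : {0..T}" "KW om ~= 0" for om u unfolding ab[symmetric] YW_def by (rule imageI) (use that in \<open>auto simp: KW_iff split: if_splits\<close>)
  show "(\<integral>om. KB om * (\<Prod>u\<in>J. h u (YB u om)) \<partial>MB) = (\<integral>om. KW om * (\<Prod>u\<in>J. h u (YW u om)) \<partial>MW)"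
   if "finite J" "J <= {0..T}" "!!u. u : J ==> utest alp bt (h u)" for J h by (rule tests[OF that(1,2)]) (rule that(3))
  show "YB u : bmeas MB" "YW u : bmeas MW" if "u : {0..T}" for u by (rule YBm[OF that], rule YWm[OF that])
  show "prob_space MB" "prob_space MW" by unfold_locales
  show "KB : bmeas MB" "KW : bmeas MW" by (rule KBm, rule KWm)
 qed (simp_all add: KB_iff KW_iff)
 \<comment> \<open>\<open>tan\<close> recovers the original coordinates, and the guard keeps
   \<open>\<phi>\<close> inside the set on which it is continuous.\<close>
 define ps where "ps z = (if (\<lambda>i\<in>{1..<k}. tan (z (t i))) : {1..<k} \<rightarrow>\<^sub>E F ` e then \<phi> (\<lambda>i\<in>{1..<k}. tan (z (t i))) else 0)" for z :: "real => real"
 have psm: "ps : bmeas ?L" unfolding ps_def[abs_def] by (rule restricted_function_measurable[OF U(1) \<open>continuous_on ({1..<k} \<rightarrow>\<^sub>E F ` e) \<phi>\<close> tT])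
 have f: "f om = KB om * ps (\<lambda>u\<in>{0..T}. YB u om)" if om: "om : space MB" for om
 proof -
  have w: "Bp om : space (path_space X)" "Bp om 0 : e" using measurable_space[OF Bp om] B0[OF om] x by (auto simp: Bp_def)
  have iff: "ennreal (t k) < hitting_time (top_of_set X frontier_of e) (%s. B s om) \<longleftrightarrow> (ALL s:{0..T}. B s om : e)"
  proof -
   have hr: "hitting_time (top_of_set X frontier_of e) (Bp om) = hitting_time (top_of_set X frontier_of e) (%s. B s om)" unfolding Bp_def by (rule hitting_time_restrict)
   have al: "(ALL s:{0..T}. Bp om s : e) \<longleftrightarrow> (ALL s:{0..T}. B s om : e)" by (rule ball_cong) (auto simp: Bp_def)
   show ?thesis using stay_iff_before_frontier[OF w E.e_open T0] unfolding hr al unfolding T_def .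
  qed
  show ?thesis
  proof (cases "ALL s:{0..T}. B s om : e")
   case True
   have "(\<lambda>i\<in>{1..<k}. tan ((\<lambda>u\<in>{0..T}. YB u om) (t i))) = (\<lambda>i\<in>{1..<k}. F (B (t i) om))"
   proof (rule restrict_ext)
    fix i assume "i : {1..<k}"
    from tT[OF this] True show "tan ((\<lambda>u\<in>{0..T}. YB u om) (t i)) = F (B (t i) om)" by (simp add: YB_def E.lift_def tan_arctan)
   qed
   moreover have "(\<lambda>i\<in>{1..<k}. F (B (t i) om)) : {1..<k} \<rightarrow>\<^sub>E F ` e" using True tT by (auto simp: PiE_iff)
   ultimately show ?thesis using True by (simp only: f_def iff ps_def KB_iff if_P[OF True] if_True mult_1)
  next
   case False
   show ?thesis by (simp only: f_def iff KB_iff if_not_P[OF False] mult_zero_left)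
  qed
 qed
 have g: "g om = KW om * ps (\<lambda>u\<in>{0..T}. YW u om)" if om: "om : space MW" for om
 proof -
  have w: "Wp om : space (path_space UNIV)" "Wp om 0 : F ` e" using measurable_space[OF Wp om] W0[OF om] x by (auto simp: Wp_def)
  have op: "openin (top_of_set UNIV) (F ` e)" using U(1) by simp
  have iff: "ennreal (t k) < hitting_time (frontier (F ` e)) (%s. W s om) \<longleftrightarrow> (ALL s:{0..T}. W s om : F ` e)"
  proof -
   have hr: "hitting_time (top_of_set UNIV frontier_of F ` e) (Wp om) = hitting_time (frontier (F ` e)) (%s. W s om)" unfolding Wp_def hitting_time_restrict by (simp add: frontier_of_def frontier_def)
   have al: "(ALL s:{0..T}. Wp om s : F ` e) \<longleftrightarrow> (ALL s:{0..T}. W s om : F ` e)" by (rule ball_cong) (auto simp: Wp_def)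
   show ?thesis using stay_iff_before_frontier[OF w op T0] unfolding hr al unfolding T_def .
  qed
  show ?thesis
  proof (cases "ALL s:{0..T}. W s om : F ` e")
   case True
   have "(\<lambda>i\<in>{1..<k}. tan ((\<lambda>u\<in>{0..T}. YW u om) (t i))) = (\<lambda>i\<in>{1..<k}. W (t i) om)"
   proof (rule restrict_ext)
    fix i assume "i : {1..<k}"
    from tT[OF this] show "tan ((\<lambda>u\<in>{0..T}. YW u om) (t i)) = W (t i) om" by (simp add: YW_def tan_arctan)
   qed
   moreover have "(\<lambda>i\<in>{1..<k}. W (t i) om) : {1..<k} \<rightarrow>\<^sub>E F ` e" using True tT unfolding PiE_iff by auto
   ultimately show ?thesis using True by (simp only: g_def iff ps_def KW_iff if_P[OF True] if_True mult_1)
  next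
   case False
   show ?thesis by (simp only: g_def iff KW_iff if_not_P[OF False] mult_zero_left)
  qed
 qed
 have Ym: "(%om. \<lambda>u\<in>{0..T}. YB u om) : MB ->> ?L" "(%om. \<lambda>u\<in>{0..T}. YW u om) : MW ->> ?L" by (rule measurable_restrict; rule YBm YWm; assumption)+
 have K0: "0 <= KB om" "0 <= KW om'" for om om' by (simp_all add: KB_iff KW_iff)
 note wB = weighted_law_integral[OF KBm K0(1) Ym(1) psm] and wW = weighted_law_integral[OF KWm K0(2) Ym(2) psm]
 have "integrable MB f \<longleftrightarrow> integrable MB (%om. KB om * ps (\<lambda>u\<in>{0..T}. YB u om))" by (rule Bochner_Integration.integrable_cong[OF refl f])
 also have "... \<longleftrightarrow> integrable MW (%om. KW om * ps (\<lambda>u\<in>{0..T}. YW u om))" unfolding wB(1) wW(1) law ..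
 also have "... \<longleftrightarrow> integrable MW g" by (rule Bochner_Integration.integrable_cong[OF refl g[symmetric]])
 finally have "integrable MB f \<longleftrightarrow> integrable MW g" .
 moreover have "(\<integral>om. f om \<partial>MB) = (\<integral>om. KB om * ps (\<lambda>u\<in>{0..T}. YB u om) \<partial>MB)" by (rule integral_congr[OF refl f])
 moreover have "... = (\<integral>om. KW om * ps (\<lambda>u\<in>{0..T}. YW u om) \<partial>MW)" unfolding wB(2) wW(2) law ..
 moreover have "... = (\<integral>om. g om \<partial>MW)" by (rule integral_congr[OF refl g[symmetric]])
 ultimately show ?thesis by simp
qed

end
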